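(* Let $P=P_h\to X$ be a (topologically) nontrivial principal $S^1$ bundle with Kaluza-Klein metric $G=G(g,h,\nabla)$ as described in the context, and suppose that the data $(g,h,\nabla)$ satisfies the following generic properties: (a) for each $m\in\mathbb{Z}$ the spectrum of the Bochner Laplacian on sections of $L^m$ is simple, and the multiplicity of the eigenvalue $\lambda_{m,j}$ of $\Delta_G$ is $1$ if $m=0$ and $2$ if $m\ne0$; (b) every eigenfunction of $\Delta_G$ is a joint eigenfunction of $\Delta_G$ and $\frac{\partial^2}{\partial\theta^2}$; (c) for $m\neq0$ all eigensections $f_{m,j}$ have isolated zeros and zero is a regular value (so the zero set of $f_{m,j}$ is finite); (d) for $m\ne0$, $\Re\phi_{m,j}$ and $\Im\phi_{m,j}$ have zero as a regular value. Then: (1) The eigenspace of $\Delta_G$ corresponding to $\lambda=\lambda_{m,j}=\lambda_{-m,j}$ is spanned by $\phi_{m,j}$ and $\phi_{-m,j}=\overline{\phi_{m,j}}$. In particular, any real eigenfunction with eigenvalue $\lambda_{m,j}$ is a constant multiple of $T_\theta(\Re\phi_{m,j})$ for some $\theta$, where $T_\theta$ is the $S^1$ action on $P$ (acting on functions) parameterized by $\theta$. (2) For $m\ne0$, the nodal set of $\Re\phi_{m,j}$ is connected. (3) For $m\neq0$, the number of nodal domains of $\Re\phi_{m,j}$ is $2$.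
   Context: $X$ is a compact connected surface with Riemannian metric $g$ and compatible complex structure $J$; $(L,h)\to X$ is a holomorphic line bundle with Hermitian metric $h$, and $\nabla$ is an $h$-compatible connection on $L$. $P_h=\{(z,\lambda)\in L^*:|\lambda|_{h^*}=1\}$, $\pi:P_h\to X$, with $\partial/\partial\theta$ the generator of the $S^1$ action. $\nabla$ gives a splitting $TP_h=H\oplus V$ into horizontal and vertical spaces; the Kaluza-Klein metric $G$ is the $S^1$-invariant metric with $H\perp V$, $d\pi:H_p\to T_{\pi(p)}X$ isometric, and $|\partial/\partial\theta|_G=1$ (orbits are unit speed geodesics). $\Delta_G$ commutes with the $S^1$ action; $\{\phi_{m,j}\}$ is an orthonormal basis of $L^2(P_h)$ of joint eigenfunctions, $\Delta_G\phi_{m,j}=-\lambda_{m,j}\phi_{m,j}$, $\frac{\partial}{\partial\theta}\phi_{m,j}=im\phi_{m,j}$ ($m\in\mathbb{Z}$), chosen with $\phi_{-m,j}=\overline{\phi_{m,j}}$. A section $s$ of $L^m$ lifts to the weight $m$ function $\hat s(z,\lambda)=\lambda^m(s(z))$; $\phi_{m,j}$ is the lift of an eigensection $f_{m,j}e_L^m$ ($e_L$ a local frame) of the Bochner Laplacian on $L^m$, the operator of the quadratic form $s\mapsto\int_X|\nabla s|^2_{h^m\otimes g}dV_g$ with the induced metric and connection on $L^m$. "Zero is a regular value" of a section means that at each zero the differential $df_{m,j}:T_zX\to\mathbb{C}$ in a local frame is surjective. Nodal set means zero set; nodal domains are the connected components of its complement. *)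

theory Defs
  imports "HOL-Analysis.Analysis" "HOL-Library.Function_Algebras"
begin

section \<open>Smooth functions and local coordinates\<close>

fun Ck_on :: "nat \<Rightarrow> ('a::real_normed_vector \<Rightarrow> 'b::real_normed_vector) \<Rightarrow> 'a set \<Rightarrow> bool" where
  "Ck_on 0 f S \<longleftrightarrow> continuous_on S f"
| "Ck_on (Suc k) f S \<longleftrightarrow>
     f differentiable_on S \<and> (\<forall>v. Ck_on k (\<lambda>x. frechet_derivative f (at x) v) S)"

text \<open>Only meant for open \<open>S\<close>.\<close>

definition smooth_on :: "('a::real_normed_vector \<Rightarrow> 'b::real_normed_vector) \<Rightarrow> 'a set \<Rightarrow> bool" where
  "smooth_on f S \<longleftrightarrow> (\<forall>k. Ck_on k f S)"

text \<open>
  A manifold is described by an indexed family of injective local parametrizations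
  \<open>\<psi> i : D i \<rightarrow> M\<close> (inverses of charts), where \<open>D i\<close> is an open subset of a Euclidean space.
  A tangent vector at \<open>\<psi> i x\<close> is given by its coordinate vector in the chart \<open>i\<close>.
\<close>

definition overlap :: "('i \<Rightarrow> 'e set) \<Rightarrow> ('i \<Rightarrow> 'e \<Rightarrow> 'm) \<Rightarrow> 'i \<Rightarrow> 'i \<Rightarrow> 'e set" where
  "overlap D \<psi> i j = {x \<in> D i. \<psi> i x \<in> \<psi> j ` D j}"

definition transition :: "('i \<Rightarrow> 'e set) \<Rightarrow> ('i \<Rightarrow> 'e \<Rightarrow> 'm) \<Rightarrow> 'i \<Rightarrow> 'i \<Rightarrow> 'e \<Rightarrow> 'e" where
  "transition D \<psi> i j = inv_into (D j) (\<psi> j) \<circ> \<psi> i"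

definition topological_atlas ::
    "'m topology \<Rightarrow> ('i \<Rightarrow> 'e::euclidean_space set) \<Rightarrow> ('i \<Rightarrow> 'e \<Rightarrow> 'm) \<Rightarrow> bool" where
  "topological_atlas M D \<psi> \<longleftrightarrow>
     (\<forall>i. open (D i) \<and> openin M (\<psi> i ` D i) \<and>
          homeomorphic_map (top_of_set (D i)) (subtopology M (\<psi> i ` D i)) (\<psi> i)) \<and>
     (\<Union>i. \<psi> i ` D i) = topspace M"

definition holomorphic_atlas ::
    "'m topology \<Rightarrow> ('i \<Rightarrow> complex set) \<Rightarrow> ('i \<Rightarrow> complex \<Rightarrow> 'm) \<Rightarrow> bool" where
  "holomorphic_atlas M D \<psi> \<longleftrightarrow>
     topological_atlas M D \<psi> \<and>
     (\<forall>i j. transition D \<psi> i j holomorphic_on overlap D \<psi> i j)"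

definition smooth_fun ::
    "('i \<Rightarrow> 'e::euclidean_space set) \<Rightarrow> ('i \<Rightarrow> 'e \<Rightarrow> 'm) \<Rightarrow> ('m \<Rightarrow> 'b::real_normed_vector) \<Rightarrow> bool" where
  "smooth_fun D \<psi> u \<longleftrightarrow> (\<forall>i. smooth_on (u \<circ> \<psi> i) (D i))"

definition zero_regular_value ::
    "('i \<Rightarrow> 'e::euclidean_space set) \<Rightarrow> ('i \<Rightarrow> 'e \<Rightarrow> 'm) \<Rightarrow> ('m \<Rightarrow> 'b::real_normed_vector) \<Rightarrow> bool" where
  "zero_regular_value D \<psi> u \<longleftrightarrow>
     (\<forall>i. \<forall>x\<in>D i. u (\<psi> i x) = 0 \<longrightarrow> surj (frechet_derivative (u \<circ> \<psi> i) (at x)))"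

section \<open>Riemannian metrics\<close>

text \<open>\<open>g i x v w\<close> is the inner product at \<open>\<psi> i x\<close> of the tangent vectors with
  coordinate vectors \<open>v\<close>, \<open>w\<close> in the chart \<open>i\<close>.\<close>

definition riemannian_metric ::
    "('i \<Rightarrow> 'e::euclidean_space set) \<Rightarrow> ('i \<Rightarrow> 'e \<Rightarrow> 'm) \<Rightarrow> ('i \<Rightarrow> 'e \<Rightarrow> 'e \<Rightarrow> 'e \<Rightarrow> real) \<Rightarrow> bool" where
  "riemannian_metric D \<psi> g \<longleftrightarrow>
     (\<forall>i. \<forall>x\<in>D i. bilinear (g i x) \<and> (\<forall>v w. g i x v w = g i x w v) \<and>
                  (\<forall>v. v \<noteq> 0 \<longrightarrow> g i x v v > 0)) \<and>
     (\<forall>i v w. smooth_on (\<lambda>x. g i x v w) (D i)) \<and>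
     (\<forall>i j. \<forall>x\<in>overlap D \<psi> i j. \<forall>v w.
        g i x v w = g j (transition D \<psi> i j x)
                      (frechet_derivative (transition D \<psi> i j) (at x) v)
                      (frechet_derivative (transition D \<psi> i j) (at x) w))"

text \<open>The determinant of the Gram matrix and the coefficients of the inverse matrix,
  with respect to the coordinate basis.\<close>

definition metric_det :: "('e::euclidean_space \<Rightarrow> 'e \<Rightarrow> real) \<Rightarrow> real" where
  "metric_det B = (\<Sum>p | p permutes (Basis :: 'e set). of_int (sign p) * (\<Prod>b\<in>Basis. B b (p b)))"

definition inverse_metric :: "('e::euclidean_space \<Rightarrow> 'e \<Rightarrow> real) \<Rightarrow> 'e \<Rightarrow> 'e \<Rightarrow> real" where
  "inverse_metric B b c = (THE v. \<forall>w. B v w = w \<bullet> b) \<bullet> c"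

definition laplacian_coord ::
    "('e::euclidean_space \<Rightarrow> 'e \<Rightarrow> 'e \<Rightarrow> real) \<Rightarrow> ('e \<Rightarrow> complex) \<Rightarrow> 'e \<Rightarrow> complex" where
  "laplacian_coord g u x =
     (\<Sum>b\<in>Basis. \<Sum>c\<in>Basis.
        frechet_derivative
          (\<lambda>y. (sqrt (metric_det (g y)) * inverse_metric (g y) b c) *\<^sub>R frechet_derivative u (at y) c)
          (at x) b) /\<^sub>R sqrt (metric_det (g x))"

text \<open>The value does not depend on the chart chosen around \<open>p\<close>.\<close>

definition laplace_beltrami ::
    "('i \<Rightarrow> 'e::euclidean_space set) \<Rightarrow> ('i \<Rightarrow> 'e \<Rightarrow> 'm) \<Rightarrow> ('i \<Rightarrow> 'e \<Rightarrow> 'e \<Rightarrow> 'e \<Rightarrow> real) \<Rightarrow>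
     ('m \<Rightarrow> complex) \<Rightarrow> 'm \<Rightarrow> complex" where
  "laplace_beltrami D \<psi> g u p =
     (let (i, x) = (SOME (i, x). x \<in> D i \<and> \<psi> i x = p) in laplacian_coord (g i) (u \<circ> \<psi> i) x)"

text \<open>These conditions determine the Riemannian measure on the Borel sets of \<open>M\<close> uniquely
  when \<open>M\<close> is covered by countably many charts.\<close>

definition riemannian_measure ::
    "'m topology \<Rightarrow> ('i \<Rightarrow> 'e::euclidean_space set) \<Rightarrow> ('i \<Rightarrow> 'e \<Rightarrow> 'm) \<Rightarrow>
     ('i \<Rightarrow> 'e \<Rightarrow> 'e \<Rightarrow> 'e \<Rightarrow> real) \<Rightarrow> 'm measure \<Rightarrow> bool" where
  "riemannian_measure M D \<psi> g \<mu> \<longleftrightarrow>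
     space \<mu> = topspace M \<and>
     sets \<mu> = sigma_sets (topspace M) {U. openin M U} \<and>
     (\<forall>i. \<forall>B\<in>sets borel. B \<subseteq> D i \<longrightarrow>
        emeasure \<mu> (\<psi> i ` B) = (\<integral>\<^sup>+x\<in>B. ennreal (sqrt (metric_det (g i x))) \<partial>lborel))"

section \<open>Hermitian line bundles with connection over a Riemann surface\<close>

text \<open>
  Each index \<open>i\<close> stands for a coordinate patch \<open>cpar i ` cdom i\<close> of the surface with a
  holomorphic coordinate together with a holomorphic frame \<open>frame i\<close> of \<open>L\<close> over the patch.
  The fibres of \<open>L\<close> are one-dimensional subspaces of an ambient complex vector space
  with scalar multiplication \<open>smult\<close>; since no topology of that space is used, this is no
  restriction (one may take the direct sum of all fibres). The topology and the
  holomorphic structure of \<open>L\<close> are those for which the frames are local trivializations.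
  The connection is given by its connection forms: \<open>\<nabla>\<^sub>v (frame i) = conn i w v \<cdot> frame i\<close> at
  \<open>cpar i w\<close>.
\<close>

record ('x, 'i, 'l) bundle_data =
  base  :: "'x topology"
  cdom  :: "'i \<Rightarrow> complex set"
  cpar  :: "'i \<Rightarrow> complex \<Rightarrow> 'x"
  gmet  :: "'i \<Rightarrow> complex \<Rightarrow> complex \<Rightarrow> complex \<Rightarrow> real"
  fibre :: "'x \<Rightarrow> 'l set"
  smult :: "complex \<Rightarrow> 'l \<Rightarrow> 'l"
  frame :: "'i \<Rightarrow> 'x \<Rightarrow> 'l"
  herm  :: "'x \<Rightarrow> 'l \<Rightarrow> 'l \<Rightarrow> complex"
  conn  :: "'i \<Rightarrow> complex \<Rightarrow> complex \<Rightarrow> complex"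

text \<open>In holomorphic coordinates the complex structure \<open>J\<close> is multiplication by \<open>\<i>\<close>.\<close>

definition riemann_surface_with_metric :: "('x, 'i, 'l) bundle_data \<Rightarrow> bool" where
  "riemann_surface_with_metric K \<longleftrightarrow>
     Hausdorff_space (base K) \<and> compact_space (base K) \<and> connected_space (base K) \<and>
     topspace (base K) \<noteq> {} \<and>
     holomorphic_atlas (base K) (cdom K) (cpar K) \<and>
     riemannian_metric (cdom K) (cpar K) (gmet K) \<and>
     (\<forall>i. \<forall>w\<in>cdom K i. \<forall>v v'. gmet K i w (\<i> * v) (\<i> * v') = gmet K i w v v')"

text \<open>\<open>frame i = frame_change i j \<cdot> frame j\<close>, as a function of the coordinate of the chart \<open>i\<close>.\<close>

definition frame_change :: "('x, 'i, 'l) bundle_data \<Rightarrow> 'i \<Rightarrow> 'i \<Rightarrow> complex \<Rightarrow> complex" where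
  "frame_change K i j w =
     (THE c. frame K i (cpar K i w) = smult K c (frame K j (cpar K i w)))"

definition holomorphic_line_bundle :: "('x, 'i, 'l::ab_group_add) bundle_data \<Rightarrow> bool" where
  "holomorphic_line_bundle K \<longleftrightarrow>
     vector_space (smult K) \<and>
     (\<forall>z\<in>topspace (base K).
        module.subspace (smult K) (fibre K z) \<and> vector_space.dim (smult K) (fibre K z) = 1) \<and>
     (\<forall>i. \<forall>w\<in>cdom K i. frame K i (cpar K i w) \<in> fibre K (cpar K i w) - {0}) \<and>
     (\<forall>i j. frame_change K i j holomorphic_on overlap (cdom K) (cpar K) i j)"

definition frame_sqnorm :: "('x, 'i, 'l) bundle_data \<Rightarrow> 'i \<Rightarrow> complex \<Rightarrow> complex" where
  "frame_sqnorm K i w =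
     herm K (cpar K i w) (frame K i (cpar K i w)) (frame K i (cpar K i w))"

definition hermitian_metric :: "('x, 'i, 'l::ab_group_add) bundle_data \<Rightarrow> bool" where
  "hermitian_metric K \<longleftrightarrow>
     (\<forall>z\<in>topspace (base K). \<forall>u\<in>fibre K z. \<forall>v\<in>fibre K z.
        (\<forall>w\<in>fibre K z. herm K z (u + v) w = herm K z u w + herm K z v w) \<and>
        (\<forall>c. herm K z (smult K c u) v = c * herm K z u v) \<and>
        herm K z v u = cnj (herm K z u v) \<and>
        (u \<noteq> 0 \<longrightarrow> Re (herm K z u u) > 0)) \<and>
     (\<forall>i. smooth_on (frame_sqnorm K i) (cdom K i))"

definition hnorm :: "('x, 'i, 'l) bundle_data \<Rightarrow> 'x \<Rightarrow> 'l \<Rightarrow> real" where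
  "hnorm K z v = sqrt (Re (herm K z v v))"

text \<open>The transformation law expresses
  \<open>\<nabla>(c \<cdot> e\<^sub>j) = dc \<otimes> e\<^sub>j + c \<cdot> \<nabla>e\<^sub>j\<close> for \<open>e\<^sub>i = c \<cdot> e\<^sub>j\<close>.\<close>

definition connection :: "('x, 'i, 'l) bundle_data \<Rightarrow> bool" where
  "connection K \<longleftrightarrow>
     (\<forall>i. \<forall>w\<in>cdom K i. linear (conn K i w)) \<and>
     (\<forall>i v. smooth_on (\<lambda>w. conn K i w v) (cdom K i)) \<and>
     (\<forall>i j. \<forall>w\<in>overlap (cdom K) (cpar K) i j. \<forall>v.
        frame_change K i j w * conn K i w v =
          frechet_derivative (frame_change K i j) (at w) v +
          frame_change K i j w *
            conn K j (transition (cdom K) (cpar K) i j w)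
              (frechet_derivative (transition (cdom K) (cpar K) i j) (at w) v))"

text \<open>\<open>d(h(e,e)) = h(\<nabla>e,e) + h(e,\<nabla>e)\<close> for each frame \<open>e\<close>.\<close>

definition compatible_connection :: "('x, 'i, 'l) bundle_data \<Rightarrow> bool" where
  "compatible_connection K \<longleftrightarrow>
     connection K \<and>
     (\<forall>i. \<forall>w\<in>cdom K i. \<forall>v.
        frechet_derivative (frame_sqnorm K i) (at w) v =
          conn K i w v * frame_sqnorm K i w + cnj (conn K i w v) * frame_sqnorm K i w)"

definition kaluza_klein_data :: "('x, 'i, 'l::ab_group_add) bundle_data \<Rightarrow> bool" where
  "kaluza_klein_data K \<longleftrightarrow>
     riemann_surface_with_metric K \<and> holomorphic_line_bundle K \<and>
     hermitian_metric K \<and> compatible_connection K"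

section \<open>Sections of powers of L and the Bochner Laplacian\<close>

text \<open>
  A section of \<open>L\<^sup>m\<close> (\<open>m \<in> \<int>\<close>, negative powers being powers of the dual) is given by its
  coefficients \<open>s i\<close> with respect to \<open>(frame i)\<^sup>m\<close> as functions of the coordinate; they
  are set to \<open>0\<close> off \<open>cdom i\<close> so that equality of sections is equality of families.
\<close>

definition smooth_section ::
    "('x, 'i, 'l) bundle_data \<Rightarrow> int \<Rightarrow> ('i \<Rightarrow> complex \<Rightarrow> complex) \<Rightarrow> bool" where
  "smooth_section K m s \<longleftrightarrow>
     (\<forall>i. smooth_on (s i) (cdom K i) \<and> (\<forall>w. w \<notin> cdom K i \<longrightarrow> s i w = 0)) \<and>
     (\<forall>i j. \<forall>w\<in>overlap (cdom K) (cpar K) i j.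
        s j (transition (cdom K) (cpar K) i j w) = frame_change K i j w powi m * s i w)"

definition cov_deriv ::
    "('x, 'i, 'l) bundle_data \<Rightarrow> int \<Rightarrow> ('i \<Rightarrow> complex \<Rightarrow> complex) \<Rightarrow> 'i \<Rightarrow> complex \<Rightarrow> complex \<Rightarrow> complex" where
  "cov_deriv K m s i w v =
     frechet_derivative (s i) (at w) v + of_int m * conn K i w v * s i w"

text \<open>The pointwise inner products of \<open>\<nabla>s\<close>, \<open>\<nabla>t\<close> in \<open>h\<^sup>m \<otimes> g\<close> and of \<open>s\<close>, \<open>t\<close> in \<open>h\<^sup>m\<close>;
  the values do not depend on the patch chosen around \<open>z\<close>.\<close>

definition cov_inner ::
    "('x, 'i, 'l) bundle_data \<Rightarrow> int \<Rightarrow> ('i \<Rightarrow> complex \<Rightarrow> complex) \<Rightarrow> ('i \<Rightarrow> complex \<Rightarrow> complex) \<Rightarrow> 'x \<Rightarrow> complex" where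
  "cov_inner K m s t z =
     (let (i, w) = (SOME (i, w). w \<in> cdom K i \<and> cpar K i w = z) in
        (\<Sum>b\<in>Basis. \<Sum>c\<in>Basis. of_real (inverse_metric (gmet K i w) b c) *
           cov_deriv K m s i w b * cnj (cov_deriv K m t i w c)) * frame_sqnorm K i w powi m)"

definition section_inner ::
    "('x, 'i, 'l) bundle_data \<Rightarrow> int \<Rightarrow> ('i \<Rightarrow> complex \<Rightarrow> complex) \<Rightarrow> ('i \<Rightarrow> complex \<Rightarrow> complex) \<Rightarrow> 'x \<Rightarrow> complex" where
  "section_inner K m s t z =
     (let (i, w) = (SOME (i, w). w \<in> cdom K i \<and> cpar K i w = z) in
        s i w * cnj (t i w) * frame_sqnorm K i w powi m)"

text \<open>The eigenspace of the operator of the quadratic form \<open>s \<mapsto> \<integral> |\<nabla>s|\<^sup>2 dV\<close>, using the associated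
  sesquilinear form; \<open>\<mu>\<close> is the Riemannian measure of the surface. Eigensections are
  smooth by elliptic regularity.\<close>

definition bochner_eigenspace ::
    "('x, 'i, 'l) bundle_data \<Rightarrow> 'x measure \<Rightarrow> int \<Rightarrow> real \<Rightarrow> ('i \<Rightarrow> complex \<Rightarrow> complex) set" where
  "bochner_eigenspace K \<mu> m ev =
     {s. smooth_section K m s \<and>
         (\<forall>t. smooth_section K m t \<longrightarrow>
            (\<integral>z. cov_inner K m s t z \<partial>\<mu>) = of_real ev * (\<integral>z. section_inner K m s t z \<partial>\<mu>))}"

abbreviation (input) section_scale :: "complex \<Rightarrow> ('i \<Rightarrow> complex \<Rightarrow> complex) \<Rightarrow> 'i \<Rightarrow> complex \<Rightarrow> complex" where
  "section_scale \<equiv> (\<lambda>c s i w. c * s i w)"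

definition section_zeros :: "('x, 'i, 'l) bundle_data \<Rightarrow> ('i \<Rightarrow> complex \<Rightarrow> complex) \<Rightarrow> 'x set" where
  "section_zeros K s = {cpar K i w | i w. w \<in> cdom K i \<and> s i w = 0}"

definition isolated_section_zeros :: "('x, 'i, 'l) bundle_data \<Rightarrow> ('i \<Rightarrow> complex \<Rightarrow> complex) \<Rightarrow> bool" where
  "isolated_section_zeros K s \<longleftrightarrow>
     (\<forall>z\<in>section_zeros K s. \<exists>U. openin (base K) U \<and> U \<inter> section_zeros K s = {z})"

definition section_zero_regular :: "('x, 'i, 'l) bundle_data \<Rightarrow> ('i \<Rightarrow> complex \<Rightarrow> complex) \<Rightarrow> bool" where
  "section_zero_regular K s \<longleftrightarrow>
     (\<forall>i. \<forall>w\<in>cdom K i. s i w = 0 \<longrightarrow> surj (frechet_derivative (s i) (at w)))"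

section \<open>The unit circle bundle in the dual bundle\<close>

text \<open>Functionals are extended by \<open>0\<close> off the fibre, so that each is represented once.\<close>

definition dual_fibre :: "('x, 'i, 'l::ab_group_add) bundle_data \<Rightarrow> 'x \<Rightarrow> ('l \<Rightarrow> complex) set" where
  "dual_fibre K z =
     {l. (\<forall>u\<in>fibre K z. \<forall>v\<in>fibre K z. l (u + v) = l u + l v) \<and>
          (\<forall>u\<in>fibre K z. \<forall>c. l (smult K c u) = c * l u) \<and>
          (\<forall>u. u \<notin> fibre K z \<longrightarrow> l u = 0)}"

definition dual_norm :: "('x, 'i, 'l) bundle_data \<Rightarrow> 'x \<Rightarrow> ('l \<Rightarrow> complex) \<Rightarrow> real" where
  "dual_norm K z l = (SUP u\<in>{u \<in> fibre K z. hnorm K z u = 1}. cmod (l u))"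

definition circle_bundle :: "('x, 'i, 'l::ab_group_add) bundle_data \<Rightarrow> ('x \<times> ('l \<Rightarrow> complex)) set" where
  "circle_bundle K =
     {(z, l). z \<in> topspace (base K) \<and> l \<in> dual_fibre K z \<and> dual_norm K z l = 1}"

definition S1_act :: "real \<Rightarrow> 'x \<times> ('l \<Rightarrow> complex) \<Rightarrow> 'x \<times> ('l \<Rightarrow> complex)" where
  "S1_act t p = (fst p, \<lambda>u. cis t * snd p u)"

definition d_theta :: "('x \<times> ('l \<Rightarrow> complex) \<Rightarrow> complex) \<Rightarrow> 'x \<times> ('l \<Rightarrow> complex) \<Rightarrow> complex" where
  "d_theta u p = vector_derivative (\<lambda>t. u (S1_act t p)) (at 0)"

text \<open>
  Coordinates \<open>(w, \<theta>)\<close> on \<open>P\<close>: the pair represents the functional \<open>e\<^bsup>i\<theta>\<^esup> h(\<sqdot>, e) / |e|\<close> at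
  \<open>z = cpar i w\<close> with \<open>e = frame i z\<close>, i.e. the unit functional with \<open>\<lambda>(e) = e\<^bsup>i\<theta>\<^esup> |e|\<close>.
  Charts are indexed by \<open>(i, \<alpha>)\<close>, the angle being confined to \<open>(\<alpha>, \<alpha> + 2\<pi>)\<close>.
\<close>

definition Pdom :: "('x, 'i, 'l) bundle_data \<Rightarrow> 'i \<times> real \<Rightarrow> (complex \<times> real) set" where
  "Pdom K k = cdom K (fst k) \<times> {snd k <..< snd k + 2 * pi}"

definition Ppar :: "('x, 'i, 'l) bundle_data \<Rightarrow> 'i \<times> real \<Rightarrow> complex \<times> real \<Rightarrow> 'x \<times> ('l \<Rightarrow> complex)" where
  "Ppar K k x =
     (let z = cpar K (fst k) (fst x); e = frame K (fst k) z in
        (z, \<lambda>u. if u \<in> fibre K z then cis (snd x) * herm K z u e / of_real (hnorm K z e) else 0))"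

definition Ptop :: "('x, 'i, 'l::ab_group_add) bundle_data \<Rightarrow> ('x \<times> ('l \<Rightarrow> complex)) topology" where
  "Ptop K = topology (\<lambda>W. W \<subseteq> circle_bundle K \<and> (\<forall>k. open {x \<in> Pdom K k. Ppar K k x \<in> W}))"

lemma istopology_Ptop:
  "istopology (\<lambda>W. W \<subseteq> circle_bundle K \<and> (\<forall>k. open {x \<in> Pdom K k. Ppar K k x \<in> W}))"
  unfolding istopology_def
proof (intro conjI allI impI)
  fix S T k
  assume S: "S \<subseteq> circle_bundle K \<and> (\<forall>k. open {x \<in> Pdom K k. Ppar K k x \<in> S})"
    and T: "T \<subseteq> circle_bundle K \<and> (\<forall>k. open {x \<in> Pdom K k. Ppar K k x \<in> T})"
  show "S \<inter> T \<subseteq> circle_bundle K"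
    using S by blast
  have eq: "{x \<in> Pdom K k. Ppar K k x \<in> S \<inter> T} =
        {x \<in> Pdom K k. Ppar K k x \<in> S} \<inter> {x \<in> Pdom K k. Ppar K k x \<in> T}"
    by blast
  show "open {x \<in> Pdom K k. Ppar K k x \<in> S \<inter> T}"
    unfolding eq by (rule open_Int) (use S T in blast)+
next
  fix \<W> k
  assume W: "\<forall>S\<in>\<W>. S \<subseteq> circle_bundle K \<and> (\<forall>k. open {x \<in> Pdom K k. Ppar K k x \<in> S})"
  show "\<Union>\<W> \<subseteq> circle_bundle K"
    using W by blast
  have eq: "{x \<in> Pdom K k. Ppar K k x \<in> \<Union>\<W>} = (\<Union>S\<in>\<W>. {x \<in> Pdom K k. Ppar K k x \<in> S})"
    by blast
  show "open {x \<in> Pdom K k. Ppar K k x \<in> \<Union>\<W>}"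
    unfolding eq by (rule open_UN) (use W in blast)
qed

lemma openin_Ptop:
  "openin (Ptop K) W \<longleftrightarrow>
     W \<subseteq> circle_bundle K \<and> (\<forall>k. open {x \<in> Pdom K k. Ppar K k x \<in> W})"
  unfolding Ptop_def topology_inverse'[OF istopology_Ptop] ..

text \<open>Existence of an isomorphism of principal circle bundles from \<open>P\<close> to the product bundle.\<close>

definition trivial_circle_bundle :: "('x, 'i, 'l::ab_group_add) bundle_data \<Rightarrow> bool" where
  "trivial_circle_bundle K \<longleftrightarrow>
     (\<exists>F. homeomorphic_map (Ptop K) (prod_topology (base K) (top_of_set (sphere (0::complex) 1))) F \<and>
          (\<forall>p\<in>circle_bundle K. fst (F p) = fst p \<and>
             (\<forall>t. F (S1_act t p) = (fst p, cis t * snd (F p)))))"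

section \<open>The Kaluza-Klein metric\<close>

text \<open>\<open>\<lambda>(e)\<close> as a function of the coordinates of the point \<open>(z, \<lambda>)\<close> of \<open>P\<close>, for \<open>e = frame i\<close>.\<close>

definition frame_pairing :: "('x, 'i, 'l) bundle_data \<Rightarrow> 'i \<times> real \<Rightarrow> complex \<times> real \<Rightarrow> complex" where
  "frame_pairing K k x = snd (Ppar K k x) (frame K (fst k) (fst (Ppar K k x)))"

text \<open>A vector is horizontal if \<open>\<lambda>\<close> is parallel in its direction for the connection dual to
  \<open>\<nabla>\<close>, i.e. \<open>d(\<lambda>(e)) = \<lambda>(\<nabla>e)\<close>. In coordinates \<open>d\<pi>\<close> is \<open>fst\<close> and \<open>\<partial>/\<partial>\<theta>\<close> is \<open>(0, 1)\<close>.\<close>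

definition horizontal :: "('x, 'i, 'l) bundle_data \<Rightarrow> 'i \<times> real \<Rightarrow> complex \<times> real \<Rightarrow> (complex \<times> real) set" where
  "horizontal K k x =
     {\<xi>. frechet_derivative (frame_pairing K k) (at x) \<xi> =
         conn K (fst k) (fst x) (fst \<xi>) * frame_pairing K k x}"

definition vertical :: "(complex \<times> real) set" where
  "vertical = {\<xi>. fst \<xi> = 0}"

definition kaluza_klein_metric ::
    "('x, 'i, 'l) bundle_data \<Rightarrow>
     ('i \<times> real \<Rightarrow> complex \<times> real \<Rightarrow> complex \<times> real \<Rightarrow> complex \<times> real \<Rightarrow> real) \<Rightarrow> bool" where
  "kaluza_klein_metric K G \<longleftrightarrow>
     riemannian_metric (Pdom K) (Ppar K) G \<and>
     (\<forall>i \<alpha> \<beta> w \<theta> \<theta>'. (w, \<theta>) \<in> Pdom K (i, \<alpha>) \<and> (w, \<theta>') \<in> Pdom K (i, \<beta>) \<longrightarrow>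
        G (i, \<alpha>) (w, \<theta>) = G (i, \<beta>) (w, \<theta>')) \<and>
     (\<forall>k. \<forall>x\<in>Pdom K k.
        (\<forall>\<xi>\<in>horizontal K k x. \<forall>\<eta>\<in>vertical. G k x \<xi> \<eta> = 0) \<and>
        (\<forall>\<xi>\<in>horizontal K k x. \<forall>\<eta>\<in>horizontal K k x.
           G k x \<xi> \<eta> = gmet K (fst k) (fst x) (fst \<xi>) (fst \<eta>)) \<and>
        sqrt (G k x (0, 1) (0, 1)) = 1)"

text \<open>Eigenfunctions are taken to be smooth, and \<open>0\<close> off \<open>P\<close>, so that equality on \<open>P\<close> is
  equality. Sign convention: \<open>\<Delta>u = - ev u\<close>.\<close>

definition laplace_eigenspace ::
    "('x, 'i, 'l::ab_group_add) bundle_data \<Rightarrow>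
     ('i \<times> real \<Rightarrow> complex \<times> real \<Rightarrow> complex \<times> real \<Rightarrow> complex \<times> real \<Rightarrow> real) \<Rightarrow>
     real \<Rightarrow> ('x \<times> ('l \<Rightarrow> complex) \<Rightarrow> complex) set" where
  "laplace_eigenspace K G ev =
     {u. smooth_fun (Pdom K) (Ppar K) u \<and> (\<forall>p. p \<notin> circle_bundle K \<longrightarrow> u p = 0) \<and>
         (\<forall>p\<in>circle_bundle K. laplace_beltrami (Pdom K) (Ppar K) G u p = - of_real ev * u p)}"

abbreviation (input) fun_scale :: "complex \<Rightarrow> ('p \<Rightarrow> complex) \<Rightarrow> 'p \<Rightarrow> complex" where
  "fun_scale \<equiv> (\<lambda>c u p. c * u p)"

text \<open>\<open>u\<close> is the lift \<open>(z, \<lambda>) \<mapsto> \<lambda>\<^sup>m(s(z))\<close> of the section \<open>s\<close> of \<open>L\<^sup>m\<close>.\<close>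

definition is_lift ::
    "('x, 'i, 'l::ab_group_add) bundle_data \<Rightarrow> int \<Rightarrow> ('i \<Rightarrow> complex \<Rightarrow> complex) \<Rightarrow>
     ('x \<times> ('l \<Rightarrow> complex) \<Rightarrow> complex) \<Rightarrow> bool" where
  "is_lift K m s u \<longleftrightarrow>
     (\<forall>i. \<forall>w\<in>cdom K i. \<forall>l. (cpar K i w, l) \<in> circle_bundle K \<longrightarrow>
        u (cpar K i w, l) = s i w * l (frame K i (cpar K i w)) powi m)"

definition orthonormal_basis_L2 :: "'p measure \<Rightarrow> ('k \<Rightarrow> 'p \<Rightarrow> complex) \<Rightarrow> bool" where
  "orthonormal_basis_L2 \<nu> \<phi> \<longleftrightarrow>
     (\<forall>k. \<phi> k \<in> borel_measurable \<nu> \<and> integrable \<nu> (\<lambda>p. (cmod (\<phi> k p))\<^sup>2)) \<and>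
     (\<forall>k l. (\<integral>p. \<phi> k p * cnj (\<phi> l p) \<partial>\<nu>) = (if k = l then 1 else 0)) \<and>
     (\<forall>u. u \<in> borel_measurable \<nu> \<and> integrable \<nu> (\<lambda>p. (cmod (u p))\<^sup>2) \<and>
          (\<forall>k. (\<integral>p. u p * cnj (\<phi> k p) \<partial>\<nu>) = 0) \<longrightarrow> (AE p in \<nu>. u p = 0))"

text \<open>\<open>\<phi> m j\<close> is the lift of the eigensection \<open>f m j\<close> of \<open>L\<^sup>m\<close>; \<open>\<mu>\<close>, \<open>\<nu>\<close> are the Riemannian
  measures of the surface and of \<open>P\<close>.\<close>

definition joint_eigenbasis ::
    "('x, 'i, 'l::ab_group_add) bundle_data \<Rightarrow>
     ('i \<times> real \<Rightarrow> complex \<times> real \<Rightarrow> complex \<times> real \<Rightarrow> complex \<times> real \<Rightarrow> real) \<Rightarrow>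
     'x measure \<Rightarrow> ('x \<times> ('l \<Rightarrow> complex)) measure \<Rightarrow>
     (int \<Rightarrow> nat \<Rightarrow> real) \<Rightarrow> (int \<Rightarrow> nat \<Rightarrow> 'x \<times> ('l \<Rightarrow> complex) \<Rightarrow> complex) \<Rightarrow>
     (int \<Rightarrow> nat \<Rightarrow> 'i \<Rightarrow> complex \<Rightarrow> complex) \<Rightarrow> bool" where
  "joint_eigenbasis K G \<mu> \<nu> ev \<phi> f \<longleftrightarrow>
     orthonormal_basis_L2 \<nu> (\<lambda>(m, j). \<phi> m j) \<and>
     (\<forall>m j. \<phi> m j \<in> laplace_eigenspace K G (ev m j)) \<and>
     (\<forall>m j. \<forall>p\<in>circle_bundle K. d_theta (\<phi> m j) p = \<i> * of_int m * \<phi> m j p) \<and>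
     (\<forall>m j. \<phi> (- m) j = (\<lambda>p. cnj (\<phi> m j p))) \<and>
     (\<forall>m j. (\<exists>b. f m j \<in> bochner_eigenspace K \<mu> m b) \<and> is_lift K m (f m j) (\<phi> m j))"

text \<open>Nodal domains of a real function on \<open>P\<close> are the connected components of the complement
  of its nodal set.\<close>

definition nodal_set ::
    "('x, 'i, 'l::ab_group_add) bundle_data \<Rightarrow> ('x \<times> ('l \<Rightarrow> complex) \<Rightarrow> real) \<Rightarrow> ('x \<times> ('l \<Rightarrow> complex)) set" where
  "nodal_set K u = {p \<in> circle_bundle K. u p = 0}"

definition nodal_domains ::
    "('x, 'i, 'l::ab_group_add) bundle_data \<Rightarrow> ('x \<times> ('l \<Rightarrow> complex) \<Rightarrow> real) \<Rightarrow> ('x \<times> ('l \<Rightarrow> complex)) set set" where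
  "nodal_domains K u = connected_components_of (subtopology (Ptop K) (circle_bundle K - nodal_set K u))"

end

theory Submission
  imports Defs "HOL-Complex_Analysis.Cauchy_Integral_Formula"
begin

text \<open>
  For \<open>m \<noteq> 0\<close> let \<open>Q c\<close> be the set where the lift \<open>\<phi>\<close> of a section \<open>s\<close> of \<open>L\<^sup>m\<close> has phase \<open>c\<close>. It
  covers the surface without the zeros of \<open>s\<close> with \<open>\<bar>m\<bar>\<close> sheets. A regular zero has index \<open>\<plusminus>1\<close>, so a
  loop around one zero permutes the sheets transitively, and \<open>Q c\<close> is connected. The half
  space \<open>Re (\<phi> * cnj c) > 0\<close> retracts fibrewise to \<open>Q c\<close>; this gives the two nodal domains. The nodal
  set consists of \<open>Q \<i>\<close>, \<open>Q (-\<i>)\<close> and the circles over the zeros, which lie in the closure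
  of both.

  The argument needs a zero. If \<open>t = f\<^sub>m\<^sub>,\<^sub>j\<close> has none, let \<open>s\<close> be an eigensection of \<open>L\<close> itself. Then
  \<open>d arg (s\<^sup>m / t)\<close> is a closed form away from the zeros of \<open>s\<close>, and Stokes' theorem shows that the
  indices of \<open>s\<close> sum to \<open>0\<close>. As the surface is connected, the zeros can be moved together and
  cancelled, and \<open>L\<close> is trivial.
\<close>

section \<open>The local index of a zero\<close>

text \<open>The index is encoded by a local form \<open>(w - a) powi n * exp (g w)\<close> with
  \<open>g\<close> merely continuous on a punctured disc. Nothing is asked at the centre, so
  products, inverses, powers and holomorphic coordinate changes act on this form directly, and zeros
  can be moved by functions that jump at finitely many points. Uniqueness of the exponent is never
  established; an index \<open>0\<close> is exploited constructively instead, by cutting off the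
  logarithm \<open>g\<close>. The degree of the line bundle is not introduced as an invariant
  either. Testing the closed form against a function that is \<open>1\<close> near all zeros and has
  its differential supported in small annuli yields \<open>m\<close> times the sum of the indices
  times the flux of a radial bump. Stokes' theorem makes this product \<open>0\<close>, the flux is
  negative, and \<open>m \<noteq> 0\<close>. The value \<plusminus>1 of the indices is what makes
  the monodromy transitive: a turn by \<open>2 * pi * n\<close> reaches all sheets only if
  \<open>n\<close> is coprime to \<open>m\<close>, and the regularity of the zeros guarantees this
  for every \<open>m\<close> at once.\<close>

definition has_index :: "(complex \<Rightarrow> complex) \<Rightarrow> complex \<Rightarrow> int \<Rightarrow> bool" where
  "has_index h a n \<longleftrightarrow> (\<exists>r>0. \<exists>g. continuous_on (ball a r - {a}) g \<and>
     (\<forall>w\<in>ball a r - {a}. h w = (w - a) powi n * exp (g w)))"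

text \<open>Shrinking the radius on demand lets several local forms share one punctured
  disc.\<close>

lemma has_indexE:
  assumes "has_index h a n" "e > 0"
  obtains r g where "0 < r" "r \<le> e" "continuous_on (ball a r - {a}) g"
    "\<And>w. w \<in> ball a r - {a} \<Longrightarrow> h w = (w - a) powi n * exp (g w)"
proof -
  obtain r g where *: "r > 0" "continuous_on (ball a r - {a}) g"
    "\<And>w. w \<in> ball a r - {a} \<Longrightarrow> h w = (w - a) powi n * exp (g w)"
    using assms(1) unfolding has_index_def by blast
  show thesis
    by (rule that[of "min r e" g])
       (use * assms(2) in \<open>auto intro: continuous_on_subset\<close>)
qed

lemma has_index_cong:
  assumes "has_index h a n" "e > 0" "\<And>w. w \<in> ball a e - {a} \<Longrightarrow> h' w = h w"
  shows "has_index h' a n"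
proof -
  obtain r g where *: "0 < r" "r \<le> e" "continuous_on (ball a r - {a}) g"
    "\<And>w. w \<in> ball a r - {a} \<Longrightarrow> h w = (w - a) powi n * exp (g w)"
    using has_indexE[OF assms(1,2)] by blast
  show ?thesis
    unfolding has_index_def by (rule exI[of _ r]) (use * assms(3) in auto)
qed

lemma has_index_mult:
  assumes "has_index h a n" "has_index k a m"
  shows "has_index (\<lambda>w. h w * k w) a (n + m)"
proof -
  obtain r g where 1: "0 < r" "continuous_on (ball a r - {a}) g"
    "\<And>w. w \<in> ball a r - {a} \<Longrightarrow> h w = (w - a) powi n * exp (g w)"
    using assms(1) unfolding has_index_def by blast
  obtain r' g' where 2: "0 < r'" "r' \<le> r" "continuous_on (ball a r' - {a}) g'"
    "\<And>w. w \<in> ball a r' - {a} \<Longrightarrow> k w = (w - a) powi m * exp (g' w)"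
    using has_indexE[OF assms(2), of r] 1(1) by auto
  have "continuous_on (ball a r' - {a}) g"
    by (rule continuous_on_subset[OF 1(2)]) (use 2 in auto)
  moreover have "h w * k w = (w - a) powi (n + m) * exp (g w + g' w)" if "w \<in> ball a r' - {a}" for w
    using that 1(3)[of w] 2 by (auto simp: power_int_add exp_add)
  ultimately show ?thesis
    unfolding has_index_def
    by (intro exI[of _ r'] conjI exI[of _ "\<lambda>w. g w + g' w"]) (use 2 in \<open>auto intro: continuous_intros\<close>)
qed

lemma has_index_inverse:
  assumes "has_index h a n"
  shows "has_index (\<lambda>w. inverse (h w)) a (- n)"
proof -
  obtain r g where 1: "0 < r" "continuous_on (ball a r - {a}) g"
    "\<And>w. w \<in> ball a r - {a} \<Longrightarrow> h w = (w - a) powi n * exp (g w)"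
    using assms(1) unfolding has_index_def by blast
  have "inverse (h w) = (w - a) powi (-n) * exp (- g w)" if "w \<in> ball a r - {a}" for w
    using that 1 by (auto simp: power_int_minus exp_minus)
  then show ?thesis
    unfolding has_index_def
    by (intro exI[of _ r] conjI exI[of _ "\<lambda>w. - g w"]) (use 1 in \<open>auto intro: continuous_intros\<close>)
qed

lemma has_index_nonzero:
  assumes "has_index h a n"
  obtains r where "r > 0" "\<And>w. w \<in> ball a r - {a} \<Longrightarrow> h w \<noteq> 0"
    "continuous_on (ball a r - {a}) h"
proof -
  obtain r g where 1: "0 < r" "continuous_on (ball a r - {a}) g"
    "\<And>w. w \<in> ball a r - {a} \<Longrightarrow> h w = (w - a) powi n * exp (g w)"
    using assms(1) unfolding has_index_def by blast
  show thesis
  proof (rule that[OF 1(1)])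
    have "continuous_on (ball a r - {a}) (\<lambda>w. (w - a) powi n * exp (g w))"
      using 1(2) by (auto intro!: continuous_intros)
    then show "continuous_on (ball a r - {a}) h"
      by (rule continuous_on_eq) (use 1(3) in auto)
  qed (use 1 in auto)
qed

text \<open>If the argument of \<open>h\<close> stays within a right angle of that of the model
  \<open>c * (w - a) powi n\<close>, the quotient avoids the branch cut, so its principal logarithm
  is continuous on the punctured disc and serves as \<open>g\<close>; the summand
  \<open>Ln c\<close> restores the constant.\<close>

lemma has_index_Ln:
  assumes "r > 0" "continuous_on (ball a r - {a}) h" "c \<noteq> 0"
    and "\<And>w. w \<in> ball a r - {a} \<Longrightarrow> Re (h w / ((w - a) powi n * c)) > 0"
  shows "has_index h a n"
proof -
  let ?u = "\<lambda>w. h w / ((w - a) powi n * c)"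
  define g where "g w = Ln (?u w) + Ln c" for w
  have slit: "?u w \<notin> \<real>\<^sub>\<le>\<^sub>0" if "w \<in> ball a r - {a}" for w
    using assms(4)[OF that] by (auto simp: complex_nonpos_Reals_iff)
  have "continuous_on (ball a r - {a}) ?u"
    using assms(2,3) by (intro continuous_intros) auto
  then have "continuous_on (ball a r - {a}) g"
    unfolding g_def
    using slit by (intro continuous_on_add continuous_on_Ln' continuous_on_const) auto
  moreover have "h w = (w - a) powi n * exp (g w)" if "w \<in> ball a r - {a}" for w
  proof -
    have "?u w \<noteq> 0"
      using assms(4)[OF that] by (metis less_irrefl zero_complex.sel(1))
    then show ?thesis
      using assms(3) that by (auto simp: g_def exp_add)
  qed
  ultimately show ?thesis
    unfolding has_index_def using assms(1) by blast
qed

text \<open>A nonzero limit pins the argument to within a right angle; this is the form in which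
  \<open>has_index_Ln\<close> and \<open>sheet\<close> use continuity.\<close>

lemma ball_Re_pos:
  fixes u :: "complex \<Rightarrow> complex"
  assumes "(u \<longlongrightarrow> c) (at a)" "c \<noteq> 0"
  obtains r where "r > 0" "\<And>w. w \<in> ball a r - {a} \<Longrightarrow> Re (u w / c) > 0"
proof -
  have "((\<lambda>w. u w / c) \<longlongrightarrow> c / c) (at a)"
    using assms by (intro tendsto_intros)
  then have "((\<lambda>w. Re (u w / c)) \<longlongrightarrow> 1) (at a)"
    using tendsto_Re[of _ "c / c"] assms(2) by force
  then have "eventually (\<lambda>w. Re (u w / c) > 0) (at a)"
    by (rule order_tendstoD) simp
  then show ?thesis
    unfolding eventually_at using that by (auto simp: dist_commute)
qed

lemma has_index_0:
  assumes "r > 0" "continuous_on (ball a r) h" "h a \<noteq> 0"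
  shows "has_index h a 0"
proof -
  have "(h \<longlongrightarrow> h a) (at a)"
    using assms(1,2) by (metis centre_in_ball continuous_on_eq_continuous_at isContD open_ball)
  then obtain r' where "r' > 0" "\<And>w. w \<in> ball a r' - {a} \<Longrightarrow> Re (h w / h a) > 0"
    using ball_Re_pos assms(3) by blast
  then show ?thesis
    by (intro has_index_Ln[of "min r r'" a h "h a"])
       (use assms in \<open>auto intro: continuous_on_subset\<close>)
qed

lemma has_index_id: "has_index (\<lambda>w. w - a) a 1"
  unfolding has_index_def by (intro exI[of _ 1] conjI exI[of _ "\<lambda>_. 0"]) auto

text \<open>The difference \<open>\<tau> w - \<tau> a\<close> has index \<open>1\<close>, because
  its quotient by \<open>w - a\<close> tends to the nonzero derivative. Its \<open>n\<close>-th
  power contributes the logarithm \<open>n * g'\<close>, to which the pulled back \<open>g\<close>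
  is added.\<close>

lemma has_index_compose:
  assumes h: "has_index h (\<tau> a) n" and hol: "\<tau> holomorphic_on U" "open U" "a \<in> U"
    and d: "deriv \<tau> a \<noteq> 0"
  shows "has_index (h \<circ> \<tau>) a n"
proof -
  obtain r g where 1: "0 < r" "continuous_on (ball (\<tau> a) r - {\<tau> a}) g"
    "\<And>w. w \<in> ball (\<tau> a) r - {\<tau> a} \<Longrightarrow> h w = (w - \<tau> a) powi n * exp (g w)"
    using h unfolding has_index_def by blast
  have D: "(\<tau> has_field_derivative deriv \<tau> a) (at a)"
    using hol holomorphic_derivI by blast
  then have lim: "((\<lambda>w. (\<tau> w - \<tau> a) / (w - a)) \<longlongrightarrow> deriv \<tau> a) (at a)"
    by (simp add: has_field_derivative_iff)
  obtain r1 where r1: "r1 > 0" "\<And>w. w \<in> ball a r1 - {a} \<Longrightarrow> Re ((\<tau> w - \<tau> a) / (w - a) / deriv \<tau> a) > 0"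
    using ball_Re_pos[OF lim d] by blast
  obtain r2 where r2: "r2 > 0" "ball a r2 \<subseteq> U"
    using hol openE by blast
  have cont: "continuous_on U \<tau>"
    using hol(1) by (rule holomorphic_on_imp_continuous_on)
  then have "isCont \<tau> a"
    using hol continuous_on_eq_continuous_at by blast
  then obtain r3 where r3: "r3 > 0" "\<And>w. w \<in> ball a r3 \<Longrightarrow> \<tau> w \<in> ball (\<tau> a) r"
    using 1(1) unfolding continuous_at_eps_delta by (auto simp: dist_commute)
  define R where "R = min r1 (min r2 r3)"
  have R: "R > 0" "ball a R \<subseteq> U"
    using r1 r2 r3 by (auto simp: R_def)
  have ne: "\<tau> w \<noteq> \<tau> a" if "w \<in> ball a R - {a}" for w
    using r1(2)[of w] that by (auto simp: R_def)
  have cR: "continuous_on (ball a R - {a}) \<tau>"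
    by (rule continuous_on_subset[OF cont]) (use R in auto)
  have m1: "\<tau> ` (ball a R - {a}) \<subseteq> ball (\<tau> a) r - {\<tau> a}"
    using ne r3 by (auto simp: R_def)
  have hi: "has_index (\<lambda>w. \<tau> w - \<tau> a) a 1"
    by (rule has_index_Ln[OF R(1) _ d]) (use r1 cR in \<open>auto simp: R_def intro!: continuous_intros\<close>)
  obtain r4 g' where g': "0 < r4" "r4 \<le> R" "continuous_on (ball a r4 - {a}) g'"
    "\<And>w. w \<in> ball a r4 - {a} \<Longrightarrow> \<tau> w - \<tau> a = (w - a) powi 1 * exp (g' w)"
    using has_indexE[OF hi R(1)] by blast
  have "continuous_on (ball a r4 - {a}) (\<lambda>w. g (\<tau> w))"
  proof (rule continuous_on_compose2[OF 1(2)])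
    show "continuous_on (ball a r4 - {a}) \<tau>"
      by (rule continuous_on_subset[OF cR]) (use g' in auto)
  qed (use g' m1 in \<open>auto simp: image_subset_iff\<close>)
  moreover have "(h \<circ> \<tau>) w = (w - a) powi n * exp (of_int n * g' w + g (\<tau> w))"
    if w: "w \<in> ball a r4 - {a}" for w
  proof -
    have "(h \<circ> \<tau>) w = ((w - a) * exp (g' w)) powi n * exp (g (\<tau> w))"
      using 1(3)[of "\<tau> w"] m1 w g'(2) g'(4)[OF w] by (auto simp: image_subset_iff)
    then show ?thesis
      by (simp add: power_int_mult_distrib exp_add exp_power_int)
  qed
  ultimately show ?thesis
    unfolding has_index_def
    by (intro exI[of _ r4] conjI exI[of _ "\<lambda>w. of_int n * g' w + g (\<tau> w)"])
       (use g' in \<open>auto intro!: continuous_intros\<close>)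
qed

text \<open>The coefficients are the Wirtinger derivatives \<open>(D 1 - \<i> * D \<i>) / 2\<close>
  and \<open>(D 1 + \<i> * D \<i>) / 2\<close>.\<close>

lemma linear_complex_form:
  fixes D :: "complex \<Rightarrow> complex"
  assumes "linear D"
  obtains A B where "\<And>v. D v = A * v + B * cnj v"
proof
  fix v
  have "v = Re v *\<^sub>R 1 + Im v *\<^sub>R \<i>"
    by (simp add: complex_eq_iff)
  then have "D v = D (Re v *\<^sub>R 1 + Im v *\<^sub>R \<i>)"
    by simp
  also have "\<dots> = Re v *\<^sub>R D 1 + Im v *\<^sub>R D \<i>"
    using assms by (simp add: linear_add linear_scale)
  also have "\<dots> = (D 1 - \<i> * D \<i>) / 2 * v + (D 1 + \<i> * D \<i>) / 2 * cnj v"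
    by (auto simp: complex_eq_iff field_simps)
  finally show "D v = (D 1 - \<i> * D \<i>) / 2 * v + (D 1 + \<i> * D \<i>) / 2 * cnj v" .
qed

text \<open>The quotient lies in the open unit disc around \<open>1\<close>, which is contained in
  the right half plane.\<close>

lemma Re_divide_pos:
  fixes x y :: complex
  assumes "cmod (x - y) < cmod y" shows "Re (x / y) > 0"
proof -
  have "cmod y > 0"
    using assms by (metis norm_ge_zero order_le_less_trans)
  then have "x / y - 1 = (x - y) / y"
    by (auto simp: diff_divide_distrib)
  then have "cmod (x / y - 1) < 1"
    using assms \<open>cmod y > 0\<close> by (simp add: norm_divide)
  then show ?thesis
    using abs_Re_le_cmod[of "x / y - 1"] by auto
qed

text \<open>The sign of the index is the orientation character of the derivative, written
  as \<open>D v = A v + B (cnj v)\<close>: the larger of the two coefficients wins.\<close>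

lemma has_index_regular_zero:
  assumes r: "r > 0" and cont: "continuous_on (ball a r) h" and D: "(h has_derivative D) (at a)"
    and s: "surj D" and z: "h a = 0"
  shows "has_index h a 1 \<or> has_index h a (-1)"
proof -
  have lin: "linear D"
    using D has_derivative_linear by blast
  then obtain A B where AB: "\<And>v. D v = A * v + B * cnj v"
    using linear_complex_form by blast
  have inj: "inj D"
    using linear_surjective_imp_injective[OF lin] s by auto
  have AneB: "cmod A \<noteq> cmod B"
  proof
    assume eq: "cmod A = cmod B"
    \<comment> \<open>A kernel vector for the case of equal moduli: a unit \<open>v\<close> with
      \<open>A * v^2 + B = 0\<close>. Since \<open>v * cnj v = 1\<close>, multiplying
      \<open>D v\<close> by \<open>v\<close> gives exactly this expression. If \<open>B = 0\<close>,
      then \<open>A = 0\<close> as well and any \<open>v\<close> will do.\<close>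
    define v where "v = (if B = 0 then 1 else csqrt (- B / A))"
    have v: "v \<noteq> 0" "D v = 0"
    proof -
      show "v \<noteq> 0" using eq by (auto simp: v_def)
      show "D v = 0"
      proof (cases "B = 0")
        case False
        then have A0: "A \<noteq> 0" using eq by auto
        have v2: "v\<^sup>2 = - B / A" using False by (simp add: v_def)
        have "cmod v ^ 2 = 1"
          using v2 eq A0 by (metis div_self nonzero_norm_divide norm_eq_zero norm_minus_cancel norm_power)
        then have "v * cnj v = 1"
          by (simp add: complex_norm_square[symmetric])
        then have "D v * v = A * v\<^sup>2 + B"
          by (simp add: AB algebra_simps power2_eq_square)
        also have "\<dots> = 0" using v2 A0 by simp
        finally show ?thesis using \<open>v \<noteq> 0\<close> by simp
      qed (use eq in \<open>simp add: AB\<close>)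
    qed
    then show False
      using inj lin by (metis injD linear_0)
  qed
  define M where "M = max (cmod A) (cmod B)"
  \<comment> \<open>Half the gap between the two moduli: the remainder of the derivative plus the
    smaller coefficient then stays strictly below the larger one.\<close>
  define e where "e = (M - min (cmod A) (cmod B)) / 2"
  have e1: "2 * e = cmod A - cmod B" if "cmod A > cmod B"
    using that by (simp add: e_def M_def)
  have e2: "2 * e = cmod B - cmod A" if "cmod B > cmod A"
    using that by (simp add: e_def M_def)
  have e: "e > 0" using AneB by (auto simp: e_def M_def)
  obtain d where d: "d > 0" "\<And>w. norm (w - a) < d \<Longrightarrow> norm (h w - h a - D (w - a)) \<le> e * norm (w - a)"
    using D e unfolding has_derivative_at_alt by blast
  define R where "R = min r d"
  have R: "R > 0" using r d by (simp add: R_def)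
  have cR: "continuous_on (ball a R - {a}) h"
    by (rule continuous_on_subset[OF cont]) (auto simp: R_def)
  have bd: "cmod (h w - A * (w - a) - B * cnj (w - a)) \<le> e * cmod (w - a)" if "w \<in> ball a R - {a}" for w
    using d(2)[of w] that z by (simp add: R_def AB dist_norm norm_minus_commute algebra_simps)
  show ?thesis
  proof (cases "cmod A > cmod B")
    case True
    then have A0: "A \<noteq> 0" by auto
    have "Re (h w / ((w - a) powi 1 * A)) > 0" if w: "w \<in> ball a R - {a}" for w
    proof (rule Re_divide_pos)
      have wa: "cmod (w - a) > 0" using w by auto
      have "cmod (h w - (w - a) powi 1 * A) \<le> cmod (h w - A * (w - a) - B * cnj (w - a)) + cmod (B * cnj (w - a))"
        using norm_triangle_ineq[of "h w - A * (w - a) - B * cnj (w - a)" "B * cnj (w - a)"]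
        by (simp add: mult.commute)
      also have "\<dots> \<le> (e + cmod B) * cmod (w - a)"
        using bd[OF w] by (simp only: norm_mult complex_mod_cnj distrib_right) 
      also have "\<dots> < cmod A * cmod (w - a)"
        by (rule mult_strict_right_mono[OF _ wa]) (use True e1[OF True] in \<open>simp add: field_simps\<close>)
      finally show "cmod (h w - (w - a) powi 1 * A) < cmod ((w - a) powi 1 * A)"
        by (simp add: norm_mult mult.commute)
    qed
    then show ?thesis
      using has_index_Ln[OF R cR A0, of 1] by blast
  next
    case False
    then have AB': "cmod B > cmod A" and B0: "B \<noteq> 0" using AneB by auto
    have *: "Re (h w / (cnj (w - a) * B)) > 0" if w: "w \<in> ball a R - {a}" for w
    proof (rule Re_divide_pos)
      have wa: "cmod (w - a) > 0" using w by auto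
      have "cmod (h w - cnj (w - a) * B) \<le> cmod (h w - A * (w - a) - B * cnj (w - a)) + cmod (A * (w - a))"
        using norm_triangle_ineq[of "h w - A * (w - a) - B * cnj (w - a)" "A * (w - a)"]
        by (simp add: mult.commute)
      also have "\<dots> \<le> (e + cmod A) * cmod (w - a)"
        using bd[OF w] by (simp only: norm_mult complex_mod_cnj distrib_right) 
      also have "\<dots> < cmod B * cmod (w - a)"
        by (rule mult_strict_right_mono[OF _ wa]) (use AB' e2[OF AB'] in \<open>simp add: field_simps\<close>)
      finally show "cmod (h w - cnj (w - a) * B) < cmod (cnj (w - a) * B)"
        by (simp only: norm_mult complex_mod_cnj mult.commute)
    qed
    have "Re (h w / ((w - a) powi (-1) * B)) > 0" if w: "w \<in> ball a R - {a}" for w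
    proof -
      \<comment> \<open>\<open>cnj q\<close> and the inverse of \<open>q\<close> differ by the
        positive factor \<open>(cmod q)^2\<close>, so the half plane condition relative to
        \<open>cnj (w - a)\<close> is the one for exponent \<open>-1\<close>.\<close>
      have gen: "x / (q powi (-1) * B) = of_real ((cmod q)\<^sup>2) * (x / (cnj q * B))" if "q \<noteq> 0" for x q
        using that B0 complex_norm_square[of q] by (simp add: power_int_minus field_simps)
      have "h w / ((w - a) powi (-1) * B) = of_real ((cmod (w - a))\<^sup>2) * (h w / (cnj (w - a) * B))"
        by (rule gen) (use w in auto)
      also have "Re \<dots> = (cmod (w - a))\<^sup>2 * Re (h w / (cnj (w - a) * B))"
        unfolding scaleR_conv_of_real[symmetric] by (rule scaleR_complex.sel(1))
      finally show ?thesis using *[OF w] w by simp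
    qed
    then show ?thesis
      using has_index_Ln[OF R cR B0, of "-1"] by blast
  qed
qed

lemma homeomorphic_map_openin_image:
  assumes "homeomorphic_map X (subtopology Y S) f" "openin Y S" "openin X U"
  shows "openin Y (f ` U)"
  using assms by (metis homeomorphic_imp_open_map open_map_def openin_trans_full)

section \<open>Coordinates on the circle bundle\<close>

locale kk_bundle =
  fixes K :: "('x, 'i, 'l::ab_group_add) bundle_data"
  assumes kk: "kaluza_klein_data K"
begin

abbreviation "X \<equiv> topspace (base K)"
abbreviation "ov \<equiv> overlap (cdom K) (cpar K)"
abbreviation "tr \<equiv> transition (cdom K) (cpar K)"
abbreviation "fc \<equiv> frame_change K"
abbreviation "fr i w \<equiv> frame K i (cpar K i w)"

section \<open>Charts of the surface\<close>

lemma surface: "riemann_surface_with_metric K" and line_bundle: "holomorphic_line_bundle K"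
  and hermitian: "hermitian_metric K"
  using kk unfolding kaluza_klein_data_def by auto

lemma Hausdorff_X: "Hausdorff_space (base K)" and compact_X: "compact_space (base K)"
  and connected_X: "connected_space (base K)" and nonempty_X: "X \<noteq> {}"
  using surface unfolding riemann_surface_with_metric_def by auto

lemma atlas: "topological_atlas (base K) (cdom K) (cpar K)"
  using surface unfolding riemann_surface_with_metric_def holomorphic_atlas_def by blast

lemma open_cdom [simp]: "open (cdom K i)"
  and openin_patch: "openin (base K) (cpar K i ` cdom K i)"
  and homeo_chart: "homeomorphic_map (top_of_set (cdom K i))
         (subtopology (base K) (cpar K i ` cdom K i)) (cpar K i)"
  and cover: "(\<Union>i. cpar K i ` cdom K i) = X"
  using atlas unfolding topological_atlas_def by blast+

lemma cpar_in_X [simp]: "w \<in> cdom K i \<Longrightarrow> cpar K i w \<in> X"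
  using cover by blast

lemma chartE:
  assumes "z \<in> X" obtains i w where "w \<in> cdom K i" "cpar K i w = z"
proof -
  have "z \<in> (\<Union>i. cpar K i ` cdom K i)"
    using assms cover by simp
  then show thesis using that by blast
qed

lemma inj_cpar: "inj_on (cpar K i) (cdom K i)"
  using homeo_chart[of i] unfolding homeomorphic_map_def
  by (metis homeo_chart homeomorphic_imp_injective_map openin_subset openin_topspace topspace_euclidean_subtopology)

lemma cpar_eq_iff: "w \<in> cdom K i \<Longrightarrow> v \<in> cdom K i \<Longrightarrow> cpar K i w = cpar K i v \<longleftrightarrow> w = v"
  using inj_cpar by (auto dest: inj_onD)

lemma continuous_map_cpar: "continuous_map (top_of_set (cdom K i)) (base K) (cpar K i)"
  using homeo_chart[of i] homeomorphic_imp_continuous_map continuous_map_in_subtopology by blast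

lemma openin_cpar_image:
  assumes "open U" "U \<subseteq> cdom K i" shows "openin (base K) (cpar K i ` U)"
  by (rule homeomorphic_map_openin_image[OF homeo_chart openin_patch])
     (use assms in \<open>auto simp: openin_open_eq\<close>)

lemma open_cpar_vimage:
  assumes "openin (base K) W" shows "open {w \<in> cdom K i. cpar K i w \<in> W}"
  using openin_continuous_map_preimage[OF continuous_map_cpar assms, of i] openin_open_trans[OF _ open_cdom] by force

lemma openin_chartI:
  assumes "W \<subseteq> X" "\<And>i. open {w \<in> cdom K i. cpar K i w \<in> W}"
  shows "openin (base K) W"
proof -
  have "W = (\<Union>i. cpar K i ` {w \<in> cdom K i. cpar K i w \<in> W})"
  proof (intro subset_antisym subsetI)
    fix z assume z: "z \<in> W"
    then obtain i w where "w \<in> cdom K i" "cpar K i w = z"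
      using assms(1) chartE by blast
    then show "z \<in> (\<Union>i. cpar K i ` {w \<in> cdom K i. cpar K i w \<in> W})"
      using z by blast
  qed auto
  moreover have "openin (base K) (\<Union>i. cpar K i ` {w \<in> cdom K i. cpar K i w \<in> W})"
  proof (rule openin_Union)
    fix T assume "T \<in> range (\<lambda>i. cpar K i ` {w \<in> cdom K i. cpar K i w \<in> W})"
    then obtain i where "T = cpar K i ` {w \<in> cdom K i. cpar K i w \<in> W}" by blast
    then show "openin (base K) T"
      using openin_cpar_image[OF assms(2)[of i], of i] by auto
  qed
  ultimately show ?thesis by simp
qed

lemma ov_iff: "w \<in> ov i j \<longleftrightarrow> w \<in> cdom K i \<and> cpar K i w \<in> cpar K j ` cdom K j"
  by (auto simp: overlap_def)

lemma open_ov: "open (ov i j)"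
  unfolding overlap_def by (rule open_cpar_vimage[OF openin_patch])

lemma tr_in: "w \<in> ov i j \<Longrightarrow> tr i j w \<in> cdom K j"
  and cpar_tr: "w \<in> ov i j \<Longrightarrow> cpar K j (tr i j w) = cpar K i w"
  by (auto simp: overlap_def transition_def inv_into_into f_inv_into_f)

lemma tr_in_ov: "w \<in> ov i j \<Longrightarrow> tr i j w \<in> ov j i"
  using cpar_tr tr_in by (fastforce simp: overlap_def)

lemma tr_eqI:
  assumes "w \<in> cdom K i" "v \<in> cdom K j" "cpar K i w = cpar K j v"
  shows "w \<in> ov i j" "tr i j w = v"
proof -
  show 1: "w \<in> ov i j" using assms by (auto simp: overlap_def)
  show "tr i j w = v"
    using cpar_eq_iff[OF tr_in[OF 1] assms(2)] cpar_tr[OF 1] assms(3) by simp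
qed

lemma tr_tr: "w \<in> ov i j \<Longrightarrow> tr j i (tr i j w) = w"
  using tr_eqI(2)[of "tr i j w" j w i] tr_in cpar_tr by (metis ov_iff)

lemma holomorphic_tr: "tr i j holomorphic_on ov i j"
  using surface unfolding riemann_surface_with_metric_def holomorphic_atlas_def by blast

lemma continuous_on_tr: "continuous_on (ov i j) (tr i j)"
  using holomorphic_tr holomorphic_on_imp_continuous_on by blast

lemma tr_has_derivative:
  "w \<in> ov i j \<Longrightarrow> (tr i j has_field_derivative deriv (tr i j) w) (at w)"
  using holomorphic_tr open_ov holomorphic_derivI by blast

text \<open>The two transitions between a pair of charts are mutually inverse, so by the chain rule
  their derivatives multiply to \<open>1\<close>.\<close>

lemma deriv_tr_nonzero:
  assumes "w \<in> ov i j" shows "deriv (tr i j) w \<noteq> 0"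
proof -
  have "((\<lambda>w. tr j i (tr i j w)) has_field_derivative deriv (tr j i) (tr i j w) * deriv (tr i j) w) (at w)"
    by (rule DERIV_chain2[OF tr_has_derivative tr_has_derivative]) (use assms tr_in_ov in auto)
  moreover have "((\<lambda>w. tr j i (tr i j w)) has_field_derivative 1) (at w)"
    by (rule has_field_derivative_transform_within_open[OF DERIV_ident open_ov assms]) (simp add: tr_tr)
  ultimately have "deriv (tr j i) (tr i j w) * deriv (tr i j) w = 1"
    using DERIV_unique by blast
  then show ?thesis by auto
qed

section \<open>Fibres, frames and the Hermitian norm\<close>

lemma vector_space_K: "vector_space (smult K)"
  using line_bundle unfolding holomorphic_line_bundle_def by blast

sublocale V: vector_space "smult K" by (rule vector_space_K)

lemma fibre_subspace: "z \<in> X \<Longrightarrow> V.subspace (fibre K z)"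
  and fibre_dim: "z \<in> X \<Longrightarrow> V.dim (fibre K z) = 1"
  using line_bundle unfolding holomorphic_line_bundle_def by blast+

lemma fr_in: "w \<in> cdom K i \<Longrightarrow> fr i w \<in> fibre K (cpar K i w)"
  and fr_nonzero: "w \<in> cdom K i \<Longrightarrow> fr i w \<noteq> 0"
  using line_bundle unfolding holomorphic_line_bundle_def by blast+

lemma smult_eq_iff: "e \<noteq> 0 \<Longrightarrow> smult K c e = smult K d e \<longleftrightarrow> c = d"
  by (metis V.scale_right_imp_eq)

lemma fibre_spanned:
  assumes z: "z \<in> X" and e: "e \<in> fibre K z" "e \<noteq> 0" and u: "u \<in> fibre K z"
  obtains c where "u = smult K c e"
proof -
  obtain B where B: "B \<subseteq> fibre K z" "V.independent B" "fibre K z \<subseteq> V.span B" "card B = V.dim (fibre K z)"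
    using V.basis_exists by blast
  then obtain b where "B = {b}"
    using fibre_dim[OF z] by (metis card_1_singletonE)
  then have sp: "\<exists>c. v = smult K c b" if "v \<in> fibre K z" for v
    using that B(3) by (auto simp: V.span_singleton)
  obtain c d where cd: "u = smult K c b" "e = smult K d b"
    using sp u e by blast
  then have "d \<noteq> 0" using e(2) by auto
  then have "u = smult K (c / d) e"
    using cd by simp
  then show thesis using that by blast
qed

text \<open>Existence and uniqueness of the ratio of two frames in a one-dimensional fibre discharge
  the definite description in \<open>frame_change\<close>.\<close>

lemma fc_eq:
  assumes "w \<in> ov i j"
  shows "fr i w = smult K (fc i j w) (fr j (tr i j w))"
proof -
  let ?e = "frame K j (cpar K i w)"
  have z: "cpar K j (tr i j w) = cpar K i w" "tr i j w \<in> cdom K j" and w: "w \<in> cdom K i"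
    using assms cpar_tr tr_in ov_iff by auto
  have e: "?e \<in> fibre K (cpar K i w)" "?e \<noteq> 0"
    using fr_in[OF z(2)] fr_nonzero[OF z(2)] z by auto
  obtain c where c: "fr i w = smult K c ?e"
    using fibre_spanned[OF _ e fr_in[OF w]] w by auto
  have "fc i j w = c"
    unfolding frame_change_def by (rule the_equality) (use c smult_eq_iff[OF e(2)] in auto)
  then show ?thesis
    using c z by simp
qed

lemma fc_nonzero: "w \<in> ov i j \<Longrightarrow> fc i j w \<noteq> 0"
  using fc_eq[of w i j] fr_nonzero[of w i] ov_iff by auto

lemma holomorphic_fc: "fc i j holomorphic_on ov i j"
  using line_bundle unfolding holomorphic_line_bundle_def by blast

lemma herm_smult: "z \<in> X \<Longrightarrow> u \<in> fibre K z \<Longrightarrow> v \<in> fibre K z \<Longrightarrow> herm K z (smult K c u) v = c * herm K z u v"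
  and herm_add: "z \<in> X \<Longrightarrow> u \<in> fibre K z \<Longrightarrow> v \<in> fibre K z \<Longrightarrow> w \<in> fibre K z \<Longrightarrow>
        herm K z (u + v) w = herm K z u w + herm K z v w"
  and herm_cnj: "z \<in> X \<Longrightarrow> u \<in> fibre K z \<Longrightarrow> v \<in> fibre K z \<Longrightarrow> herm K z v u = cnj (herm K z u v)"
  and herm_pos: "z \<in> X \<Longrightarrow> u \<in> fibre K z \<Longrightarrow> u \<noteq> 0 \<Longrightarrow> Re (herm K z u u) > 0"
  using hermitian unfolding hermitian_metric_def by blast+

lemma smult_in: "z \<in> X \<Longrightarrow> u \<in> fibre K z \<Longrightarrow> smult K c u \<in> fibre K z"
  using fibre_subspace V.subspace_scale by blast

lemma add_in: "z \<in> X \<Longrightarrow> u \<in> fibre K z \<Longrightarrow> v \<in> fibre K z \<Longrightarrow> u + v \<in> fibre K z"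
  using fibre_subspace V.subspace_add by blast

lemma hnorm_pos: "z \<in> X \<Longrightarrow> u \<in> fibre K z \<Longrightarrow> u \<noteq> 0 \<Longrightarrow> hnorm K z u > 0"
  unfolding hnorm_def using herm_pos by simp

lemma hnorm_smult:
  assumes "z \<in> X" "u \<in> fibre K z" shows "hnorm K z (smult K c u) = cmod c * hnorm K z u"
proof -
  have "herm K z (smult K c u) (smult K c u) = c * herm K z u (smult K c u)"
    using assms herm_smult smult_in by blast
  also have "herm K z u (smult K c u) = cnj (c * herm K z u u)"
    using assms herm_smult smult_in herm_cnj by metis
  also have "cnj (c * herm K z u u) = cnj c * herm K z u u"
    using herm_cnj[OF assms(1,2,2)] by simp
  finally have "herm K z (smult K c u) (smult K c u) = of_real ((cmod c)\<^sup>2) * herm K z u u"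
    using complex_norm_square[of c] by simp
  then show ?thesis
    by (simp add: hnorm_def real_sqrt_mult)
qed

definition frame_norm :: "'i \<Rightarrow> complex \<Rightarrow> real" where
  "frame_norm i w = hnorm K (cpar K i w) (fr i w)"

lemma frame_norm_pos: "w \<in> cdom K i \<Longrightarrow> frame_norm i w > 0"
  unfolding frame_norm_def using hnorm_pos fr_in fr_nonzero by simp

lemma herm_fr: "w \<in> cdom K i \<Longrightarrow> herm K (cpar K i w) (fr i w) (fr i w) = of_real ((frame_norm i w)\<^sup>2)"
  using herm_pos[of "cpar K i w" "fr i w"] herm_cnj[of "cpar K i w" "fr i w" "fr i w"] fr_in fr_nonzero
  by (auto simp: frame_norm_def hnorm_def complex_eq_iff)

lemma continuous_on_frame_norm: "continuous_on (cdom K i) (frame_norm i)"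
proof -
  have "continuous_on (cdom K i) (frame_sqnorm K i)"
    using hermitian unfolding hermitian_metric_def smooth_on_def by (metis Ck_on.simps(1))
  then have "continuous_on (cdom K i) (\<lambda>w. sqrt (Re (frame_sqnorm K i w)))"
    by (intro continuous_intros)
  then show ?thesis
    by (simp add: frame_norm_def[abs_def] frame_sqnorm_def hnorm_def)
qed

lemma frame_norm_tr: "w \<in> ov i j \<Longrightarrow> frame_norm i w = cmod (fc i j w) * frame_norm j (tr i j w)"
  using fc_eq[of w i j] hnorm_smult[of "cpar K i w" "fr j (tr i j w)" "fc i j w"] fr_in[OF tr_in, of w i j]
  by (auto simp: frame_norm_def cpar_tr ov_iff)

text \<open>The fibre coordinate is a unit complex number instead of an angle. Each trivialization
  thus covers whole fibres without a cut, and \<open>Ppar\<close> is the case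
  \<open>\<zeta> = cis \<theta>\<close>.\<close>

definition circle_pt :: "'i \<Rightarrow> complex \<Rightarrow> complex \<Rightarrow> 'x \<times> ('l \<Rightarrow> complex)" where
  "circle_pt i w \<zeta> = (cpar K i w, \<lambda>u. if u \<in> fibre K (cpar K i w)
     then \<zeta> * herm K (cpar K i w) u (fr i w) / of_real (frame_norm i w) else 0)"

lemma Ppar_eq: "Ppar K (i, \<alpha>) (w, \<theta>) = circle_pt i w (cis \<theta>)"
  by (simp add: Ppar_def Let_def circle_pt_def frame_norm_def cong: if_cong)

lemma fst_circle_pt [simp]: "fst (circle_pt i w \<zeta>) = cpar K i w"
  by (simp add: circle_pt_def)

lemma snd_circle_pt_fr: "w \<in> cdom K i \<Longrightarrow> snd (circle_pt i w \<zeta>) (fr i w) = \<zeta> * of_real (frame_norm i w)"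
  using frame_norm_pos[of w i] by (simp add: circle_pt_def fr_in herm_fr power2_eq_square)

text \<open>In a one-dimensional fibre all unit vectors differ by a phase, so the supremum in
  \<open>dual_norm\<close> is taken over a single value.\<close>

lemma dual_norm_eq:
  assumes w: "w \<in> cdom K i" and l: "l \<in> dual_fibre K (cpar K i w)"
  shows "dual_norm K (cpar K i w) l = cmod (l (fr i w)) / frame_norm i w"
proof -
  let ?z = "cpar K i w" and ?e = "fr i w"
  have z: "?z \<in> X" using w by simp
  have val: "cmod (l u) = cmod (l ?e) / frame_norm i w" if u: "u \<in> fibre K ?z" "hnorm K ?z u = 1" for u
  proof -
    obtain c where c: "u = smult K c ?e"
      using fibre_spanned[OF z fr_in[OF w] fr_nonzero[OF w] u(1)] by blast
    then have "cmod c * frame_norm i w = 1"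
      using u(2) hnorm_smult[OF z fr_in[OF w]] by (simp add: frame_norm_def)
    moreover have "l u = c * l ?e"
      using l c fr_in[OF w] by (auto simp: dual_fibre_def)
    ultimately show ?thesis
      using frame_norm_pos[OF w] by (simp add: norm_mult field_simps)
  qed
  \<comment> \<open>The normalised frame shows that there are unit vectors at all; the supremum of a
    constant needs a nonempty index set.\<close>
  let ?u = "smult K (of_real (inverse (frame_norm i w))) ?e"
  have "?u \<in> {u \<in> fibre K ?z. hnorm K ?z u = 1}"
    using smult_in[OF z fr_in[OF w]] hnorm_smult[OF z fr_in[OF w]] frame_norm_pos[OF w]
    by (simp add: frame_norm_def[symmetric] norm_inverse)
  then have ne: "{u \<in> fibre K ?z. hnorm K ?z u = 1} \<noteq> {}"
    by blast
  have "(SUP u\<in>{u \<in> fibre K ?z. hnorm K ?z u = 1}. cmod (l u))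
      = (SUP u\<in>{u \<in> fibre K ?z. hnorm K ?z u = 1}. cmod (l ?e) / frame_norm i w)"
    by (intro arg_cong[where f=Sup] image_cong) (use val in auto)
  then show ?thesis
    using ne by (simp add: dual_norm_def)
qed

lemma snd_circle_pt_in:
  assumes w: "w \<in> cdom K i" shows "snd (circle_pt i w \<zeta>) \<in> dual_fibre K (cpar K i w)"
proof -
  have z: "cpar K i w \<in> X" using w by simp
  show ?thesis
    unfolding dual_fibre_def circle_pt_def
    using herm_add[OF z] herm_smult[OF z] add_in[OF z] smult_in[OF z] fr_in[OF w]
    by (auto simp: algebra_simps add_divide_distrib)
qed

lemma circle_pt_in:
  assumes w: "w \<in> cdom K i" and "cmod \<zeta> = 1" shows "circle_pt i w \<zeta> \<in> circle_bundle K"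
proof -
  have "dual_norm K (cpar K i w) (snd (circle_pt i w \<zeta>)) = 1"
    using dual_norm_eq[OF w snd_circle_pt_in[OF w]] snd_circle_pt_fr[OF w] assms frame_norm_pos[OF w] by (simp add: norm_mult)
  then show ?thesis
    using snd_circle_pt_in[OF w] w unfolding circle_bundle_def
    by (metis (mono_tags, lifting) case_prodI cpar_in_X fst_circle_pt mem_Collect_eq prod.collapse)
qed

text \<open>The coordinate is forced to be the value of the functional on the frame divided by the
  norm of the frame, since a functional on a line is determined by one value.\<close>

lemma circle_pt_ex:
  assumes p: "p \<in> circle_bundle K" and w: "w \<in> cdom K i" and f: "fst p = cpar K i w"
  obtains \<zeta> where "cmod \<zeta> = 1" "p = circle_pt i w \<zeta>"
proof
  let ?z = "cpar K i w" and ?e = "fr i w"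
  define l where "l = snd p"
  have l: "l \<in> dual_fibre K ?z" "dual_norm K ?z l = 1"
    using p f by (auto simp: circle_bundle_def l_def)
  have z: "?z \<in> X" using w by simp
  let ?\<zeta> = "l ?e / of_real (frame_norm i w)"
  show "cmod ?\<zeta> = 1"
    using dual_norm_eq[OF w l(1)] l(2) frame_norm_pos[OF w] by (simp add: norm_divide)
  have "l u = snd (circle_pt i w ?\<zeta>) u" for u
  proof (cases "u \<in> fibre K ?z")
    case True
    then obtain c where c: "u = smult K c ?e"
      using fibre_spanned[OF z fr_in[OF w] fr_nonzero[OF w]] by blast
    have "l u = c * l ?e" "herm K ?z u ?e = c * of_real ((frame_norm i w)\<^sup>2)"
      using l c fr_in[OF w] herm_smult[OF z] herm_fr[OF w] by (auto simp: dual_fibre_def)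
    then show ?thesis
      using True frame_norm_pos[OF w] by (simp add: circle_pt_def power2_eq_square)
  next
    case False
    then show ?thesis
      using l by (auto simp: circle_pt_def dual_fibre_def)
  qed
  then show "p = circle_pt i w ?\<zeta>"
    by (metis ext f fst_circle_pt l_def prod.collapse)
qed

lemma pointE:
  assumes "p \<in> circle_bundle K"
  obtains i w \<zeta> where "w \<in> cdom K i" "cmod \<zeta> = 1" "p = circle_pt i w \<zeta>"
proof -
  have "fst p \<in> X" using assms by (auto simp: circle_bundle_def)
  then show thesis using that assms by (metis chartE circle_pt_ex)
qed

text \<open>The points are functionals, so the fibre coordinate changes by the inverse of the
  transition function; the modulus of that function is absorbed by the two frame norms, and its
  phase remains.\<close>

lemma circle_pt_tr:
  assumes w: "w \<in> ov i j" and "cmod \<zeta> = 1"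
  shows "circle_pt i w \<zeta> = circle_pt j (tr i j w) (\<zeta> * inverse (sgn (fc i j w)))"
proof -
  have w': "w \<in> cdom K i" using w ov_iff by auto
  obtain \<xi> where x: "cmod \<xi> = 1" "circle_pt i w \<zeta> = circle_pt j (tr i j w) \<xi>"
    using circle_pt_ex[OF circle_pt_in[OF w' assms(2)] tr_in[OF w]] cpar_tr[OF w] by auto
  let ?e = "fr j (tr i j w)"
  have e: "?e \<in> fibre K (cpar K i w)" using fr_in[OF tr_in[OF w]] cpar_tr[OF w] by simp
  have "\<zeta> * of_real (frame_norm i w) = snd (circle_pt i w \<zeta>) (smult K (fc i j w) ?e)"
    using snd_circle_pt_fr[OF w'] fc_eq[OF w] by simp
  also have "\<dots> = fc i j w * snd (circle_pt i w \<zeta>) ?e"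
    using snd_circle_pt_in[OF w'] e by (auto simp: dual_fibre_def)
  also have "\<dots> = fc i j w * (\<xi> * of_real (frame_norm j (tr i j w)))"
    using x snd_circle_pt_fr[OF tr_in[OF w]] by simp
  finally have "\<zeta> * of_real (cmod (fc i j w)) = fc i j w * \<xi>"
    using frame_norm_tr[OF w] frame_norm_pos[OF tr_in[OF w]] by simp
  then have "\<xi> = \<zeta> * inverse (sgn (fc i j w))"
    using fc_nonzero[OF w] by (simp add: sgn_eq field_simps)
  then show ?thesis using x by simp
qed

lemma S1_act_circle_pt: "S1_act t (circle_pt i w \<zeta>) = circle_pt i w (cis t * \<zeta>)"
  by (auto simp: S1_act_def circle_pt_def)

lemma lift_circle_pt:
  assumes "is_lift K m s u" "w \<in> cdom K i" "cmod \<zeta> = 1"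
  shows "u (circle_pt i w \<zeta>) = s i w * (\<zeta> * of_real (frame_norm i w)) powi m"
proof -
  obtain l where l: "circle_pt i w \<zeta> = (cpar K i w, l)"
    by (metis fst_circle_pt prod.collapse)
  then have "u (cpar K i w, l) = s i w * l (fr i w) powi m"
    using assms circle_pt_in[OF assms(2,3)] unfolding is_lift_def by auto
  then show ?thesis
    using l snd_circle_pt_fr[OF assms(2), of \<zeta>] by simp
qed

section \<open>The topology of the circle bundle\<close>

lemma open_Pdom [simp]: "open (Pdom K k)"
  unfolding Pdom_def by (intro open_Times open_greaterThanLessThan open_cdom)

lemma Ppar_in: "x \<in> Pdom K k \<Longrightarrow> Ppar K k x \<in> circle_bundle K"
  by (cases k; cases x) (auto simp: Pdom_def Ppar_eq intro: circle_pt_in)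

lemma topspace_Ptop [simp]: "topspace (Ptop K) = circle_bundle K"
proof -
  have "{x \<in> Pdom K k. Ppar K k x \<in> circle_bundle K} = Pdom K k" for k
    using Ppar_in by blast
  then have "openin (Ptop K) (circle_bundle K)"
    unfolding openin_Ptop using open_Pdom by simp
  then show ?thesis
    by (metis openin_Ptop openin_subset openin_topspace subset_antisym)
qed

lemma continuous_map_from_Ptop:
  assumes "\<And>k. continuous_map (top_of_set (Pdom K k)) Y (f \<circ> Ppar K k)"
    and "f \<in> circle_bundle K \<rightarrow> topspace Y"
  shows "continuous_map (Ptop K) Y f"
  unfolding continuous_map_def
proof (intro conjI allI impI)
  fix U assume U: "openin Y U"
  show "openin (Ptop K) {x \<in> topspace (Ptop K). f x \<in> U}"
    unfolding openin_Ptop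
  proof (intro conjI allI)
    fix k
    have "openin (top_of_set (Pdom K k)) {x \<in> Pdom K k. (f \<circ> Ppar K k) x \<in> U}"
      using openin_continuous_map_preimage[OF assms(1) U, of k] by simp
    moreover have "{x \<in> Pdom K k. (f \<circ> Ppar K k) x \<in> U} = {x \<in> Pdom K k. Ppar K k x \<in> {x \<in> topspace (Ptop K). f x \<in> U}}"
    proof -
      have "Ppar K k x \<in> topspace (Ptop K)" if "x \<in> Pdom K k" for x
        using Ppar_in[OF that] by simp
      then show ?thesis by (intro Collect_cong) (simp cong: conj_cong)
    qed
    ultimately show "open {x \<in> Pdom K k. Ppar K k x \<in> {x \<in> topspace (Ptop K). f x \<in> U}}"
      using openin_open_trans[OF _ open_Pdom] by metis
  qed auto
qed (use assms in auto)

text \<open>\<open>Ptop\<close> is described by charts with an angle in an open interval. A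
  continuous choice of the angle near a given \<open>\<zeta>\<close> is obtained from the principal
  logarithm of the quotient by \<open>\<zeta>\<close>, which is near \<open>1\<close> there.\<close>

lemma continuous_map_circle_pt:
  "continuous_map (top_of_set (cdom K i \<times> sphere 0 1)) (Ptop K) (\<lambda>(w, \<zeta>). circle_pt i w \<zeta>)"
  unfolding continuous_map_def
proof (intro conjI allI impI)
  fix W assume W: "openin (Ptop K) W"
  let ?S = "{x \<in> cdom K i \<times> sphere 0 1. (case x of (w, \<zeta>) \<Rightarrow> circle_pt i w \<zeta>) \<in> W}"
  have "\<exists>e>0. \<forall>y\<in>cdom K i \<times> sphere 0 1. dist y x < e \<longrightarrow> y \<in> ?S" if x: "x \<in> ?S" for x
  proof -
    obtain w \<zeta> where xw: "x = (w, \<zeta>)" "w \<in> cdom K i" "cmod \<zeta> = 1" "circle_pt i w \<zeta> \<in> W"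
      using x by (auto simp: dist_norm)
    define \<theta> where "\<theta> = Arg \<zeta>"
    have z: "\<zeta> = cis \<theta>" 
    proof -
      have "\<zeta> \<noteq> 0" using xw(3) by auto
      then have "cis \<theta> = sgn \<zeta>" unfolding \<theta>_def by (rule cis_Arg)
      also have "\<dots> = \<zeta>" unfolding sgn_eq xw(3) by simp
      finally show ?thesis by simp
    qed
    \<comment> \<open>The angles of this chart form the interval of length \<open>2 * pi\<close>
      centred at \<open>\<theta>\<close>, so the cut is opposite to the point.\<close>
    let ?k = "(i, \<theta> - pi)"
    let ?T = "{y \<in> Pdom K ?k. Ppar K ?k y \<in> W}"
    have "open ?T" using W openin_Ptop by blast
    moreover have "(w, \<theta>) \<in> ?T"
      using xw z by (auto simp: Pdom_def Ppar_eq)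
    ultimately obtain e where e: "e > 0" "ball (w, \<theta>) e \<subseteq> ?T"
      using openE by blast
    let ?q = "\<lambda>y. (fst y, \<theta> + Im (Ln (snd y / \<zeta>))) :: complex \<times> real"
    have "isCont (\<lambda>y::complex \<times> complex. snd y / \<zeta>) x"
      using xw by (auto intro!: continuous_intros)
    then have "isCont (\<lambda>y::complex \<times> complex. Ln (snd y / \<zeta>)) x"
      by (rule isCont_Ln') (use xw in \<open>auto simp: complex_nonpos_Reals_iff\<close>)
    then have "isCont ?q x"
      by (intro continuous_Pair continuous_add continuous_const continuous_Im continuous_fst continuous_ident)
    moreover have "?q x = (w, \<theta>)" using xw by auto
    ultimately obtain d where d: "d > 0" "\<And>y. dist y x < d \<Longrightarrow> dist (?q y) (w, \<theta>) < e"
      using e(1) unfolding continuous_at_eps_delta by metis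
    show ?thesis
    proof (intro exI[of _ d] conjI ballI impI)
      fix y assume y: "y \<in> cdom K i \<times> sphere 0 1" "dist y x < d"
      obtain v \<xi> where v: "y = (v, \<xi>)" "v \<in> cdom K i" "cmod \<xi> = 1"
        using y by (auto simp: dist_norm)
      have "(v, \<theta> + Im (Ln (\<xi> / \<zeta>))) \<in> ?T"
        using d(2)[OF y(2)] by (intro subsetD[OF e(2)]) (use v in \<open>auto simp: dist_commute\<close>)
      then have "circle_pt i v (cis (\<theta> + Im (Ln (\<xi> / \<zeta>)))) \<in> W"
        by (simp add: Ppar_eq)
      moreover have "cis (\<theta> + Im (Ln (\<xi> / \<zeta>))) = \<xi>"
      proof -
        have n: "\<xi> / \<zeta> \<noteq> 0" "cmod (\<xi> / \<zeta>) = 1" using v xw by (auto simp: norm_divide)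
        have "\<xi> / \<zeta> = exp (Ln (\<xi> / \<zeta>))" using n by simp
        also have "\<dots> = cis (Im (Ln (\<xi> / \<zeta>)))"
          unfolding exp_eq_polar[of "Ln (\<xi> / \<zeta>)"] using n by (simp del: exp_Ln)
        finally show ?thesis
          using xw(3) by (auto simp: cis_mult[symmetric] z[symmetric] field_simps)
      qed
      ultimately show "y \<in> ?S" using v by simp
    qed (use d in auto)
  qed
  then show "openin (top_of_set (cdom K i \<times> sphere 0 1)) {x \<in> topspace (top_of_set (cdom K i \<times> sphere 0 1)). (case x of (w, \<zeta>) \<Rightarrow> circle_pt i w \<zeta>) \<in> W}"
    unfolding openin_euclidean_subtopology_iff by auto
qed (auto intro: circle_pt_in)

end

section \<open>Phase sets and nodal domains\<close>

text \<open>The sets \<open>Q \<union> C\<close>, one for each connecting set \<open>C\<close>, are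
  connected, share \<open>Q\<close> and exhaust \<open>P\<close>.\<close>

lemma connectedin_star:
  assumes Q: "connectedin T Q" "Q \<noteq> {}" "Q \<subseteq> P"
    and star: "\<And>p. p \<in> P \<Longrightarrow> \<exists>C. connectedin T C \<and> C \<subseteq> P \<and> p \<in> C \<and> C \<inter> Q \<noteq> {}"
  shows "connectedin T P"
proof -
  let ?U = "{Q \<union> C |C. connectedin T C \<and> C \<subseteq> P \<and> C \<inter> Q \<noteq> {}}"
  have "connectedin T (\<Union>?U)"
  proof (rule connectedin_Union)
    fix S assume "S \<in> ?U"
    then obtain C where "S = Q \<union> C" "connectedin T C" "C \<inter> Q \<noteq> {}" by blast
    then show "connectedin T S"
      using connectedin_Un[OF Q(1)] by (simp add: Int_commute)
  next
    show "\<Inter>?U \<noteq> {}" using Q(2) by blast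
  qed
  moreover have "\<Union>?U = P"
  proof (intro subset_antisym subsetI)
    fix p assume p: "p \<in> P"
    obtain C where "connectedin T C" "C \<subseteq> P" "p \<in> C" "C \<inter> Q \<noteq> {}"
      using star[OF p] by blast
    then show "p \<in> \<Union>?U" by (intro UnionI[of "Q \<union> C"]) auto
  qed (use Q(3) in auto)
  ultimately show ?thesis by simp
qed

lemma cis_eq_1_iff: "cis x = 1 \<longleftrightarrow> (\<exists>k::int. x = 2 * pi * of_int k)"
proof -
  have "cis x = 1 \<longleftrightarrow> cos x = 1 \<and> sin x = 0"
    by (auto simp: complex_eq_iff)
  also have "\<dots> \<longleftrightarrow> cos x = 1"
    using cos_one_sin_zero by blast
  also have "\<dots> \<longleftrightarrow> (\<exists>k::int. x = of_int k * 2 * pi)"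
    by (rule cos_one_2pi_int)
  finally show ?thesis by (simp add: mult_ac)
qed

lemma cis_powi: "cis x powi n = cis (of_int n * x)"
proof (cases n rule: int_cases2)
  case (nonneg k)
  then show ?thesis using Complex.DeMoivre[of x k] by simp
next
  case (nonpos k)
  then show ?thesis using Complex.DeMoivre[of x k] by (simp add: power_int_minus)
qed

lemma cis_Arg_unit: "cmod z = 1 \<Longrightarrow> cis (Arg z) = z"
  using cis_Arg[of z] by (cases "z = 0") (auto simp: sgn_eq)

lemma unit_root_cis:
  assumes "m \<noteq> 0" "cmod \<eta> = 1" "\<eta> powi m = 1"
  obtains j :: int where "\<eta> = cis (2 * pi * of_int j / of_int m)"
proof -
  define a where "a = Arg \<eta>"
  have eta: "\<eta> = cis a"
    using cis_Arg_unit[OF assms(2)] by (simp add: a_def)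
  then obtain j :: int where j: "of_int m * a = 2 * pi * of_int j"
    using assms(3) cis_powi cis_eq_1_iff by metis
  then have "a = 2 * pi * of_int j / of_int m"
    using assms(1) by (simp add: field_simps)
  then show thesis using that eta by blast
qed

context kk_bundle begin

lemma connectedin_circle_pt_image:
  assumes "connected T" "continuous_on T a" "a ` T \<subseteq> cdom K i" "continuous_on T b"
    and "\<And>t. t \<in> T \<Longrightarrow> cmod (b t) = 1"
  shows "connectedin (Ptop K) ((\<lambda>t. circle_pt i (a t) (b t)) ` T)"
proof -
  have "continuous_map (top_of_set T) (top_of_set (cdom K i \<times> sphere 0 1)) (\<lambda>t. (a t, b t))"
    using assms by (auto intro!: continuous_intros)
  then have "continuous_map (top_of_set T) (Ptop K) ((\<lambda>(w, \<zeta>). circle_pt i w \<zeta>) \<circ> (\<lambda>t. (a t, b t)))"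
    using continuous_map_compose continuous_map_circle_pt by blast
  then have "connectedin (Ptop K) (((\<lambda>(w, \<zeta>). circle_pt i w \<zeta>) \<circ> (\<lambda>t. (a t, b t))) ` T)"
    by (rule connectedin_continuous_map_image)
       (use assms(1) in \<open>simp add: connectedin_subtopology\<close>)
  then show ?thesis by (simp add: comp_def)
qed

text \<open>The phase of a nowhere vanishing equivariant function is a global fibre coordinate:
  \<open>p\<close> goes to its base point together with \<open>sgn (u p)\<close>. In a frame this
  map is multiplication of the fibre coordinate by a continuous phase depending on the base point,
  hence a continuous open bijection. By equivariance it suffices to control \<open>u\<close> on the
  slice \<open>\<zeta> = 1\<close>.\<close>

lemma equivariant_trivial:
  assumes eq: "\<And>p t. p \<in> circle_bundle K \<Longrightarrow> u (S1_act t p) = cis t * u p"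
    and nz: "\<And>i w. w \<in> cdom K i \<Longrightarrow> u (circle_pt i w 1) \<noteq> (0::complex)"
    and cont: "\<And>i. continuous_on (cdom K i) (\<lambda>w. u (circle_pt i w 1))"
  shows "trivial_circle_bundle K"
proof -
  define F where "F p = (fst p, sgn (u p))" for p
  have u1: "u (circle_pt i w \<zeta>) = \<zeta> * u (circle_pt i w 1)" if "w \<in> cdom K i" "cmod \<zeta> = 1" for i w \<zeta>
  proof -
    have z: "\<zeta> = cis (Arg \<zeta>)"
      using cis_Arg_unit[OF that(2)] by simp
    have "u (S1_act (Arg \<zeta>) (circle_pt i w 1)) = cis (Arg \<zeta>) * u (circle_pt i w 1)"
      by (rule eq) (use that(1) in \<open>auto intro: circle_pt_in\<close>)
    then show ?thesis using z by (simp add: S1_act_circle_pt)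
  qed
  have F1: "F (circle_pt i w \<zeta>) = (cpar K i w, \<zeta> * sgn (u (circle_pt i w 1)))" if "w \<in> cdom K i" "cmod \<zeta> = 1" for i w \<zeta>
    using u1[OF that] that by (simp add: F_def sgn_mult) (simp add: sgn_eq)
  have s1: "cmod (sgn (u (circle_pt i w 1))) = 1" "sgn (u (circle_pt i w 1)) \<noteq> 0" if "w \<in> cdom K i" for i w
    using nz[OF that] by (auto simp: norm_sgn sgn_zero_iff)
  have conts: "continuous_on (cdom K i) (\<lambda>w. sgn (u (circle_pt i w 1)))" for i
    unfolding sgn_eq by (intro continuous_intros cont) (use nz in auto)
  have inF: "F p \<in> X \<times> sphere 0 1" if "p \<in> circle_bundle K" for p
    using that by (rule pointE) (use F1 s1 in \<open>auto simp: norm_mult dist_norm\<close>)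
  have F_cont: "continuous_map (Ptop K) (prod_topology (base K) (top_of_set (sphere 0 1))) F"
  proof (rule continuous_map_from_Ptop)
    fix k :: "'i \<times> real" obtain i \<alpha> where k: "k = (i, \<alpha>)" by force
    have 1: "continuous_map (top_of_set (Pdom K k)) (base K) (\<lambda>x. cpar K i (fst x))"
    proof -
      have "continuous_map (top_of_set (Pdom K k)) (top_of_set (cdom K i)) fst"
        by (auto simp: Pdom_def k intro!: continuous_intros)
      from continuous_map_compose[OF this continuous_map_cpar] show ?thesis by (simp add: comp_def)
    qed
    have 2: "continuous_on (Pdom K k) (\<lambda>x. cis (snd x) * sgn (u (circle_pt i (fst x) 1)))"
    proof (intro continuous_on_mult)
      show "continuous_on (Pdom K k) (\<lambda>x. cis (snd x))"
        by (intro continuous_intros)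
      show "continuous_on (Pdom K k) (\<lambda>x. sgn (u (circle_pt i (fst x) 1)))"
        by (rule continuous_on_compose2[OF conts]) (auto simp: Pdom_def k intro: continuous_intros)
    qed
    have "continuous_map (top_of_set (Pdom K k)) (prod_topology (base K) (top_of_set (sphere 0 1)))
       (\<lambda>x. (cpar K i (fst x), cis (snd x) * sgn (u (circle_pt i (fst x) 1))))"
      unfolding continuous_map_pairwise comp_def
      using 1 2 s1 by (auto simp: Pdom_def k norm_mult)
    then show "continuous_map (top_of_set (Pdom K k)) (prod_topology (base K) (top_of_set (sphere 0 1))) (F \<circ> Ppar K k)"
      by (rule continuous_map_eq) (auto simp: Pdom_def k Ppar_eq F1)
  qed (use inF in auto)
  have F_open: "open_map (Ptop K) (prod_topology (base K) (top_of_set (sphere 0 1))) F"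
    unfolding open_map_def
  proof (intro allI impI)
    fix W assume W: "openin (Ptop K) W"
    show "openin (prod_topology (base K) (top_of_set (sphere 0 1))) (F ` W)"
      unfolding openin_prod_topology_alt
    proof (intro allI impI)
      fix z \<xi> assume "(z, \<xi>) \<in> F ` W"
      then obtain p where p: "p \<in> W" "F p = (z, \<xi>)" by auto
      have "p \<in> circle_bundle K"
        using W p openin_subset by fastforce
      then obtain i w \<zeta> where w: "w \<in> cdom K i" "cmod \<zeta> = 1" "p = circle_pt i w \<zeta>"
        by (rule pointE)
      \<comment> \<open>The inverse of \<open>F\<close> in the coordinates of this frame; openness
        of \<open>F\<close> becomes continuity of \<open>?h\<close>.\<close>
      let ?h = "\<lambda>x. (fst x, snd x * inverse (sgn (u (circle_pt i (fst x) 1))))"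
      have "continuous_on (cdom K i \<times> sphere 0 1) (\<lambda>x. sgn (u (circle_pt i (fst x) 1)))"
        by (rule continuous_on_compose2[OF conts]) (auto intro: continuous_intros)
      then have "continuous_on (cdom K i \<times> sphere 0 1) ?h"
        by (intro continuous_on_Pair continuous_on_mult continuous_on_inverse continuous_on_fst
            continuous_on_snd continuous_on_id) (use s1 in auto)
      then have "continuous_map (top_of_set (cdom K i \<times> sphere 0 1)) (top_of_set (cdom K i \<times> sphere 0 1)) ?h"
        using s1 by (auto simp: norm_mult norm_inverse)
      from continuous_map_compose[OF this continuous_map_circle_pt]
      have "openin (top_of_set (cdom K i \<times> sphere 0 1))
         {x \<in> topspace (top_of_set (cdom K i \<times> sphere 0 1)). ((\<lambda>(w, \<zeta>). circle_pt i w \<zeta>) \<circ> ?h) x \<in> W}"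
        by (rule openin_continuous_map_preimage) (rule W)
      then obtain N where N: "open N" "{x \<in> cdom K i \<times> sphere 0 1. circle_pt i (fst x) (snd x * inverse (sgn (u (circle_pt i (fst x) 1)))) \<in> W}
          = (cdom K i \<times> sphere 0 1) \<inter> N"
        by (auto simp: openin_open comp_def)
      have xi: "\<xi> = \<zeta> * sgn (u (circle_pt i w 1))" "z = cpar K i w"
        using p F1 w by auto
      have "(w, \<xi>) \<in> (cdom K i \<times> sphere 0 1) \<inter> N"
        unfolding N(2)[symmetric] using w xi s1[OF w(1)] p by (auto simp: norm_mult mult.assoc)
      then have "(w, \<xi>) \<in> N" by blast
      then obtain A B where "open A" "open B" "(w, \<xi>) \<in> A \<times> B" "A \<times> B \<subseteq> N"
        using open_prod_elim[OF N(1)] by blast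
      then have AB: "open A" "open B" "w \<in> A" "\<xi> \<in> B" "A \<times> B \<subseteq> N" by auto
      have sub: "cpar K i ` (A \<inter> cdom K i) \<times> (B \<inter> sphere 0 1) \<subseteq> F ` W"
      proof clarsimp
        fix v \<eta> assume v: "v \<in> A" "v \<in> cdom K i" "\<eta> \<in> B" "cmod \<eta> = 1"
        then have "(v, \<eta>) \<in> (cdom K i \<times> sphere 0 1) \<inter> N"
          using AB by auto
        then have W': "circle_pt i v (\<eta> * inverse (sgn (u (circle_pt i v 1)))) \<in> W"
          unfolding N(2)[symmetric] by auto
        have "F (circle_pt i v (\<eta> * inverse (sgn (u (circle_pt i v 1))))) = (cpar K i v, \<eta>)"
          using F1[OF v(2), of "\<eta> * inverse (sgn (u (circle_pt i v 1)))"] v s1[OF v(2)]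
          by (simp add: norm_mult norm_inverse mult.assoc)
        then show "(cpar K i v, \<eta>) \<in> F ` W"
          using W' by (metis imageI)
      qed
      show "\<exists>U V. openin (base K) U \<and> openin (top_of_set (sphere 0 1)) V \<and> z \<in> U \<and> \<xi> \<in> V \<and> U \<times> V \<subseteq> F ` W"
      proof (intro exI conjI)
        show "openin (base K) (cpar K i ` (A \<inter> cdom K i))"
          by (rule openin_cpar_image) (use AB in auto)
        show "openin (top_of_set (sphere 0 1)) (B \<inter> sphere 0 1)"
          by (subst Int_commute) (rule openin_open_Int[OF AB(2)])
      qed (use sub AB w xi s1 in \<open>auto simp: norm_mult\<close>)
    qed
  qed
  have F_surj: "F ` topspace (Ptop K) = topspace (prod_topology (base K) (top_of_set (sphere 0 1)))"
  proof (intro subset_antisym)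
    show "F ` topspace (Ptop K) \<subseteq> topspace (prod_topology (base K) (top_of_set (sphere 0 1)))"
      unfolding topspace_Ptop topspace_prod_topology topspace_euclidean_subtopology
      by (rule image_subsetI) (rule inF)
    show "topspace (prod_topology (base K) (top_of_set (sphere 0 1))) \<subseteq> F ` topspace (Ptop K)"
    proof clarsimp
      fix z \<xi> assume z: "z \<in> X" "cmod \<xi> = 1"
      then obtain i w where w: "w \<in> cdom K i" "cpar K i w = z"
        using chartE by blast
      let ?p = "circle_pt i w (\<xi> * inverse (sgn (u (circle_pt i w 1))))"
      have n: "cmod (\<xi> * inverse (sgn (u (circle_pt i w 1)))) = 1"
        using z s1[OF w(1)] by (simp add: norm_mult norm_inverse)
      have "F ?p = (z, \<xi>)"
        using F1[OF w(1) n] w s1[OF w(1)] by (simp add: mult.assoc)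
      then show "(z, \<xi>) \<in> F ` circle_bundle K"
        using circle_pt_in[OF w(1) n] by (metis imageI)
    qed
  qed
  have F_inj: "inj_on F (topspace (Ptop K))"
  proof (rule inj_onI)
    fix p q assume pq: "p \<in> topspace (Ptop K)" "q \<in> topspace (Ptop K)" "F p = F q"
    obtain i w \<zeta> where p: "w \<in> cdom K i" "cmod \<zeta> = 1" "p = circle_pt i w \<zeta>"
      using pq(1) by (auto elim: pointE)
    have "fst q = cpar K i w"
      using pq(3) p by (auto simp: F_def)
    then obtain \<xi> where q: "cmod \<xi> = 1" "q = circle_pt i w \<xi>"
      using circle_pt_ex[OF _ p(1)] pq(2) by (metis topspace_Ptop)
    show "p = q"
      using pq(3) F1 p q s1 by auto
  qed
  have "homeomorphic_map (Ptop K) (prod_topology (base K) (top_of_set (sphere 0 1))) F"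
    using bijective_open_imp_homeomorphic_map[OF F_cont F_open F_surj F_inj] .
  moreover have "fst (F p) = fst p \<and> (\<forall>t. F (S1_act t p) = (fst p, cis t * snd (F p)))"
    if "p \<in> circle_bundle K" for p
    using eq[OF that] by (auto simp: F_def sgn_mult S1_act_def)
  ultimately show ?thesis
    unfolding trivial_circle_bundle_def by blast
qed

end

text \<open>What the nodal count retains of an eigensection: continuous coefficients, a lift of
  nonzero weight, and zeros of index \<plusminus>1. All arguments about sheets and closures are
  topological.\<close>

locale kk_lift = kk_bundle K for K :: "('x, 'i, 'l::ab_group_add) bundle_data" +
  fixes s :: "'i \<Rightarrow> complex \<Rightarrow> complex" and m :: int and \<phi> :: "'x \<times> ('l \<Rightarrow> complex) \<Rightarrow> complex"
  assumes m0: "m \<noteq> 0" and lift: "is_lift K m s \<phi>"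
    and cont_s: "continuous_on (cdom K i) (s i)"
    and zero_index: "w \<in> cdom K i \<Longrightarrow> s i w = 0 \<Longrightarrow> \<exists>n\<in>{1,-1}. has_index (s i) w n"
begin

lemma phi_circle_pt: "w \<in> cdom K i \<Longrightarrow> cmod \<zeta> = 1 \<Longrightarrow>
    \<phi> (circle_pt i w \<zeta>) = s i w * \<zeta> powi m * of_real (frame_norm i w powi m)"
  using lift_circle_pt[OF lift] by (simp add: power_int_mult_distrib)

lemma phi_zero: "w \<in> cdom K i \<Longrightarrow> cmod \<zeta> = 1 \<Longrightarrow> \<phi> (circle_pt i w \<zeta>) = 0 \<longleftrightarrow> s i w = 0"
  using phi_circle_pt frame_norm_pos[of w i] by auto

lemma sgn_phi: "w \<in> cdom K i \<Longrightarrow> cmod \<zeta> = 1 \<Longrightarrow> sgn (\<phi> (circle_pt i w \<zeta>)) = sgn (s i w) * \<zeta> powi m"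
  using phi_circle_pt[of w i \<zeta>] frame_norm_pos[of w i]
  by (simp add: sgn_mult sgn_eq[of "\<zeta> powi m"] norm_power_int sgn_of_real flip: of_real_power_int)

lemma continuous_map_phi: "continuous_map (Ptop K) euclidean \<phi>"
proof (rule continuous_map_from_Ptop)
  fix k :: "'i \<times> real" obtain i \<alpha> where k: "k = (i, \<alpha>)" by force
  have "continuous_on (Pdom K k) (\<lambda>x. s i (fst x) * cis (snd x) powi m * of_real (frame_norm i (fst x) powi m))"
    by (intro continuous_intros continuous_on_compose2[OF cont_s] continuous_on_compose2[OF continuous_on_frame_norm])
       (auto simp: Pdom_def k dest: frame_norm_pos)
  then have "continuous_map (top_of_set (Pdom K k)) euclidean (\<lambda>x. s i (fst x) * cis (snd x) powi m * of_real (frame_norm i (fst x) powi m))"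
    by simp
  then show "continuous_map (top_of_set (Pdom K k)) euclidean (\<phi> \<circ> Ppar K k)"
    by (rule continuous_map_eq) (auto simp: Pdom_def k Ppar_eq phi_circle_pt)
qed auto

definition Z :: "'x set" where
  "Z = {cpar K i w |i w. w \<in> cdom K i \<and> s i w = 0}"

text \<open>Vanishing does not depend on the frame because both coefficients are read off from the
  same function \<open>\<phi>\<close> on the same fibre.\<close>

lemma Z_iff: assumes w: "w \<in> cdom K i" shows "cpar K i w \<in> Z \<longleftrightarrow> s i w = 0"
proof
  assume "cpar K i w \<in> Z"
  then obtain j v where v: "v \<in> cdom K j" "s j v = 0" "cpar K i w = cpar K j v"
    by (auto simp: Z_def)
  obtain \<zeta> where "cmod \<zeta> = 1" "circle_pt j v 1 = circle_pt i w \<zeta>"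
    using circle_pt_ex[OF circle_pt_in[OF v(1), of 1] w] v(3) by auto
  then show "s i w = 0"
    using phi_zero v w by (metis norm_one)
qed (use w in \<open>auto simp: Z_def\<close>)

section \<open>Locally constant predicates and local sheets\<close>

definition Q :: "complex \<Rightarrow> ('x \<times> ('l \<Rightarrow> complex)) set" where
  "Q c = {p \<in> circle_bundle K. \<phi> p \<noteq> 0 \<and> sgn (\<phi> p) = c}"

lemma Q_iff: "w \<in> cdom K i \<Longrightarrow> cmod \<zeta> = 1 \<Longrightarrow> circle_pt i w \<zeta> \<in> Q c \<longleftrightarrow> s i w \<noteq> 0 \<and> sgn (s i w) * \<zeta> powi m = c"
  by (simp add: Q_def phi_zero sgn_phi circle_pt_in)

text \<open>A punctured disc in the plane is connected, so a predicate that is locally constant off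
  the zeros takes one value \<open>b\<close> around each zero.\<close>

lemma punctured_const:
  assumes R: "\<And>i w. w \<in> cdom K i \<Longrightarrow> s i w \<noteq> 0 \<Longrightarrow>
      \<exists>r>0. \<forall>v\<in>ball w r. v \<in> cdom K i \<longrightarrow> R (cpar K i v) = R (cpar K i w)"
    and w: "w \<in> cdom K i"
  shows "\<exists>r>0. \<exists>b. ball w r \<subseteq> cdom K i \<and> (\<forall>v\<in>ball w r - {w}. R (cpar K i v) = b) \<and>
      (s i w \<noteq> 0 \<longrightarrow> R (cpar K i w) = (b::bool))"
proof -
  obtain r0 where r0: "r0 > 0" "ball w r0 \<subseteq> cdom K i"
    using w open_cdom openE by blast
  show ?thesis
  proof (cases "s i w = 0")
    case False
    obtain r where r: "r > 0" "\<forall>v\<in>ball w r. v \<in> cdom K i \<longrightarrow> R (cpar K i v) = R (cpar K i w)"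
      using R[OF w False] by blast
    show ?thesis
    proof (intro exI conjI ballI impI)
      show "ball w (min r r0) \<subseteq> cdom K i" "min r r0 > 0" using r r0 by auto
      fix v assume v: "v \<in> ball w (min r r0) - {w}"
      then have "v \<in> cdom K i" using r0 by auto
      then show "R (cpar K i v) = R (cpar K i w)" using v r(2) by auto
    qed simp
  next
    case True
    obtain n where n: "has_index (s i) w n" using zero_index[OF w True] by blast
    obtain r1 where r1: "r1 > 0" "\<And>v. v \<in> ball w r1 - {w} \<Longrightarrow> s i v \<noteq> 0"
      using has_index_nonzero[OF n] by metis
    define r where "r = min r0 r1"
    let ?A = "ball w r - {w}"
    have r: "r > 0" "ball w r \<subseteq> cdom K i" "\<And>v. v \<in> ?A \<Longrightarrow> s i v \<noteq> 0"
      using r0 r1 by (auto simp: r_def)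
    have A: "open ?A" "connected ?A"
      by (auto intro!: connected_open_delete)
    have "w + of_real (r / 2) \<in> ?A"
      using r(1) by (auto simp: dist_norm)
    moreover have "R (cpar K i a) = R (cpar K i b)" if "a \<in> ?A" "b \<in> ?A" for a b
    proof (rule connected_local_const[OF A(2) that, of "\<lambda>v. R (cpar K i v)"], intro ballI)
      fix a assume a: "a \<in> ?A"
      then obtain r' where r': "r' > 0" "\<forall>v\<in>ball a r'. v \<in> cdom K i \<longrightarrow> R (cpar K i v) = R (cpar K i a)"
        using R[of a i] r by blast
      show "\<forall>\<^sub>F b in at a within ?A. R (cpar K i a) = R (cpar K i b)"
        unfolding eventually_at
        by (rule exI[of _ r']) (use r' r in \<open>auto simp: dist_commute subset_iff\<close>)
    qed
    ultimately show ?thesis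
      using r True by blast
  qed
qed

text \<open>Isolated zeros do not disconnect the surface. Giving a zero the value found on the
  punctured discs around it extends the partition by \<open>R\<close> to an open partition
  \<open>B True\<close>, \<open>B False\<close> of the whole connected surface.\<close>

lemma locally_const_imp_const:
  assumes R: "\<And>i w. w \<in> cdom K i \<Longrightarrow> s i w \<noteq> 0 \<Longrightarrow>
      \<exists>r>0. \<forall>v\<in>ball w r. v \<in> cdom K i \<longrightarrow> R (cpar K i v) = R (cpar K i w)"
    and z: "z \<in> X - Z" "z' \<in> X - Z"
  shows "R z = (R z' :: bool)"
proof -
  define B where "B b = {z. \<exists>i w r. w \<in> cdom K i \<and> cpar K i w = z \<and> r > 0 \<and> ball w r \<subseteq> cdom K i \<and>
     (\<forall>v\<in>ball w r - {w}. R (cpar K i v) = b)}" for b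
  have openB: "openin (base K) (B b)" for b
  proof (subst openin_subopen, intro ballI)
    fix z assume "z \<in> B b"
    then obtain i w r where w: "w \<in> cdom K i" "cpar K i w = z" "r > 0" "ball w r \<subseteq> cdom K i"
      "\<forall>v\<in>ball w r - {w}. R (cpar K i v) = b"
      unfolding B_def by blast
    have "cpar K i ` ball w r \<subseteq> B b"
    proof clarify
      fix v assume v: "v \<in> ball w r"
      show "cpar K i v \<in> B b"
      proof (cases "v = w")
        case False
        then obtain r' where r': "r' > 0" "ball v r' \<subseteq> ball w r - {w}"
          using v openE[of "ball w r - {w}" v] by auto
        then show ?thesis
          using v w unfolding B_def by blast
      qed (use w in \<open>auto simp: B_def\<close>)
    qed
    moreover have "openin (base K) (cpar K i ` ball w r)"
      by (rule openin_cpar_image) (use w in auto)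
    ultimately show "\<exists>T. openin (base K) T \<and> z \<in> T \<and> T \<subseteq> B b"
      using w by (intro exI[of _ "cpar K i ` ball w r"]) auto
  qed
  have disj: "B True \<inter> B False = {}"
  proof (rule ccontr)
    assume "B True \<inter> B False \<noteq> {}"
    then obtain z where z: "z \<in> B True" "z \<in> B False" by blast
    obtain i w r where w: "w \<in> cdom K i" "cpar K i w = z" "r > 0" "ball w r \<subseteq> cdom K i"
      "\<forall>v\<in>ball w r - {w}. R (cpar K i v) = True"
      using z(1) unfolding B_def by blast
    obtain j w' r' where w': "w' \<in> cdom K j" "cpar K j w' = z" "r' > 0" "ball w' r' \<subseteq> cdom K j"
      "\<forall>v\<in>ball w' r' - {w'}. R (cpar K j v) = False"
      using z(2) unfolding B_def by blast
    let ?T = "ball w r \<inter> {v \<in> cdom K i. cpar K i v \<in> cpar K j ` ball w' r'}"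
    have "openin (base K) (cpar K j ` ball w' r')"
      by (rule openin_cpar_image) (use w' in auto)
    then have opT: "open ?T"
      using open_cpar_vimage by (intro open_Int open_ball) blast
    have "w \<in> ?T" using w w' by (auto intro!: image_eqI[of _ _ w'])
    \<comment> \<open>The two discs overlap in an open set around the common centre, and no
      singleton is open in the plane, so there is a point other than the centre where the two values
      of \<open>R\<close> clash.\<close>
    have "?T \<noteq> {w}"
    proof
      assume "?T = {w}"
      then show False using opT not_open_singleton[of w] by (simp only:)
    qed
    then obtain v where v: "v \<in> ?T" "v \<noteq> w"
      using \<open>w \<in> ?T\<close> by blast
    then obtain v' where v': "v' \<in> ball w' r'" "cpar K i v = cpar K j v'" by auto
    have "v' \<noteq> w'"
      using v v' w w' cpar_eq_iff[of v i w] by auto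
    have "R (cpar K i v) = True" "R (cpar K j v') = False"
      using w(5) w'(5) v v' \<open>v' \<noteq> w'\<close> by blast+
    then show False
      unfolding v'(2) by simp
  qed
  have cov: "X \<subseteq> B True \<union> B False"
  proof
    fix z assume "z \<in> X"
    then obtain i w where w: "w \<in> cdom K i" "cpar K i w = z" using chartE by blast
    obtain r b where rb: "r > 0" "ball w r \<subseteq> cdom K i" "\<forall>v\<in>ball w r - {w}. R (cpar K i v) = b"
      using punctured_const[of R, OF R w(1)] by blast
    then have "z \<in> B b" using w unfolding B_def by blast
    then show "z \<in> B True \<union> B False" by (cases b) auto
  qed
  have "B True = {} \<or> B False = {}"
    using connected_X openB disj cov unfolding connected_space_def by blast
  moreover have val: "z \<in> B (R z)" if z: "z \<in> X - Z" for z
  proof -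
    obtain i w where w: "w \<in> cdom K i" "cpar K i w = z" using chartE z by blast
    have "s i w \<noteq> 0" using Z_iff w z by auto
    then obtain r where "r > 0" "ball w r \<subseteq> cdom K i" "\<forall>v\<in>ball w r - {w}. R (cpar K i v) = R z"
      using punctured_const[of R, OF R w(1)] w(2) by blast
    then show ?thesis using w unfolding B_def by blast
  qed
  ultimately show ?thesis
    using val[OF z(1)] val[OF z(2)] by (cases "R z"; cases "R z'") auto
qed

text \<open>On a disc where the argument of the section stays within a right angle of its value at
  the centre, the change of argument is a continuous real function \<open>g\<close>. Turning the
  fibre coordinate by minus that change divided by \<open>m\<close> keeps the phase of
  \<open>\<phi>\<close> fixed and gives a connected sheet through any prescribed point of
  \<open>Q c\<close>.\<close>

lemma sheet:
  assumes w: "w \<in> cdom K i" and s: "s i w \<noteq> 0"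
  obtains r where "r > 0" "ball w r \<subseteq> cdom K i"
    "\<And>v v' p. v \<in> ball w r \<Longrightarrow> v' \<in> ball w r \<Longrightarrow> p \<in> Q c \<Longrightarrow> fst p = cpar K i v \<Longrightarrow>
       \<exists>C q. connectedin (Ptop K) C \<and> C \<subseteq> Q c \<and> p \<in> C \<and> q \<in> C \<and> fst q = cpar K i v'"
proof -
  obtain r0 where r0: "r0 > 0" "ball w r0 \<subseteq> cdom K i"
    using w open_cdom openE by blast
  have "(s i \<longlongrightarrow> s i w) (at w)"
    using cont_s[of i] w by (metis continuous_on_eq_continuous_at isContD open_cdom)
  then obtain r1 where r1: "r1 > 0" "\<And>v. v \<in> ball w r1 - {w} \<Longrightarrow> Re (s i v / s i w) > 0"
    using ball_Re_pos s by blast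
  define r where "r = min r0 r1"
  have r: "r > 0" "ball w r \<subseteq> cdom K i" using r0 r1 by (auto simp: r_def)
  have pos: "Re (s i v / s i w) > 0" if "v \<in> ball w r" for v
    using r1(2)[of v] that s by (cases "v = w") (auto simp: r_def)
  define g where "g v = Im (Ln (s i v / s i w))" for v
  have cs: "continuous_on (ball w r) (s i)"
    using continuous_on_subset[OF cont_s r(2)] .
  have slit: "s i v / s i w \<notin> \<real>\<^sub>\<le>\<^sub>0" if "v \<in> ball w r" for v
    using pos[OF that] by (auto simp: complex_nonpos_Reals_iff)
  have cg: "continuous_on (ball w r) g"
    unfolding g_def
    by (intro continuous_on_Im continuous_on_Ln' continuous_on_divide cs continuous_on_const)
       (use slit s in auto)
  have nz: "s i v \<noteq> 0" if "v \<in> ball w r" for v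
    using slit[OF that] by auto
  have sg: "sgn (s i v) = sgn (s i w) * cis (g v)" if "v \<in> ball w r" for v
  proof -
    have "s i v / s i w \<noteq> 0" using nz[OF that] s by auto
    then have "sgn (s i v / s i w) = cis (g v)"
      unfolding g_def by (metis Arg_def cis_Arg)
    then show ?thesis using s by (simp add: sgn_divide field_simps sgn_zero_iff)
  qed
  have "\<exists>C q. connectedin (Ptop K) C \<and> C \<subseteq> Q c \<and> p \<in> C \<and> q \<in> C \<and> fst q = cpar K i v'"
    if v: "v \<in> ball w r" "v' \<in> ball w r" "p \<in> Q c" "fst p = cpar K i v" for v v' p
  proof -
    have vc: "v \<in> cdom K i" "v' \<in> cdom K i" using v r by auto
    obtain \<zeta> where z: "cmod \<zeta> = 1" "p = circle_pt i v \<zeta>"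
      using circle_pt_ex[OF _ vc(1) v(4)] v(3) by (auto simp: Q_def)
    let ?b = "\<lambda>x. \<zeta> * cis ((g v - g x) / of_int m)"
    let ?C = "(\<lambda>x. circle_pt i x (?b x)) ` ball w r"
    have "connectedin (Ptop K) ?C"
      by (rule connectedin_circle_pt_image)
         (use r z m0 in \<open>auto intro!: continuous_intros cg simp: norm_mult\<close>)
    moreover have "?C \<subseteq> Q c"
    proof (rule image_subsetI)
      fix x assume x: "x \<in> ball w r"
      have "c = sgn (s i v) * \<zeta> powi m"
        using v z Q_iff[OF vc(1) z(1)] by simp
      also have "\<dots> = sgn (s i w) * cis (g x) * (?b x) powi m"
        using m0 sg[OF v(1)] by (simp add: power_int_mult_distrib cis_powi cis_mult mult_ac)
      finally show "circle_pt i x (?b x) \<in> Q c"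
        using x r nz[OF x] sg[OF x] z by (subst Q_iff) (auto simp: norm_mult)
    qed
    moreover have "p \<in> ?C"
      using v(1) z by (intro image_eqI[of _ _ v]) auto
    moreover have "circle_pt i v' (?b v') \<in> ?C" using v(2) by blast
    ultimately show ?thesis
      by (intro exI[of _ ?C] exI[of _ "circle_pt i v' (?b v')"]) auto
  qed
  then show thesis by (rule that[OF r])
qed

end

section \<open>Monodromy and connectedness of the phase sets\<close>

context kk_lift begin

text \<open>Plays the part of a relatively open and closed subset of \<open>Q c\<close>: connected
  subsets of \<open>Q c\<close> cannot leave it. The relative complement inherits the property, so
  both alternatives of a separation can be treated alike.\<close>

definition linked :: "complex \<Rightarrow> ('x \<times> ('l \<Rightarrow> complex)) set \<Rightarrow> bool" where
  "linked c A \<longleftrightarrow> (\<forall>C. connectedin (Ptop K) C \<and> C \<subseteq> Q c \<and> C \<inter> A \<noteq> {} \<longrightarrow> C \<subseteq> A)"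

lemma linked_Diff:
  assumes "linked c A" shows "linked c (Q c - A)"
  using assms unfolding linked_def by blast

text \<open>Whether all of \<open>Q c\<close> over a base point lies in \<open>A\<close> is a
  locally constant question, since the sheets through neighbouring fibres are connected; hence it
  has one answer off the zeros.\<close>

lemma linked_fibre_const:
  assumes A: "linked c A" and z: "z \<in> X - Z" "z' \<in> X - Z"
    and z_in: "\<And>p. p \<in> Q c \<Longrightarrow> fst p = z \<Longrightarrow> p \<in> A"
    and p: "p \<in> Q c" "fst p = z'"
  shows "p \<in> A"
proof -
  let ?R = "\<lambda>z. \<forall>p\<in>Q c. fst p = z \<longrightarrow> p \<in> A"
  have "?R z = ?R z'"
  proof (rule locally_const_imp_const[OF _ z])
    fix i w assume w: "w \<in> cdom K i" "s i w \<noteq> 0"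
    obtain r where r: "r > 0" "ball w r \<subseteq> cdom K i"
      "\<And>v v' p. v \<in> ball w r \<Longrightarrow> v' \<in> ball w r \<Longrightarrow> p \<in> Q c \<Longrightarrow> fst p = cpar K i v \<Longrightarrow>
       \<exists>C q. connectedin (Ptop K) C \<and> C \<subseteq> Q c \<and> p \<in> C \<and> q \<in> C \<and> fst q = cpar K i v'"
      using sheet[OF w, of c] by blast
    have step: "?R (cpar K i v')" if v: "v \<in> ball w r" "v' \<in> ball w r" "?R (cpar K i v)" for v v'
    proof (intro ballI impI)
      fix p assume p: "p \<in> Q c" "fst p = cpar K i v'"
      obtain C q where C: "connectedin (Ptop K) C" "C \<subseteq> Q c" "p \<in> C" "q \<in> C" "fst q = cpar K i v"
        using r(3)[OF v(2,1) p] by blast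
      then have "q \<in> A" using v(3) by blast
      then have "C \<subseteq> A" using A C unfolding linked_def by blast
      then show "p \<in> A" using C by blast
    qed
    have "w \<in> ball w r" using r(1) by simp
    then show "\<exists>r>0. \<forall>v\<in>ball w r. v \<in> cdom K i \<longrightarrow> ?R (cpar K i v) = ?R (cpar K i w)"
      using step r(1) by blast
  qed
  then show ?thesis using z_in p by blast
qed

text \<open>On circles around a zero the imaginary part \<open>g\<close> of the logarithm is
  single-valued, so all turning of the phase is in the term \<open>n * t\<close>.\<close>

lemma zero_coordinates:
  assumes w0: "w0 \<in> cdom K i" "s i w0 = 0"
  obtains n r g where "n = 1 \<or> n = -1" "r > 0" "ball w0 r \<subseteq> cdom K i" "continuous_on (ball w0 r - {w0}) g"
    "\<And>v. v \<in> ball w0 r - {w0} \<Longrightarrow> s i v \<noteq> 0"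
    "\<And>\<epsilon> t. 0 < \<epsilon> \<Longrightarrow> \<epsilon> < r \<Longrightarrow> sgn (s i (w0 + of_real \<epsilon> * cis t)) = cis (of_int n * t + g (w0 + of_real \<epsilon> * cis t))"
proof -
  obtain n where n: "n \<in> {1, -1}" "has_index (s i) w0 n"
    using zero_index[OF w0] by blast
  obtain r0 where r0: "r0 > 0" "ball w0 r0 \<subseteq> cdom K i"
    using w0 open_cdom openE by blast
  obtain r g where g: "0 < r" "r \<le> r0" "continuous_on (ball w0 r - {w0}) g"
    "\<And>w. w \<in> ball w0 r - {w0} \<Longrightarrow> s i w = (w - w0) powi n * exp (g w)"
    using has_indexE[OF n(2) r0(1)] by blast
  show thesis
  proof (rule that[of n r "\<lambda>w. Im (g w)"])
    fix \<epsilon> t :: real assume e: "0 < \<epsilon>" "\<epsilon> < r"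
    let ?v = "w0 + of_real \<epsilon> * cis t"
    have "?v \<in> ball w0 r - {w0}"
      using e by (auto simp: dist_norm norm_mult)
    then have "s i ?v = (of_real \<epsilon> * cis t) powi n * exp (g ?v)"
      using g(4) by simp
    also have "\<dots> = of_real (\<epsilon> powi n * exp (Re (g ?v))) * (cis (of_int n * t) * cis (Im (g ?v)))"
      by (simp add: power_int_mult_distrib cis_powi exp_eq_polar[of "g ?v"])
    finally show "sgn (s i ?v) = cis (of_int n * t + Im (g ?v))"
      using e by (simp add: sgn_mult sgn_of_real sgn_eq[of "cis _"] cis_mult del: of_real_mult)
  qed (use g r0 n in \<open>auto intro: continuous_intros\<close>)
qed

text \<open>Going once around a zero of index \<open>n = \<plusminus>1\<close> turns the phase of the section by \<open>2\<pi>n\<close>,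
  hence moves the points of \<open>Q c\<close> by \<open>- 2\<pi>n/m\<close> along the fibre. As \<open>n\<close> is a unit, these
  rotations act transitively on the points over a point near the zero.\<close>

lemma monodromy:
  assumes "Z \<noteq> {}" and A: "linked c A" "A \<subseteq> Q c"
  obtains z where "z \<in> X - Z"
    "(\<forall>p\<in>Q c. fst p = z \<longrightarrow> p \<in> A) \<or> (\<forall>p\<in>Q c. fst p = z \<longrightarrow> p \<in> Q c - A)"
proof -
  obtain i w0 where w0: "w0 \<in> cdom K i" "s i w0 = 0"
    using assms(1) by (auto simp: Z_def)
  obtain n r g where n: "n = 1 \<or> n = -1" and r: "r > 0" "ball w0 r \<subseteq> cdom K i"
    and g: "continuous_on (ball w0 r - {w0}) g" and nz: "\<And>v. v \<in> ball w0 r - {w0} \<Longrightarrow> s i v \<noteq> 0"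
    and sg: "\<And>\<epsilon> t. 0 < \<epsilon> \<Longrightarrow> \<epsilon> < r \<Longrightarrow> sgn (s i (w0 + of_real \<epsilon> * cis t)) = cis (of_int n * t + g (w0 + of_real \<epsilon> * cis t))"
    using zero_coordinates[OF w0] by metis
  define \<epsilon> where "\<epsilon> = r / 2"
  have e: "0 < \<epsilon>" "\<epsilon> < r" using r by (auto simp: \<epsilon>_def)
  define a where "a t = w0 + of_real \<epsilon> * cis t" for t
  have a_in: "a t \<in> ball w0 r - {w0}" for t
    using e by (auto simp: a_def dist_norm norm_mult)
  have a_dom: "a t \<in> cdom K i" for t using a_in r by blast
  have ca: "continuous_on T a" for T
    unfolding a_def by (intro continuous_intros)
  have cg: "continuous_on T (\<lambda>t. g (a t))" for T
    by (rule continuous_on_compose2[OF g ca]) (use a_in in auto)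
  have per: "a (2 * pi) = a 0" by (simp add: a_def)
  have step: "circle_pt i (a 0) (\<zeta> * cis (- (2 * pi * of_int n) / of_int m)) \<in> A"
    if z: "cmod \<zeta> = 1" "circle_pt i (a 0) \<zeta> \<in> A" for \<zeta>
  proof -
    \<comment> \<open>This coordinate compensates the phase of the section along the circle. After a
      full turn \<open>g (a t) - g (a 0)\<close> is back at \<open>0\<close>, and the rotation by
      \<open>- 2 * pi * n / m\<close> is left.\<close>
    let ?b = "\<lambda>t. \<zeta> * cis (- (of_int n * t + g (a t) - g (a 0)) / of_int m)"
    let ?C = "(\<lambda>t. circle_pt i (a t) (?b t)) ` {0..2 * pi}"
    have "connectedin (Ptop K) ?C"
    proof (rule connectedin_circle_pt_image)
      show "continuous_on {0..2 * pi} ?b"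
        by (intro continuous_intros cg) (use m0 in auto)
    qed (use a_dom ca z in \<open>auto simp: norm_mult\<close>)
    moreover have "?C \<subseteq> Q c"
    proof (rule image_subsetI)
      fix t
      have "c = cis (g (a 0)) * \<zeta> powi m"
        using A(2) z Q_iff[OF a_dom z(1), of 0 c] sg[OF e, of 0] by (auto simp: a_def)
      also have "\<dots> = cis (of_int n * t + g (a t)) * ?b t powi m"
        using m0 by (simp add: power_int_mult_distrib cis_powi cis_mult mult_ac)
      finally show "circle_pt i (a t) (?b t) \<in> Q c"
        using sg[OF e, of t] nz[OF a_in] z by (subst Q_iff[OF a_dom]) (auto simp: norm_mult a_def)
    qed
    moreover have "circle_pt i (a 0) \<zeta> \<in> ?C"
      by (rule image_eqI[of _ _ 0]) auto
    ultimately have "?C \<subseteq> A"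
      using A(1) z(2) unfolding linked_def by blast
    moreover have "circle_pt i (a (2 * pi)) (?b (2 * pi)) \<in> ?C"
      by (rule imageI) auto
    ultimately have "circle_pt i (a (2 * pi)) (?b (2 * pi)) \<in> A"
      by blast
    moreover have "?b (2 * pi) = \<zeta> * cis (- (2 * pi * of_int n) / of_int m)"
      unfolding per by (simp add: mult.commute)
    ultimately show ?thesis
      by (simp only: per)
  qed
  have steps: "circle_pt i (a 0) (\<zeta> * cis (real k * (- (2 * pi * of_int n) / of_int m))) \<in> A"
    if z: "cmod \<zeta> = 1" "circle_pt i (a 0) \<zeta> \<in> A" for \<zeta> and k :: nat
  proof (induction k)
    case (Suc k)
    have "circle_pt i (a 0) (\<zeta> * cis (real k * (- (2 * pi * of_int n) / of_int m)) * cis (- (2 * pi * of_int n) / of_int m)) \<in> A"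
      by (rule step[OF _ Suc]) (simp add: norm_mult z)
    moreover have "cis (real (Suc k) * x) = cis (real k * x) * cis x" for x
      by (simp add: cis_mult distrib_right add.commute)
    ultimately show ?case by (simp only: mult.assoc)
  qed (use z in simp)
  have all: "q \<in> A" if p: "p \<in> A" "fst p = cpar K i (a 0)" and q: "q \<in> Q c" "fst q = cpar K i (a 0)" for p q
  proof -
    obtain \<zeta> where z: "cmod \<zeta> = 1" "p = circle_pt i (a 0) \<zeta>"
      using circle_pt_ex[OF _ a_dom p(2)] p(1) A(2) by (auto simp: Q_def)
    obtain \<xi> where x: "cmod \<xi> = 1" "q = circle_pt i (a 0) \<xi>"
      using circle_pt_ex[OF _ a_dom q(2)] q(1) by (auto simp: Q_def)
    have sn: "sgn (s i (a 0)) \<noteq> 0" using nz[OF a_in] by (simp add: sgn_zero_iff)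
    have "sgn (s i (a 0)) * \<zeta> powi m = sgn (s i (a 0)) * \<xi> powi m"
      using p(1) A(2) q(1) z x Q_iff[OF a_dom] by auto
    then have eq: "\<zeta> powi m = \<xi> powi m" using sn by simp
    have z0: "\<zeta> \<noteq> 0" using z by auto
    have "(\<xi> / \<zeta>) powi m = 1"
      using eq z0 x by (auto simp: power_int_divide_distrib)
    then obtain j where j: "\<xi> / \<zeta> = cis (2 * pi * of_int j / of_int m)"
      using unit_root_cis[OF m0, of "\<xi> / \<zeta>"] z x by (auto simp: norm_divide)
    \<comment> \<open>The number of turns must be a natural number with \<open>j + n * k\<close>
      divisible by \<open>m\<close>. As \<open>n * n = 1\<close>, any \<open>k\<close> congruent to
      \<open>- n * j\<close> works, and the remainder modulo \<open>\<bar>m\<bar>\<close> is such a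
      \<open>k\<close>.\<close>
    define k where "k = nat ((- n * j) mod \<bar>m\<bar>)"
    have "int k = (- n * j) mod \<bar>m\<bar>" using m0 by (simp add: k_def)
    then have "\<bar>m\<bar> dvd (- n * j) - int k" by (simp add: mod_eq_dvd_iff[symmetric])
    then obtain l where l: "- n * j - int k = m * l" by (auto elim: dvdE)
    have nn: "n * n = 1" using n by auto
    have "j + n * int k = - m * l * n"
    proof -
      have "int k = - n * j - m * l" using l by simp
      then have "j + n * int k = j + n * (- n * j - m * l)" by (simp only:)
      also have "\<dots> = j - (n * n) * j - n * (m * l)" by (simp add: right_diff_distrib)
      also have "\<dots> = - m * l * n" by (simp add: nn)
      finally show ?thesis .
    qed
    then have "of_int j + of_int n * real k = - of_int m * of_int l * (of_int n :: real)"
      by (metis of_int_add of_int_mult of_int_of_nat_eq of_int_minus)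
    then have jr: "real_of_int j = - of_int m * of_int l * of_int n - of_int n * real k"
      by simp
    have "2 * pi * of_int j / of_int m = real k * (- (2 * pi * of_int n) / of_int m) + 2 * pi * of_int (- l * n)"
      unfolding jr using m0 by (simp add: field_simps)
    then have "\<xi> / \<zeta> = cis (real k * (- (2 * pi * of_int n) / of_int m)) * cis (2 * pi * of_int (- l * n))"
      unfolding j by (simp only: cis_mult)
    also have "cis (2 * pi * of_int (- l * n)) = 1"
      using cis_eq_1_iff by blast
    finally have "\<xi> = \<zeta> * cis (real k * (- (2 * pi * of_int n) / of_int m))"
      using z0 by (simp add: field_simps)
    then show "q \<in> A" using steps[OF z(1), of k] p z x by simp
  qed
  show thesis
  proof (rule that[of "cpar K i (a 0)"])
    show "cpar K i (a 0) \<in> X - Z"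
      using a_dom nz[OF a_in] Z_iff by auto
  qed (use all in blast)
qed

lemma Q_nonempty:
  assumes "Z \<noteq> {}" "cmod c = 1" shows "Q c \<noteq> {}"
proof -
  obtain i w0 where w0: "w0 \<in> cdom K i" "s i w0 = 0"
    using assms(1) by (auto simp: Z_def)
  obtain n r g where r: "r > 0" "ball w0 r \<subseteq> cdom K i"
    and nz: "\<And>v. v \<in> ball w0 r - {w0} \<Longrightarrow> s i v \<noteq> 0"
    using zero_coordinates[OF w0] by metis
  define w where "w = w0 + of_real (r/2)"
  have "w \<in> ball w0 r - {w0}" using r by (auto simp: w_def dist_norm)
  then have w: "w \<in> cdom K i" "s i w \<noteq> 0" using r nz by blast+
  define d where "d = c / sgn (s i w)"
  have d: "cmod d = 1" using assms w by (simp add: d_def norm_divide norm_sgn)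
  define \<zeta> where "\<zeta> = cis (Arg d / of_int m)"
  have "\<zeta> powi m = d" using m0 cis_Arg_unit[OF d] by (simp add: \<zeta>_def cis_powi)
  then have "circle_pt i w \<zeta> \<in> Q c"
    using w by (subst Q_iff) (auto simp: \<zeta>_def d_def sgn_zero_iff)
  then show ?thesis by blast
qed

text \<open>The component \<open>?A\<close> of a point \<open>p0\<close> is linked. By
  \<open>monodromy\<close> some fibre of \<open>Q c\<close> lies entirely in \<open>?A\<close> or
  entirely outside, and \<open>linked_fibre_const\<close> spreads the alternative over all of
  \<open>Q c\<close>. The second case would expel \<open>p0\<close> itself.\<close>

lemma connectedin_Q:
  assumes Z: "Z \<noteq> {}" shows "connectedin (Ptop K) (Q c)"
proof (cases "Q c = {}")
  case False
  then obtain p0 where p0: "p0 \<in> Q c" by blast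
  let ?U = "{C. connectedin (Ptop K) C \<and> C \<subseteq> Q c \<and> p0 \<in> C}"
  let ?A = "\<Union>?U"
  have p0_in: "connectedin (Ptop K) {p0}"
    using p0 by (auto simp: Q_def)
  then have p0A: "p0 \<in> ?A" using p0 by blast
  have conn: "connectedin (Ptop K) ?A"
    by (rule connectedin_Union) (use p0_in in auto)
  have sub: "?A \<subseteq> Q c" by blast
  have lk: "linked c ?A"
    unfolding linked_def
  proof (intro allI impI)
    fix C assume C: "connectedin (Ptop K) C \<and> C \<subseteq> Q c \<and> C \<inter> ?A \<noteq> {}"
    then have "connectedin (Ptop K) (?A \<union> C)"
      using conn by (intro connectedin_Un) auto
    then show "C \<subseteq> ?A" using C sub p0A by blast
  qed
  obtain z where z: "z \<in> X - Z" and alt: "(\<forall>p\<in>Q c. fst p = z \<longrightarrow> p \<in> ?A) \<or> (\<forall>p\<in>Q c. fst p = z \<longrightarrow> p \<in> Q c - ?A)"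
    using monodromy[OF Z lk sub] by blast
  have base_in: "fst p \<in> X - Z" if pq: "p \<in> Q c" for p
  proof -
    have "p \<in> circle_bundle K" using pq by (auto simp: Q_def)
    then obtain i w \<zeta> where w: "w \<in> cdom K i" "cmod \<zeta> = 1" "p = circle_pt i w \<zeta>" by (rule pointE)
    then have "s i w \<noteq> 0" using pq Q_iff by blast
    then show ?thesis using w Z_iff by auto
  qed
  have "Q c \<subseteq> ?A"
  proof
    fix q assume q: "q \<in> Q c"
    from alt show "q \<in> ?A"
    proof
      assume "\<forall>p\<in>Q c. fst p = z \<longrightarrow> p \<in> ?A"
      then show ?thesis
        using linked_fibre_const[OF lk z base_in[OF q], of q] q by blast
    next
      assume "\<forall>p\<in>Q c. fst p = z \<longrightarrow> p \<in> Q c - ?A"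
      then have "p0 \<in> Q c - ?A"
        using linked_fibre_const[OF linked_Diff[OF lk] z base_in[OF p0], of p0] p0 by blast
      then show ?thesis using p0A by blast
    qed
  qed
  then have "Q c = ?A" using sub by blast
  then show ?thesis using conn by metis
qed simp

lemma connectedin_half:
  assumes Z: "Z \<noteq> {}" and c: "cmod c = 1"
  shows "connectedin (Ptop K) {p \<in> circle_bundle K. Re (\<phi> p * cnj c) > 0}"
proof (rule connectedin_star[OF connectedin_Q[OF Z] Q_nonempty[OF Z c]])
  have cc: "c * cnj c = 1" using c complex_norm_square[of c] by simp
  show "Q c \<subseteq> {p \<in> circle_bundle K. Re (\<phi> p * cnj c) > 0}"
  proof clarify
    fix p assume "p \<in> Q c"
    then have p: "p \<in> circle_bundle K" "\<phi> p \<noteq> 0" "\<phi> p = of_real (cmod (\<phi> p)) * c"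
      by (auto simp: Q_def sgn_eq)
    then have "\<phi> p * cnj c = of_real (cmod (\<phi> p))"
      using cc by (metis mult.assoc mult.right_neutral)
    then show "p \<in> circle_bundle K \<and> Re (\<phi> p * cnj c) > 0"
      using p by simp
  qed
  fix p assume "p \<in> {p \<in> circle_bundle K. Re (\<phi> p * cnj c) > 0}"
  then have p: "p \<in> circle_bundle K" "Re (\<phi> p * cnj c) > 0" by auto
  then obtain i w \<zeta> where w: "w \<in> cdom K i" "cmod \<zeta> = 1" "p = circle_pt i w \<zeta>" by (metis pointE)
  define \<alpha> where "\<alpha> = Arg (\<phi> p * cnj c)"
  have ne: "\<phi> p * cnj c \<noteq> 0" using p by auto
  have ab: "\<bar>\<alpha>\<bar> < pi / 2"
    using p(2) Arg_Re_pos[of "\<phi> p * cnj c"] by (auto simp: \<alpha>_def)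
  have polar: "\<phi> p * cnj c = of_real (cmod (\<phi> p)) * cis \<alpha>"
    using ne cis_Arg[OF ne] c by (simp add: \<alpha>_def sgn_eq norm_mult)
  \<comment> \<open>Moving along the fibre turns \<open>\<phi>\<close> by
    \<open>- t * \<alpha>\<close>. The remaining angle to \<open>c\<close> shrinks from
    \<open>\<alpha>\<close> to \<open>0\<close>, so the path stays in the half space and ends in
    \<open>Q c\<close>.\<close>
  let ?b = "\<lambda>t. \<zeta> * cis (- t * \<alpha> / of_int m)"
  let ?C = "(\<lambda>t. circle_pt i w (?b t)) ` {0..1}"
  have b1: "cmod (?b t) = 1" for t using w by (simp add: norm_mult)
  have val: "\<phi> (circle_pt i w (?b t)) = of_real (cmod (\<phi> p)) * cis ((1 - t) * \<alpha>) * c" for t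
  proof -
    have "\<phi> (circle_pt i w (?b t)) = \<phi> p * cis (- t * \<alpha>)"
      using phi_circle_pt[OF w(1) b1, of t] phi_circle_pt[OF w(1,2)] w(3) m0
      by (simp add: power_int_mult_distrib cis_powi)
    also have "\<phi> p = of_real (cmod (\<phi> p)) * cis \<alpha> * c"
      using polar cc by (metis mult.assoc mult.commute mult.right_neutral)
    finally show ?thesis by (simp add: cis_mult mult_ac algebra_simps)
  qed
  have vc: "\<phi> (circle_pt i w (?b t)) * cnj c = of_real (cmod (\<phi> p)) * cis ((1 - t) * \<alpha>)" for t
    using val[of t] cc by (metis mult.assoc mult.right_neutral)
  have "connectedin (Ptop K) ?C"
    by (rule connectedin_circle_pt_image) (use w m0 in \<open>auto intro!: continuous_intros simp: norm_mult\<close>)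
  moreover have "?C \<subseteq> {p \<in> circle_bundle K. Re (\<phi> p * cnj c) > 0}"
  proof (rule image_subsetI)
    fix t :: real assume t: "t \<in> {0..1}"
    have "\<bar>(1 - t) * \<alpha>\<bar> \<le> 1 * \<bar>\<alpha>\<bar>"
      unfolding abs_mult by (rule mult_right_mono) (use t in auto)
    then have "cos ((1 - t) * \<alpha>) > 0"
      using ab by (intro cos_gt_zero_pi) linarith+
    then have "Re (\<phi> (circle_pt i w (?b t)) * cnj c) > 0"
      unfolding vc using ne by (simp add: zero_less_mult_iff)
    then show "circle_pt i w (?b t) \<in> {p \<in> circle_bundle K. Re (\<phi> p * cnj c) > 0}"
      using circle_pt_in[OF w(1) b1] by blast
  qed
  moreover have "p \<in> ?C" using w by (intro image_eqI[of _ _ 0]) auto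
  moreover have "circle_pt i w (?b 1) \<in> Q c"
  proof -
    have "sgn (\<phi> (circle_pt i w (?b 1))) = c"
      using val[of 1] ne c by (simp add: sgn_eq norm_mult)
    then show ?thesis using circle_pt_in[OF w(1) b1[of 1]] val[of 1] ne c unfolding Q_def by auto
  qed
  moreover have "circle_pt i w (?b 1) \<in> ?C" by (rule imageI) auto
  ultimately show "\<exists>C. connectedin (Ptop K) C \<and> C \<subseteq> {p \<in> circle_bundle K. Re (\<phi> p * cnj c) > 0} \<and> p \<in> C \<and> C \<inter> Q c \<noteq> {}"
    by blast
qed

section \<open>The nodal set and the nodal domains\<close>

definition F0 :: "('x \<times> ('l \<Rightarrow> complex)) set" where
  "F0 = {p \<in> circle_bundle K. \<phi> p = 0}"

text \<open>Along an arbitrarily small circle around the zero the argument of the section changes by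
  a full turn, so by the intermediate value theorem it attains every phase. With the fibre
  coordinate held fixed this gives points of \<open>Q c\<close> arbitrarily near the given
  one.\<close>

lemma F0_closure:
  assumes c: "cmod c = 1" shows "F0 \<subseteq> Ptop K closure_of (Q c)"
proof
  fix p assume p: "p \<in> F0"
  then have pc: "p \<in> circle_bundle K" by (simp add: F0_def)
  then obtain i w0 \<zeta> where w: "w0 \<in> cdom K i" "cmod \<zeta> = 1" "p = circle_pt i w0 \<zeta>" by (rule pointE)
  have w0: "w0 \<in> cdom K i" "s i w0 = 0" using p w phi_zero by (auto simp: F0_def)
  obtain n r g where n: "n = 1 \<or> n = -1" and r: "r > 0" "ball w0 r \<subseteq> cdom K i"
    and g: "continuous_on (ball w0 r - {w0}) g" and nz: "\<And>v. v \<in> ball w0 r - {w0} \<Longrightarrow> s i v \<noteq> 0"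
    and sg: "\<And>\<epsilon> t. 0 < \<epsilon> \<Longrightarrow> \<epsilon> < r \<Longrightarrow> sgn (s i (w0 + of_real \<epsilon> * cis t)) = cis (of_int n * t + g (w0 + of_real \<epsilon> * cis t))"
    using zero_coordinates[OF w0] by metis
  show "p \<in> Ptop K closure_of (Q c)"
    unfolding in_closure_of
  proof (intro conjI allI impI)
    show "p \<in> topspace (Ptop K)" using pc by simp
    fix W assume W: "p \<in> W \<and> openin (Ptop K) W"
    have "continuous_map (top_of_set (cdom K i)) (top_of_set (cdom K i \<times> sphere 0 1)) (\<lambda>v. (v, \<zeta>))"
      using w by (auto intro!: continuous_intros)
    from continuous_map_compose[OF this continuous_map_circle_pt]
    have "openin (top_of_set (cdom K i)) {v \<in> topspace (top_of_set (cdom K i)). ((\<lambda>(w, \<zeta>). circle_pt i w \<zeta>) \<circ> (\<lambda>v. (v, \<zeta>))) v \<in> W}"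
      by (rule openin_continuous_map_preimage) (use W in blast)
    then have "open {v \<in> cdom K i. circle_pt i v \<zeta> \<in> W}"
      using openin_open_trans[OF _ open_cdom] by (simp add: comp_def)
    moreover have "w0 \<in> {v \<in> cdom K i. circle_pt i v \<zeta> \<in> W}" using w W by auto
    ultimately obtain \<delta> where d: "\<delta> > 0" "ball w0 \<delta> \<subseteq> {v \<in> cdom K i. circle_pt i v \<zeta> \<in> W}"
      by (rule openE)
    define \<epsilon> where "\<epsilon> = min \<delta> r / 2"
    have e: "0 < \<epsilon>" "\<epsilon> < r" "\<epsilon> < \<delta>" using r d by (auto simp: \<epsilon>_def)
    define a where "a t = w0 + of_real \<epsilon> * cis t" for t
    have a_in: "a t \<in> ball w0 r - {w0}" "a t \<in> ball w0 \<delta>" for t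
      using e by (auto simp: a_def dist_norm norm_mult)
    have ca: "continuous_on T a" for T
      unfolding a_def by (intro continuous_intros)
    have cg: "continuous_on T (\<lambda>t. g (a t))" for T
      by (rule continuous_on_compose2[OF g ca]) (use a_in in auto)
    define h where "h t = of_int n * t + g (a t)" for t
    have ch: "continuous_on {0..2*pi} h"
      unfolding h_def by (intro continuous_intros cg)
    have h2: "h (2 * pi) = h 0 + 2 * pi * of_int n"
      by (simp add: h_def a_def)
    define d where "d = c / \<zeta> powi m"
    have dd: "cmod d = 1" using c w by (simp add: d_def norm_divide norm_power_int)
    \<comment> \<open>\<open>Arg d\<close> has to be shifted by a multiple of \<open>2 * pi\<close>
      into the range between \<open>h 0\<close> and \<open>h (2 * pi)\<close>, which lies above
      \<open>h 0\<close> for \<open>n = 1\<close> and below it for \<open>n = -1\<close>; hence the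
      ceiling and the floor.\<close>
    define k where "k = (if n = 1 then \<lceil>(h 0 - Arg d) / (2 * pi)\<rceil> else \<lfloor>(h 0 - Arg d) / (2 * pi)\<rfloor>)"
    define y where "y = Arg d + 2 * pi * of_int k"
    have "\<exists>t\<in>{0..2*pi}. h t = y"
    proof (cases "n = 1")
      case True
      define q where "q = (h 0 - Arg d) / (2 * pi)"
      have q: "h 0 = Arg d + 2 * pi * q" by (simp add: q_def)
      have "q \<le> of_int k" "of_int k < q + 1"
        using True ceiling_correct[of q] by (simp_all add: k_def flip: q_def) 
      then have "2 * pi * q \<le> 2 * pi * of_int k" "2 * pi * of_int k \<le> 2 * pi * (q + 1)"
        by (auto intro!: mult_left_mono)
      then have "h 0 \<le> y" "y \<le> h (2 * pi)"
        using h2 True unfolding y_def q by (auto simp: algebra_simps)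
      then show ?thesis using IVT'[of h 0 y "2 * pi"] ch by auto
    next
      case False
      then have n1: "n = -1" using n by auto
      define q where "q = (h 0 - Arg d) / (2 * pi)"
      have q: "h 0 = Arg d + 2 * pi * q" by (simp add: q_def)
      have "of_int k \<le> q" "q < of_int k + 1"
        using False floor_correct[of q] by (simp_all add: k_def flip: q_def) 
      then have "2 * pi * of_int k \<le> 2 * pi * q" "2 * pi * q \<le> 2 * pi * (of_int k + 1)"
        by (auto intro!: mult_left_mono)
      then have "y \<le> h 0" "h (2 * pi) \<le> y"
        using h2 n1 unfolding y_def q by (auto simp: algebra_simps)
      then show ?thesis using IVT2'[of h "2 * pi" y 0] ch by auto
    qed
    then obtain t where t: "h t = y" by blast
    have "sgn (s i (a t)) = cis y"
      using sg[OF e(1,2), of t] t by (simp add: a_def h_def)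
    also have "\<dots> = cis (Arg d) * cis (2 * pi * of_int k)"
      unfolding y_def cis_mult ..
    also have "cis (2 * pi * of_int k) = 1" using cis_eq_1_iff by blast
    also have "cis (Arg d) = d" by (rule cis_Arg_unit[OF dd])
    finally have "sgn (s i (a t)) * \<zeta> powi m = c"
      using w by (auto simp: d_def)
    then have "circle_pt i (a t) \<zeta> \<in> Q c"
      using a_in(1)[of t] r nz w by (subst Q_iff) auto
    moreover have "circle_pt i (a t) \<zeta> \<in> W" using d a_in(2)[of t] by blast
    ultimately show "\<exists>y. y \<in> Q c \<and> y \<in> W" by blast
  qed
qed

lemma nodal_set_connected:
  assumes Z: "Z \<noteq> {}"
  shows "connectedin (Ptop K) (nodal_set K (\<lambda>p. Re (\<phi> p)))"
proof -
  have 1: "connectedin (Ptop K) (Q c \<union> F0)" if "cmod c = 1" for c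
    by (rule connectedin_intermediate_closure_of[OF connectedin_Q[OF Z]])
       (use F0_closure[OF that] closure_of_subset[of "Q c" "Ptop K"] in \<open>auto simp: Q_def\<close>)
  obtain i w where w: "w \<in> cdom K i" "s i w = 0" using Z by (auto simp: Z_def)
  then have "circle_pt i w 1 \<in> F0" by (simp add: F0_def phi_zero circle_pt_in)
  \<comment> \<open>The circle over a zero belongs to both pieces and joins them.\<close>
  then have "connectedin (Ptop K) ((Q \<i> \<union> F0) \<union> (Q (-\<i>) \<union> F0))"
    by (intro connectedin_Un 1) auto
  moreover have "(Q \<i> \<union> F0) \<union> (Q (-\<i>) \<union> F0) = nodal_set K (\<lambda>p. Re (\<phi> p))"
  proof (intro subset_antisym subsetI)
    fix p assume "p \<in> nodal_set K (\<lambda>p. Re (\<phi> p))"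
    then have p: "p \<in> circle_bundle K" "Re (\<phi> p) = 0" by (auto simp: nodal_set_def)
    then have e: "\<phi> p = of_real (Im (\<phi> p)) * \<i>" by (simp add: complex_eq_iff)
    have "\<phi> p = 0 \<or> sgn (\<phi> p) = \<i> \<or> sgn (\<phi> p) = - \<i>"
      by (subst (2 3) e, subst (1) e) (auto simp: sgn_mult sgn_of_real sgn_eq[of \<i>] sgn_real_def)
    then show "p \<in> (Q \<i> \<union> F0) \<union> (Q (-\<i>) \<union> F0)"
      using p by (auto simp: Q_def F0_def)
  next
    fix p assume "p \<in> (Q \<i> \<union> F0) \<union> (Q (-\<i>) \<union> F0)"
    moreover have "\<phi> p = of_real (cmod (\<phi> p)) * c" if "p \<in> Q c" for c
      using that by (auto simp: Q_def sgn_eq)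
    from arg_cong[OF this[of \<i>], of Re] arg_cong[OF this[of "- \<i>"], of Re]
    have "Re (\<phi> p) = 0" if "p \<in> Q \<i> \<or> p \<in> Q (- \<i>)"
      using that by auto
    ultimately show "p \<in> nodal_set K (\<lambda>p. Re (\<phi> p))"
      by (auto simp: Q_def F0_def nodal_set_def)
  qed
  ultimately show ?thesis by metis
qed

text \<open>The sets where the real part is positive and negative are the half spaces for
  \<open>c = 1\<close> and \<open>c = -1\<close>. They are disjoint, open, connected and cover the
  complement of the nodal set, so they are its components.\<close>

lemma nodal_domains_card:
  assumes Z: "Z \<noteq> {}"
  shows "card (nodal_domains K (\<lambda>p. Re (\<phi> p))) = 2"
proof -
  let ?P = "\<lambda>c. {p \<in> circle_bundle K. Re (\<phi> p * cnj c) > 0}"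
  let ?N = "circle_bundle K - nodal_set K (\<lambda>p. Re (\<phi> p))"
  let ?Y = "subtopology (Ptop K) ?N"
  have ne: "?P c \<noteq> {}" if c: "cmod c = 1" for c
  proof -
    obtain p where p: "p \<in> circle_bundle K" "\<phi> p \<noteq> 0" "sgn (\<phi> p) = c"
      using Q_nonempty[OF Z c] by (auto simp: Q_def)
    then have "\<phi> p * cnj c = of_real (cmod (\<phi> p)) * (c * cnj c)" by (auto simp: sgn_eq)
    also have "c * cnj c = 1" using c complex_norm_square[of c] by simp
    finally have "Re (\<phi> p * cnj c) > 0" using p(2) by (simp del: times_complex.sel)
    then show ?thesis using p(1) by blast
  qed
  have op: "openin (Ptop K) (?P c)" for c
  proof -
    have "open {x. Re (x * cnj c) > 0}"
      by (intro open_Collect_less continuous_intros)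
    then have "openin (Ptop K) {p \<in> topspace (Ptop K). \<phi> p \<in> {x. Re (x * cnj c) > 0}}"
      by (intro openin_continuous_map_preimage[OF continuous_map_phi]) auto
    then show ?thesis by simp
  qed
  have U: "?N = ?P 1 \<union> ?P (-1)" by (auto simp: nodal_set_def)
  have D: "?P 1 \<inter> ?P (-1) = {}" by auto
  have top: "topspace ?Y = ?N" by auto
  have sub: "?P c \<subseteq> ?N" if "c \<in> {1,-1}" for c
  proof -
    have "c = 1 \<or> c = -1" using that by simp
    then show ?thesis unfolding U by (rule disjE) (simp_all only: Un_upper1 Un_upper2)
  qed
  have opY: "openin ?Y (?P c)" if "c \<in> {1,-1}" for c
    unfolding openin_subtopology
    by (intro exI[of _ "?P c"] conjI op) (use sub[OF that] in blast)
  have con: "connectedin ?Y (?P c)" if "c \<in> {1,-1}" for c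
  proof -
    have "cmod c = 1" using that by auto
    then show ?thesis
      using connectedin_half[OF Z, of c] sub[OF that] by (simp only: connectedin_subtopology)
  qed
  have comp: "connected_component_of_set ?Y x = ?P c" if c: "c \<in> {1,-1}" and x: "x \<in> ?P c" for x c
  proof (rule subset_antisym)
    show "?P c \<subseteq> connected_component_of_set ?Y x"
      by (rule connected_component_of_maximal[OF con[OF c] x])
    let ?C = "connected_component_of_set ?Y x"
    have cC: "connectedin ?Y ?C" by (rule connectedin_connected_component_of)
    have s1: "?C \<subseteq> ?P c \<union> ?P (-c)"
      using connectedin_subset_topspace[OF cC] top U c by auto
    have d1: "?P c \<inter> ?P (-c) \<inter> ?C = {}" by auto
    have n1: "?P c \<inter> ?C \<noteq> {}"
      using x \<open>?P c \<subseteq> ?C\<close> by blast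
    have o1: "openin ?Y (?P c)" by (rule opY[OF c])
    have o2: "openin ?Y (?P (-c))" by (rule opY) (use c in auto)
    have no: "\<not> (\<exists>E1 E2. openin ?Y E1 \<and> openin ?Y E2 \<and> ?C \<subseteq> E1 \<union> E2 \<and> E1 \<inter> E2 \<inter> ?C = {} \<and>
        E1 \<inter> ?C \<noteq> {} \<and> E2 \<inter> ?C \<noteq> {})"
      using cC unfolding connectedin by (rule conjunct2)
    have "?P (-c) \<inter> ?C = {}"
    proof (rule ccontr)
      assume n2: "?P (-c) \<inter> ?C \<noteq> {}"
      show False
        by (rule notE[OF no]) (intro exI[of _ "?P c"] exI[of _ "?P (-c)"] conjI o1 o2 s1 d1 n1 n2)
    qed
    then show "?C \<subseteq> ?P c" using s1 by blast
  qed
  have "nodal_domains K (\<lambda>p. Re (\<phi> p)) = {?P 1, ?P (-1)}"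
  proof -
    have "nodal_domains K (\<lambda>p. Re (\<phi> p)) = connected_component_of_set ?Y ` (?P 1 \<union> ?P (-1))"
      unfolding nodal_domains_def connected_components_of_def trans[OF top U] ..
    also have "\<dots> = connected_component_of_set ?Y ` ?P 1 \<union> connected_component_of_set ?Y ` ?P (-1)"
      by (rule image_Un)
    also have "connected_component_of_set ?Y ` ?P 1 = {?P 1}"
      using comp[of 1] ne[of 1] by (auto simp: image_iff) 
    also have "connected_component_of_set ?Y ` ?P (-1) = {?P (-1)}"
      using comp[of "-1"] ne[of "-1"] by (auto simp: image_iff)
    finally show ?thesis by auto
  qed
  moreover have "?P 1 \<noteq> ?P (-1)" using ne[of 1] D by auto
  ultimately show ?thesis by simp
qed

end

section \<open>Moving and cancelling zeros\<close>

lemma has_index_powi: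
  assumes "has_index h a n" shows "has_index (\<lambda>w. h w powi k) a (k * n)"
proof -
  obtain r g where 1: "0 < r" "continuous_on (ball a r - {a}) g"
    "\<And>w. w \<in> ball a r - {a} \<Longrightarrow> h w = (w - a) powi n * exp (g w)"
    using assms(1) unfolding has_index_def by blast
  have "h w powi k = (w - a) powi (k * n) * exp (of_int k * g w)" if "w \<in> ball a r - {a}" for w
    using 1(3)[OF that] by (simp add: power_int_mult_distrib exp_power_int mult.commute[of k] power_int_mult)
  then show ?thesis
    unfolding has_index_def
    by (intro exI[of _ r] conjI exI[of _ "\<lambda>w. of_int k * g w"]) (use 1 in \<open>auto intro: continuous_intros\<close>)
qed

lemma has_index_0_open:
  assumes "open S" "a \<in> S" "continuous_on S h" "h a \<noteq> 0"
  shows "has_index h a 0"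
proof -
  obtain r where "r > 0" "ball a r \<subseteq> S" using assms openE by blast
  then show ?thesis using has_index_0[of r a h] assms continuous_on_subset by blast
qed

lemma has_index_cong_open:
  assumes "has_index h a n" "open S" "a \<in> S" "\<And>w. w \<in> S - {a} \<Longrightarrow> h' w = h w"
  shows "has_index h' a n"
proof -
  obtain r where "r > 0" "ball a r \<subseteq> S" using assms openE by blast
  then show ?thesis using has_index_cong[OF assms(1)] assms(4) by blast
qed

text \<open>Near \<open>a\<close> the function is \<open>(v - a)/(v - b)\<close>; as this quotient has a logarithm
  away from the segment from \<open>a\<close> to \<open>b\<close>, it can be deformed to \<open>1\<close> further outside.\<close>

lemma move_zero_in_ball:
  fixes a b :: complex
  assumes R: "R > 0" and b: "b \<in> ball a (R / 4)"
  obtains \<rho> where "\<And>v. v \<notin> cball a R \<Longrightarrow> \<rho> v = 1"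
    "\<And>v. has_index \<rho> v ((if v = a then 1 else 0) - (if v = b then 1 else 0))"
proof -
  define q where "q v = (v - b) / (v - a)" for v
  \<comment> \<open>The cutoff is \<open>1\<close> for \<open>cmod (v - a) \<le> R / 2\<close> and
    \<open>0\<close> from \<open>3 * R / 4\<close> on. The two formulas for \<open>\<rho>\<close>
    agree on the annulus between \<open>R / 4\<close> and \<open>R / 2\<close>, where
    \<open>b\<close> is already inside the inner circle and \<open>q\<close> has positive real
    part.\<close>
  define ct where "ct v = max 0 (min 1 (3 - 4 * cmod (v - a) / R))" for v
  define \<rho> where "\<rho> v = (if cmod (v - a) \<le> R / 2 then (v - a) / (v - b) else exp (- of_real (ct v) * Ln (q v)))" for v
  let ?V = "{v. R / 4 < cmod (v - a)}"
  have opV: "open ?V" by (intro open_Collect_less continuous_intros)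
  have ba: "cmod (b - a) < R / 4" using b by (simp add: dist_norm norm_minus_commute)
  have Oab: "v \<noteq> a" "v \<noteq> b" if "v \<in> ?V" for v using that ba R by auto
  have qpos: "Re (q v) > 0" if "v \<in> ?V" for v
    unfolding q_def by (rule Re_divide_pos) (use that ba in \<open>auto simp: norm_minus_commute\<close>)
  have slit: "q v \<notin> \<real>\<^sub>\<le>\<^sub>0" if "v \<in> ?V" for v
    using qpos[OF that] by (auto simp: complex_nonpos_Reals_iff)
  have eqO: "\<rho> v = exp (- of_real (ct v) * Ln (q v))" if v: "v \<in> ?V" for v
  proof (cases "cmod (v - a) \<le> R / 2")
    case True
    then have "4 * cmod (v - a) / R \<le> 2" using R by (simp add: field_simps)
    then have "ct v = 1" by (simp add: ct_def)
    moreover have "q v \<noteq> 0" using slit[OF v] by auto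
    ultimately show ?thesis using True by (simp add: \<rho>_def exp_minus q_def)
  qed (simp add: \<rho>_def)
  have contO: "continuous_on ?V \<rho>"
  proof -
    have "continuous_on ?V (\<lambda>v. exp (- of_real (ct v) * Ln (q v)))"
      unfolding ct_def q_def
      by (intro continuous_intros continuous_on_Ln') (use slit Oab R in \<open>auto simp: q_def\<close>)
    then show ?thesis by (rule continuous_on_eq) (use eqO in simp)
  qed
  show thesis
  proof (rule that[of \<rho>])
    fix v assume "v \<notin> cball a R"
    then have v: "cmod (v - a) > R" by (simp add: dist_norm norm_minus_commute)
    then have "4 * cmod (v - a) / R \<ge> 4" using R by (simp add: field_simps)
    then have "ct v = 0" by (simp add: ct_def)
    then show "\<rho> v = 1" using v R by (simp add: \<rho>_def)
  next
    fix v
    show "has_index \<rho> v ((if v = a then 1 else 0) - (if v = b then 1 else 0))"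
    proof (cases "v \<in> ?V")
      case True
      then have "\<rho> v \<noteq> 0" using eqO by simp
      then show ?thesis
        using has_index_0_open[OF opV True contO] Oab[OF True] by simp
    next
      case False
      have lin: "has_index (\<lambda>w. w - c) v (if v = c then 1 else 0)" for c :: complex
      proof (cases "v = c")
        case False
        have "continuous_on (ball v 1) (\<lambda>w. w - c)" by (intro continuous_intros)
        from has_index_0[OF zero_less_one this] False show ?thesis by simp
      qed (simp add: has_index_id)
      have "has_index (\<lambda>w. (w - a) * inverse (w - b)) v ((if v = a then 1 else 0) + - (if v = b then 1 else 0))"
        by (rule has_index_mult[OF lin has_index_inverse[OF lin]])
      then have "has_index \<rho> v ((if v = a then 1 else 0) + - (if v = b then 1 else 0))"
      proof (rule has_index_cong)
        show "R / 4 > 0" using R by simp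
        fix w assume "w \<in> ball v (R / 4) - {v}"
        then have "cmod (w - v) < R / 4" by (simp add: dist_norm norm_minus_commute)
        moreover have "cmod (v - a) \<le> R / 4" using False by simp
        moreover have "cmod (w - a) \<le> cmod (w - v) + cmod (v - a)"
          using norm_triangle_ineq[of "w - v" "v - a"] by simp
        ultimately have "cmod (w - a) \<le> R / 2" by linarith
        then show "\<rho> w = (w - a) * inverse (w - b)" unfolding \<rho>_def by (simp add: divide_inverse[of "w - a"])
      qed
      then show ?thesis by simp
    qed
  qed
qed

section \<open>Transplanting functions from a chart to the surface\<close>

context kk_bundle begin

text \<open>The image of a closed disc is compact, hence closed in the Hausdorff surface.\<close>

lemma openin_compl_ball:
  assumes "cball w R \<subseteq> cdom K i" shows "openin (base K) (X - cpar K i ` cball w R)"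
proof -
  have "compactin (top_of_set (cdom K i)) (cball w R)"
    using assms by (simp add: compactin_subtopology)
  then have "compactin (base K) (cpar K i ` cball w R)"
    using continuous_map_cpar by (rule image_compactin)
  then have "closedin (base K) (cpar K i ` cball w R)"
    using Hausdorff_X compactin_imp_closedin by blast
  then show ?thesis by blast
qed

text \<open>The gluing lemmas below take \<open>\<rho>\<close> equal to \<open>d\<close> off a
  closed disc inside the patch; the image of the disc is closed in the surface, so nothing happens
  at the edge of the patch.\<close>

definition extf :: "'i \<Rightarrow> (complex \<Rightarrow> 'b) \<Rightarrow> 'b \<Rightarrow> 'x \<Rightarrow> 'b" where
  "extf i \<rho> d z = (if z \<in> cpar K i ` cdom K i then \<rho> (inv_into (cdom K i) (cpar K i) z) else d)"

lemma extf_cpar: "w \<in> cdom K i \<Longrightarrow> extf i \<rho> d (cpar K i w) = \<rho> w"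
  by (simp add: extf_def inv_into_f_f[OF inj_cpar])

lemma extf_tr:
  assumes "w \<in> ov j i" shows "extf i \<rho> d (cpar K j w) = \<rho> (tr j i w)"
  unfolding cpar_tr[OF assms, symmetric] by (rule extf_cpar[OF tr_in[OF assms]])

lemma extf_off:
  assumes "z \<notin> cpar K i ` cball w R" "\<And>v. v \<notin> cball w R \<Longrightarrow> \<rho> v = d"
  shows "extf i \<rho> d z = d"
proof (cases "z \<in> cpar K i ` cdom K i")
  case True
  then obtain v where v: "v \<in> cdom K i" "z = cpar K i v" by blast
  then have "v \<notin> cball w R" using assms(1) by blast
  then show ?thesis using v assms(2) by (simp add: extf_cpar)
qed (simp add: extf_def)

text \<open>A point of another chart either lies in the overlap, where the transition map applies,
  or has a neighbourhood that does not see the disc, where the extended function is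
  constant.\<close>

lemma cpar_cases:
  assumes w: "w \<in> cdom K j" and sub: "cball a R \<subseteq> cdom K i"
  obtains "w \<in> ov j i" | S where "open S" "w \<in> S" "S \<subseteq> cdom K j" "\<And>v. v \<in> S \<Longrightarrow> cpar K j v \<notin> cpar K i ` cball a R"
proof (cases "w \<in> ov j i")
  case False
  then have "cpar K j w \<in> X - cpar K i ` cball a R"
    using w sub by (auto simp: ov_iff)
  then show thesis
    using that(2)[of "{v \<in> cdom K j. cpar K j v \<in> X - cpar K i ` cball a R}"]
      open_cpar_vimage[OF openin_compl_ball[OF sub], of j] w by blast
qed (use that in blast)

lemma extf_continuous:
  assumes sub: "cball a R \<subseteq> cdom K i" and off: "\<And>v. v \<notin> cball a R \<Longrightarrow> \<rho> v = d"
    and cont: "continuous_on (cdom K i - {b}) \<rho>" and b: "b \<in> cdom K i"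
  shows "open {v \<in> cdom K j. cpar K j v \<noteq> cpar K i b}" (is "open ?S")
    and "continuous_on {v \<in> cdom K j. cpar K j v \<noteq> cpar K i b} (\<lambda>v. extf i \<rho> d (cpar K j v))"
proof -
  have "closedin (base K) {cpar K i b}"
    using Hausdorff_X b by (metis Hausdorff_imp_t1_space closedin_t1_singleton cpar_in_X)
  then have "openin (base K) (X - {cpar K i b})" by blast
  from open_cpar_vimage[OF this, of j]
  show opS: "open ?S" by (rule back_subst[where P="open"]) auto
  show "continuous_on ?S (\<lambda>v. extf i \<rho> d (cpar K j v))"
  proof (rule continuous_at_imp_continuous_on, rule ballI)
    fix w assume w: "w \<in> ?S"
    then have wd: "w \<in> cdom K j" by simp
    consider (in_patch) "w \<in> ov j i" | (off) S where "open S" "w \<in> S" "\<And>v. v \<in> S \<Longrightarrow> cpar K j v \<notin> cpar K i ` cball a R"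
      using cpar_cases[OF wd sub] by metis
    then show "isCont (\<lambda>v. extf i \<rho> d (cpar K j v)) w"
    proof cases
      case in_patch
      let ?T = "?S \<inter> ov j i"
      have opT: "open ?T" using opS open_ov by blast
      have c1: "continuous_on ?T (\<lambda>v. \<rho> (tr j i v))"
      proof (rule continuous_on_compose2[OF cont])
        show "continuous_on ?T (tr j i)" by (rule continuous_on_subset[OF continuous_on_tr]) auto
        show "tr j i ` ?T \<subseteq> cdom K i - {b}"
          using tr_in cpar_tr by force
      qed
      have e: "\<rho> (tr j i v) = extf i \<rho> d (cpar K j v)" if "v \<in> ?T" for v
        using extf_tr[of v j i \<rho> d] that by simp
      from continuous_on_eq[OF c1 e]
      have "continuous_on ?T (\<lambda>v. extf i \<rho> d (cpar K j v))" .
      then show ?thesis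
        using in_patch w opT by (simp add: continuous_on_eq_continuous_at)
    next
      case (off S)
      have "continuous_on S (\<lambda>v. extf i \<rho> d (cpar K j v))"
        by (rule continuous_on_eq[OF continuous_on_const[of _ d]])
           (use off(3) extf_off[of _ i a R \<rho> d] assms(2) in auto)
      then show ?thesis using off by (simp add: continuous_on_eq_continuous_at)
    qed
  qed
qed

text \<open>\<open>N\<close> is the divisor of \<open>r\<close> in a topological sense:
  \<open>r\<close> is continuous and nonzero on a punctured disc around each point, and its value at
  the point itself is left open.\<close>

definition fun_index :: "('x \<Rightarrow> complex) \<Rightarrow> ('x \<Rightarrow> int) \<Rightarrow> bool" where
  "fun_index r N \<longleftrightarrow> (\<forall>i. \<forall>w\<in>cdom K i. has_index (\<lambda>v. r (cpar K i v)) w (N (cpar K i w)))"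

lemma has_index_chart:
  assumes h: "has_index (\<lambda>v. r (cpar K i v)) (tr j i w) n" and w: "w \<in> ov j i"
  shows "has_index (\<lambda>v. r (cpar K j v)) w n"
proof -
  have "has_index ((\<lambda>v. r (cpar K i v)) \<circ> tr j i) w n"
    using h holomorphic_tr open_ov w deriv_tr_nonzero[OF w] by (rule has_index_compose)
  then show ?thesis
    by (rule has_index_cong_open[OF _ open_ov w]) (auto simp: cpar_tr)
qed

lemma fun_index_extf:
  assumes sub: "cball a R \<subseteq> cdom K i" and off: "\<And>v. v \<notin> cball a R \<Longrightarrow> \<rho> v = 1"
    and ind: "\<And>v. v \<in> cdom K i \<Longrightarrow> has_index \<rho> v (N (cpar K i v))"
    and N: "\<And>z. z \<notin> cpar K i ` cdom K i \<Longrightarrow> N z = 0"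
  shows "fun_index (extf i \<rho> 1) N"
  unfolding fun_index_def
proof (intro allI ballI)
  fix j w assume w: "w \<in> cdom K j"
  show "has_index (\<lambda>v. extf i \<rho> 1 (cpar K j v)) w (N (cpar K j w))"
  proof (cases "w \<in> ov j i")
    case True
    have v: "tr j i w \<in> cdom K i" using tr_in[OF True] .
    have "has_index (\<lambda>v. extf i \<rho> 1 (cpar K i v)) (tr j i w) (N (cpar K i (tr j i w)))"
      by (rule has_index_cong_open[OF ind[OF v] open_cdom v]) (simp add: extf_cpar)
    then show ?thesis
      using has_index_chart[OF _ True] cpar_tr[OF True] by simp
  next
    case False
    then obtain S where S: "open S" "w \<in> S" "\<And>v. v \<in> S \<Longrightarrow> cpar K j v \<notin> cpar K i ` cball a R"
      using cpar_cases[OF w sub] by metis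
    have "N (cpar K j w) = 0" using False w N by (auto simp: ov_iff)
    moreover have "has_index (\<lambda>_. 1) w 0" by (rule has_index_0[of 1]) auto
    then have "has_index (\<lambda>v. extf i \<rho> 1 (cpar K j v)) w 0"
      by (rule has_index_cong_open[OF _ S(1,2)]) (use extf_off[OF S(3) off] in auto)
    ultimately show ?thesis by simp
  qed
qed

lemma fun_index_mult: "fun_index r N \<Longrightarrow> fun_index r' N' \<Longrightarrow> fun_index (\<lambda>z. r z * r' z) (\<lambda>z. N z + N' z)"
  unfolding fun_index_def using has_index_mult by blast

lemma fun_index_powi: "fun_index r N \<Longrightarrow> fun_index (\<lambda>z. r z powi k) (\<lambda>z. k * N z)"
  unfolding fun_index_def using has_index_powi by blast

lemma fun_index_one: "fun_index (\<lambda>_. 1) (\<lambda>_. 0)"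
  unfolding fun_index_def by (auto intro: has_index_0[of 1])

abbreviation pt :: "'x \<Rightarrow> 'x \<Rightarrow> int" where
  "pt p z \<equiv> (if z = p then 1 else 0)"

text \<open>Linear equivalence of points, with continuous in place of meromorphic functions. This
  flexibility is what makes any two points of a connected surface equivalent.\<close>

definition movable :: "'x \<Rightarrow> 'x \<Rightarrow> bool" where
  "movable p p' \<longleftrightarrow> (\<exists>r. fun_index r (\<lambda>z. pt p z - pt p' z))"

lemma movable_refl: "movable p p"
  unfolding movable_def using fun_index_one by (intro exI[of _ "\<lambda>_. 1"]) simp

lemma movable_sym: assumes "movable p p'" shows "movable p' p"
proof -
  obtain r where "fun_index r (\<lambda>z. pt p z - pt p' z)" using assms movable_def by blast
  from fun_index_powi[OF this, of "-1"] show ?thesis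
    unfolding movable_def by (intro exI[of _ "\<lambda>z. r z powi - 1"]) (simp add: algebra_simps)
qed

lemma movable_trans: assumes "movable p p'" "movable p' p''" shows "movable p p''"
proof -
  obtain r r' where "fun_index r (\<lambda>z. pt p z - pt p' z)" "fun_index r' (\<lambda>z. pt p' z - pt p'' z)"
    using assms movable_def by blast
  from fun_index_mult[OF this] show ?thesis
    unfolding movable_def by (intro exI[of _ "\<lambda>z. r z * r' z"]) (simp add: algebra_simps)
qed

lemma movable_nearby:
  assumes "z \<in> X" shows "\<exists>T. openin (base K) T \<and> z \<in> T \<and> (\<forall>z'\<in>T. movable z z')"
proof -
  obtain i w where w: "w \<in> cdom K i" "cpar K i w = z" using assms chartE by blast
  obtain R where R: "R > 0" "cball w R \<subseteq> cdom K i"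
    using w open_cdom open_contains_cball by blast
  have "movable z (cpar K i v)" if v: "v \<in> ball w (R / 4)" for v
  proof -
    obtain \<rho> where rho: "\<And>v. v \<notin> cball w R \<Longrightarrow> \<rho> v = 1"
      "\<And>x. has_index \<rho> x ((if x = w then 1 else 0) - (if x = v then 1 else 0))"
      using move_zero_in_ball[OF R(1) v] by blast
    have vd: "v \<in> cdom K i" using v R by auto
    have "fun_index (extf i \<rho> 1) (\<lambda>x. pt z x - pt (cpar K i v) x)"
    proof (rule fun_index_extf[OF R(2) rho(1)])
      fix x assume "x \<in> cdom K i"
      then show "has_index \<rho> x (pt z (cpar K i x) - pt (cpar K i v) (cpar K i x))"
        using rho(2)[of x] w vd cpar_eq_iff by auto
    qed (use w vd in auto)
    then show ?thesis unfolding movable_def by blast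
  qed
  moreover have "openin (base K) (cpar K i ` ball w (R / 4))"
    by (rule openin_cpar_image) (use R in auto)
  ultimately show ?thesis
    using w R by (intro exI[of _ "cpar K i ` ball w (R / 4)"]) auto
qed

text \<open>The classes of the equivalence relation \<open>movable\<close> are open by
  \<open>movable_nearby\<close>, so connectedness leaves only one.\<close>

lemma all_movable: assumes "p \<in> X" "p' \<in> X" shows "movable p p'"
proof -
  let ?A = "{z \<in> X. movable p z}" and ?B = "{z \<in> X. \<not> movable p z}"
  have "openin (base K) ?A"
  proof (subst openin_subopen, intro ballI)
    fix z assume z: "z \<in> ?A"
    then obtain T where "openin (base K) T" "z \<in> T" "\<forall>z'\<in>T. movable z z'" using movable_nearby by blast
    moreover from this have "T \<subseteq> X" by (simp add: openin_subset)
    ultimately show "\<exists>T. openin (base K) T \<and> z \<in> T \<and> T \<subseteq> ?A"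
      using z by (intro exI[of _ T]) (auto intro: movable_trans)
  qed
  moreover have "openin (base K) ?B"
  proof (subst openin_subopen, intro ballI)
    fix z assume z: "z \<in> ?B"
    then obtain T where "openin (base K) T" "z \<in> T" "\<forall>z'\<in>T. movable z z'" using movable_nearby by blast
    moreover from this have "T \<subseteq> X" by (simp add: openin_subset)
    ultimately show "\<exists>T. openin (base K) T \<and> z \<in> T \<and> T \<subseteq> ?B"
      using z by (intro exI[of _ T]) (auto dest: movable_trans movable_sym)
  qed
  moreover have "p \<in> ?A" using assms movable_refl by blast
  moreover have "X \<subseteq> ?A \<union> ?B" "?A \<inter> ?B = {}" by blast+
  ultimately have "?B = {}"
    using connected_X unfolding connected_space_def by blast
  then show ?thesis using assms by blast
qed

text \<open>Every divisor of degree \<open>0\<close> is principal: each point \<open>y\<close> is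
  moved to a common base point \<open>b\<close> with multiplicity \<open>N y\<close>, and the
  contributions at \<open>b\<close> cancel because the multiplicities sum to
  \<open>0\<close>.\<close>

lemma fun_index_exists:
  assumes "finite S" "S \<subseteq> X" "(\<Sum>z\<in>S. N z) = 0" "\<And>z. z \<notin> S \<Longrightarrow> N z = 0"
  obtains r where "fun_index r N"
proof -
  obtain b where b: "b \<in> X" using nonempty_X by blast
  have "\<exists>r. fun_index r (\<lambda>z. \<Sum>y\<in>S. N y * (pt y z - pt b z))"
    using assms(1,2)
  proof (induction S)
    case empty
    then show ?case using fun_index_one by auto
  next
    case (insert y S)
    then obtain r where r: "fun_index r (\<lambda>z. \<Sum>y\<in>S. N y * (pt y z - pt b z))" by auto
    have "movable y b" using insert.prems b all_movable by auto
    then obtain r' where "fun_index r' (\<lambda>z. pt y z - pt b z)"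
      unfolding movable_def by blast
    from fun_index_mult[OF fun_index_powi[OF this, of "N y"] r] show ?case
      using insert.hyps by auto
  qed
  moreover have "(\<Sum>y\<in>S. N y * (pt y z - pt b z)) = N z" for z
  proof -
    have "(\<Sum>y\<in>S. N y * (pt y z - pt b z)) = (\<Sum>y\<in>S. N y * pt y z) - (\<Sum>y\<in>S. N y) * pt b z"
      by (simp add: right_diff_distrib sum_subtractf sum_distrib_right)
    also have "(\<Sum>y\<in>S. N y * pt y z) = N z"
      using assms(1,4) by (simp add: if_distrib[of "\<lambda>x. _ * x"] cong: if_cong)
    finally show ?thesis using assms(3) by simp
  qed
  ultimately show thesis using that by auto
qed

text \<open>A finite subcover by neighbourhoods that contain at most one exceptional point each,
  namely their centre, leaves the finitely many centres as candidates.\<close>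

lemma finite_exceptional_points:
  assumes "\<And>z. z \<in> X \<Longrightarrow> \<exists>T. openin (base K) T \<and> z \<in> T \<and> T \<inter> B \<subseteq> {z}" and "B \<subseteq> X"
  shows "finite B"
proof -
  obtain T where T: "\<And>z. z \<in> X \<Longrightarrow> openin (base K) (T z) \<and> z \<in> T z \<and> T z \<inter> B \<subseteq> {z}"
    using assms(1) by metis
  have "X \<subseteq> \<Union>(T ` X)" "\<forall>U\<in>T ` X. openin (base K) U" using T by auto
  then obtain F where F: "finite F" "F \<subseteq> T ` X" "X \<subseteq> \<Union>F"
    using compact_X unfolding compact_space_alt by meson
  then obtain S where S: "finite S" "S \<subseteq> X" "F = T ` S" by (meson finite_subset_image)
  have "B \<subseteq> S"
  proof
    fix b assume b: "b \<in> B"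
    then obtain z where "z \<in> S" "b \<in> T z" using F S assms(2) by blast
    then show "b \<in> S" using T[of z] S b by blast
  qed
  then show ?thesis using S finite_subset by blast
qed

section \<open>Equivariant functions and the removal of bad points\<close>

definition equivariant :: "('x \<times> ('l \<Rightarrow> complex) \<Rightarrow> complex) \<Rightarrow> bool" where
  "equivariant u \<longleftrightarrow> (\<forall>p\<in>circle_bundle K. \<forall>t. u (S1_act t p) = cis t * u p)"

text \<open>An equivariant function corresponds to a section of \<open>L\<close>; its values on the
  slice \<open>\<zeta> = 1\<close> are the coefficients with respect to the normalised
  frame.\<close>

definition eq_index :: "('x \<times> ('l \<Rightarrow> complex) \<Rightarrow> complex) \<Rightarrow> ('x \<Rightarrow> int) \<Rightarrow> bool" where
  "eq_index u N \<longleftrightarrow> equivariant u \<and>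
     (\<forall>i. \<forall>w\<in>cdom K i. has_index (\<lambda>v. u (circle_pt i v 1)) w (N (cpar K i w)))"

lemma equivariant_circle_pt:
  assumes "equivariant u" "w \<in> cdom K i" "cmod \<zeta> = 1"
  shows "u (circle_pt i w \<zeta>) = \<zeta> * u (circle_pt i w 1)"
proof -
  have "u (S1_act (Arg \<zeta>) (circle_pt i w 1)) = cis (Arg \<zeta>) * u (circle_pt i w 1)"
    using assms(1) circle_pt_in[OF assms(2), of 1] unfolding equivariant_def by simp
  then show ?thesis
    using cis_Arg_unit[OF assms(3)] by (simp add: S1_act_circle_pt)
qed

text \<open>One chart is enough, as \<open>good_chart\<close> carries the property to all others. A
  point of index \<open>0\<close> can still be bad, since the local form of the index says nothing
  about the value at the centre.\<close>

definition good :: "('x \<times> ('l \<Rightarrow> complex) \<Rightarrow> complex) \<Rightarrow> 'x \<Rightarrow> bool" where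
  "good u z \<longleftrightarrow> (\<exists>i w S. w \<in> S \<and> S \<subseteq> cdom K i \<and> open S \<and> cpar K i w = z \<and>
     continuous_on S (\<lambda>v. u (circle_pt i v 1)) \<and> u (circle_pt i w 1) \<noteq> 0)"

text \<open>A change of frame multiplies the coefficient by \<open>inverse (sgn (fc j i v))\<close>,
  which is continuous and has modulus \<open>1\<close>.\<close>

lemma good_chart:
  assumes u: "equivariant u" and g: "good u (cpar K j w)" and w: "w \<in> cdom K j"
  obtains S where "open S" "w \<in> S" "S \<subseteq> cdom K j" "continuous_on S (\<lambda>v. u (circle_pt j v 1))" "u (circle_pt j w 1) \<noteq> 0"
proof -
  obtain i w' S where S: "w' \<in> S" "S \<subseteq> cdom K i" "open S" "cpar K i w' = cpar K j w"
    "continuous_on S (\<lambda>v. u (circle_pt i v 1))" "u (circle_pt i w' 1) \<noteq> 0"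
    using g unfolding good_def by blast
  have wo: "w \<in> ov j i" "tr j i w = w'" using tr_eqI[OF w, of w' i] S by auto
  let ?S = "ov j i \<inter> tr j i -` S"
  have opS: "open ?S"
    using continuous_open_preimage[OF continuous_on_tr open_ov S(3)] .
  have eq: "u (circle_pt j v 1) = inverse (sgn (fc j i v)) * u (circle_pt i (tr j i v) 1)" if v: "v \<in> ov j i" for v
  proof -
    have "cmod (inverse (sgn (fc j i v))) = 1"
      using fc_nonzero[OF v] by (simp add: norm_inverse norm_sgn)
    note equivariant_circle_pt[OF u tr_in[OF v] this]
    moreover have "circle_pt j v 1 = circle_pt i (tr j i v) (inverse (sgn (fc j i v)))"
      using circle_pt_tr[OF v norm_one] by (simp only: mult_1)
    ultimately show ?thesis by (simp only:)
  qed
  have cf: "continuous_on (ov j i) (fc j i)" using holomorphic_fc holomorphic_on_imp_continuous_on by blast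
  have "continuous_on ?S (\<lambda>v. inverse (sgn (fc j i v)) * u (circle_pt i (tr j i v) 1))"
    unfolding sgn_eq
    by (intro continuous_intros continuous_on_subset[OF cf] continuous_on_compose2[OF S(5)] continuous_on_subset[OF continuous_on_tr])
       (auto simp: fc_nonzero)
  then have "continuous_on ?S (\<lambda>v. u (circle_pt j v 1))"
    by (rule continuous_on_eq) (simp add: eq)
  moreover have "u (circle_pt j w 1) \<noteq> 0"
    using eq[OF wo(1)] S(6) wo fc_nonzero[OF wo(1)] by (simp add: sgn_zero_iff)
  moreover have "w \<in> ?S" "?S \<subseteq> cdom K j" using wo S by (auto simp: ov_iff)
  ultimately show thesis using that opS by blast
qed

lemma good_imp_trivial:
  assumes u: "equivariant u" and g: "\<And>z. z \<in> X \<Longrightarrow> good u z"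
  shows "trivial_circle_bundle K"
proof (rule equivariant_trivial[of u])
  fix i
  show "continuous_on (cdom K i) (\<lambda>w. u (circle_pt i w 1))"
  proof (rule continuous_at_imp_continuous_on, rule ballI)
    fix w assume w: "w \<in> cdom K i"
    obtain S where "open S" "w \<in> S" "continuous_on S (\<lambda>v. u (circle_pt i v 1))"
      using good_chart[OF u g w] w by (metis cpar_in_X)
    then show "isCont (\<lambda>w. u (circle_pt i w 1)) w" by (simp add: continuous_on_eq_continuous_at)
  qed
next
  fix i w assume w: "w \<in> cdom K i"
  show "u (circle_pt i w 1) \<noteq> 0"
    using good_chart[OF u g w] w by (metis cpar_in_X)
qed (use u in \<open>simp add: equivariant_def\<close>)

lemma finite_bad:
  assumes "eq_index u N" shows "finite {z \<in> X. \<not> good u z}"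
proof (rule finite_exceptional_points)
  fix z assume "z \<in> X"
  then obtain i w where w: "w \<in> cdom K i" "cpar K i w = z" using chartE by blast
  then have "has_index (\<lambda>v. u (circle_pt i v 1)) w (N z)" using assms unfolding eq_index_def by blast
  then obtain r where r: "r > 0" "\<And>v. v \<in> ball w r - {w} \<Longrightarrow> u (circle_pt i v 1) \<noteq> 0"
    "continuous_on (ball w r - {w}) (\<lambda>v. u (circle_pt i v 1))"
    using has_index_nonzero by blast
  let ?S = "ball w r \<inter> cdom K i"
  have "good u (cpar K i v)" if v: "v \<in> ?S - {w}" for v
    unfolding good_def
  proof (intro exI conjI)
    show "continuous_on (?S - {w}) (\<lambda>v. u (circle_pt i v 1))" by (rule continuous_on_subset[OF r(3)]) auto
    show "u (circle_pt i v 1) \<noteq> 0" using r(2) v by auto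
  qed (use v in \<open>auto intro!: open_Diff open_Int\<close>)
  then have gd: "v = w" if "v \<in> ?S" "\<not> good u (cpar K i v)" for v
    using that by blast
  have "cpar K i ` ?S \<inter> {z \<in> X. \<not> good u z} \<subseteq> {z}"
    using gd w(2) by blast
  moreover have "openin (base K) (cpar K i ` ?S)"
    by (rule openin_cpar_image) (auto intro: open_Int)
  ultimately show "\<exists>T. openin (base K) T \<and> z \<in> T \<and> T \<inter> {z \<in> X. \<not> good u z} \<subseteq> {z}"
    using w r(1) by (intro exI[of _ "cpar K i ` ?S"]) auto
qed auto

lemma good_imp_index_0:
  assumes "equivariant u" "good u (cpar K j w)" "w \<in> cdom K j"
  shows "has_index (\<lambda>v. u (circle_pt j v 1)) w 0"
  using good_chart[OF assms] has_index_0_open by metis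

text \<open>In a chart around \<open>b\<close> a function of index \<open>0\<close> is \<open>exp g\<close> off the centre; it is replaced by
  \<open>exp (ct g)\<close> with a cutoff \<open>ct\<close> that vanishes near the centre.\<close>

lemma remove_bad_point:
  assumes u: "eq_index u (\<lambda>_. 0)" and b: "b \<in> X"
  obtains u' where "eq_index u' (\<lambda>_. 0)" "\<And>z. z \<in> X \<Longrightarrow> good u z \<or> z = b \<Longrightarrow> good u' z"
proof -
  have ueq: "equivariant u" using u by (simp add: eq_index_def)
  obtain i w0 where w0: "w0 \<in> cdom K i" "cpar K i w0 = b" using b chartE by blast
  obtain r0 where r0: "r0 > 0" "ball w0 r0 \<subseteq> cdom K i" using w0 open_cdom openE by blast
  have "has_index (\<lambda>v. u (circle_pt i v 1)) w0 0" using u w0 unfolding eq_index_def by blast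
  then obtain r g where g: "0 < r" "r \<le> r0" "continuous_on (ball w0 r - {w0}) g"
    "\<And>w. w \<in> ball w0 r - {w0} \<Longrightarrow> u (circle_pt i w 1) = (w - w0) powi 0 * exp (g w)"
    using has_indexE r0(1) by blast
  define R where "R = r / 2"
  have R: "R > 0" "R < r" "cball w0 R \<subseteq> cdom K i" using g r0 by (auto simp: R_def)
  \<comment> \<open>This cutoff is \<open>0\<close> on the disc of radius \<open>R / 2\<close> and
    \<open>1\<close> off the disc of radius \<open>R\<close>. The multiplier \<open>M\<close> turns
    \<open>exp (g v)\<close> into \<open>exp (ct v * g v)\<close>, and being \<open>1\<close> away
    from the centre it extends to the whole surface.\<close>
  define ct where "ct v = max 0 (min 1 (2 * cmod (v - w0) / R - 1))" for v
  define M where "M v = (if v \<in> ball w0 r - {w0} then exp (of_real (ct v - 1) * g v) else 1)" for v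
  have ct1: "ct v = 1" if "v \<notin> cball w0 R" for v
  proof -
    have "2 * cmod (v - w0) / R \<ge> 2"
      using that R by (simp add: dist_norm norm_minus_commute field_simps)
    then show ?thesis by (simp add: ct_def)
  qed
  have ct0: "ct v = 0" if "v \<in> ball w0 (R / 2)" for v
  proof -
    have "2 * cmod (v - w0) / R \<le> 1"
      using that R by (simp add: dist_norm norm_minus_commute field_simps)
    then show ?thesis by (simp add: ct_def)
  qed
  have Moff: "M v = 1" if "v \<notin> cball w0 R" for v
    using ct1[OF that] by (simp add: M_def)
  have Mnz: "M v \<noteq> 0" for v by (simp add: M_def)
  have cM0: "continuous_on (ball w0 r - {w0}) M"
  proof -
    have "continuous_on (ball w0 r - {w0}) (\<lambda>v. exp (of_real (ct v - 1) * g v))"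
      unfolding ct_def by (intro continuous_intros g(3)) (use R in auto)
    then show ?thesis by (rule continuous_on_eq) (simp add: M_def)
  qed
  have cM: "continuous_on (- {w0}) M"
  proof -
    have "continuous_on (- cball w0 R) M"
      by (rule continuous_on_eq[OF continuous_on_const[of _ 1]]) (use Moff in simp)
    then have "continuous_on ((ball w0 r - {w0}) \<union> (- cball w0 R)) M"
      by (intro continuous_on_open_Un cM0) (auto intro!: open_Diff open_Compl)
    then show ?thesis by (rule continuous_on_subset) (use R in auto)
  qed
  have "has_index M w0 0"
    unfolding has_index_def
    by (intro exI[of _ r] conjI exI[of _ "\<lambda>v. of_real (ct v - 1) * g v"])
       (use g(1,3) R in \<open>auto simp: M_def ct_def intro!: continuous_intros\<close>)
  then have Mind: "has_index M v 0" for v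
    using has_index_0_open[of "- {w0}" v M] cM Mnz by (cases "v = w0") (auto simp: open_Compl)
  define E where "E = extf i M 1"
  have Eind: "fun_index E (\<lambda>_. 0)"
    unfolding E_def by (rule fun_index_extf[OF R(3) Moff Mind]) auto
  \<comment> \<open>Over \<open>b\<close> the value of \<open>u\<close> may be arbitrary and is
    replaced outright by the fibre coordinate of the frame \<open>i\<close>. This is equivariant and
    continues the constant \<open>1\<close> taken nearby on the slice.\<close>
  define u' where "u' p = (if fst p = b then snd p (fr i w0) / of_real (frame_norm i w0) else E (fst p) * u p)" for p
  have u'eq: "equivariant u'"
    unfolding equivariant_def
  proof (intro ballI allI)
    fix p t assume p: "p \<in> circle_bundle K"
    have "u (S1_act t p) = cis t * u p" using ueq p unfolding equivariant_def by blast
    then show "u' (S1_act t p) = cis t * u' p"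
      by (simp add: u'_def) (simp add: S1_act_def)
  qed
  have u'b: "u' (circle_pt i w0 1) = 1"
    using w0 frame_norm_pos[OF w0(1)] snd_circle_pt_fr[OF w0(1), of 1] by (simp add: u'_def)
  have u'near: "u' (circle_pt i v 1) = 1" if v: "v \<in> ball w0 (R / 2)" for v
  proof (cases "v = w0")
    case False
    have vb: "v \<in> ball w0 r - {w0}" and vd: "v \<in> cdom K i" using v R False r0 g by auto
    then have "cpar K i v \<noteq> b" using cpar_eq_iff[OF vd w0(1)] w0 False by auto
    then have "u' (circle_pt i v 1) = M v * u (circle_pt i v 1)"
      by (simp add: u'_def E_def extf_cpar[OF vd])
    also have "\<dots> = exp (- g v) * exp (g v)"
      using vb g(4)[OF vb] ct0[OF v] by (simp add: M_def)
    finally show ?thesis by (simp add: exp_minus)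
  qed (use u'b in simp)
  have good_b: "good u' b"
    unfolding good_def
  proof (intro exI conjI)
    show "continuous_on (ball w0 (R / 2)) (\<lambda>v. u' (circle_pt i v 1))"
      by (rule continuous_on_eq[OF continuous_on_const[of _ 1]]) (use u'near in simp)
  qed (use R w0 u'b in auto)
  have good': "good u' z" if z: "z \<in> X" "good u z \<or> z = b" for z
  proof (cases "z = b")
    case False
    then have gz: "good u z" using z by blast
    obtain j w where w: "w \<in> cdom K j" "cpar K j w = z" using z chartE by blast
    obtain S where S: "open S" "w \<in> S" "S \<subseteq> cdom K j" "continuous_on S (\<lambda>v. u (circle_pt j v 1))" "u (circle_pt j w 1) \<noteq> 0"
      using good_chart[OF ueq _ w(1)] gz w by blast
    let ?T = "{v \<in> cdom K j. cpar K j v \<noteq> cpar K i w0}"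
    have cM': "continuous_on (cdom K i - {w0}) M" by (rule continuous_on_subset[OF cM]) auto
    have T: "open ?T" "continuous_on ?T (\<lambda>v. E (cpar K j v))"
      unfolding E_def by (rule extf_continuous[OF R(3) Moff cM' w0(1)]; assumption)+
    have eq: "u' (circle_pt j v 1) = E (cpar K j v) * u (circle_pt j v 1)" if "v \<in> S \<inter> ?T" for v
      using that w0 by (simp add: u'_def)
    have Enz: "E y \<noteq> 0" for y using Mnz by (simp add: E_def extf_def)
    have "continuous_on (S \<inter> ?T) (\<lambda>v. E (cpar K j v) * u (circle_pt j v 1))"
      by (intro continuous_intros continuous_on_subset[OF T(2)] continuous_on_subset[OF S(4)]) auto
    then have "continuous_on (S \<inter> ?T) (\<lambda>v. u' (circle_pt j v 1))"
      by (rule continuous_on_eq) (simp add: eq)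
    moreover have wS: "w \<in> S \<inter> ?T" using S w w0 False by auto
    moreover have "u' (circle_pt j w 1) \<noteq> 0" using eq[OF wS] Enz S by simp
    ultimately show ?thesis
      unfolding good_def
      by (intro exI[of _ j] exI[of _ w] exI[of _ "S \<inter> ?T"] conjI open_Int S(1) T(1) w(2)) (use S(3) in blast)+
  qed (use good_b in simp)
  have "eq_index u' (\<lambda>_. 0)"
    unfolding eq_index_def
  proof (intro conjI u'eq allI ballI)
    fix j w assume w: "w \<in> cdom K j"
    show "has_index (\<lambda>v. u' (circle_pt j v 1)) w 0"
    proof (cases "cpar K j w = b")
      case True
      then show ?thesis using good_imp_index_0[OF u'eq _ w] good_b by simp
    next
      case False
      have "has_index (\<lambda>v. E (cpar K j v) * u (circle_pt j v 1)) w (0 + 0)"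
        by (rule has_index_mult) (use Eind u w in \<open>auto simp: fun_index_def eq_index_def\<close>)
      then have h0: "has_index (\<lambda>v. E (cpar K j v) * u (circle_pt j v 1)) w 0" by simp
      have opS: "open {v \<in> cdom K j. cpar K j v \<noteq> cpar K i w0}"
        by (rule extf_continuous(1)[OF R(3) Moff continuous_on_subset[OF cM] w0(1)]) auto
      show ?thesis
      proof (rule has_index_cong_open[OF h0 opS])
        show "w \<in> {v \<in> cdom K j. cpar K j v \<noteq> cpar K i w0}" using w False w0 by simp
        fix v assume "v \<in> {v \<in> cdom K j. cpar K j v \<noteq> cpar K i w0} - {w}"
        then show "u' (circle_pt j v 1) = E (cpar K j v) * u (circle_pt j v 1)" using w0 by (simp add: u'_def)
      qed
    qed
  qed
  then show thesis using that good' by blast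
qed

text \<open>There are finitely many bad points, and each application of
  \<open>remove_bad_point\<close> repairs one without creating another. With none left, the phase of
  the function trivializes the bundle.\<close>

lemma eq_index_0_trivial:
  assumes "eq_index u (\<lambda>_. 0)" shows "trivial_circle_bundle K"
  using assms
proof (induction "card {z \<in> X. \<not> good u z}" arbitrary: u rule: less_induct)
  case less
  let ?B = "\<lambda>u. {z \<in> X. \<not> good u z}"
  show ?case
  proof (cases "?B u = {}")
    case True
    then show ?thesis using good_imp_trivial[of u] less.prems unfolding eq_index_def by blast
  next
    case False
    then obtain b where b: "b \<in> X" "\<not> good u b" by blast
    obtain u' where u': "eq_index u' (\<lambda>_. 0)" "\<And>z. z \<in> X \<Longrightarrow> good u z \<or> z = b \<Longrightarrow> good u' z"
      using remove_bad_point[OF less.prems b(1)] by metis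
    have "?B u' \<subset> ?B u" using u'(2) b by blast
    then have "card (?B u') < card (?B u)"
      using finite_bad[OF less.prems] by (rule psubset_card_mono[rotated])
    then show ?thesis using less.hyps u'(1) by blast
  qed
qed

text \<open>A function on the surface with the same divisor exists because the indices sum to
  \<open>0\<close>. Dividing by it preserves equivariance and leaves index \<open>0\<close>
  everywhere.\<close>

lemma total_index_0_trivial:
  assumes u: "eq_index u N" and S: "finite S" "S \<subseteq> X" "(\<Sum>z\<in>S. N z) = 0" "\<And>z. z \<notin> S \<Longrightarrow> N z = 0"
  shows "trivial_circle_bundle K"
proof -
  obtain r where r: "fun_index r N"
    using fun_index_exists[OF S] by blast
  define u' where "u' p = u p * inverse (r (fst p))" for p
  have "has_index (\<lambda>v. u (circle_pt i v 1) * inverse (r (cpar K i v))) w (N (cpar K i w) + - N (cpar K i w))"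
    if "w \<in> cdom K i" for i w
    by (rule has_index_mult[OF _ has_index_inverse]) (use u r that in \<open>auto simp: eq_index_def fun_index_def\<close>)
  moreover have "equivariant u'"
    using u unfolding eq_index_def equivariant_def u'_def by (auto simp: S1_act_def)
  ultimately have "eq_index u' (\<lambda>_. 0)"
    unfolding eq_index_def by (simp add: u'_def)
  then show ?thesis by (rule eq_index_0_trivial)
qed

end

section \<open>Stokes' theorem and the total index\<close>

text \<open>The increment of \<open>f\<close> over \<open>h *\<^sub>R v\<close> is viewed as a
  function of the displacement \<open>t\<close> along \<open>u\<close>. Differentiability of
  \<open>y \<mapsto> f' y u\<close> at \<open>x\<close> controls its derivative, and the mean value
  inequality on \<open>{0..h}\<close> turns this into a bound for the mixed second
  difference.\<close>

lemma second_difference_bound: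
  fixes f :: "'a::real_normed_vector \<Rightarrow> 'b::real_normed_vector"
  assumes S: "open S" "x \<in> S" and f': "\<And>y. y \<in> S \<Longrightarrow> (f has_derivative f' y) (at y)"
    and U: "((\<lambda>y. f' y u) has_derivative U) (at x)" and e: "e > 0"
  shows "\<exists>d>0. \<forall>h. 0 < h \<and> h < d \<longrightarrow>
     norm (f (x + h *\<^sub>R v + h *\<^sub>R u) - f (x + h *\<^sub>R u) - (f (x + h *\<^sub>R v) - f x) - h\<^sup>2 *\<^sub>R U v) \<le> 2 * e * (norm u + norm v) * h\<^sup>2"
proof -
  have lin: "linear U" using U has_derivative_linear by blast
  obtain d1 where d1: "d1 > 0" "ball x d1 \<subseteq> S" using S openE by blast
  obtain d2 where d2: "d2 > 0" "\<And>y. norm (y - x) < d2 \<Longrightarrow> norm (f' y u - f' x u - U (y - x)) \<le> e * norm (y - x)"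
    using U e unfolding has_derivative_at_alt by blast
  define N where "N = norm u + norm v + 1"
  have N: "N > 0" by (simp add: N_def add_nonneg_pos)
  define d where "d = min d1 d2 / N"
  have d: "d > 0" using d1 d2 N by (simp add: d_def)
  show ?thesis
  proof (intro exI[of _ d] conjI d allI impI)
    fix h :: real assume h: "0 < h \<and> h < d"
    have hN: "h * N < min d1 d2" using h N by (simp add: d_def field_simps)
    have near: "norm (a *\<^sub>R v + t *\<^sub>R u) < min d1 d2" if "a \<in> {0, h}" "t \<in> {0..h}" for a t
    proof -
      have "norm (a *\<^sub>R v + t *\<^sub>R u) \<le> a * norm v + t * norm u"
        using norm_triangle_ineq[of "a *\<^sub>R v" "t *\<^sub>R u"] that h by auto
      also have "\<dots> \<le> h * norm v + h * norm u"
        using that h by (intro add_mono mult_right_mono) auto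
      also have "\<dots> \<le> h * N" using h by (simp add: N_def algebra_simps)
      finally show ?thesis using hN by simp
    qed
    have inS: "x + a *\<^sub>R v + t *\<^sub>R u \<in> S" if "a \<in> {0, h}" "t \<in> {0..h}" for a t
    proof -
      have "dist x (x + a *\<^sub>R v + t *\<^sub>R u) = norm (a *\<^sub>R v + t *\<^sub>R u)"
        by (metis add.assoc add_diff_cancel_left' dist_commute dist_norm)
      then show ?thesis using near[OF that] d1(2) by (auto simp: subset_iff)
    qed
    let ?g = "\<lambda>t. f (x + h *\<^sub>R v + t *\<^sub>R u) - f (x + 0 *\<^sub>R v + t *\<^sub>R u) - (t * h) *\<^sub>R U v"
    let ?D = "\<lambda>t. f' (x + h *\<^sub>R v + t *\<^sub>R u) u - f' (x + 0 *\<^sub>R v + t *\<^sub>R u) u - h *\<^sub>R U v"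
    have der: "(?g has_derivative (\<lambda>s. s *\<^sub>R ?D t)) (at t within {0..h})" if t: "t \<in> {0..h}" for t
    proof -
      have 1: "((\<lambda>t. f (x + a *\<^sub>R v + t *\<^sub>R u)) has_derivative (\<lambda>s. f' (x + a *\<^sub>R v + t *\<^sub>R u) (s *\<^sub>R u))) (at t within {0..h})"
        if a: "a \<in> {0, h}" for a
      proof (rule has_derivative_compose[where g = f])
        show "((\<lambda>t. x + a *\<^sub>R v + t *\<^sub>R u) has_derivative (\<lambda>s. s *\<^sub>R u)) (at t within {0..h})"
          by (auto intro!: derivative_eq_intros)
        show "(f has_derivative f' (x + a *\<^sub>R v + t *\<^sub>R u)) (at (x + a *\<^sub>R v + t *\<^sub>R u))"
          by (rule f'[OF inS[OF a t]])
      qed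
      have 2: "f' (x + a *\<^sub>R v + t *\<^sub>R u) (s *\<^sub>R u) = s *\<^sub>R f' (x + a *\<^sub>R v + t *\<^sub>R u) u" if a: "a \<in> {0, h}" for a s
        using has_derivative_linear[OF f'[OF inS[OF a t]]] by (rule linear_scale)
      have "(?g has_derivative (\<lambda>s. f' (x + h *\<^sub>R v + t *\<^sub>R u) (s *\<^sub>R u) - f' (x + 0 *\<^sub>R v + t *\<^sub>R u) (s *\<^sub>R u) - (s * h) *\<^sub>R U v)) (at t within {0..h})"
        by (intro has_derivative_diff 1) (auto intro!: derivative_eq_intros)
      then show ?thesis
        by (rule has_derivative_eq_rhs) (use 2[of h] 2[of 0] in \<open>simp add: scaleR_diff_right fun_eq_iff\<close>)
    qed
    have bd: "norm (?D t) \<le> 2 * e * (norm u + norm v) * h" if t: "t \<in> {0..h}" for t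
    proof -
      let ?R = "\<lambda>a. f' (x + a *\<^sub>R v + t *\<^sub>R u) u - f' x u - U (a *\<^sub>R v + t *\<^sub>R u)"
      have R: "norm (?R a) \<le> e * (h * (norm u + norm v))" if a: "a \<in> {0, h}" for a
      proof -
        have s: "x + a *\<^sub>R v + t *\<^sub>R u - x = a *\<^sub>R v + t *\<^sub>R u" by simp
        have "norm (?R a) \<le> e * norm (a *\<^sub>R v + t *\<^sub>R u)"
          using d2(2)[of "x + a *\<^sub>R v + t *\<^sub>R u"] near[OF a t] unfolding s by simp
        also have "norm (a *\<^sub>R v + t *\<^sub>R u) \<le> a * norm v + t * norm u"
          using norm_triangle_ineq[of "a *\<^sub>R v" "t *\<^sub>R u"] a t h by auto
        also have "\<dots> \<le> h * norm v + h * norm u"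
          using a t h by (intro add_mono mult_right_mono) auto
        finally show ?thesis using e by (simp add: algebra_simps)
      qed
      have "?D t = ?R h - ?R 0"
        using lin by (simp add: linear_add linear_scale)
      then have "norm (?D t) \<le> norm (?R h) + norm (?R 0)" by (metis norm_triangle_ineq4)
      also have "\<dots> \<le> e * (h * (norm u + norm v)) + e * (h * (norm u + norm v))"
        by (intro add_mono R) auto
      finally show ?thesis by (simp add: algebra_simps)
    qed
    have "norm (?g h - ?g 0) \<le> (2 * e * (norm u + norm v) * h) * norm (h - 0)"
    proof (rule differentiable_bound[of "{0..h}" ?g "\<lambda>t s. s *\<^sub>R ?D t"])
      fix t assume t: "t \<in> {0..h}"
      show "onorm (\<lambda>s. s *\<^sub>R ?D t) \<le> 2 * e * (norm u + norm v) * h"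
      proof (rule onorm_le)
        fix s :: real
        show "norm (s *\<^sub>R ?D t) \<le> 2 * e * (norm u + norm v) * h * norm s"
          using mult_right_mono[OF bd[OF t], of "norm s"] by (simp add: mult.commute)
      qed
    qed (use der h in auto)
    then show "norm (f (x + h *\<^sub>R v + h *\<^sub>R u) - f (x + h *\<^sub>R u) - (f (x + h *\<^sub>R v) - f x) - h\<^sup>2 *\<^sub>R U v) \<le> 2 * e * (norm u + norm v) * h\<^sup>2"
      using h by (simp add: power2_eq_square algebra_simps)
  qed
qed

text \<open>The mixed second difference is symmetric in \<open>u\<close> and \<open>v\<close>. After
  division by \<open>h^2\<close> it tends to \<open>U v\<close> by one reading and to
  \<open>V u\<close> by the other.\<close>

lemma second_derivative_symmetric:
  fixes f :: "'a::real_normed_vector \<Rightarrow> 'b::real_normed_vector"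
  assumes S: "open S" "x \<in> S" and f': "\<And>y. y \<in> S \<Longrightarrow> (f has_derivative f' y) (at y)"
    and U: "((\<lambda>y. f' y u) has_derivative U) (at x)" and V: "((\<lambda>y. f' y v) has_derivative V) (at x)"
  shows "U v = V u"
proof (rule ccontr)
  assume "U v \<noteq> V u"
  then have n: "norm (U v - V u) > 0" by simp
  define M where "M = norm u + norm v + 1"
  have M: "M > 0" by (simp add: M_def add_nonneg_pos)
  \<comment> \<open>With this choice the two error terms together,
    \<open>4 * e * (norm u + norm v)\<close>, stay below half of
    \<open>norm (U v - V u)\<close>.\<close>
  define e where "e = norm (U v - V u) / (8 * M)"
  have e: "e > 0" using n M by (simp add: e_def)
  obtain d1 where d1: "d1 > 0" "\<And>h. 0 < h \<and> h < d1 \<Longrightarrow>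
     norm (f (x + h *\<^sub>R v + h *\<^sub>R u) - f (x + h *\<^sub>R u) - (f (x + h *\<^sub>R v) - f x) - h\<^sup>2 *\<^sub>R U v) \<le> 2 * e * (norm u + norm v) * h\<^sup>2"
    using second_difference_bound[OF S f' U e, of v] by blast
  obtain d2 where d2: "d2 > 0" "\<And>h. 0 < h \<and> h < d2 \<Longrightarrow>
     norm (f (x + h *\<^sub>R u + h *\<^sub>R v) - f (x + h *\<^sub>R v) - (f (x + h *\<^sub>R u) - f x) - h\<^sup>2 *\<^sub>R V u) \<le> 2 * e * (norm v + norm u) * h\<^sup>2"
    using second_difference_bound[OF S f' V e, of u] by blast
  define h where "h = min d1 d2 / 2"
  have h: "0 < h \<and> h < d1" "0 < h \<and> h < d2" using d1 d2 by (auto simp: h_def)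
  let ?A = "f (x + h *\<^sub>R v + h *\<^sub>R u) - f (x + h *\<^sub>R u) - (f (x + h *\<^sub>R v) - f x)"
  have sym: "f (x + h *\<^sub>R u + h *\<^sub>R v) - f (x + h *\<^sub>R v) - (f (x + h *\<^sub>R u) - f x) = ?A"
    by (simp add: algebra_simps)
  have "h\<^sup>2 *\<^sub>R (U v - V u) = (?A - h\<^sup>2 *\<^sub>R V u) - (?A - h\<^sup>2 *\<^sub>R U v)"
    by (simp add: algebra_simps)
  then have "norm (h\<^sup>2 *\<^sub>R (U v - V u)) \<le> norm (?A - h\<^sup>2 *\<^sub>R V u) + norm (?A - h\<^sup>2 *\<^sub>R U v)"
    by (metis norm_triangle_ineq4)
  also have "\<dots> \<le> 4 * e * (norm u + norm v) * h\<^sup>2"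
    using d1(2)[OF h(1)] d2(2)[OF h(2)] unfolding sym by (simp add: algebra_simps)
  finally have "norm (h\<^sup>2 *\<^sub>R (U v - V u)) \<le> 4 * e * (norm u + norm v) * h\<^sup>2" .
  moreover have "norm (h\<^sup>2 *\<^sub>R (U v - V u)) = h\<^sup>2 * norm (U v - V u)"
    by (simp only: norm_scaleR abs_power2)
  ultimately have "h\<^sup>2 * norm (U v - V u) \<le> h\<^sup>2 * (4 * e * (norm u + norm v))"
    by (simp only: mult_ac)
  then have "norm (U v - V u) \<le> 4 * e * (norm u + norm v)"
    using h by simp
  also have "\<dots> < 4 * e * M" using e by (simp add: M_def)
  also have "\<dots> = norm (U v - V u) / 2" using M by (simp add: e_def field_simps)
  finally show False using n by simp
qed

text \<open>Differentiate the translation invariant integral \<open>\<integral> u (x + t v) dx\<close> at \<open>t = 0\<close>.\<close>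

lemma integral_derivative_zero:
  fixes u :: "'a::euclidean_space \<Rightarrow> real"
  assumes D: "\<And>x. (u has_derivative D x) (at x)"
    and supp: "\<And>x. u x \<noteq> 0 \<Longrightarrow> norm x \<le> R"
    and B: "\<And>x h. \<bar>D x h\<bar> \<le> B * norm h"
  shows "(\<integral>x. D x v \<partial>lborel) = 0"
proof -
  define q where "q n x = (u (x + (1 / real (Suc n)) *\<^sub>R v) - u x) * real (Suc n)" for n x
  have contu: "continuous_on UNIV u"
    using D by (meson continuous_at_imp_continuous_on has_derivative_continuous)
  then have mu: "u \<in> borel_measurable borel" by (rule borel_measurable_continuous_onI)
  have iu: "integrable lborel u"
  proof -
    have "integrable lborel (\<lambda>x. indicator (cball 0 R) x *\<^sub>R u x)"
      by (rule borel_integrable_compact) (auto intro: continuous_on_subset[OF contu])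
    moreover have "(\<lambda>x. indicator (cball 0 R) x *\<^sub>R u x) = u"
      using supp by (auto simp: fun_eq_iff indicator_def split: if_splits)
    ultimately show ?thesis by simp
  qed
  have trans: "integrable lborel (\<lambda>x. u (x + c))" "(\<integral>x. u (x + c) \<partial>lborel) = (\<integral>x. u x \<partial>lborel)" for c
  proof -
    have m: "(+) c \<in> measurable lborel borel" by simp
    have "integrable (distr lborel borel ((+) c)) u" using iu lborel_distr_plus[of c] by simp
    then show "integrable lborel (\<lambda>x. u (x + c))"
      using integrable_distr_eq[OF m mu] by (simp add: add.commute)
    have "(\<integral>x. u x \<partial>lborel) = (\<integral>x. u x \<partial>(distr lborel borel ((+) c)))" using lborel_distr_plus[of c] by simp
    also have "\<dots> = (\<integral>x. u (c + x) \<partial>lborel)" by (rule integral_distr[OF m mu])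
    finally show "(\<integral>x. u (x + c) \<partial>lborel) = (\<integral>x. u x \<partial>lborel)" by (simp add: add.commute)
  qed
  have q0: "(\<integral>x. q n x \<partial>lborel) = 0" for n
    unfolding q_def using trans iu by simp
  have mq: "q n \<in> borel_measurable lborel" for n
    unfolding q_def using mu by measurable
  have lim: "(\<lambda>n. q n x) \<longlonglongrightarrow> D x v" for x
  proof -
    have "((\<lambda>t::real. u (x + t *\<^sub>R v)) has_derivative (\<lambda>s. D (x + 0 *\<^sub>R v) (s *\<^sub>R v))) (at 0)"
    proof (rule has_derivative_compose[where g = u])
      show "((\<lambda>t. x + t *\<^sub>R v) has_derivative (\<lambda>s. s *\<^sub>R v)) (at 0)"
        by (auto intro!: derivative_eq_intros)
    qed (rule D)
    moreover have "D x (s *\<^sub>R v) = D x v * s" for s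
      using has_derivative_linear[OF D[of x]] by (simp add: linear_scale)
    ultimately have "((\<lambda>t::real. u (x + t *\<^sub>R v)) has_field_derivative D x v) (at 0)"
      by (simp add: has_field_derivative_def)
    then have l: "((\<lambda>h. (u (x + h *\<^sub>R v) - u x) / h) \<longlongrightarrow> D x v) (at 0)"
      by (simp add: DERIV_def)
    have "filterlim (\<lambda>n. 1 / real (Suc n)) (at 0) sequentially"
      unfolding filterlim_at by (intro conjI lim_1_over_n[THEN LIMSEQ_Suc] always_eventually) auto
    from filterlim_compose[OF l this] show ?thesis by (simp add: q_def)
  qed
  \<comment> \<open>The dominating function: difference quotients are bounded by the Lipschitz
    constant \<open>B\<close> times \<open>norm v\<close>, and the steps have length at most
    \<open>norm v\<close>, which enlarges the support by that amount.\<close>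
  let ?w = "\<lambda>x. (B * norm v) * indicator (cball 0 (\<bar>R\<bar> + norm v)) x"
  have lip: "\<bar>u x - u y\<bar> \<le> B * norm (x - y)" for x y
  proof -
    have "norm (u x - u y) \<le> B * norm (x - y)"
      by (rule differentiable_bound[of UNIV u D]) (use D B in \<open>auto intro!: onorm_le\<close>)
    then show ?thesis by simp
  qed
  have bd: "norm (q n x) \<le> ?w x" for n x
  proof (cases "norm x \<le> \<bar>R\<bar> + norm v")
    case True
    have "\<bar>q n x\<bar> = \<bar>u (x + (1 / real (Suc n)) *\<^sub>R v) - u x\<bar> * real (Suc n)"
      by (simp add: q_def abs_mult)
    also have "\<dots> \<le> (B * norm ((1 / real (Suc n)) *\<^sub>R v)) * real (Suc n)"
      using lip[of "x + (1 / real (Suc n)) *\<^sub>R v" x] by (intro mult_right_mono) auto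
    also have "\<dots> = B * norm v" by simp
    finally show ?thesis using True by simp
  next
    case False
    have "norm ((1 / real (Suc n)) *\<^sub>R v) \<le> norm v"
      using mult_left_le_one_le[of "norm v" "1 / real (Suc n)"] by simp
    then have "norm (x + (1 / real (Suc n)) *\<^sub>R v) > R"
      using norm_diff_ineq[of x "(1 / real (Suc n)) *\<^sub>R v"] False by linarith
    moreover have "norm x > R" using False norm_ge_zero[of v] by linarith
    ultimately have "u (x + (1 / real (Suc n)) *\<^sub>R v) = 0" "u x = 0"
      using supp by (meson not_le)+
    then show ?thesis using False by (simp add: q_def)
  qed
  have iw: "integrable lborel ?w"
    by (intro integrable_mult_right integrable_real_indicator) (use emeasure_bounded_finite[OF bounded_cball] in \<open>auto simp: infinity_ennreal_def\<close>)
  have "(\<lambda>n. \<integral>x. q n x \<partial>lborel) \<longlonglongrightarrow> (\<integral>x. D x v \<partial>lborel)"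
  proof (rule integral_dominated_convergence[OF _ mq iw])
    show "(\<lambda>x. D x v) \<in> borel_measurable lborel"
      by (rule borel_measurable_LIMSEQ_real[OF _ mq]) (use lim in auto)
  qed (use lim bd in auto)
  then have "(\<lambda>n::nat. 0) \<longlonglongrightarrow> (\<integral>x. D x v \<partial>lborel)" by (simp only: q0)
  from LIMSEQ_unique[OF this tendsto_const] show ?thesis .
qed

text \<open>A continuous logarithm inherits the differentiability of \<open>u\<close>: near
  \<open>w\<close> the imaginary part of \<open>g v - g w\<close> stays below \<open>pi\<close>, so
  \<open>g\<close> coincides with \<open>g w + Ln (u v / u w)\<close>.\<close>

lemma log_has_derivative:
  fixes u g :: "complex \<Rightarrow> complex"
  assumes T: "open T" "w \<in> T" and g: "continuous_on T g" and eq: "\<And>v. v \<in> T \<Longrightarrow> u v = exp (g v)"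
    and u: "(u has_derivative U) (at w)"
  shows "(g has_derivative (\<lambda>h. U h / u w)) (at w)"
proof -
  have u0: "u w \<noteq> 0" using eq T by simp
  have "isCont g w" using g T by (simp add: continuous_on_eq_continuous_at)
  then obtain d where d: "d > 0" "\<And>v. dist v w < d \<Longrightarrow> dist (g v) (g w) < pi"
    unfolding continuous_at_eps_delta using pi_gt_zero by blast
  have "((\<lambda>v. u v / u w) has_derivative (\<lambda>h. U h / u w)) (at w)"
    using bounded_linear.has_derivative[OF bounded_linear_divide u] .
  moreover have "(Ln has_field_derivative 1) (at (u w / u w))"
    using has_field_derivative_Ln[of 1] u0 by simp
  then have "(Ln has_derivative (\<lambda>h. h)) (at (u w / u w))"
    unfolding has_field_derivative_def by (rule has_derivative_eq_rhs) auto
  ultimately have "((\<lambda>v. Ln (u v / u w)) has_derivative (\<lambda>h. U h / u w)) (at w)"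
    using has_derivative_compose[of "\<lambda>v. u v / u w" _ w UNIV Ln] by simp
  then have "((\<lambda>v. g w + Ln (u v / u w)) has_derivative (\<lambda>h. U h / u w)) (at w)"
    using has_derivative_add[OF has_derivative_const] by fastforce
  then show ?thesis
  proof (rule has_derivative_transform_within_open)
    show "open (T \<inter> ball w d)" "w \<in> T \<inter> ball w d" using T d by auto
    fix v assume v: "v \<in> T \<inter> ball w d"
    have "\<bar>Im (g v - g w)\<bar> < pi"
      using d(2)[of v] v abs_Im_le_cmod[of "g v - g w"] by (auto simp: dist_norm norm_minus_commute)
    then have "Ln (exp (g v - g w)) = g v - g w" by (intro Ln_exp) auto
    then show "g w + Ln (u v / u w) = g v"
      using eq v T by (simp add: exp_diff)
  qed
qed

section \<open>A cutoff function with two continuous derivatives\<close>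

definition clamp01 :: "real \<Rightarrow> real" where "clamp01 x = max 0 (min 1 x)"

lemma clamp01_lipschitz: "\<bar>clamp01 x - clamp01 y\<bar> \<le> \<bar>x - y\<bar>"
  by (simp add: clamp01_def)

text \<open>Clamping is not differentiable at \<open>0\<close> and \<open>1\<close>, but there
  \<open>Q\<close> is stationary. Since clamping does not increase distances, the error estimate for
  \<open>Q\<close> carries over with derivative \<open>0\<close>.\<close>

lemma clamp01_has_derivative:
  assumes Q: "\<And>x. (Q has_real_derivative Q' x) (at x)" and z: "Q' 0 = 0" "Q' 1 = 0"
  shows "((\<lambda>x. Q (clamp01 x)) has_real_derivative Q' (clamp01 x)) (at x)"
proof (cases "0 < x \<and> x < 1")
  case True
  then have x: "clamp01 x = x" by (simp add: clamp01_def)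
  show ?thesis
    unfolding x by (rule has_field_derivative_transform_within_open[OF Q, where S="{0<..<1}"])
      (use True in \<open>auto simp: clamp01_def\<close>)
next
  case False
  then have Q0: "Q' (clamp01 x) = 0" using z by (auto simp: clamp01_def min_def max_def)
  have "((\<lambda>x. Q (clamp01 x)) has_derivative (\<lambda>_. 0)) (at x)"
    unfolding has_derivative_at_alt
  proof (intro conjI allI impI)
    fix e :: real assume e: "e > 0"
    have "(Q has_derivative (\<lambda>_. 0)) (at (clamp01 x))"
      using Q[of "clamp01 x", unfolded has_field_derivative_def]
      by (rule has_derivative_eq_rhs) (simp add: Q0 fun_eq_iff)
    then obtain d where d: "d > 0" "\<And>y. \<bar>y - clamp01 x\<bar> < d \<Longrightarrow> \<bar>Q y - Q (clamp01 x)\<bar> \<le> e * \<bar>y - clamp01 x\<bar>"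
      using e unfolding has_derivative_at_alt by auto
    show "\<exists>d>0. \<forall>y. norm (y - x) < d \<longrightarrow> norm (Q (clamp01 y) - Q (clamp01 x) - 0) \<le> e * norm (y - x)"
    proof (intro exI[of _ d] conjI d allI impI)
      fix y assume y: "norm (y - x) < d"
      have "\<bar>Q (clamp01 y) - Q (clamp01 x)\<bar> \<le> e * \<bar>clamp01 y - clamp01 x\<bar>"
        by (rule d(2)) (use y clamp01_lipschitz[of y x] in auto)
      also have "\<dots> \<le> e * \<bar>y - x\<bar>" using e clamp01_lipschitz[of y x] by simp
      finally show "norm (Q (clamp01 y) - Q (clamp01 x) - 0) \<le> e * norm (y - x)" by simp
    qed
  qed auto
  then show ?thesis
    unfolding has_field_derivative_def by (rule has_derivative_eq_rhs) (simp add: Q0 fun_eq_iff)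
qed

text \<open>The quintic has vanishing first and second derivatives at \<open>0\<close> and \<open>1\<close>, so \<open>cutoff\<close> is \<open>C\<^sup>2\<close>,
  equal to \<open>1\<close> on \<open>{..1/4}\<close> and to \<open>0\<close> on \<open>{1..}\<close>.\<close>

definition cutoff :: "real \<Rightarrow> real" where
  "cutoff r = (\<lambda>c. 1 - (10 * c^3 - 15 * c^4 + 6 * c^5)) (clamp01 ((4 * r - 1) / 3))"
definition cutoff' :: "real \<Rightarrow> real" where
  "cutoff' r = (\<lambda>c. - (4/3) * (30 * c^2 - 60 * c^3 + 30 * c^4)) (clamp01 ((4 * r - 1) / 3))"
definition cutoff'' :: "real \<Rightarrow> real" where
  "cutoff'' r = (\<lambda>c. - (4/3) * (4/3) * (60 * c - 180 * c^2 + 120 * c^3)) (clamp01 ((4 * r - 1) / 3))"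

lemma cutoff_deriv: "(cutoff has_real_derivative cutoff' r) (at r)"
proof -
  have "((\<lambda>x. (\<lambda>c. 1 - (10 * c^3 - 15 * c^4 + 6 * c^5)) (clamp01 x)) has_real_derivative
     (\<lambda>c. - (30 * c^2 - 60 * c^3 + 30 * c^4)) (clamp01 ((4 * r - 1) / 3))) (at ((4 * r - 1) / 3))"
    by (rule clamp01_has_derivative) (auto intro!: derivative_eq_intros simp: algebra_simps)
  moreover have "((\<lambda>r. (4 * r - 1) / 3) has_real_derivative 4 / 3) (at r)"
    by (auto intro!: derivative_eq_intros)
  ultimately have "((\<lambda>r. (\<lambda>c. 1 - (10 * c^3 - 15 * c^4 + 6 * c^5)) (clamp01 ((4 * r - 1) / 3))) has_real_derivative
     (\<lambda>c. - (30 * c^2 - 60 * c^3 + 30 * c^4)) (clamp01 ((4 * r - 1) / 3)) * (4 / 3)) (at r)"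
    by (rule DERIV_chain2)
  then show ?thesis
    unfolding cutoff_def[abs_def] cutoff'_def by (rule DERIV_cong) (simp add: field_simps)
qed

lemma cutoff'_deriv: "(cutoff' has_real_derivative cutoff'' r) (at r)"
proof -
  have "((\<lambda>x. (\<lambda>c. - (4/3) * (30 * c^2 - 60 * c^3 + 30 * c^4)) (clamp01 x)) has_real_derivative
     (\<lambda>c. - (4/3) * (60 * c - 180 * c^2 + 120 * c^3)) (clamp01 ((4 * r - 1) / 3))) (at ((4 * r - 1) / 3))"
    by (rule clamp01_has_derivative) (auto intro!: derivative_eq_intros simp: algebra_simps)
  moreover have "((\<lambda>r. (4 * r - 1) / 3) has_real_derivative 4 / 3) (at r)"
    by (auto intro!: derivative_eq_intros)
  ultimately have "((\<lambda>r. (\<lambda>c. - (4/3) * (30 * c^2 - 60 * c^3 + 30 * c^4)) (clamp01 ((4 * r - 1) / 3))) has_real_derivative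
     (\<lambda>c. - (4/3) * (60 * c - 180 * c^2 + 120 * c^3)) (clamp01 ((4 * r - 1) / 3)) * (4 / 3)) (at r)"
    by (rule DERIV_chain2)
  then show ?thesis
    unfolding cutoff'_def[abs_def] cutoff''_def by (rule DERIV_cong) (simp add: field_simps)
qed

lemma cutoff_1: "r \<le> 1/4 \<Longrightarrow> cutoff r = 1" and cutoff_0: "r \<ge> 1 \<Longrightarrow> cutoff r = 0"
  and cutoff'_0: "r \<le> 1/4 \<Longrightarrow> cutoff' r = 0" and cutoff'_1: "r \<ge> 1 \<Longrightarrow> cutoff' r = 0"
  by (simp_all add: cutoff_def cutoff'_def clamp01_def)

lemma continuous_on_cutoff'': "continuous_on A cutoff''"
  unfolding cutoff''_def clamp01_def by (intro continuous_intros) auto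

lemma cutoff'_neg: "cutoff' r \<le> 0"
proof -
  define c where "c = clamp01 ((4 * r - 1) / 3)"
  have "cutoff' r = - 40 * (c * (1 - c))\<^sup>2"
    unfolding cutoff'_def c_def[symmetric]
    by (simp add: power2_eq_square power3_eq_cube power4_eq_xxxx algebra_simps)
  then show ?thesis by simp
qed

lemma cutoff'_strict: "cutoff' (5/8) < 0"
  by (simp add: cutoff'_def clamp01_def power2_eq_square power3_eq_cube power4_eq_xxxx)

section \<open>The conformal factor of the metric\<close>

context kk_bundle begin

text \<open>Since multiplication by \<open>\<i>\<close> is an isometry, the metric is this factor
  times the Euclidean one in each chart; for the same reason it is the density of the area
  measure.\<close>

definition gm :: "'i \<Rightarrow> complex \<Rightarrow> real" where "gm i w = gmet K i w 1 1"

lemma riemannian: "riemannian_metric (cdom K) (cpar K) (gmet K)"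
  and conformal: "w \<in> cdom K i \<Longrightarrow> gmet K i w (\<i> * v) (\<i> * v') = gmet K i w v v'"
  using surface unfolding riemann_surface_with_metric_def by blast+

lemma gmet_bilinear: "w \<in> cdom K i \<Longrightarrow> bilinear (gmet K i w)"
  and gmet_sym: "w \<in> cdom K i \<Longrightarrow> gmet K i w v v' = gmet K i w v' v"
  and gmet_pos: "w \<in> cdom K i \<Longrightarrow> v \<noteq> 0 \<Longrightarrow> gmet K i w v v > 0"
  and gmet_smooth: "smooth_on (\<lambda>w. gmet K i w v v') (cdom K i)"
  and gmet_tr: "w \<in> ov i j \<Longrightarrow> gmet K i w v v' = gmet K j (tr i j w)
                      (frechet_derivative (tr i j) (at w) v) (frechet_derivative (tr i j) (at w) v')"
  using riemannian unfolding riemannian_metric_def by blast+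

lemma gm_pos: "w \<in> cdom K i \<Longrightarrow> gm i w > 0"
  unfolding gm_def by (rule gmet_pos) auto

lemma gmet_off_diagonal: "w \<in> cdom K i \<Longrightarrow> gmet K i w 1 \<i> = 0"
proof -
  assume w: "w \<in> cdom K i"
  have "gmet K i w 1 \<i> = gmet K i w (\<i> * 1) (\<i> * \<i>)" using conformal[OF w, of 1 \<i>] by simp
  also have "\<dots> = gmet K i w \<i> (- 1)" by simp
  also have "\<dots> = - gmet K i w \<i> 1" using bilinear_rneg[OF gmet_bilinear[OF w]] by simp
  finally show ?thesis using gmet_sym[OF w, of 1 \<i>] by simp
qed

lemma gmet_conformal:
  assumes w: "w \<in> cdom K i" shows "gmet K i w v v' = gm i w * Re (v * cnj v')"
proof -
  note bil = gmet_bilinear[OF w]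
  have e: "x = Re x *\<^sub>R 1 + Im x *\<^sub>R \<i>" for x by (simp add: complex_eq_iff)
  have ii: "gmet K i w \<i> \<i> = gm i w" using conformal[OF w, of 1 1] by (simp add: gm_def)
  have i1: "gmet K i w \<i> 1 = 0" "gmet K i w 1 \<i> = 0" using gmet_off_diagonal[OF w] gmet_sym[OF w, of 1 \<i>] by auto
  have "gmet K i w v v' = gmet K i w (Re v *\<^sub>R 1 + Im v *\<^sub>R \<i>) (Re v' *\<^sub>R 1 + Im v' *\<^sub>R \<i>)"
    using e[of v] e[of v'] by simp
  also have "\<dots> = Re v * (Re v' * gm i w) + Im v * (Im v' * gm i w)"
    by (simp only: bilinear_ladd[OF bil] bilinear_radd[OF bil] bilinear_lmul[OF bil] bilinear_rmul[OF bil] ii i1)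
       (simp add: gm_def)
  finally show ?thesis by (simp add: algebra_simps)
qed

lemma metric_det_gmet:
  assumes w: "w \<in> cdom K i" shows "sqrt (metric_det (gmet K i w)) = gm i w"
proof -
  have ne: "(1::complex) \<noteq> \<i>" by (simp add: complex_eq_iff)
  have P: "{p. p permutes (Basis::complex set)} = {id, Transposition.transpose 1 \<i>}"
    by (auto simp: Basis_complex_def permutes_doubleton_iff)
  have tid: "id \<noteq> Transposition.transpose 1 \<i>" using ne by (metis id_apply transpose_apply_first)
  have "metric_det (gmet K i w) = gm i w * gm i w"
    unfolding metric_det_def P using tid ne
    by (simp add: Basis_complex_def sign_swap_id sign_id gmet_conformal[OF w])
  then show ?thesis using gm_pos[OF w] by (simp add: real_sqrt_mult)
qed

lemma fd_tr: "w \<in> ov i j \<Longrightarrow> frechet_derivative (tr i j) (at w) v = deriv (tr i j) w * v"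
  using tr_has_derivative[of w i j] by (simp add: frechet_derivative_at[symmetric] has_field_derivative_def)

lemma gm_tr:
  assumes w: "w \<in> ov i j" shows "gm i w = (cmod (deriv (tr i j) w))\<^sup>2 * gm j (tr i j w)"
proof -
  let ?c = "deriv (tr i j) w"
  have "gm i w = gmet K j (tr i j w) ?c ?c"
    using gmet_tr[OF w, of 1 1] by (simp add: gm_def fd_tr[OF w])
  also have "\<dots> = gm j (tr i j w) * Re (?c * cnj ?c)"
    by (rule gmet_conformal[OF tr_in[OF w]])
  also have "Re (?c * cnj ?c) = (cmod ?c)\<^sup>2"
    by (simp only: cmod_power2) (simp add: power2_eq_square)
  finally show ?thesis by (simp add: mult.commute)
qed

lemma continuous_on_gm: "continuous_on (cdom K i) (gm i)"
  using gmet_smooth[of i 1 1] unfolding smooth_on_def gm_def[abs_def] by (metis Ck_on.simps(1))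

end

section \<open>Integration over the surface\<close>

locale kk_measure = kk_bundle K for K :: "('x, 'i, 'l::ab_group_add) bundle_data" +
  fixes \<mu> :: "'x measure"
  assumes vol: "riemannian_measure (base K) (cdom K) (cpar K) (gmet K) \<mu>"
begin

lemma space_mu: "space \<mu> = X" and sets_mu: "sets \<mu> = sigma_sets X {U. openin (base K) U}"
  and emeasure_mu: "B \<in> sets borel \<Longrightarrow> B \<subseteq> cdom K i \<Longrightarrow>
     emeasure \<mu> (cpar K i ` B) = (\<integral>\<^sup>+x\<in>B. ennreal (sqrt (metric_det (gmet K i x))) \<partial>lborel)"
  using vol unfolding riemannian_measure_def by blast+

lemma open_in_sets: "openin (base K) U \<Longrightarrow> U \<in> sets \<mu>"
  unfolding sets_mu by (rule sigma_sets.Basic) simp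

lemma measurable_into_mu:
  assumes f: "\<And>w. f w \<in> X" and o: "\<And>U. openin (base K) U \<Longrightarrow> f -` U \<in> sets borel"
  shows "f \<in> measurable borel \<mu>"
proof (rule measurable_sigma_sets[OF sets_mu])
  show "{U. openin (base K) U} \<subseteq> Pow X" using openin_subset by auto
qed (use f o in auto)

lemma continuous_map_measurable:
  assumes "\<And>i. continuous_on (cdom K i) (\<lambda>w. k (cpar K i w))"
  shows "k \<in> borel_measurable (\<mu> :: 'x measure)"
    and "open (U::real set) \<Longrightarrow> openin (base K) {z \<in> X. k z \<in> U}"
proof -
  have op: "openin (base K) {z \<in> X. k z \<in> U}" if "open U" for U :: "real set"
  proof (rule openin_chartI)
    fix i
    have "open (cdom K i \<inter> (\<lambda>w. k (cpar K i w)) -` U)"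
      by (rule continuous_open_preimage[OF assms open_cdom that])
    moreover have "cdom K i \<inter> (\<lambda>w. k (cpar K i w)) -` U = {w \<in> cdom K i. cpar K i w \<in> {z \<in> X. k z \<in> U}}"
      by auto
    ultimately show "open {w \<in> cdom K i. cpar K i w \<in> {z \<in> X. k z \<in> U}}" by simp
  qed auto
  then show "open U \<Longrightarrow> openin (base K) {z \<in> X. k z \<in> U}" by blast
  show "k \<in> borel_measurable \<mu>"
  proof (rule borel_measurableI)
    fix S :: "real set" assume "open S"
    from open_in_sets[OF op[OF this]] show "k -` S \<inter> space \<mu> \<in> sets \<mu>"
      by (simp add: space_mu Int_def conj_commute vimage_def)
  qed
qed

text \<open>The image of Lebesgue measure with density \<open>gm i\<close> under the parametrization
  agrees on all measurable sets with the restriction of \<open>\<mu>\<close> to the patch; integrals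
  then follow by change of variables.\<close>

lemma chart_integral:
  assumes k: "k \<in> borel_measurable \<mu>" and off: "\<And>z. z \<in> X \<Longrightarrow> z \<notin> cpar K i ` cdom K i \<Longrightarrow> k z = 0"
  shows "(\<integral>z. k z \<partial>\<mu>) = (\<integral>w. indicator (cdom K i) w * gm i w * k (cpar K i w) \<partial>lborel)"
proof -
  let ?D = "cdom K i" and ?U = "cpar K i ` cdom K i"
  obtain z0 where z0: "z0 \<in> X" using nonempty_X by blast
  \<comment> \<open>The value \<open>z0\<close> off the coordinate domain makes \<open>f\<close> a
    total measurable map into the surface; the density \<open>d\<close> vanishes there.\<close>
  define f where "f w = (if w \<in> ?D then cpar K i w else z0)" for w
  define d where "d w = indicator ?D w * gm i w" for w
  have dpos: "d w \<ge> 0" for w using gm_pos[of w i] by (auto simp: d_def indicator_def)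
  have md: "d \<in> borel_measurable borel"
  proof -
    have "(\<lambda>w. indicator ?D w *\<^sub>R gm i w) \<in> borel_measurable borel"
      by (rule borel_measurable_continuous_on_indicator) (use continuous_on_gm in auto)
    then show ?thesis by (simp add: d_def[abs_def])
  qed
  have mf: "f \<in> measurable borel \<mu>"
  proof (rule measurable_into_mu)
    show "f w \<in> X" for w using z0 by (simp add: f_def)
    fix U assume U: "openin (base K) U"
    have "f -` U = {w \<in> ?D. cpar K i w \<in> U} \<union> (if z0 \<in> U then - ?D else {})"
      by (auto simp: f_def split: if_splits)
    moreover have "{w \<in> ?D. cpar K i w \<in> U} \<in> sets borel" using open_cpar_vimage[OF U] by auto
    ultimately show "f -` U \<in> sets borel" by auto
  qed
  let ?N = "density lborel (\<lambda>w. ennreal (d w))"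
  have mf': "f \<in> measurable ?N \<mu>" using mf by simp
  have U: "?U \<in> sets \<mu>" using open_in_sets openin_patch by blast
  have eq: "distr ?N \<mu> f = density \<mu> (\<lambda>z. ennreal (indicator ?U z))"
  proof (rule measure_eqI)
    fix A assume "A \<in> sets (distr ?N \<mu> f)"
    then have A: "A \<in> sets \<mu>" by simp
    define B where "B = f -` A \<inter> ?D"
    have fA: "f -` A \<in> sets borel" using measurable_sets[OF mf A] by simp
    then have B: "B \<in> sets borel" "B \<subseteq> ?D" by (auto simp: B_def)
    have img: "cpar K i ` B = ?U \<inter> A" by (auto simp: B_def f_def)
    have "emeasure (distr ?N \<mu> f) A = emeasure ?N (f -` A)"
      using emeasure_distr[OF mf' A] by simp
    also have "\<dots> = (\<integral>\<^sup>+w. ennreal (d w) * indicator (f -` A) w \<partial>lborel)"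
      by (rule emeasure_density) (use md fA in auto)
    also have "\<dots> = (\<integral>\<^sup>+x\<in>B. ennreal (sqrt (metric_det (gmet K i x))) \<partial>lborel)"
      by (intro nn_integral_cong) (auto simp: d_def B_def indicator_def metric_det_gmet)
    also have "\<dots> = emeasure \<mu> (?U \<inter> A)"
      using emeasure_mu[OF B] img by simp
    also have "\<dots> = emeasure (density \<mu> (\<lambda>z. ennreal (indicator ?U z))) A"
      using emeasure_restricted[OF U A] by (simp add: ennreal_indicator)
    finally show "emeasure (distr ?N \<mu> f) A = emeasure (density \<mu> (\<lambda>z. ennreal (indicator ?U z))) A" .
  qed simp
  have "(\<integral>z. k z \<partial>\<mu>) = (\<integral>z. indicator ?U z *\<^sub>R k z \<partial>\<mu>)"
    by (rule Bochner_Integration.integral_cong) (use off space_mu in \<open>auto simp: indicator_def\<close>)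
  also have "\<dots> = (\<integral>z. k z \<partial>(density \<mu> (\<lambda>z. ennreal (indicator ?U z))))"
    by (rule integral_density[symmetric]) (use k U in auto)
  also have "\<dots> = (\<integral>z. k z \<partial>(distr ?N \<mu> f))" by (simp add: eq)
  also have "\<dots> = (\<integral>w. k (f w) \<partial>?N)" by (rule integral_distr[OF mf' k])
  also have "\<dots> = (\<integral>w. d w *\<^sub>R k (f w) \<partial>lborel)"
    by (rule integral_density) (use md dpos measurable_compose[OF mf k] in auto)
  also have "\<dots> = (\<integral>w. indicator ?D w * gm i w * k (cpar K i w) \<partial>lborel)"
    by (rule Bochner_Integration.integral_cong) (auto simp: d_def f_def indicator_def)
  finally show ?thesis .
qed

lemma emeasure_ball_finite:
  assumes "cball w R \<subseteq> cdom K i" shows "emeasure \<mu> (cpar K i ` ball w R) < \<infinity>"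
proof -
  have sub: "ball w R \<subseteq> cdom K i" using assms by auto
  have "compact (gm i ` cball w R)"
    by (intro compact_continuous_image continuous_on_subset[OF continuous_on_gm assms]) auto
  then obtain M where M: "\<forall>v\<in>cball w R. \<bar>gm i v\<bar> \<le> M"
    using compact_imp_bounded[of "gm i ` cball w R"] unfolding bounded_real by auto
  have "emeasure \<mu> (cpar K i ` ball w R) = (\<integral>\<^sup>+x\<in>ball w R. ennreal (sqrt (metric_det (gmet K i x))) \<partial>lborel)"
    by (rule emeasure_mu) (use sub in auto)
  also have "\<dots> \<le> (\<integral>\<^sup>+x\<in>ball w R. ennreal M \<partial>lborel)"
  proof (intro nn_integral_mono)
    fix x
    show "ennreal (sqrt (metric_det (gmet K i x))) * indicator (ball w R) x \<le> ennreal M * indicator (ball w R) x"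
    proof (cases "x \<in> ball w R")
      case True
      then have "sqrt (metric_det (gmet K i x)) \<le> M"
        using bspec[OF M, of x] metric_det_gmet[of x i] sub by fastforce
      then show ?thesis using True by (simp add: ennreal_leI)
    qed simp
  qed
  also have "\<dots> = ennreal M * emeasure lborel (ball w R)"
    by (simp add: nn_integral_cmult_indicator)
  also have "\<dots> < \<infinity>"
    using emeasure_bounded_finite[OF bounded_ball, of w R] by (auto simp: ennreal_mult_less_top infinity_ennreal_def)
  finally show ?thesis .
qed

text \<open>Members of the subcover are stored as triples of chart, centre and set, so that the data
  used to build each set can be recovered afterwards.\<close>

lemma finite_chart_cover:
  assumes "\<And>i w. w \<in> cdom K i \<Longrightarrow> \<exists>T. P i w T \<and> openin (base K) T \<and> cpar K i w \<in> T"
  obtains C where "finite C" "X \<subseteq> (\<Union>c\<in>C. snd (snd c))"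
    "\<And>c. c \<in> C \<Longrightarrow> fst (snd c) \<in> cdom K (fst c) \<and> P (fst c) (fst (snd c)) (snd (snd c)) \<and> openin (base K) (snd (snd c))"
proof -
  let ?A = "{(i, w, T). w \<in> cdom K i \<and> P i w T \<and> openin (base K) T \<and> cpar K i w \<in> T}"
  let ?F = "(\<lambda>c. snd (snd c)) ` ?A"
  have "X \<subseteq> \<Union>?F"
  proof
    fix z assume "z \<in> X"
    then obtain i w where w: "w \<in> cdom K i" "cpar K i w = z" using chartE by blast
    then obtain T where "P i w T" "openin (base K) T" "cpar K i w \<in> T" using assms by blast
    then show "z \<in> \<Union>?F" using w by (intro UnionI[of T]) force+
  qed
  moreover have "\<forall>U\<in>?F. openin (base K) U" by auto
  ultimately obtain F where F: "finite F" "F \<subseteq> ?F" "X \<subseteq> \<Union>F"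
    using compact_X unfolding compact_space_alt by meson
  obtain C where C: "C \<subseteq> ?A" "finite C" "F = (\<lambda>c. snd (snd c)) ` C"
    using finite_subset_image[OF F(1,2)] by blast
  show thesis
    by (rule that[of C]) (use C F in auto)
qed

lemma finite_mu: "finite_measure \<mu>"
proof -
  define P where "P i w T \<longleftrightarrow> emeasure \<mu> T < \<infinity>" for i :: 'i and w :: complex and T
  have ex: "\<exists>T. P i w T \<and> openin (base K) T \<and> cpar K i w \<in> T" if w: "w \<in> cdom K i" for i w
  proof -
    obtain R where R: "R > 0" "cball w R \<subseteq> cdom K i" using w open_cdom open_contains_cball by blast
    then have sub: "ball w R \<subseteq> cdom K i" by auto
    show ?thesis
      by (rule exI[of _ "cpar K i ` ball w R"])
         (use emeasure_ball_finite[OF R(2)] openin_cpar_image[OF open_ball sub] R in \<open>auto simp: P_def\<close>)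
  qed
  obtain C where C: "finite C" "X \<subseteq> (\<Union>c\<in>C. snd (snd c))"
    "\<And>c. c \<in> C \<Longrightarrow> fst (snd c) \<in> cdom K (fst c) \<and> P (fst c) (fst (snd c)) (snd (snd c)) \<and> openin (base K) (snd (snd c))"
    using finite_chart_cover[of P, OF ex] by blast
  have sets: "snd (snd c) \<in> sets \<mu>" if "c \<in> C" for c
    using C(3)[OF that] open_in_sets by blast
  have "emeasure \<mu> (space \<mu>) \<le> emeasure \<mu> (\<Union>c\<in>C. snd (snd c))"
    by (intro emeasure_mono) (use C(1,2) sets space_mu in \<open>auto intro!: sets.finite_UN\<close>)
  also have "\<dots> \<le> (\<Sum>c\<in>C. emeasure \<mu> (snd (snd c)))"
    by (rule emeasure_subadditive_finite) (use C(1) sets in auto)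
  also have "\<dots> < \<infinity>"
    unfolding infinity_ennreal_def ennreal_sum_less_top[OF C(1)] using C(3) unfolding P_def infinity_ennreal_def by blast
  finally show ?thesis by (intro finite_measureI) auto
qed

lemma integrable_continuous:
  assumes "\<And>i. continuous_on (cdom K i) (\<lambda>w. k (cpar K i w))"
  shows "integrable \<mu> (k :: 'x \<Rightarrow> real)"
proof -
  interpret finite_measure \<mu> by (rule finite_mu)
  have m: "k \<in> borel_measurable \<mu>" by (rule continuous_map_measurable(1)[OF assms])
  define P where "P i w T \<longleftrightarrow> (\<exists>M. \<forall>z\<in>T. \<bar>k z\<bar> \<le> M)" for i :: 'i and w :: complex and T
  have ex: "\<exists>T. P i w T \<and> openin (base K) T \<and> cpar K i w \<in> T" if w: "w \<in> cdom K i" for i w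
  proof (rule exI[of _ "{z \<in> X. k z \<in> ball (k (cpar K i w)) 1}"], intro conjI)
    show "P i w {z \<in> X. k z \<in> ball (k (cpar K i w)) 1}"
      unfolding P_def by (rule exI[of _ "\<bar>k (cpar K i w)\<bar> + 1"]) (auto simp: dist_real_def)
    show "openin (base K) {z \<in> X. k z \<in> ball (k (cpar K i w)) 1}"
      by (rule continuous_map_measurable(2)[OF assms]) auto
  qed (use w in auto)
  obtain C where C: "finite C" "X \<subseteq> (\<Union>c\<in>C. snd (snd c))"
    "\<And>c. c \<in> C \<Longrightarrow> fst (snd c) \<in> cdom K (fst c) \<and> P (fst c) (fst (snd c)) (snd (snd c)) \<and> openin (base K) (snd (snd c))"
    using finite_chart_cover[of P, OF ex] by blast
  have "\<forall>c\<in>C. \<exists>M. \<forall>z\<in>snd (snd c). \<bar>k z\<bar> \<le> M" using C(3) unfolding P_def by blast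
  then obtain M where M: "\<And>c z. c \<in> C \<Longrightarrow> z \<in> snd (snd c) \<Longrightarrow> \<bar>k z\<bar> \<le> M c" by metis
  have "\<bar>k z\<bar> \<le> (\<Sum>c\<in>C. \<bar>M c\<bar>)" if z: "z \<in> X" for z
  proof -
    obtain c where c: "c \<in> C" "z \<in> snd (snd c)" using C(2) z by blast
    then have "\<bar>k z\<bar> \<le> \<bar>M c\<bar>" using M[OF c] by linarith
    also have "\<dots> \<le> (\<Sum>c\<in>C. \<bar>M c\<bar>)" by (rule member_le_sum) (use c C(1) in auto)
    finally show ?thesis .
  qed
  then show ?thesis
    by (intro integrable_const_bound[OF _ m, of "\<Sum>c\<in>C. \<bar>M c\<bar>"] AE_I2) (simp add: space_mu)
qed

end

text \<open>Green's theorem without boundary for the form \<open>Q dx + P dy\<close> of compact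
  support: each of the two partial derivatives integrates to \<open>0\<close>. Differentiability is
  asked locally around each point because the forms it serves are pieced together from a formula on
  one open set and \<open>0\<close> on others.\<close>

lemma curl_integral_zero:
  fixes P Q :: "complex \<Rightarrow> real"
  assumes P: "\<And>w. \<exists>S. open S \<and> w \<in> S \<and> (\<forall>v\<in>S. (P has_derivative DP v) (at v)) \<and> (\<forall>l. continuous_on S (\<lambda>v. DP v l))"
    and Q: "\<And>w. \<exists>S. open S \<and> w \<in> S \<and> (\<forall>v\<in>S. (Q has_derivative DQ v) (at v)) \<and> (\<forall>l. continuous_on S (\<lambda>v. DQ v l))"
    and off: "\<And>w. w \<notin> cball a R \<Longrightarrow> P w = 0 \<and> Q w = 0"
  shows "integrable lborel (\<lambda>w. DP w 1 - DQ w \<i>)" and "(\<integral>w. DP w 1 - DQ w \<i> \<partial>lborel) = 0"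
proof -
  have main: "integrable lborel (\<lambda>w. DF w l) \<and> (\<integral>w. DF w l \<partial>lborel) = 0"
    if F: "\<And>w. \<exists>S. open S \<and> w \<in> S \<and> (\<forall>v\<in>S. (F has_derivative DF v) (at v)) \<and> (\<forall>l. continuous_on S (\<lambda>v. DF v l))"
      and offF: "\<And>w. w \<notin> cball a R \<Longrightarrow> F w = 0" for F :: "complex \<Rightarrow> real" and DF l
  proof -
    have der: "(F has_derivative DF w) (at w)" for w using F by blast
    have cont: "continuous_on UNIV (\<lambda>w. DF w l)" for l
    proof (rule continuous_at_imp_continuous_on, rule ballI)
      fix w
      obtain S where "open S" "w \<in> S" "continuous_on S (\<lambda>v. DF v l)" using F by meson
      then show "isCont (\<lambda>v. DF v l) w" by (simp add: continuous_on_eq_continuous_at)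
    qed
    have off0: "DF w l = 0" if w: "w \<notin> cball a R" for w l
    proof -
      have "(F has_derivative (\<lambda>_. 0)) (at w)"
        by (rule has_derivative_transform_within_open[OF has_derivative_const, of "- cball a R"])
           (use w offF in \<open>auto simp: open_Compl\<close>)
      then have "DF w = (\<lambda>_. 0)" using der has_derivative_unique by blast
      then show ?thesis by simp
    qed
    have bdd: "\<exists>B. \<forall>w. \<bar>DF w l\<bar> \<le> B" for l
    proof -
      have "compact ((\<lambda>w. DF w l) ` cball a R)"
        by (intro compact_continuous_image continuous_on_subset[OF cont]) auto
      then obtain B where B: "\<forall>w\<in>cball a R. \<bar>DF w l\<bar> \<le> B"
        using compact_imp_bounded[of "(\<lambda>w. DF w l) ` cball a R"] unfolding bounded_real by auto
      have "\<bar>DF w l\<bar> \<le> \<bar>B\<bar>" for w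
        using bspec[OF B, of w] off0[of w l] by (cases "w \<in> cball a R") auto
      then show ?thesis by blast
    qed
    obtain B1 B2 where B: "\<And>w. \<bar>DF w 1\<bar> \<le> B1" "\<And>w. \<bar>DF w \<i>\<bar> \<le> B2" using bdd by metis
    have bd: "\<bar>DF w h\<bar> \<le> (B1 + B2) * norm h" for w h
    proof -
      have lin: "linear (DF w)" using der has_derivative_linear by blast
      have "h = Re h *\<^sub>R 1 + Im h *\<^sub>R \<i>" by (simp add: complex_eq_iff)
      then have "DF w h = Re h * DF w 1 + Im h * DF w \<i>"
        using linear_add[OF lin, of "Re h *\<^sub>R 1" "Im h *\<^sub>R \<i>"] linear_scale[OF lin] by simp
      then have "\<bar>DF w h\<bar> \<le> \<bar>Re h\<bar> * \<bar>DF w 1\<bar> + \<bar>Im h\<bar> * \<bar>DF w \<i>\<bar>"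
        by (metis abs_mult abs_triangle_ineq)
      also have "\<dots> \<le> norm h * B1 + norm h * B2"
        using B abs_Re_le_cmod abs_Im_le_cmod by (intro add_mono mult_mono) auto
      finally show ?thesis by (simp add: algebra_simps)
    qed
    have supp: "norm w \<le> norm a + R" if "F w \<noteq> 0" for w
    proof -
      have "w \<in> cball a R" using offF that by blast
      then show ?thesis using norm_triangle_ineq[of a "w - a"] by (simp add: dist_norm norm_minus_commute)
    qed
    have "integrable lborel (\<lambda>w. indicator (cball a R) w *\<^sub>R DF w l)"
      by (rule borel_integrable_compact) (auto intro: continuous_on_subset[OF cont])
    moreover have "(\<lambda>w. indicator (cball a R) w *\<^sub>R DF w l) = (\<lambda>w. DF w l)"
      using off0 by (auto simp: fun_eq_iff indicator_def)
    ultimately show ?thesis using integral_derivative_zero[OF der supp bd, of l] by simp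
  qed
  show "integrable lborel (\<lambda>w. DP w 1 - DQ w \<i>)" "(\<integral>w. DP w 1 - DQ w \<i> \<partial>lborel) = 0"
    using main[OF P, of 1] main[OF Q, of \<i>] off by simp_all
qed

lemma smooth_on_has_derivative:
  "smooth_on f S \<Longrightarrow> open S \<Longrightarrow> x \<in> S \<Longrightarrow> (f has_derivative frechet_derivative f (at x)) (at x)"
  unfolding smooth_on_def
  by (metis Ck_on.simps(2) differentiable_on_eq_differentiable_at frechet_derivative_works)

lemma smooth_on_frechet_derivative: "smooth_on f S \<Longrightarrow> smooth_on (\<lambda>x. frechet_derivative f (at x) v) S"
  unfolding smooth_on_def by (metis Ck_on.simps(2))

lemma smooth_on_continuous: "smooth_on f S \<Longrightarrow> continuous_on S f"
  unfolding smooth_on_def by (metis Ck_on.simps(1))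

lemma linear_complex_real:
  assumes D: "linear (D :: complex \<Rightarrow> 'b::real_vector)"
  shows "D h = Re h *\<^sub>R D 1 + Im h *\<^sub>R D \<i>"
proof -
  have "h = Re h *\<^sub>R 1 + Im h *\<^sub>R \<i>" by (simp add: complex_eq_iff)
  then have "D h = D (Re h *\<^sub>R 1 + Im h *\<^sub>R \<i>)" by (rule arg_cong)
  then show ?thesis by (simp only: linear_add[OF D] linear_scale[OF D])
qed

text \<open>The differential at \<open>v\<close> in direction \<open>h\<close> of the radial bump
  around \<open>a\<close>. The bump is a function of the squared radius, which is smooth at the
  centre as well.\<close>

definition dcutoff :: "complex \<Rightarrow> real \<Rightarrow> complex \<Rightarrow> complex \<Rightarrow> real" where
  "dcutoff a R v h = cutoff' ((cmod (v - a))\<^sup>2 / R\<^sup>2) * (2 * ((v - a) \<bullet> h) / R\<^sup>2)"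

lemma radial_deriv:
  assumes "\<And>r. (f has_real_derivative f' r) (at r)"
  shows "((\<lambda>v::complex. f ((cmod (v - a))\<^sup>2 / R\<^sup>2)) has_derivative (\<lambda>h. f' ((cmod (v - a))\<^sup>2 / R\<^sup>2) * (2 * ((v - a) \<bullet> h) / R\<^sup>2))) (at v)"
proof -
  have "((\<lambda>v. (cmod (v - a))\<^sup>2 / R\<^sup>2) has_derivative (\<lambda>h. 2 * ((v - a) \<bullet> h) / R\<^sup>2)) (at v)"
  proof (rule bounded_linear.has_derivative[OF bounded_linear_divide])
    show "((\<lambda>v. (cmod (v - a))\<^sup>2) has_derivative (\<lambda>h. 2 * ((v - a) \<bullet> h))) (at v)"
      unfolding power2_norm_eq_inner by (auto intro!: derivative_eq_intros simp: inner_commute)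
  qed
  from has_derivative_compose[OF this, of f "(*) (f' ((cmod (v - a))\<^sup>2 / R\<^sup>2))"] assms
  show ?thesis by (simp add: has_field_derivative_def)
qed

lemma cutoff_radial_deriv: "((\<lambda>v. cutoff ((cmod (v - a))\<^sup>2 / R\<^sup>2)) has_derivative dcutoff a R v) (at v)"
  unfolding dcutoff_def[abs_def] by (rule radial_deriv[OF cutoff_deriv])

lemma continuous_on_cutoff': "continuous_on A cutoff'"
  by (meson DERIV_isCont continuous_at_imp_continuous_on cutoff'_deriv)

lemma continuous_on_dcutoff: "continuous_on A (\<lambda>v. dcutoff a R v h)"
  unfolding dcutoff_def divide_inverse
  by (intro continuous_intros continuous_on_compose2[OF continuous_on_cutoff'[of UNIV]]) auto

lemma ratio_ge: "R > 0 \<Longrightarrow> v \<notin> cball a R \<Longrightarrow> (cmod (v - a))\<^sup>2 / R\<^sup>2 \<ge> 1"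
  by (simp add: dist_norm norm_minus_commute power_mono)

lemma ratio_le: "R > 0 \<Longrightarrow> v \<in> ball a (R/2) \<Longrightarrow> (cmod (v - a))\<^sup>2 / R\<^sup>2 \<le> 1/4"
  using power_mono[of "cmod (v - a)" "R/2" 2]
  by (simp add: dist_norm norm_minus_commute field_simps power2_eq_square)

section \<open>Continuously differentiable functions on the surface\<close>

context kk_bundle begin

definition df :: "('x \<Rightarrow> real) \<Rightarrow> 'i \<Rightarrow> complex \<Rightarrow> complex \<Rightarrow> real" where
  "df \<eta> i w = frechet_derivative (\<lambda>v. \<eta> (cpar K i v)) (at w)"

definition C1X :: "('x \<Rightarrow> real) \<Rightarrow> bool" where
  "C1X \<eta> \<longleftrightarrow> (\<forall>i. \<forall>w\<in>cdom K i. ((\<lambda>v. \<eta> (cpar K i v)) has_derivative df \<eta> i w) (at w)) \<and>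
     (\<forall>i h. continuous_on (cdom K i) (\<lambda>w. df \<eta> i w h))"

lemma C1X_deriv: "C1X \<eta> \<Longrightarrow> w \<in> cdom K i \<Longrightarrow> ((\<lambda>v. \<eta> (cpar K i v)) has_derivative df \<eta> i w) (at w)"
  and C1X_cont_df: "C1X \<eta> \<Longrightarrow> continuous_on (cdom K i) (\<lambda>w. df \<eta> i w h)"
  unfolding C1X_def by blast+

lemma df_eqI: "((\<lambda>v. \<eta> (cpar K i v)) has_derivative D) (at w) \<Longrightarrow> df \<eta> i w = D"
  unfolding df_def by (rule frechet_derivative_at[symmetric])

lemma C1X_cont: "C1X \<eta> \<Longrightarrow> continuous_on (cdom K i) (\<lambda>w. \<eta> (cpar K i w))"
  using has_derivative_continuous[OF C1X_deriv] by (auto intro: continuous_at_imp_continuous_on)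

lemma C1X_I:
  assumes "\<And>i w. w \<in> cdom K i \<Longrightarrow> \<exists>S D. open S \<and> w \<in> S \<and> (\<forall>v\<in>S. ((\<lambda>v. \<eta> (cpar K i v)) has_derivative D v) (at v)) \<and>
     (\<forall>h. continuous_on S (\<lambda>v. D v h))"
  shows "C1X \<eta>"
proof -
  have *: "((\<lambda>v. \<eta> (cpar K i v)) has_derivative df \<eta> i w) (at w)" "isCont (\<lambda>w. df \<eta> i w h) w"
    if w: "w \<in> cdom K i" for i w h
  proof -
    obtain S D where S: "open S" "w \<in> S" "\<forall>v\<in>S. ((\<lambda>v. \<eta> (cpar K i v)) has_derivative D v) (at v)"
      "\<forall>h. continuous_on S (\<lambda>v. D v h)" using assms[OF w] by blast
    have eq: "df \<eta> i v = D v" if "v \<in> S" for v using S(3) that df_eqI by blast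
    show "((\<lambda>v. \<eta> (cpar K i v)) has_derivative df \<eta> i w) (at w)" using S eq by simp
    have "continuous_on S (\<lambda>v. df \<eta> i v h)"
      using S(4) eq by (simp cong: continuous_on_cong_simp)
    then show "isCont (\<lambda>w. df \<eta> i w h) w" using S by (simp add: continuous_on_eq_continuous_at)
  qed
  show ?thesis
    unfolding C1X_def using * by (auto intro: continuous_at_imp_continuous_on)
qed

lemma C1X_const: "C1X (\<lambda>_. c)" and df_const: "df (\<lambda>_. c) i w h = 0"
proof -
  show "C1X (\<lambda>_. c)"
    by (rule C1X_I) (intro exI[of _ UNIV] exI[of _ "\<lambda>_ _. 0"], auto)
  show "df (\<lambda>_. c) i w h = 0" using df_eqI[of "\<lambda>_. c" i "\<lambda>_. 0" w] by simp
qed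

lemma C1X_add:
  assumes "C1X \<eta>" "C1X \<eta>'"
  shows "C1X (\<lambda>z. \<eta> z + \<eta>' z)" and "w \<in> cdom K i \<Longrightarrow> df (\<lambda>z. \<eta> z + \<eta>' z) i w h = df \<eta> i w h + df \<eta>' i w h"
proof -
  have d: "((\<lambda>v. \<eta> (cpar K i v) + \<eta>' (cpar K i v)) has_derivative (\<lambda>h. df \<eta> i w h + df \<eta>' i w h)) (at w)"
    if "w \<in> cdom K i" for i w
    by (intro has_derivative_add C1X_deriv assms that)
  show "C1X (\<lambda>z. \<eta> z + \<eta>' z)"
  proof (rule C1X_I)
    fix i w assume "w \<in> cdom K i"
    then show "\<exists>S D. open S \<and> w \<in> S \<and> (\<forall>v\<in>S. ((\<lambda>v. \<eta> (cpar K i v) + \<eta>' (cpar K i v)) has_derivative D v) (at v)) \<and>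
     (\<forall>h. continuous_on S (\<lambda>v. D v h))"
      by (intro exI[of _ "cdom K i"] exI[of _ "\<lambda>w h. df \<eta> i w h + df \<eta>' i w h"])
         (auto intro!: d continuous_on_add C1X_cont_df assms)
  qed
  show "w \<in> cdom K i \<Longrightarrow> df (\<lambda>z. \<eta> z + \<eta>' z) i w h = df \<eta> i w h + df \<eta>' i w h"
    using df_eqI[OF d] by simp
qed

lemma C1X_mult:
  assumes "C1X \<eta>" "C1X \<eta>'" shows "C1X (\<lambda>z. \<eta> z * \<eta>' z)"
proof (rule C1X_I)
  fix i w assume "w \<in> cdom K i"
  then show "\<exists>S D. open S \<and> w \<in> S \<and> (\<forall>v\<in>S. ((\<lambda>v. \<eta> (cpar K i v) * \<eta>' (cpar K i v)) has_derivative D v) (at v)) \<and>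
     (\<forall>h. continuous_on S (\<lambda>v. D v h))"
    by (intro exI[of _ "cdom K i"] exI[of _ "\<lambda>w h. \<eta> (cpar K i w) * df \<eta>' i w h + df \<eta> i w h * \<eta>' (cpar K i w)"])
       (auto intro!: has_derivative_mult C1X_deriv continuous_intros C1X_cont C1X_cont_df assms)
qed

lemma C1X_minus: assumes "C1X \<eta>" shows "C1X (\<lambda>z. - \<eta> z)"
  using C1X_mult[OF C1X_const[of "-1"] assms] by simp

lemma C1X_diff: assumes "C1X \<eta>" "C1X \<eta>'" shows "C1X (\<lambda>z. \<eta> z - \<eta>' z)"
  using C1X_add(1)[OF assms(1) C1X_minus[OF assms(2)]] by simp

lemma C1X_prod: "(\<And>c. c \<in> C \<Longrightarrow> C1X (e c)) \<Longrightarrow> C1X (\<lambda>z. \<Prod>c\<in>C. e c z)"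
  by (induction C rule: infinite_finite_induct) (auto intro!: C1X_const C1X_mult)

lemma df_linear: "C1X \<eta> \<Longrightarrow> w \<in> cdom K i \<Longrightarrow> linear (df \<eta> i w)"
  using C1X_deriv has_derivative_linear by blast

lemma df_tr:
  assumes "C1X \<eta>" and w: "w \<in> ov i j"
  shows "df \<eta> i w h = df \<eta> j (tr i j w) (deriv (tr i j) w * h)"
proof -
  have "((\<lambda>v. \<eta> (cpar K j (tr i j v))) has_derivative (\<lambda>h. df \<eta> j (tr i j w) (deriv (tr i j) w * h))) (at w)"
    by (rule has_derivative_compose[where g="\<lambda>v. \<eta> (cpar K j v)"])
       (use tr_has_derivative[OF w] C1X_deriv[OF assms(1) tr_in[OF w]] in \<open>auto simp: has_field_derivative_def\<close>)
  then have "((\<lambda>v. \<eta> (cpar K i v)) has_derivative (\<lambda>h. df \<eta> j (tr i j w) (deriv (tr i j) w * h))) (at w)"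
    by (rule has_derivative_transform_within_open[OF _ open_ov w]) (simp add: cpar_tr)
  from df_eqI[OF this] show ?thesis by simp
qed

lemma continuous_on_deriv_tr: "continuous_on (ov i j) (deriv (tr i j))"
  by (intro holomorphic_on_imp_continuous_on holomorphic_deriv holomorphic_tr open_ov)

lemma C1X_extf:
  assumes sub: "cball a R \<subseteq> cdom K i" and off: "\<And>v. v \<notin> cball a R \<Longrightarrow> \<rho> v = 0"
    and d: "\<And>v. v \<in> cdom K i \<Longrightarrow> (\<rho> has_derivative D v) (at v)"
    and c: "\<And>h. continuous_on (cdom K i) (\<lambda>v. D v h)"
  shows "C1X (extf i \<rho> 0)"
proof (rule C1X_I)
  fix j w assume w: "w \<in> cdom K j"
  consider (in_patch) "w \<in> ov j i" | (off) S where "open S" "w \<in> S" "\<And>v. v \<in> S \<Longrightarrow> cpar K j v \<notin> cpar K i ` cball a R"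
    using cpar_cases[OF w sub] by metis
  then show "\<exists>S D. open S \<and> w \<in> S \<and> (\<forall>v\<in>S. ((\<lambda>v. extf i \<rho> 0 (cpar K j v)) has_derivative D v) (at v)) \<and>
     (\<forall>h. continuous_on S (\<lambda>v. D v h))"
  proof cases
    case in_patch
    \<comment> \<open>The pulled back differential is expanded in the values of \<open>D\<close> at
      \<open>1\<close> and \<open>\<i>\<close>: the hypothesis gives continuity in the base point
      for fixed directions, whereas the direction \<open>deriv (tr j i) v * h\<close> varies with
      \<open>v\<close>.\<close>
    let ?D = "\<lambda>v h. Re (deriv (tr j i) v * h) *\<^sub>R D (tr j i v) 1 + Im (deriv (tr j i) v * h) *\<^sub>R D (tr j i v) \<i>"
    have lin: "D (tr j i v) h = Re h *\<^sub>R D (tr j i v) 1 + Im h *\<^sub>R D (tr j i v) \<i>" if "v \<in> ov j i" for v h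
      using has_derivative_linear[OF d[OF tr_in[OF that]]] by (rule linear_complex_real)
    have "((\<lambda>v. extf i \<rho> 0 (cpar K j v)) has_derivative ?D v) (at v)" if v: "v \<in> ov j i" for v
    proof -
      have "((\<lambda>v. \<rho> (tr j i v)) has_derivative (\<lambda>h. D (tr j i v) (deriv (tr j i) v * h))) (at v)"
        by (rule has_derivative_compose[where g=\<rho>])
           (use tr_has_derivative[OF v] d[OF tr_in[OF v]] in \<open>auto simp: has_field_derivative_def\<close>)
      then have "((\<lambda>v. extf i \<rho> 0 (cpar K j v)) has_derivative (\<lambda>h. D (tr j i v) (deriv (tr j i) v * h))) (at v)"
        by (rule has_derivative_transform_within_open[OF _ open_ov v]) (simp add: extf_tr)
      then show ?thesis by (rule has_derivative_eq_rhs) (rule ext, rule lin[OF v])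
    qed
    moreover have "continuous_on (ov j i) (\<lambda>v. ?D v h)" for h
      by (intro continuous_intros continuous_on_deriv_tr continuous_on_compose2[OF c continuous_on_tr])
         (auto intro: tr_in)
    ultimately show ?thesis
      by (intro exI[of _ "ov j i"] exI[of _ ?D]) (use in_patch open_ov in auto)
  next
    case (off S)
    have "((\<lambda>v. extf i \<rho> 0 (cpar K j v)) has_derivative (\<lambda>_. 0)) (at v)" if "v \<in> S" for v
      by (rule has_derivative_transform_within_open[OF has_derivative_const off(1) that, of 0])
         (use off(3) extf_off[of _ i a R \<rho> 0] assms(2) in auto)
    then show ?thesis
      by (intro exI[of _ S] exI[of _ "\<lambda>_ _. 0"]) (use off in auto)
  qed
qed

text \<open>The plateau of \<open>cutoff\<close> ends at \<open>1/4\<close> in the squared ratio, so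
  the bump is \<open>1\<close> up to half the radius.\<close>

definition bump :: "'i \<Rightarrow> complex \<Rightarrow> real \<Rightarrow> 'x \<Rightarrow> real" where
  "bump i a R = extf i (\<lambda>v. cutoff ((cmod (v - a))\<^sup>2 / R\<^sup>2)) 0"

context
  fixes a :: complex and R :: real and i :: 'i
  assumes R: "R > 0" and sub: "cball a R \<subseteq> cdom K i"
begin

lemma C1X_bump: "C1X (bump i a R)"
  unfolding bump_def
  by (rule C1X_extf[OF sub _ cutoff_radial_deriv continuous_on_dcutoff]) (simp add: cutoff_0 ratio_ge[OF R])

lemma bump_off: "z \<notin> cpar K i ` cball a R \<Longrightarrow> bump i a R z = 0"
  unfolding bump_def by (rule extf_off[where w=a and R=R]) (simp_all add: cutoff_0 ratio_ge[OF R])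

lemma bump_1: assumes "v \<in> ball a (R/2)" shows "bump i a R (cpar K i v) = 1"
proof -
  have "v \<in> cdom K i" using sub assms R by auto
  then show ?thesis
    unfolding bump_def using cutoff_1[OF ratio_le[OF R assms]] by (simp add: extf_cpar)
qed

lemma df_bump: assumes "v \<in> cdom K i" shows "df (bump i a R) i v = dcutoff a R v"
proof (rule df_eqI)
  show "((\<lambda>v. bump i a R (cpar K i v)) has_derivative dcutoff a R v) (at v)"
    unfolding bump_def
    by (rule has_derivative_transform_within_open[OF cutoff_radial_deriv open_cdom assms]) (simp add: extf_cpar)
qed

end

end

section \<open>The closed form comparing two sections\<close>

locale kk_stokes = kk_measure K \<mu> for K :: "('x, 'i, 'l::ab_group_add) bundle_data" and \<mu> +
  fixes s t :: "'i \<Rightarrow> complex \<Rightarrow> complex" and m :: int and N :: "'x \<Rightarrow> int"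
  assumes ss: "smooth_section K 1 s" and ts: "smooth_section K m t" and m0: "m \<noteq> 0"
    and t_nonzero: "w \<in> cdom K i \<Longrightarrow> t i w \<noteq> 0"
    and s_index: "w \<in> cdom K i \<Longrightarrow> has_index (s i) w (N (cpar K i w))"
begin

lemma s_smooth: "smooth_on (s i) (cdom K i)" and t_smooth: "smooth_on (t i) (cdom K i)"
  using ss ts unfolding smooth_section_def by blast+

lemma s_tr: "w \<in> ov i j \<Longrightarrow> s j (tr i j w) = fc i j w * s i w"
  and t_tr: "w \<in> ov i j \<Longrightarrow> t j (tr i j w) = fc i j w powi m * t i w"
  using ss ts unfolding smooth_section_def by auto

definition s1 :: "'i \<Rightarrow> complex \<Rightarrow> complex \<Rightarrow> complex" where
  "s1 i w h = frechet_derivative (s i) (at w) h"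
definition t1 :: "'i \<Rightarrow> complex \<Rightarrow> complex \<Rightarrow> complex" where
  "t1 i w h = frechet_derivative (t i) (at w) h"
definition s2 :: "'i \<Rightarrow> complex \<Rightarrow> complex \<Rightarrow> complex \<Rightarrow> complex" where
  "s2 i w h l = frechet_derivative (\<lambda>w. s1 i w h) (at w) l"
definition t2 :: "'i \<Rightarrow> complex \<Rightarrow> complex \<Rightarrow> complex \<Rightarrow> complex" where
  "t2 i w h l = frechet_derivative (\<lambda>w. t1 i w h) (at w) l"

lemma s1_smooth: "smooth_on (\<lambda>w. s1 i w h) (cdom K i)" and t1_smooth: "smooth_on (\<lambda>w. t1 i w h) (cdom K i)"
  unfolding s1_def t1_def by (rule smooth_on_frechet_derivative s_smooth t_smooth)+

lemma s_deriv: "w \<in> cdom K i \<Longrightarrow> (s i has_derivative s1 i w) (at w)"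
  and t_deriv: "w \<in> cdom K i \<Longrightarrow> (t i has_derivative t1 i w) (at w)"
  and s1_deriv: "w \<in> cdom K i \<Longrightarrow> ((\<lambda>w. s1 i w h) has_derivative s2 i w h) (at w)"
  and t1_deriv: "w \<in> cdom K i \<Longrightarrow> ((\<lambda>w. t1 i w h) has_derivative t2 i w h) (at w)"
  using smooth_on_has_derivative[OF s_smooth open_cdom] smooth_on_has_derivative[OF t_smooth open_cdom]
    smooth_on_has_derivative[OF s1_smooth open_cdom] smooth_on_has_derivative[OF t1_smooth open_cdom]
  unfolding s1_def[abs_def] t1_def[abs_def] s2_def[abs_def] t2_def[abs_def] by auto

lemma cont_all: "continuous_on (cdom K i) (s i)" "continuous_on (cdom K i) (t i)"
  "continuous_on (cdom K i) (\<lambda>w. s1 i w h)" "continuous_on (cdom K i) (\<lambda>w. t1 i w h)"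
  "continuous_on (cdom K i) (\<lambda>w. s2 i w h l)" "continuous_on (cdom K i) (\<lambda>w. t2 i w h l)"
  using s_smooth t_smooth s1_smooth t1_smooth unfolding s2_def t2_def
  by (auto intro!: smooth_on_continuous smooth_on_frechet_derivative)

lemma s2_sym: "w \<in> cdom K i \<Longrightarrow> s2 i w h l = s2 i w l h"
  by (rule second_derivative_symmetric[OF open_cdom _ s_deriv s1_deriv s1_deriv])

lemma t2_sym: "w \<in> cdom K i \<Longrightarrow> t2 i w h l = t2 i w l h"
  by (rule second_derivative_symmetric[OF open_cdom _ t_deriv t1_deriv t1_deriv])

definition nz :: "'i \<Rightarrow> complex set" where "nz i = {w \<in> cdom K i. s i w \<noteq> 0}"

lemma open_nz: "open (nz i)"
proof -
  have "open (cdom K i \<inter> s i -` (- {0}))"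
    by (rule continuous_open_preimage[OF cont_all(1) open_cdom]) auto
  then show ?thesis by (rule back_subst[where P="open"]) (auto simp: nz_def)
qed

text \<open>The form \<open>d arg (s\<^sup>m / t)\<close>, which does not depend on the frame.\<close>

definition \<alpha> :: "'i \<Rightarrow> complex \<Rightarrow> complex \<Rightarrow> real" where
  "\<alpha> i w h = Im (of_int m * (s1 i w h / s i w) - t1 i w h / t i w)"

definition \<alpha>1 :: "'i \<Rightarrow> complex \<Rightarrow> complex \<Rightarrow> complex \<Rightarrow> real" where
  "\<alpha>1 i w h l = Im (of_int m * ((s2 i w h l * s i w - s1 i w h * s1 i w l) / (s i w * s i w))
      - (t2 i w h l * t i w - t1 i w h * t1 i w l) / (t i w * t i w))"

lemma alpha_deriv:
  assumes w: "w \<in> nz i" shows "((\<lambda>w. \<alpha> i w h) has_derivative \<alpha>1 i w h) (at w)"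
proof -
  have d: "w \<in> cdom K i" "s i w \<noteq> 0" "t i w \<noteq> 0" using w t_nonzero by (auto simp: nz_def)
  have q: "((\<lambda>w. f w / g w) has_derivative (\<lambda>l. (f' l * g w - f w * g' l) / (g w * g w))) (at w)"
    if "(f has_derivative f') (at w)" "(g has_derivative g') (at w)" "g w \<noteq> 0" for f g :: "complex \<Rightarrow> complex" and f' g'
    using has_derivative_divide'[OF that] .
  show ?thesis
    unfolding \<alpha>_def \<alpha>1_def[abs_def]
    by (intro has_derivative_Im has_derivative_diff has_derivative_mult_right q s1_deriv s_deriv t1_deriv t_deriv d)
qed

lemma alpha1_cont: "continuous_on (nz i) (\<lambda>w. \<alpha>1 i w h l)" and alpha_cont: "continuous_on (nz i) (\<lambda>w. \<alpha> i w h)"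
proof -
  have sub: "nz i \<subseteq> cdom K i" by (auto simp: nz_def)
  note c = cont_all[THEN continuous_on_subset, OF sub]
  show "continuous_on (nz i) (\<lambda>w. \<alpha>1 i w h l)"
    unfolding \<alpha>1_def by (intro continuous_intros c) (auto simp: nz_def t_nonzero)
  show "continuous_on (nz i) (\<lambda>w. \<alpha> i w h)"
    unfolding \<alpha>_def by (intro continuous_intros c) (auto simp: nz_def t_nonzero)
qed

text \<open>This is the closedness of the form. Here \<open>\<alpha>1 i w h l\<close> differentiates
  \<open>\<alpha> i w h\<close> in direction \<open>l\<close>; the second derivatives are symmetric,
  and so are the products of first derivatives from the quotient rule.\<close>

lemma alpha1_sym: "w \<in> cdom K i \<Longrightarrow> \<alpha>1 i w h l = \<alpha>1 i w l h"
  unfolding \<alpha>1_def by (simp add: s2_sym[of w i h l] t2_sym[of w i h l] mult.commute)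

lemma alpha_linear: assumes "w \<in> cdom K i" shows "linear (\<alpha> i w)"
proof -
  have l: "linear (s1 i w)" "linear (t1 i w)"
    using has_derivative_linear s_deriv[OF assms] t_deriv[OF assms] by blast+
  have a: "\<alpha> i w = (\<lambda>h. Im (of_int m / s i w * s1 i w h - inverse (t i w) * t1 i w h))"
    by (simp add: fun_eq_iff \<alpha>_def divide_inverse mult_ac)
  show ?thesis
    unfolding a
  proof (rule linearI)
    fix x y
    show "Im (of_int m / s i w * s1 i w (x + y) - inverse (t i w) * t1 i w (x + y)) =
        Im (of_int m / s i w * s1 i w x - inverse (t i w) * t1 i w x) + Im (of_int m / s i w * s1 i w y - inverse (t i w) * t1 i w y)"
      unfolding linear_add[OF l(1)] linear_add[OF l(2)] distrib_left plus_complex.sel[symmetric] by (rule arg_cong[where f=Im]) simp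
    fix r :: real
    show "Im (of_int m / s i w * s1 i w (r *\<^sub>R x) - inverse (t i w) * t1 i w (r *\<^sub>R x)) =
        r *\<^sub>R Im (of_int m / s i w * s1 i w x - inverse (t i w) * t1 i w x)"
      unfolding linear_scale[OF l(1)] linear_scale[OF l(2)] mult_scaleR_right scaleR_diff_right[symmetric] by simp
  qed
qed

lemma fc_deriv: "w \<in> ov i j \<Longrightarrow> (fc i j has_derivative (\<lambda>h. deriv (fc i j) w * h)) (at w)"
  using holomorphic_derivI[OF holomorphic_fc open_ov] by (simp add: has_field_derivative_def)

text \<open>A change of frame adds the logarithmic differential of \<open>fc\<close> to that of
  \<open>s\<close> and \<open>m\<close> times it to that of \<open>t\<close>; in
  \<open>\<alpha>\<close> the two contributions cancel.\<close>

lemma alpha_tr: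
  assumes w: "w \<in> ov i j" and nzs: "s i w \<noteq> 0"
  shows "\<alpha> i w h = \<alpha> j (tr i j w) (deriv (tr i j) w * h)"
proof -
  let ?c = "deriv (tr i j) w" and ?f = "fc i j w" and ?f' = "deriv (fc i j) w"
  have wd: "w \<in> cdom K i" and wj: "tr i j w \<in> cdom K j" using w tr_in by (auto simp: ov_iff)
  have f0: "?f \<noteq> 0" using fc_nonzero[OF w] .
  have t0: "t i w \<noteq> 0" using t_nonzero[OF wd] .
  have trd: "(tr i j has_derivative (\<lambda>h. ?c * h)) (at w)"
    using tr_has_derivative[OF w] by (simp add: has_field_derivative_def)
  have sA: "((\<lambda>v. s j (tr i j v)) has_derivative (\<lambda>h. s1 j (tr i j w) (?c * h))) (at w)"
    by (rule has_derivative_compose[OF trd s_deriv[OF wj]])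
  have sB: "((\<lambda>v. s j (tr i j v)) has_derivative (\<lambda>h. ?f * s1 i w h + ?f' * h * s i w)) (at w)"
    by (rule has_derivative_transform_within_open[OF has_derivative_mult[OF fc_deriv[OF w] s_deriv[OF wd]] open_ov w])
       (simp add: s_tr)
  have es: "s1 j (tr i j w) (?c * h) = ?f * s1 i w h + ?f' * h * s i w"
    using fun_cong[OF has_derivative_unique[OF sA sB]] .
  have tA: "((\<lambda>v. t j (tr i j v)) has_derivative (\<lambda>h. t1 j (tr i j w) (?c * h))) (at w)"
    by (rule has_derivative_compose[OF trd t_deriv[OF wj]])
  have tB: "((\<lambda>v. t j (tr i j v)) has_derivative
      (\<lambda>h. ?f powi m * t1 i w h + ?f' * h * (of_int m * ?f powi (m - 1)) * t i w)) (at w)"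
    by (rule has_derivative_transform_within_open[OF has_derivative_mult[OF has_derivative_power_int[OF f0 fc_deriv[OF w]] t_deriv[OF wd]] open_ov w])
       (simp add: t_tr)
  have et: "t1 j (tr i j w) (?c * h) = ?f powi m * t1 i w h + ?f' * h * (of_int m * ?f powi (m - 1)) * t i w"
    using fun_cong[OF has_derivative_unique[OF tA tB]] .
  have 1: "s1 j (tr i j w) (?c * h) / s j (tr i j w) = s1 i w h / s i w + ?f' * h / ?f"
    unfolding es s_tr[OF w] using f0 nzs by (simp add: field_simps)
  have 2: "t1 j (tr i j w) (?c * h) / t j (tr i j w) = t1 i w h / t i w + of_int m * (?f' * h / ?f)"
  proof -
    have fm: "?f powi m = ?f * ?f powi (m - 1)" "?f powi (m - 1) \<noteq> 0"
      using f0 by (simp_all add: power_int_diff)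
    show ?thesis
      unfolding et t_tr[OF w] fm(1) using f0 t0 fm(2) by (simp add: field_simps)
  qed
  show ?thesis unfolding \<alpha>_def 1 2 by (simp add: algebra_simps)
qed

text \<open>The density of \<open>d\<eta> \<and> d arg (s\<^sup>m / t)\<close> with respect to the area form.\<close>

definition wedge_coord :: "('x \<Rightarrow> real) \<Rightarrow> 'i \<Rightarrow> complex \<Rightarrow> real" where
  "wedge_coord \<eta> i w = (if s i w = 0 then 0 else (df \<eta> i w 1 * \<alpha> i w \<i> - df \<eta> i w \<i> * \<alpha> i w 1) / gm i w)"

text \<open>Under a holomorphic coordinate change the numerator picks up the Jacobian, the squared
  modulus of the derivative, and so does the conformal factor.\<close>

lemma wedge_coord_tr:
  assumes \<eta>: "C1X \<eta>" and w: "w \<in> ov i j" shows "wedge_coord \<eta> i w = wedge_coord \<eta> j (tr i j w)"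
proof (cases "s i w = 0")
  case True
  then show ?thesis using s_tr[OF w] by (simp add: wedge_coord_def)
next
  case False
  let ?c = "deriv (tr i j) w" and ?v = "tr i j w"
  have wj: "?v \<in> cdom K j" using w tr_in by auto
  have sj: "s j ?v \<noteq> 0" using s_tr[OF w] fc_nonzero[OF w] False by simp
  note L1 = linear_complex_real[OF df_linear[OF \<eta> wj]] and L2 = linear_complex_real[OF alpha_linear[OF wj]]
  have "df \<eta> i w 1 * \<alpha> i w \<i> - df \<eta> i w \<i> * \<alpha> i w 1 =
     df \<eta> j ?v ?c * \<alpha> j ?v (?c * \<i>) - df \<eta> j ?v (?c * \<i>) * \<alpha> j ?v ?c"
    using df_tr[OF \<eta> w] alpha_tr[OF w False] by simp
  also have "\<dots> = ((Re ?c)\<^sup>2 + (Im ?c)\<^sup>2) * (df \<eta> j ?v 1 * \<alpha> j ?v \<i> - df \<eta> j ?v \<i> * \<alpha> j ?v 1)"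
    unfolding L1[of ?c] L2[of ?c] L1[of "?c * \<i>"] L2[of "?c * \<i>"] by (simp add: algebra_simps power2_eq_square)
  also have "(Re ?c)\<^sup>2 + (Im ?c)\<^sup>2 = (cmod ?c)\<^sup>2" by (rule cmod_power2[symmetric])
  finally show ?thesis
    using gm_tr[OF w] deriv_tr_nonzero[OF w] False sj by (simp add: wedge_coord_def)
qed

definition wedge :: "('x \<Rightarrow> real) \<Rightarrow> 'x \<Rightarrow> real" where
  "wedge \<eta> z = (case SOME (i, w). w \<in> cdom K i \<and> cpar K i w = z of (i, w) \<Rightarrow> wedge_coord \<eta> i w)"

lemma wedge_cpar:
  assumes "C1X \<eta>" "w \<in> cdom K i" shows "wedge \<eta> (cpar K i w) = wedge_coord \<eta> i w"
proof -
  let ?P = "\<lambda>x. case x of (j, v) \<Rightarrow> v \<in> cdom K j \<and> cpar K j v = cpar K i w"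
  obtain j v where jv: "(SOME x. ?P x) = (j, v)" by force
  have "?P (i, w)" using assms by simp
  then have "?P (SOME x. ?P x)" by (rule someI)
  then have v: "v \<in> cdom K j" "cpar K i w = cpar K j v" using jv by auto
  have o: "w \<in> ov i j" "tr i j w = v" using tr_eqI[OF assms(2) v] by auto
  show ?thesis unfolding wedge_def jv using wedge_coord_tr[OF assms(1) o(1)] o(2) by simp
qed

text \<open>The functions whose differential vanishes near the zeros of \<open>s\<close>. The
  singularities of \<alpha> are then invisible, and the wedge density is continuous on the whole
  compact surface.\<close>

definition const_near_zeros :: "('x \<Rightarrow> real) \<Rightarrow> bool" where
  "const_near_zeros \<eta> \<longleftrightarrow> C1X \<eta> \<and> (\<forall>i w. w \<in> cdom K i \<and> s i w = 0 \<longrightarrow>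
     (\<exists>T. openin (base K) T \<and> cpar K i w \<in> T \<and> (\<forall>z\<in>T. \<eta> z = \<eta> (cpar K i w))))"

text \<open>Here not only the differential of \<eta> but the product of \<eta> with the form extends
  by \<open>0\<close> over the zeros, which is the condition under which Stokes' theorem
  applies.\<close>

definition zero_near_zeros :: "('x \<Rightarrow> real) \<Rightarrow> bool" where
  "zero_near_zeros \<eta> \<longleftrightarrow> C1X \<eta> \<and> (\<forall>i w. w \<in> cdom K i \<and> s i w = 0 \<longrightarrow>
     (\<exists>T. openin (base K) T \<and> cpar K i w \<in> T \<and> (\<forall>z\<in>T. \<eta> z = 0)))"

lemma zero_near_zeros_const_near_zeros: "zero_near_zeros \<eta> \<Longrightarrow> const_near_zeros \<eta>"
  unfolding zero_near_zeros_def const_near_zeros_def by metis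

lemma df_locally_const:
  assumes T: "openin (base K) T" "\<And>z. z \<in> T \<Longrightarrow> \<eta> z = c" and w: "w \<in> cdom K i" "cpar K i w \<in> T"
  shows "df \<eta> i w h = 0"
proof -
  have "((\<lambda>v. \<eta> (cpar K i v)) has_derivative (\<lambda>_. 0)) (at w)"
    by (rule has_derivative_transform_within_open[OF has_derivative_const open_cpar_vimage[OF T(1), of i], of w c])
       (use w T in auto)
  from df_eqI[OF this] show ?thesis by simp
qed

lemma cont_wedge_coord: assumes "const_near_zeros \<eta>" shows "continuous_on (cdom K i) (wedge_coord \<eta> i)"
proof (rule continuous_at_imp_continuous_on, rule ballI)
  fix w assume w: "w \<in> cdom K i"
  have C: "C1X \<eta>" using assms by (simp add: const_near_zeros_def)
  show "isCont (wedge_coord \<eta> i) w"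
  proof (cases "s i w = 0")
    case True
    then obtain T where T: "openin (base K) T" "cpar K i w \<in> T" "\<forall>z\<in>T. \<eta> z = \<eta> (cpar K i w)"
      using assms w unfolding const_near_zeros_def by blast
    let ?S = "{v \<in> cdom K i. cpar K i v \<in> T}"
    have S: "open ?S" "w \<in> ?S" using open_cpar_vimage[OF T(1)] w T by auto
    have "wedge_coord \<eta> i v = 0" if "v \<in> ?S" for v
      using df_locally_const[OF T(1), of \<eta> "\<eta> (cpar K i w)" v i] T(3) that by (simp add: wedge_coord_def)
    then have "continuous_on ?S (wedge_coord \<eta> i)"
      by (intro continuous_on_eq[OF continuous_on_const[of _ 0]]) simp
    then show ?thesis using S by (simp add: continuous_on_eq_continuous_at)
  next
    case False
    then have wn: "w \<in> nz i" using w by (simp add: nz_def)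
    have sub: "nz i \<subseteq> cdom K i" by (auto simp: nz_def)
    have "continuous_on (nz i) (\<lambda>w. (df \<eta> i w 1 * \<alpha> i w \<i> - df \<eta> i w \<i> * \<alpha> i w 1) / gm i w)"
      by (intro continuous_intros alpha_cont continuous_on_subset[OF C1X_cont_df[OF C] sub]
          continuous_on_subset[OF continuous_on_gm sub]) (use gm_pos sub in force)
    then have "continuous_on (nz i) (wedge_coord \<eta> i)"
      by (rule continuous_on_eq) (simp add: wedge_coord_def nz_def)
    then show ?thesis using wn open_nz by (simp add: continuous_on_eq_continuous_at)
  qed
qed

lemma cont_wedge: assumes "const_near_zeros \<eta>" shows "continuous_on (cdom K i) (\<lambda>w. wedge \<eta> (cpar K i w))"
  by (rule continuous_on_eq[OF cont_wedge_coord[OF assms]]) (use assms wedge_cpar in \<open>simp add: const_near_zeros_def\<close>)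

lemma integrable_wedge: "const_near_zeros \<eta> \<Longrightarrow> integrable \<mu> (wedge \<eta>)"
  by (rule integrable_continuous) (rule cont_wedge)

definition wedge_int :: "('x \<Rightarrow> real) \<Rightarrow> real" where "wedge_int \<eta> = (\<integral>z. wedge \<eta> z \<partial>\<mu>)"

lemma wedge_add: assumes "C1X \<eta>" "C1X \<eta>'" "z \<in> X" shows "wedge (\<lambda>z. \<eta> z + \<eta>' z) z = wedge \<eta> z + wedge \<eta>' z"
proof -
  obtain i w where w: "w \<in> cdom K i" "z = cpar K i w" using chartE[OF assms(3)] by metis
  show ?thesis
    unfolding w(2) wedge_cpar[OF C1X_add(1)[OF assms(1,2)] w(1)] wedge_cpar[OF assms(1) w(1)] wedge_cpar[OF assms(2) w(1)]
    by (simp add: wedge_coord_def C1X_add(2)[OF assms(1,2) w(1)] add_divide_distrib[symmetric] algebra_simps)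
qed

lemma wedge_int_add: assumes "const_near_zeros \<eta>" "const_near_zeros \<eta>'" shows "wedge_int (\<lambda>z. \<eta> z + \<eta>' z) = wedge_int \<eta> + wedge_int \<eta>'"
proof -
  have "wedge_int (\<lambda>z. \<eta> z + \<eta>' z) = (\<integral>z. wedge \<eta> z + wedge \<eta>' z \<partial>\<mu>)"
    unfolding wedge_int_def by (rule Bochner_Integration.integral_cong)
      (use assms wedge_add space_mu in \<open>auto simp: const_near_zeros_def\<close>)
  then show ?thesis using integrable_wedge assms by (simp add: wedge_int_def)
qed

lemma wedge_int_const: "wedge_int (\<lambda>_. c) = 0"
proof -
  have "wedge_int (\<lambda>_. c) = (\<integral>z. 0 \<partial>\<mu>)"
    unfolding wedge_int_def
  proof (rule Bochner_Integration.integral_cong[OF refl])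
    fix z assume "z \<in> space \<mu>"
    then obtain i w where w: "w \<in> cdom K i" "z = cpar K i w" using chartE space_mu by metis
    show "wedge (\<lambda>_. c) z = 0" unfolding w(2) wedge_cpar[OF C1X_const w(1)] by (simp add: wedge_coord_def df_const)
  qed
  then show ?thesis by simp
qed

text \<open>The conformal factor in the area measure cancels the denominator of the density, so the
  integral involves the Euclidean area alone.\<close>

lemma wedge_int_chart:
  assumes const_near_zeros: "const_near_zeros \<eta>" and sub: "cball a R \<subseteq> cdom K i" and off: "\<And>z. z \<in> X \<Longrightarrow> z \<notin> cpar K i ` cball a R \<Longrightarrow> \<eta> z = 0"
  shows "wedge_int \<eta> = (\<integral>w. (if w \<in> nz i then df \<eta> i w 1 * \<alpha> i w \<i> - df \<eta> i w \<i> * \<alpha> i w 1 else 0) \<partial>lborel)"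
proof -
  have C: "C1X \<eta>" using const_near_zeros by (simp add: const_near_zeros_def)
  have o: "wedge \<eta> z = 0" if z: "z \<in> X" "z \<notin> cpar K i ` cdom K i" for z
  proof -
    obtain j w where w: "w \<in> cdom K j" "z = cpar K j w" using chartE z by metis
    let ?T = "X - cpar K i ` cball a R"
    have "openin (base K) ?T" by (rule openin_compl_ball[OF sub])
    moreover have "cpar K j w \<in> ?T" using z w sub by auto
    ultimately have "df \<eta> j w h = 0" for h
      using df_locally_const[of ?T \<eta> 0 w j] off w by blast
    then show ?thesis unfolding w(2) wedge_cpar[OF C w(1)] by (simp add: wedge_coord_def)
  qed
  have m: "wedge \<eta> \<in> borel_measurable \<mu>" using integrable_wedge[OF const_near_zeros] by blast
  have "wedge_int \<eta> = (\<integral>w. indicator (cdom K i) w * gm i w * wedge \<eta> (cpar K i w) \<partial>lborel)"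
    unfolding wedge_int_def by (rule chart_integral[OF m o])
  also have "\<dots> = (\<integral>w. (if w \<in> nz i then df \<eta> i w 1 * \<alpha> i w \<i> - df \<eta> i w \<i> * \<alpha> i w 1 else 0) \<partial>lborel)"
  proof (rule Bochner_Integration.integral_cong[OF refl])
    fix w
    show "indicator (cdom K i) w * gm i w * wedge \<eta> (cpar K i w) = (if w \<in> nz i then df \<eta> i w 1 * \<alpha> i w \<i> - df \<eta> i w \<i> * \<alpha> i w 1 else 0)"
      using wedge_cpar[OF C, of w i] gm_pos[of w i] by (auto simp: indicator_def wedge_coord_def nz_def)
  qed
  finally show ?thesis .
qed

text \<open>As the form is closed, its wedge product with the differential of \<eta> is the exterior
  derivative of \<eta> times the form. This product has compact support in one chart and no
  singularity, so \<open>curl_integral_zero\<close> applies.\<close>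

lemma wedge_int_local:
  assumes zero_near_zeros: "zero_near_zeros \<eta>" and sub: "cball a R \<subseteq> cdom K i" and off: "\<And>z. z \<in> X \<Longrightarrow> z \<notin> cpar K i ` cball a R \<Longrightarrow> \<eta> z = 0"
  shows "wedge_int \<eta> = 0"
proof -
  have C: "C1X \<eta>" using zero_near_zeros by (simp add: zero_near_zeros_def)
  \<comment> \<open>The two components of the form multiplied by \<eta>, extended by
    \<open>0\<close> over the zeros of \<open>s\<close> and outside the chart; \<open>DP\<close> is
    the derivative of \<open>P\<close>.\<close>
  define P where "P h w = (if w \<in> nz i then \<eta> (cpar K i w) * \<alpha> i w h else 0)" for h w
  define DP where "DP h w l = (if w \<in> nz i then \<eta> (cpar K i w) * \<alpha>1 i w h l + df \<eta> i w l * \<alpha> i w h else 0)" for h w l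
  have zero_on: "(\<forall>v\<in>S. (P h has_derivative DP h v) (at v)) \<and> (\<forall>l. continuous_on S (\<lambda>v. DP h v l))"
    if S: "open S" "\<And>v. v \<in> S \<Longrightarrow> v \<in> nz i \<Longrightarrow> \<eta> (cpar K i v) = 0" for S h
  proof -
    have P0: "P h v = 0" if "v \<in> S" for v using S(2)[OF that] by (simp add: P_def)
    have D0: "DP h v l = 0" if v: "v \<in> S" for v l
    proof (cases "v \<in> nz i")
      case True
      then have vd: "v \<in> cdom K i" by (simp add: nz_def)
      have "((\<lambda>v. \<eta> (cpar K i v)) has_derivative (\<lambda>_. 0)) (at v)"
        by (rule has_derivative_transform_within_open[OF has_derivative_const, of "S \<inter> nz i"])
           (use S True v open_nz in auto)
      from df_eqI[OF this] show ?thesis using S(2)[OF v True] by (simp add: DP_def)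
    qed (simp add: DP_def)
    have "(P h has_derivative DP h v) (at v)" if v: "v \<in> S" for v
    proof -
      have "DP h v = (\<lambda>_. 0)" using D0[OF v] by auto
      moreover have "(P h has_derivative (\<lambda>_. 0)) (at v)"
        by (rule has_derivative_transform_within_open[OF has_derivative_const S(1) v, of 0]) (simp add: P0)
      ultimately show ?thesis by simp
    qed
    moreover have "continuous_on S (\<lambda>v. DP h v l)" for l
      by (rule continuous_on_eq[OF continuous_on_const[of _ 0]]) (simp add: D0)
    ultimately show ?thesis by blast
  qed
  have loc: "\<exists>S. open S \<and> w \<in> S \<and> (\<forall>v\<in>S. (P h has_derivative DP h v) (at v)) \<and> (\<forall>l. continuous_on S (\<lambda>v. DP h v l))" for h w
  proof -
    consider "w \<in> nz i" | "w \<in> cdom K i" "s i w = 0" | "w \<notin> cdom K i" by (auto simp: nz_def)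
    then show ?thesis
    proof cases
      case 1
      have sub': "nz i \<subseteq> cdom K i" by (auto simp: nz_def)
      have "(P h has_derivative DP h v) (at v)" if v: "v \<in> nz i" for v
      proof -
        have "((\<lambda>v. \<eta> (cpar K i v) * \<alpha> i v h) has_derivative (\<lambda>l. \<eta> (cpar K i v) * \<alpha>1 i v h l + df \<eta> i v l * \<alpha> i v h)) (at v)"
          by (intro has_derivative_mult C1X_deriv C alpha_deriv) (use v sub' in auto)
        then have "(P h has_derivative (\<lambda>l. \<eta> (cpar K i v) * \<alpha>1 i v h l + df \<eta> i v l * \<alpha> i v h)) (at v)"
          by (rule has_derivative_transform_within_open[OF _ open_nz v]) (simp add: P_def)
        then show ?thesis using v by (simp add: DP_def[abs_def])
      qed
      moreover have "continuous_on (nz i) (\<lambda>v. DP h v l)" for l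
      proof -
        have "continuous_on (nz i) (\<lambda>w. \<eta> (cpar K i w) * \<alpha>1 i w h l + df \<eta> i w l * \<alpha> i w h)"
          by (intro continuous_intros alpha_cont alpha1_cont continuous_on_subset[OF C1X_cont_df[OF C] sub']
              continuous_on_subset[OF C1X_cont[OF C] sub'])
        then show ?thesis by (rule continuous_on_eq) (simp add: DP_def)
      qed
      ultimately show ?thesis using 1 open_nz by blast
    next
      case 2
      then obtain T where T: "openin (base K) T" "cpar K i w \<in> T" "\<forall>z\<in>T. \<eta> z = 0"
        using zero_near_zeros unfolding zero_near_zeros_def by blast
      let ?S = "{v \<in> cdom K i. cpar K i v \<in> T}"
      have "open ?S" "w \<in> ?S" using open_cpar_vimage[OF T(1)] 2 T by auto
      then show ?thesis using zero_on[of ?S h] T(3) by blast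
    next
      case 3
      then have "w \<in> - cball a R" using sub by blast
      moreover have "\<eta> (cpar K i v) = 0" if "v \<in> - cball a R" "v \<in> nz i" for v
      proof (rule off)
        have vd: "v \<in> cdom K i" using that by (simp add: nz_def)
        then show "cpar K i v \<in> X" by simp
        show "cpar K i v \<notin> cpar K i ` cball a R"
        proof
          assume "cpar K i v \<in> cpar K i ` cball a R"
          then obtain x where x: "x \<in> cball a R" "cpar K i v = cpar K i x" by blast
          then have "v = x" using cpar_eq_iff[OF vd, of x] sub by blast
          then show False using x that by blast
        qed
      qed
      ultimately show ?thesis using zero_on[of "- cball a R" h] by (intro exI[of _ "- cball a R"]) (auto simp: open_Compl)
    qed
  qed
  have offP: "P h w = 0" if w: "w \<notin> cball a R" for h w
  proof (cases "w \<in> nz i")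
    case True
    then have wd: "w \<in> cdom K i" by (simp add: nz_def)
    have "cpar K i w \<notin> cpar K i ` cball a R"
    proof
      assume "cpar K i w \<in> cpar K i ` cball a R"
      then obtain x where x: "x \<in> cball a R" "cpar K i w = cpar K i x" by blast
      then have "w = x" using cpar_eq_iff[OF wd, of x] sub by blast
      then show False using x w by blast
    qed
    then show ?thesis using off wd by (simp add: P_def)
  qed (simp add: P_def)
  have "wedge_int \<eta> = (\<integral>w. DP \<i> w 1 - DP 1 w \<i> \<partial>lborel)"
  proof (rule trans[OF wedge_int_chart[OF zero_near_zeros_const_near_zeros[OF zero_near_zeros] sub off]])
    show "(\<integral>w. (if w \<in> nz i then df \<eta> i w 1 * \<alpha> i w \<i> - df \<eta> i w \<i> * \<alpha> i w 1 else 0) \<partial>lborel) =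
        (\<integral>w. DP \<i> w 1 - DP 1 w \<i> \<partial>lborel)"
      by (rule Bochner_Integration.integral_cong) (auto simp: DP_def nz_def alpha1_sym[of _ i 1 \<i>])
  qed
  also have "\<dots> = 0"
    by (rule curl_integral_zero(2)[OF loc loc]) (use offP in blast)
  finally show ?thesis .
qed

lemma zero_near_zeros_mult: assumes "zero_near_zeros \<eta>" "C1X e" shows "zero_near_zeros (\<lambda>z. \<eta> z * e z)"
  unfolding zero_near_zeros_def
proof (intro conjI allI impI)
  show "C1X (\<lambda>z. \<eta> z * e z)" using assms C1X_mult unfolding zero_near_zeros_def by blast
  fix i w assume "w \<in> cdom K i \<and> s i w = 0"
  then obtain T where "openin (base K) T" "cpar K i w \<in> T" "\<forall>z\<in>T. \<eta> z = 0"
    using assms(1) unfolding zero_near_zeros_def by blast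
  then show "\<exists>T. openin (base K) T \<and> cpar K i w \<in> T \<and> (\<forall>z\<in>T. \<eta> z * e z = 0)" by auto
qed

text \<open>A substitute for a partition of unity: multiplying \<eta> by \<open>1 - e c\<close> for
  one bump after another changes it each time by a function supported in a single chart, which does
  not affect the integral. Every point lies on the plateau of some bump, so the final product is
  \<open>0\<close>.\<close>

lemma wedge_int_zero_near_zeros: assumes "zero_near_zeros \<eta>" shows "wedge_int \<eta> = 0"
proof -
  define P where "P i w T \<longleftrightarrow> (\<exists>R>0. cball w R \<subseteq> cdom K i \<and> T = cpar K i ` ball w (R/2))" for i w T
  have ex: "\<exists>T. P i w T \<and> openin (base K) T \<and> cpar K i w \<in> T" if w: "w \<in> cdom K i" for i w
  proof -
    obtain R where R: "R > 0" "cball w R \<subseteq> cdom K i" using w open_cdom open_contains_cball by blast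
    then have sub: "ball w (R/2) \<subseteq> cdom K i" by auto
    show ?thesis
      by (rule exI[of _ "cpar K i ` ball w (R/2)"])
         (use openin_cpar_image[OF open_ball sub] R in \<open>auto simp: P_def\<close>)
  qed
  obtain C where C: "finite C" "X \<subseteq> (\<Union>c\<in>C. snd (snd c))"
    "\<And>c. c \<in> C \<Longrightarrow> fst (snd c) \<in> cdom K (fst c) \<and> P (fst c) (fst (snd c)) (snd (snd c)) \<and> openin (base K) (snd (snd c))"
    using finite_chart_cover[of P, OF ex] by blast
  have "\<forall>c\<in>C. \<exists>R>0. cball (fst (snd c)) R \<subseteq> cdom K (fst c) \<and> snd (snd c) = cpar K (fst c) ` ball (fst (snd c)) (R/2)"
    using C(3) unfolding P_def by blast
  then obtain R where R: "\<And>c. c \<in> C \<Longrightarrow> R c > 0 \<and> cball (fst (snd c)) (R c) \<subseteq> cdom K (fst c) \<and>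
      snd (snd c) = cpar K (fst c) ` ball (fst (snd c)) (R c/2)" by metis
  define e where "e c = bump (fst c) (fst (snd c)) (R c)" for c
  have Ce: "C1X (e c)" if "c \<in> C" for c
    unfolding e_def using C1X_bump R[OF that] by blast
  have step: "wedge_int \<eta> = wedge_int (\<lambda>z. \<eta> z * (\<Prod>c\<in>D. 1 - e c z))" if "D \<subseteq> C" for D
    using finite_subset[OF that C(1)] that
  proof (induction D)
    case (insert c D)
    let ?p = "\<lambda>z. \<eta> z * (\<Prod>c\<in>D. 1 - e c z)"
    have cC: "c \<in> C" using insert.prems by auto
    have "C1X (\<lambda>z. \<Prod>c\<in>D. 1 - e c z)"
      by (intro C1X_prod C1X_diff C1X_const Ce) (use insert.prems in auto)
    then have vp: "zero_near_zeros ?p" by (rule zero_near_zeros_mult[OF assms])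
    have v1: "zero_near_zeros (\<lambda>z. ?p z * e c z)" by (rule zero_near_zeros_mult[OF vp Ce[OF cC]])
    have v2: "zero_near_zeros (\<lambda>z. ?p z * (1 - e c z))"
      by (rule zero_near_zeros_mult[OF vp]) (intro C1X_diff C1X_const Ce[OF cC])
    have "wedge_int (\<lambda>z. ?p z * e c z) = 0"
    proof (rule wedge_int_local[OF v1])
      show "cball (fst (snd c)) (R c) \<subseteq> cdom K (fst c)" using R[OF cC] by blast
      fix z assume "z \<notin> cpar K (fst c) ` cball (fst (snd c)) (R c)"
      then show "?p z * e c z = 0"
        unfolding e_def using bump_off[of "R c" "fst (snd c)" "fst c" z] R[OF cC] by simp
    qed
    moreover have "wedge_int (\<lambda>z. ?p z * e c z + ?p z * (1 - e c z)) = wedge_int (\<lambda>z. ?p z * e c z) + wedge_int (\<lambda>z. ?p z * (1 - e c z))"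
      by (rule wedge_int_add[OF zero_near_zeros_const_near_zeros[OF v1] zero_near_zeros_const_near_zeros[OF v2]])
    moreover have "(\<lambda>z. ?p z * e c z + ?p z * (1 - e c z)) = ?p" by (auto simp: algebra_simps)
    ultimately have "wedge_int ?p = wedge_int (\<lambda>z. ?p z * (1 - e c z))" by simp
    moreover have "(\<lambda>z. ?p z * (1 - e c z)) = (\<lambda>z. \<eta> z * (\<Prod>c\<in>insert c D. 1 - e c z))"
      using insert.hyps by (auto simp: mult_ac)
    ultimately show ?case using insert by simp
  qed simp
  let ?q = "\<lambda>z. \<eta> z * (\<Prod>c\<in>C. 1 - e c z)"
  have q0: "?q z = 0" if z: "z \<in> X" for z
  proof -
    obtain c where c: "c \<in> C" "z \<in> snd (snd c)" using C(2) z by blast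
    then obtain v where v: "v \<in> ball (fst (snd c)) (R c/2)" "z = cpar K (fst c) v" using R[OF c(1)] by blast
    then have "e c z = 1" unfolding e_def using bump_1[of "R c" "fst (snd c)" "fst c" v] R[OF c(1)] by simp
    then have "(\<Prod>c\<in>C. 1 - e c z) = 0" using c C(1) by (auto intro!: prod_zero)
    then show ?thesis by simp
  qed
  have "C1X (\<lambda>z. \<Prod>c\<in>C. 1 - e c z)" by (intro C1X_prod C1X_diff C1X_const Ce)
  from zero_near_zeros_mult[OF assms this] have "C1X ?q" unfolding zero_near_zeros_def by blast
  have "wedge_int ?q = (\<integral>z. 0 \<partial>\<mu>)"
    unfolding wedge_int_def
  proof (rule Bochner_Integration.integral_cong[OF refl])
    fix z assume z: "z \<in> space \<mu>"
    then obtain i w where w: "w \<in> cdom K i" "z = cpar K i w" using chartE space_mu by metis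
    have "openin (base K) X" by simp
    from df_locally_const[OF this, of ?q 0 w i] q0 w have "df ?q i w h = 0" for h by simp
    then show "wedge ?q z = 0" unfolding w(2) wedge_cpar[OF \<open>C1X ?q\<close> w(1)] by (simp add: wedge_coord_def)
  qed
  then show ?thesis using step[of C] by simp
qed

end

section \<open>The flux of a radial bump\<close>

lemma integral_lborel_translate:
  fixes f :: "'a::euclidean_space \<Rightarrow> real"
  assumes "f \<in> borel_measurable borel" shows "(\<integral>x. f (x - c) \<partial>lborel) = (\<integral>x. f x \<partial>lborel)"
proof -
  have m: "(+) (- c) \<in> measurable lborel borel" by simp
  have "(\<integral>x. f x \<partial>lborel) = (\<integral>x. f x \<partial>(distr lborel borel ((+) (- c))))" by (simp add: lborel_distr_plus)
  also have "\<dots> = (\<integral>x. f (- c + x) \<partial>lborel)" by (rule integral_distr[OF m assms])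
  finally show ?thesis by simp
qed

text \<open>The integral of the differential of a bump wedged with the angular form. Polar
  coordinates would give \<open>- 2 * pi\<close>; the argument relies on the sign.\<close>

definition flux :: "real \<Rightarrow> real" where
  "flux \<epsilon> = (\<integral>w. 2 * cutoff' ((cmod w)\<^sup>2 / \<epsilon>\<^sup>2) / \<epsilon>\<^sup>2 \<partial>lborel)"

lemma continuous_radial: "continuous_on A (\<lambda>w::complex. 2 * cutoff' ((cmod (w - a))\<^sup>2 / \<epsilon>\<^sup>2) / \<epsilon>\<^sup>2)"
  unfolding divide_inverse
  by (intro continuous_intros continuous_on_compose2[OF continuous_on_cutoff'[of UNIV]]) auto

lemma integrable_radial:
  assumes e: "\<epsilon> > 0" shows "integrable lborel (\<lambda>w::complex. 2 * cutoff' ((cmod (w - a))\<^sup>2 / \<epsilon>\<^sup>2) / \<epsilon>\<^sup>2)"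
proof -
  let ?f = "\<lambda>w::complex. 2 * cutoff' ((cmod (w - a))\<^sup>2 / \<epsilon>\<^sup>2) / \<epsilon>\<^sup>2"
  have "integrable lborel (\<lambda>w. indicator (cball a \<epsilon>) w *\<^sub>R ?f w)"
    by (rule borel_integrable_compact) (auto intro: continuous_radial)
  moreover have "(\<lambda>w. indicator (cball a \<epsilon>) w *\<^sub>R ?f w) = ?f"
    using cutoff'_1[OF ratio_ge[OF e]] by (auto simp: fun_eq_iff indicator_def)
  ultimately show ?thesis by simp
qed

lemma flux_neg:
  assumes e: "\<epsilon> > 0" shows "flux \<epsilon> < 0"
proof -
  let ?f = "\<lambda>w::complex. 2 * cutoff' ((cmod w)\<^sup>2 / \<epsilon>\<^sup>2) / \<epsilon>\<^sup>2"
  \<comment> \<open>At this point the squared ratio is \<open>5/8\<close>, the midpoint of the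
    interval from \<open>1/4\<close> to \<open>1\<close> on which the cutoff descends, so its slope
    is strictly negative there.\<close>
  define p :: complex where "p = of_real (\<epsilon> * sqrt (5/8))"
  have "cmod p = \<epsilon> * sqrt (5/8)" unfolding p_def norm_of_real using e by simp
  then have "(cmod p)\<^sup>2 / \<epsilon>\<^sup>2 = 5/8" using e by (simp add: power_mult_distrib)
  then have "?f p = 2 * cutoff' (5/8) / \<epsilon>\<^sup>2" by (simp only:)
  also have "\<dots> < 0" using cutoff'_strict e by (simp add: divide_neg_pos)
  finally have fp: "?f p < 0" .
  have cont: "continuous_on UNIV ?f" using continuous_radial[of UNIV 0 \<epsilon>] by simp
  then have "isCont ?f p" by (simp add: continuous_on_eq_continuous_at)
  then obtain r where r: "r > 0" "\<And>w. dist w p < r \<Longrightarrow> dist (?f w) (?f p) < - ?f p / 2"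
    unfolding continuous_at_eps_delta using fp by (metis half_gt_zero neg_0_less_iff_less)
  have neg: "?f w \<le> 0" for w using cutoff'_neg by (simp add: divide_nonpos_nonneg)
  let ?g = "\<lambda>w. (?f p / 2) * indicator (ball p r) w"
  have le: "?f w \<le> ?g w" for w
  proof (cases "w \<in> ball p r")
    case True
    then have "\<bar>?f w - ?f p\<bar> < - ?f p / 2" using r(2)[of w] by (simp add: dist_commute dist_real_def)
    then show ?thesis using True by (simp add: abs_less_iff)
  qed (use neg in simp)
  have ig: "integrable lborel ?g"
    by (intro integrable_mult_right integrable_real_indicator)
       (use emeasure_bounded_finite[OF bounded_ball] in \<open>auto simp: infinity_ennreal_def\<close>)
  have "flux \<epsilon> \<le> (\<integral>w. ?g w \<partial>lborel)"
    unfolding flux_def by (rule integral_mono[OF _ ig le]) (use integrable_radial[OF e, of 0] in simp)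
  also have "\<dots> = ?f p / 2 * measure lborel (ball p r)" by simp
  also have "\<dots> < 0"
  proof (rule mult_neg_pos)
    show "?f p / 2 < 0" by (rule divide_neg_pos[OF fp]) simp
    show "measure lborel (ball p r) > 0" using content_ball_pos[OF r(1), of p] by simp
  qed
  finally show ?thesis .
qed

definition d2cutoff :: "complex \<Rightarrow> real \<Rightarrow> complex \<Rightarrow> complex \<Rightarrow> complex \<Rightarrow> real" where
  "d2cutoff a R v h l = cutoff' ((cmod (v - a))\<^sup>2 / R\<^sup>2) * (2 * (l \<bullet> h) / R\<^sup>2) +
      (cutoff'' ((cmod (v - a))\<^sup>2 / R\<^sup>2) * (2 * ((v - a) \<bullet> l) / R\<^sup>2)) * (2 * ((v - a) \<bullet> h) / R\<^sup>2)"

lemma dcutoff_deriv: "((\<lambda>v. dcutoff a R v h) has_derivative d2cutoff a R v h) (at v)"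
proof -
  have "((\<lambda>v. 2 * ((v - a) \<bullet> h) / R\<^sup>2) has_derivative (\<lambda>l. 2 * (l \<bullet> h) / R\<^sup>2)) (at v)"
    by (rule bounded_linear.has_derivative[OF bounded_linear_divide]) (auto intro!: derivative_eq_intros)
  from has_derivative_mult[OF radial_deriv[OF cutoff'_deriv] this] show ?thesis
    unfolding dcutoff_def d2cutoff_def[abs_def] .
qed

lemma continuous_on_d2cutoff: "continuous_on A (\<lambda>v. d2cutoff a R v h l)"
  unfolding d2cutoff_def divide_inverse
  by (intro continuous_intros continuous_on_compose2[OF continuous_on_cutoff'[of UNIV]]
      continuous_on_compose2[OF continuous_on_cutoff''[of UNIV]]) auto

lemma d2cutoff_sym: "d2cutoff a R v h l = d2cutoff a R v l h"
  by (simp add: d2cutoff_def inner_commute mult_ac)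

lemma cutoff''_flat: "r \<le> 1/4 \<Longrightarrow> cutoff'' r = 0" "r \<ge> 1 \<Longrightarrow> cutoff'' r = 0"
  by (simp_all add: cutoff''_def clamp01_def)

lemma dcutoff_flat:
  assumes "R > 0" "v \<in> ball a (R/2) \<or> v \<notin> cball a R"
  shows "dcutoff a R v h = 0" "d2cutoff a R v h l = 0"
proof -
  have "(cmod (v - a))\<^sup>2 / R\<^sup>2 \<le> 1/4 \<or> (cmod (v - a))\<^sup>2 / R\<^sup>2 \<ge> 1"
    using assms ratio_le ratio_ge by blast
  then have "cutoff' ((cmod (v - a))\<^sup>2 / R\<^sup>2) = 0" "cutoff'' ((cmod (v - a))\<^sup>2 / R\<^sup>2) = 0"
    using cutoff'_0 cutoff'_1 cutoff''_flat by blast+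
  then show "dcutoff a R v h = 0" "d2cutoff a R v h l = 0" by (simp_all add: dcutoff_def d2cutoff_def)
qed

text \<open>\<open>Im (h / (v - a))\<close> is the differential of the argument of
  \<open>v - a\<close>. Against a radial differential its wedge product involves the radial slope
  alone, and the factor \<open>1 / (cmod (v - a))^2\<close> cancels. At the centre both sides
  vanish.\<close>

lemma dcutoff_angle:
  assumes R: "R > 0"
  shows "dcutoff a R v 1 * Im (\<i> / (v - a)) - dcutoff a R v \<i> * Im (1 / (v - a)) = 2 * cutoff' ((cmod (v - a))\<^sup>2 / R\<^sup>2) / R\<^sup>2"
proof (cases "v = a")
  case True
  then show ?thesis using R by (simp add: dcutoff_def cutoff'_0)
next
  case False
  define x y where "x = Re (v - a)" and "y = Im (v - a)"
  have nz: "x\<^sup>2 + y\<^sup>2 \<noteq> 0" using False by (auto simp: x_def y_def complex_eq_iff sum_power2_eq_zero_iff)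
  have i: "(v - a) \<bullet> 1 = x" "(v - a) \<bullet> \<i> = y" by (simp_all add: x_def y_def inner_complex_def)
  define D where "D = x\<^sup>2 + y\<^sup>2"
  have j: "Im (\<i> / (v - a)) = x / D" "Im (1 / (v - a)) = - y / D"
    unfolding D_def x_def y_def by (simp_all add: Im_divide)
  have "(2 * x / R\<^sup>2) * (x / D) - (2 * y / R\<^sup>2) * (- y / D) = (2 / R\<^sup>2) * ((x\<^sup>2 + y\<^sup>2) / D)"
    by (simp add: add_divide_distrib power2_eq_square[of x] power2_eq_square[of y] distrib_left)
  also have "(x\<^sup>2 + y\<^sup>2) / D = 1" using nz unfolding D_def[symmetric] by simp
  also have "(2 / R\<^sup>2) * 1 = 2 / R\<^sup>2" by simp
  finally have e: "(2 * x / R\<^sup>2) * (x / D) - (2 * y / R\<^sup>2) * (- y / D) = 2 / R\<^sup>2" .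
  let ?s = "cutoff' ((cmod (v - a))\<^sup>2 / R\<^sup>2)"
  have "dcutoff a R v 1 * Im (\<i> / (v - a)) - dcutoff a R v \<i> * Im (1 / (v - a)) =
     ?s * ((2 * x / R\<^sup>2) * (x / D) - (2 * y / R\<^sup>2) * (- y / D))"
    unfolding dcutoff_def i j by (simp only: right_diff_distrib mult.assoc)
  then show ?thesis unfolding e by simp
qed

context kk_stokes begin

text \<open>Around the zero the form is the differential of a single-valued function
  \<open>a\<close> plus \<open>m * n\<close> times the angular form. The exact part contributes
  nothing, because wedging it with the differential of the bump gives up to sign the derivative of
  \<open>a\<close> times that differential, which has compact support off the centre. The angular
  part gives the flux. The second derivative of the cutoff enters here.\<close>

lemma wedge_int_bump:
  assumes w0: "w0 \<in> cdom K i" "s i w0 = 0" and e: "0 < \<epsilon>" "\<epsilon> < R" and sub: "ball w0 R \<subseteq> cdom K i"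
    and g: "continuous_on (ball w0 R - {w0}) g" "\<And>v. v \<in> ball w0 R - {w0} \<Longrightarrow> s i v = (v - w0) powi n * exp (g v)"
    and gt: "continuous_on (ball w0 R - {w0}) gt" "\<And>v. v \<in> ball w0 R - {w0} \<Longrightarrow> t i v = exp (gt v)"
  shows "const_near_zeros (bump i w0 \<epsilon>)" and "wedge_int (bump i w0 \<epsilon>) = of_int (m * n) * flux \<epsilon>"
    and "\<And>j w. w \<in> cdom K j \<Longrightarrow> s j w = 0 \<Longrightarrow> cpar K j w \<noteq> cpar K i w0 \<Longrightarrow> bump i w0 \<epsilon> (cpar K j w) = 0"
proof -
  let ?B = "ball w0 R - {w0}" and ?e = "bump i w0 \<epsilon>"
  have csub: "cball w0 \<epsilon> \<subseteq> cdom K i" using e sub by (auto simp: subset_iff)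
  have C: "C1X ?e" by (rule C1X_bump[OF e(1) csub])
  have snz: "s i v \<noteq> 0" if "v \<in> ?B" for v using g(2)[OF that] that by auto
  have far: "cpar K j w \<in> X - cpar K i ` cball w0 \<epsilon>"
    if w: "w \<in> cdom K j" "s j w = 0" "cpar K j w \<noteq> cpar K i w0" for j w
  proof -
    have "cpar K j w \<notin> cpar K i ` cball w0 \<epsilon>"
    proof
      assume "cpar K j w \<in> cpar K i ` cball w0 \<epsilon>"
      then obtain v where v: "v \<in> cball w0 \<epsilon>" "cpar K j w = cpar K i v" by blast
      have vd: "v \<in> cdom K i" using v csub by blast
      have "s i v = 0" using s_tr[of w j i] tr_eqI[OF w(1) vd v(2)] w(2) by simp
      moreover have "v \<in> ?B" using v w(3) e by auto
      ultimately show False using snz by blast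
    qed
    then show ?thesis using w by simp
  qed
  show off: "bump i w0 \<epsilon> (cpar K j w) = 0" if "w \<in> cdom K j" "s j w = 0" "cpar K j w \<noteq> cpar K i w0" for j w
    using bump_off[OF e(1) csub] far[OF that] by blast
  show const_near_zeros: "const_near_zeros ?e"
    unfolding const_near_zeros_def
  proof (intro conjI C allI impI)
    fix j w assume w: "w \<in> cdom K j \<and> s j w = 0"
    show "\<exists>T. openin (base K) T \<and> cpar K j w \<in> T \<and> (\<forall>z\<in>T. ?e z = ?e (cpar K j w))"
    proof (cases "cpar K j w = cpar K i w0")
      case True
      have "openin (base K) (cpar K i ` ball w0 (\<epsilon>/2))"
        by (rule openin_cpar_image) (use e sub in auto)
      then show ?thesis
        using bump_1[OF e(1) csub] True e
        by (intro exI[of _ "cpar K i ` ball w0 (\<epsilon>/2)"]) auto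
    next
      case False
      then show ?thesis
        using far[of w j] off[of w j] w bump_off[OF e(1) csub] openin_compl_ball[OF csub]
        by (intro exI[of _ "X - cpar K i ` cball w0 \<epsilon>"]) auto
    qed
  qed
  define a where "a v = Im (of_int m * g v - gt v)" for v
  define a' where "a' v h = \<alpha> i v h - of_int (m * n) * Im (h / (v - w0))" for v h
  have opB: "open ?B" by auto
  have a_der: "(a has_derivative a' v) (at v)" if v: "v \<in> ?B" for v
  proof -
    have vd: "v \<in> cdom K i" and v0: "v - w0 \<noteq> 0" using v sub by auto
    \<comment> \<open>Dividing out the power leaves a differentiable function equal to
      \<open>exp (g v)\<close>, so the merely continuous \<open>g\<close> is differentiable with a
      computable derivative.\<close>
    let ?u = "\<lambda>v. s i v * (v - w0) powi (- n)"
    have u: "(?u has_derivative (\<lambda>h. s i v * (h * (of_int (- n) * (v - w0) powi (- n - 1))) + s1 i v h * (v - w0) powi (- n))) (at v)"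
      by (intro has_derivative_mult has_derivative_power_int s_deriv vd v0) (auto intro!: derivative_eq_intros)
    have ug: "?u v = exp (g v)" if "v \<in> ?B" for v
      using g(2)[OF that] that by (simp add: power_int_minus)
    have gd: "(g has_derivative (\<lambda>h. (s i v * (h * (of_int (- n) * (v - w0) powi (- n - 1))) + s1 i v h * (v - w0) powi (- n)) / ?u v)) (at v)"
      by (rule log_has_derivative[OF opB v g(1) ug u])
    have eq: "(s i v * (h * (of_int (- n) * (v - w0) powi (- n - 1))) + s1 i v h * (v - w0) powi (- n)) / ?u v
        = s1 i v h / s i v - of_int n * (h / (v - w0))" for h
    proof -
      have p: "(v - w0) powi (- n - 1) = (v - w0) powi (- n) / (v - w0)" "(v - w0) powi (- n) \<noteq> 0"
        using v0 by (simp_all add: power_int_diff)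
      show ?thesis unfolding p(1) using p(2) v0 snz[OF v] by (simp add: field_simps)
    qed
    have td: "(gt has_derivative (\<lambda>h. t1 i v h / t i v)) (at v)"
      by (rule log_has_derivative[OF opB v gt t_deriv[OF vd]])
    have "(a has_derivative (\<lambda>h. Im (of_int m * (s1 i v h / s i v - of_int n * (h / (v - w0))) - t1 i v h / t i v))) (at v)"
      unfolding a_def using gd[unfolded eq] td by (intro has_derivative_Im has_derivative_diff has_derivative_mult_right)
    moreover have "Im (of_int m * (s1 i v h / s i v - of_int n * (h / (v - w0))) - t1 i v h / t i v) = a' v h" for h
    proof -
      have "of_int m * (s1 i v h / s i v - of_int n * (h / (v - w0))) - t1 i v h / t i v =
          (of_int m * (s1 i v h / s i v) - t1 i v h / t i v) - of_int (m * n) *\<^sub>R (h / (v - w0))"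
        by (simp add: scaleR_conv_of_real algebra_simps)
      then show ?thesis by (simp only: a'_def \<alpha>_def minus_complex.sel scaleR_complex.sel)
    qed
    ultimately show ?thesis by simp
  qed
  have Bn: "?B \<subseteq> nz i" using sub snz by (auto simp: nz_def)
  have ca': "continuous_on ?B (\<lambda>v. a' v h)" for h
    unfolding a'_def by (intro continuous_intros continuous_on_subset[OF alpha_cont Bn]) auto
  have ca: "continuous_on ?B a"
    unfolding a_def by (intro continuous_intros g gt)
  \<comment> \<open>The function \<open>a\<close> has no control at the centre, but the differential
    of the bump vanishes on the inner half of the disc, so the product extends by
    \<open>0\<close>.\<close>
  define P where "P h v = (if v \<in> ?B then a v * dcutoff w0 \<epsilon> v h else 0)" for h v
  define DP where "DP h v l = (if v \<in> ?B then a v * d2cutoff w0 \<epsilon> v h l + a' v l * dcutoff w0 \<epsilon> v h else 0)" for h v l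
  have zero_on: "(\<forall>v\<in>S. (P h has_derivative DP h v) (at v)) \<and> (\<forall>l. continuous_on S (\<lambda>v. DP h v l))"
    if S: "open S" "\<And>v. v \<in> S \<Longrightarrow> v \<in> ball w0 (\<epsilon>/2) \<or> v \<notin> cball w0 \<epsilon>" for S h
  proof -
    have P0: "P h v = 0" and D0: "DP h v l = 0" if "v \<in> S" for v l
      using dcutoff_flat[OF e(1) S(2)[OF that]] by (simp_all add: P_def DP_def)
    have "(P h has_derivative DP h v) (at v)" if v: "v \<in> S" for v
    proof -
      have "DP h v = (\<lambda>_. 0)" using D0[OF v] by auto
      moreover have "(P h has_derivative (\<lambda>_. 0)) (at v)"
        by (rule has_derivative_transform_within_open[OF has_derivative_const S(1) v, of 0]) (simp add: P0)
      ultimately show ?thesis by simp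
    qed
    moreover have "continuous_on S (\<lambda>v. DP h v l)" for l
      by (rule continuous_on_eq[OF continuous_on_const[of _ 0]]) (simp add: D0)
    ultimately show ?thesis by blast
  qed
  have loc: "\<exists>S. open S \<and> w \<in> S \<and> (\<forall>v\<in>S. (P h has_derivative DP h v) (at v)) \<and> (\<forall>l. continuous_on S (\<lambda>v. DP h v l))" for h w
  proof -
    consider "w \<in> ?B" | "w = w0" | "w \<notin> ball w0 R" by auto
    then show ?thesis
    proof cases
      case 1
      have "(P h has_derivative DP h v) (at v)" if v: "v \<in> ?B" for v
      proof -
        have "((\<lambda>v. a v * dcutoff w0 \<epsilon> v h) has_derivative (\<lambda>l. a v * d2cutoff w0 \<epsilon> v h l + a' v l * dcutoff w0 \<epsilon> v h)) (at v)"
          by (intro has_derivative_mult a_der dcutoff_deriv v)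
        then have "(P h has_derivative (\<lambda>l. a v * d2cutoff w0 \<epsilon> v h l + a' v l * dcutoff w0 \<epsilon> v h)) (at v)"
          by (rule has_derivative_transform_within_open[OF _ opB v]) (simp add: P_def)
        then show ?thesis using v by (simp add: DP_def[abs_def])
      qed
      moreover have "continuous_on ?B (\<lambda>v. DP h v l)" for l
      proof -
        have "continuous_on ?B (\<lambda>v. a v * d2cutoff w0 \<epsilon> v h l + a' v l * dcutoff w0 \<epsilon> v h)"
          by (intro continuous_on_add continuous_on_mult ca ca' continuous_on_dcutoff continuous_on_d2cutoff)
        then show ?thesis by (rule continuous_on_eq) (simp add: DP_def)
      qed
      ultimately show ?thesis using 1 opB by blast
    next
      case 2
      then show ?thesis using zero_on[of "ball w0 (\<epsilon>/2)" h] e by (intro exI[of _ "ball w0 (\<epsilon>/2)"]) auto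
    next
      case 3
      then have "w \<in> - cball w0 \<epsilon>" using e by auto
      then show ?thesis using zero_on[of "- cball w0 \<epsilon>" h] by (intro exI[of _ "- cball w0 \<epsilon>"]) (auto simp: open_Compl)
    qed
  qed
  have offP: "P h w = 0" if "w \<notin> cball w0 \<epsilon>" for h w
    using dcutoff_flat[OF e(1), of w w0] that by (simp add: P_def)
  have curl: "integrable lborel (\<lambda>w. DP \<i> w 1 - DP 1 w \<i>)" "(\<integral>w. DP \<i> w 1 - DP 1 w \<i> \<partial>lborel) = 0"
    using curl_integral_zero[OF loc loc, where a=w0 and R=\<epsilon>] offP by blast+
  let ?r = "\<lambda>w. 2 * cutoff' ((cmod (w - w0))\<^sup>2 / \<epsilon>\<^sup>2) / \<epsilon>\<^sup>2"
  have pw: "(if w \<in> nz i then df ?e i w 1 * \<alpha> i w \<i> - df ?e i w \<i> * \<alpha> i w 1 else 0) =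
      of_int (m * n) * ?r w - (DP \<i> w 1 - DP 1 w \<i>)" for w
  proof (cases "w \<in> ?B")
    case True
    then have wd: "w \<in> cdom K i" "w \<in> nz i" using sub Bn by auto
    have al: "\<alpha> i w h = a' w h + of_int (m * n) * Im (h / (w - w0))" for h by (simp add: a'_def)
    have "df ?e i w 1 * \<alpha> i w \<i> - df ?e i w \<i> * \<alpha> i w 1 =
       of_int (m * n) * (dcutoff w0 \<epsilon> w 1 * Im (\<i> / (w - w0)) - dcutoff w0 \<epsilon> w \<i> * Im (1 / (w - w0)))
       + (dcutoff w0 \<epsilon> w 1 * a' w \<i> - dcutoff w0 \<epsilon> w \<i> * a' w 1)"
      unfolding df_bump[OF e(1) csub wd(1)] al by (simp only: algebra_simps)
    also have "\<dots> = of_int (m * n) * ?r w - (DP \<i> w 1 - DP 1 w \<i>)"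
      unfolding dcutoff_angle[OF e(1)] using True by (simp add: DP_def d2cutoff_sym[of _ _ _ \<i> 1] algebra_simps)
    finally show ?thesis using wd by simp
  next
    case False
    have D0: "DP h w l = 0" for h l by (simp only: DP_def False if_False)
    have fl: "w \<in> ball w0 (\<epsilon>/2) \<or> w \<notin> cball w0 \<epsilon>" using False e by auto
    have d0: "dcutoff w0 \<epsilon> w h = 0" for h using dcutoff_flat[OF e(1) fl] by blast
    have "?r w = 0" using dcutoff_angle[OF e(1), of w0 w] d0 by simp
    moreover have "df ?e i w h = 0" if "w \<in> nz i" for h
      using df_bump[OF e(1) csub, of w] d0 that by (simp add: nz_def)
    ultimately show ?thesis using D0 by simp
  qed
  have "wedge_int ?e = (\<integral>w. of_int (m * n) * ?r w - (DP \<i> w 1 - DP 1 w \<i>) \<partial>lborel)"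
    by (rule trans[OF wedge_int_chart[OF const_near_zeros csub bump_off[OF e(1) csub]] Bochner_Integration.integral_cong[OF refl pw]])
  also have "\<dots> = of_int (m * n) * (\<integral>w. ?r w \<partial>lborel) - (\<integral>w. DP \<i> w 1 - DP 1 w \<i> \<partial>lborel)"
    unfolding Bochner_Integration.integral_diff[OF integrable_mult_right[OF integrable_radial[OF e(1)]] curl(1)]
      integral_mult_right_zero ..
  also have "(\<integral>w. ?r w \<partial>lborel) = flux \<epsilon>"
    unfolding flux_def
    by (rule integral_lborel_translate[of "\<lambda>w. 2 * cutoff' ((cmod w)\<^sup>2 / \<epsilon>\<^sup>2) / \<epsilon>\<^sup>2"])
       (rule borel_measurable_continuous_onI, use continuous_radial[of UNIV 0 \<epsilon>] in simp)
  finally show "wedge_int ?e = of_int (m * n) * flux \<epsilon>" using curl(2) by simp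
qed

definition Zs :: "'x set" where "Zs = {cpar K i w |i w. w \<in> cdom K i \<and> s i w = 0}"

lemma Zs_iff: "w \<in> cdom K i \<Longrightarrow> cpar K i w \<in> Zs \<longleftrightarrow> s i w = 0"
proof
  assume w: "w \<in> cdom K i" and "cpar K i w \<in> Zs"
  then obtain j v where v: "v \<in> cdom K j" "s j v = 0" "cpar K j v = cpar K i w" by (auto simp: Zs_def)
  then show "s i w = 0" using s_tr[of v j i] tr_eqI[OF v(1) w v(3)] by simp
qed (auto simp: Zs_def)

lemma finite_Zs: "finite Zs"
proof (rule finite_exceptional_points)
  show "Zs \<subseteq> X" by (auto simp: Zs_def)
  fix z assume "z \<in> X"
  then obtain i w where w: "w \<in> cdom K i" "cpar K i w = z" using chartE by blast
  obtain r where r: "r > 0" "\<And>v. v \<in> ball w r - {w} \<Longrightarrow> s i v \<noteq> 0"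
    using has_index_nonzero[OF s_index[OF w(1)]] by blast
  let ?S = "ball w r \<inter> cdom K i"
  have "openin (base K) (cpar K i ` ?S)" by (rule openin_cpar_image) (auto intro: open_Int)
  moreover have "cpar K i ` ?S \<inter> Zs \<subseteq> {z}"
  proof clarify
    fix v assume v: "cpar K i v \<in> Zs" "v \<in> ball w r" "v \<in> cdom K i"
    then have "s i v = 0" using Zs_iff by blast
    then have "v = w" using r(2)[of v] v by blast
    then show "cpar K i v = z" using w by simp
  qed
  ultimately show "\<exists>T. openin (base K) T \<and> z \<in> T \<and> T \<inter> Zs \<subseteq> {z}"
    using w r by (intro exI[of _ "cpar K i ` ?S"]) auto
qed

lemma const_near_zeros_add: assumes "const_near_zeros \<eta>" "const_near_zeros \<eta>'" shows "const_near_zeros (\<lambda>z. \<eta> z + \<eta>' z)"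
  unfolding const_near_zeros_def
proof (intro conjI allI impI)
  show "C1X (\<lambda>z. \<eta> z + \<eta>' z)" using assms C1X_add unfolding const_near_zeros_def by blast
  fix i w assume w: "w \<in> cdom K i \<and> s i w = 0"
  obtain T where T: "openin (base K) T" "cpar K i w \<in> T" "\<forall>z\<in>T. \<eta> z = \<eta> (cpar K i w)"
    using assms(1) w unfolding const_near_zeros_def by blast
  obtain T' where T': "openin (base K) T'" "cpar K i w \<in> T'" "\<forall>z\<in>T'. \<eta>' z = \<eta>' (cpar K i w)"
    using assms(2) w unfolding const_near_zeros_def by blast
  show "\<exists>T. openin (base K) T \<and> cpar K i w \<in> T \<and> (\<forall>z\<in>T. \<eta> z + \<eta>' z = \<eta> (cpar K i w) + \<eta>' (cpar K i w))"
  proof (intro exI[of _ "T \<inter> T'"] conjI ballI openin_Int T(1) T'(1) IntI T(2) T'(2))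
    fix z assume "z \<in> T \<inter> T'"
    then show "\<eta> z + \<eta>' z = \<eta> (cpar K i w) + \<eta>' (cpar K i w)"
      using bspec[OF T(3), of z] bspec[OF T'(3), of z] by simp
  qed
qed

lemma const_near_zeros_minus: assumes "const_near_zeros \<eta>" shows "const_near_zeros (\<lambda>z. - \<eta> z)"
  unfolding const_near_zeros_def
proof (intro conjI allI impI)
  show "C1X (\<lambda>z. - \<eta> z)" using assms C1X_minus unfolding const_near_zeros_def by blast
  fix i w assume w: "w \<in> cdom K i \<and> s i w = 0"
  obtain T where T: "openin (base K) T" "cpar K i w \<in> T" "\<forall>z\<in>T. \<eta> z = \<eta> (cpar K i w)"
    using assms w unfolding const_near_zeros_def by blast
  show "\<exists>T. openin (base K) T \<and> cpar K i w \<in> T \<and> (\<forall>z\<in>T. - \<eta> z = - \<eta> (cpar K i w))"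
    by (intro exI[of _ T] conjI T(1,2) ballI) (simp only: bspec[OF T(3)])
qed

lemma const_near_zeros_const: "const_near_zeros (\<lambda>_. c)"
  unfolding const_near_zeros_def using C1X_const by (metis openin_topspace cpar_in_X)

lemma wedge_int_sum:
  assumes "\<And>c. c \<in> C \<Longrightarrow> const_near_zeros (e c)"
  shows "const_near_zeros (\<lambda>z. \<Sum>c\<in>C. e c z) \<and> wedge_int (\<lambda>z. \<Sum>c\<in>C. e c z) = (\<Sum>c\<in>C. wedge_int (e c))"
  using assms
proof (induction C rule: infinite_finite_induct)
  case (insert c C)
  then show ?case using wedge_int_add[of "e c" "\<lambda>z. \<Sum>c\<in>C. e c z"] const_near_zeros_add[of "e c" "\<lambda>z. \<Sum>c\<in>C. e c z"] by auto
qed (simp_all add: const_near_zeros_const wedge_int_const)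

text \<open>The sum \<open>?S\<close> of bumps around all zeros equals \<open>1\<close> near each
  zero. Hence \<open>1 - ?S\<close> is subject to Stokes' theorem and has wedge integral
  \<open>0\<close>, and so has the constant \<open>1\<close>. Thus the wedge integral of
  \<open>?S\<close> vanishes; by \<open>wedge_int_bump\<close> it is \<open>m\<close> times the flux
  times the sum of the indices.\<close>

theorem sum_index_zero: "(\<Sum>z\<in>Zs. N z) = 0"
proof -
  let ?G = "\<lambda>z (i, w, R). w \<in> cdom K i \<and> cpar K i w = z \<and> R > 0 \<and> ball w R \<subseteq> cdom K i \<and>
     (\<exists>g gt. continuous_on (ball w R - {w}) g \<and> (\<forall>v\<in>ball w R - {w}. s i v = (v - w) powi (N z) * exp (g v)) \<and>
        continuous_on (ball w R - {w}) gt \<and> (\<forall>v\<in>ball w R - {w}. t i v = exp (gt v)))"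
  define G0 where "G0 z x \<longleftrightarrow> ?G z x" for z x
  have ex: "\<exists>x. G0 z x" if "z \<in> Zs" for z
  proof -
    obtain i w where w: "w \<in> cdom K i" "cpar K i w = z" using \<open>z \<in> Zs\<close> by (auto simp: Zs_def)
    obtain r where r: "r > 0" "ball w r \<subseteq> cdom K i" using w open_cdom openE by blast
    obtain r1 g where g: "0 < r1" "r1 \<le> r" "continuous_on (ball w r1 - {w}) g"
      "\<And>v. v \<in> ball w r1 - {w} \<Longrightarrow> s i v = (v - w) powi (N z) * exp (g v)"
      using has_indexE[OF s_index[OF w(1)] r(1)] w(2) by blast
    have "has_index (t i) w 0"
      by (rule has_index_0_open[OF open_cdom w(1) cont_all(2) t_nonzero[OF w(1)]])
    then obtain r2 gt where gt: "0 < r2" "r2 \<le> r1" "continuous_on (ball w r2 - {w}) gt"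
      "\<And>v. v \<in> ball w r2 - {w} \<Longrightarrow> t i v = (v - w) powi 0 * exp (gt v)"
      using has_indexE g(1) by blast
    have cg: "continuous_on (ball w r2 - {w}) g" by (rule continuous_on_subset[OF g(3)]) (use gt in auto)
    have sub2: "ball w r2 \<subseteq> cdom K i" using r(2) g(2) gt(2) by auto
    have g4: "s i v = (v - w) powi (N z) * exp (g v)" if "v \<in> ball w r2 - {w}" for v
      using g(4)[of v] that gt(2) by simp
    have gt4: "t i v = exp (gt v)" if "v \<in> ball w r2 - {w}" for v
      using gt(4)[OF that] by simp
    have "?G z (i, w, r2)"
      unfolding prod.case
      by (intro conjI exI[of _ g] exI[of _ gt] ballI w gt(1,3) sub2 cg g4 gt4; assumption)
    then have "G0 z (i, w, r2)" unfolding G0_def .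
    then show ?thesis by blast
  qed
  then obtain ch where ch: "\<And>z. z \<in> Zs \<Longrightarrow> G0 z (ch z)" by metis
  define I where "I z = fst (ch z)" for z
  define W where "W z = fst (snd (ch z))" for z
  define R where "R z = snd (snd (ch z))" for z
  have G: "W z \<in> cdom K (I z) \<and> cpar K (I z) (W z) = z \<and> R z > 0 \<and> ball (W z) (R z) \<subseteq> cdom K (I z) \<and>
     (\<exists>g gt. continuous_on (ball (W z) (R z) - {W z}) g \<and> (\<forall>v\<in>ball (W z) (R z) - {W z}. s (I z) v = (v - W z) powi (N z) * exp (g v)) \<and>
        continuous_on (ball (W z) (R z) - {W z}) gt \<and> (\<forall>v\<in>ball (W z) (R z) - {W z}. t (I z) v = exp (gt v)))" if "z \<in> Zs" for z
    using ch[OF that] by (simp add: G0_def I_def W_def R_def split_beta)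
  show ?thesis
  proof (cases "Zs = {}")
    case False
    \<comment> \<open>A common radius for all zeros gives every bump the same flux, which can then
      be factored out of the sum; half of the minimum is strictly below each
      \<open>R z\<close>.\<close>
    define \<epsilon> where "\<epsilon> = Min (R ` Zs) / 2"
    have Mpos: "Min (R ` Zs) > 0" using G finite_Zs False by (subst Min_gr_iff) auto
    have e: "0 < \<epsilon>" "\<epsilon> < R z" if "z \<in> Zs" for z
    proof -
      have "Min (R ` Zs) \<le> R z" using finite_Zs that by simp
      then show "0 < \<epsilon>" "\<epsilon> < R z" using Mpos by (simp_all add: \<epsilon>_def)
    qed
    have e0: "0 < \<epsilon>" using Mpos by (simp add: \<epsilon>_def)
    define b where "b z = bump (I z) (W z) \<epsilon>" for z
    have B: "const_near_zeros (b z) \<and> wedge_int (b z) = of_int (m * N z) * flux \<epsilon> \<and> (\<forall>z'\<in>Zs. b z z' = (if z' = z then 1 else 0))" if z: "z \<in> Zs" for z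
    proof -
      obtain g gt where gg: "continuous_on (ball (W z) (R z) - {W z}) g" "\<And>v. v \<in> ball (W z) (R z) - {W z} \<Longrightarrow> s (I z) v = (v - W z) powi (N z) * exp (g v)"
        "continuous_on (ball (W z) (R z) - {W z}) gt" "\<And>v. v \<in> ball (W z) (R z) - {W z} \<Longrightarrow> t (I z) v = exp (gt v)"
        using G[OF z] by blast
      have w: "W z \<in> cdom K (I z)" "cpar K (I z) (W z) = z" and sub: "ball (W z) (R z) \<subseteq> cdom K (I z)" using G[OF z] by auto
      have s0: "s (I z) (W z) = 0" using Zs_iff[OF w(1)] w(2) z by simp
      note fb = wedge_int_bump[OF w(1) s0 e[OF z] sub gg]
      have "b z z' = (if z' = z then 1 else 0)" if z': "z' \<in> Zs" for z'
      proof (cases "z' = z")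
        case True
        have "cball (W z) \<epsilon> \<subseteq> cdom K (I z)" using sub e[OF z] by (auto simp: subset_iff)
        from bump_1[OF e0 this, of "W z"] True w e0 show ?thesis by (simp add: b_def)
      next
        case False
        obtain j v where "v \<in> cdom K j" "s j v = 0" "z' = cpar K j v" using z' by (auto simp: Zs_def)
        then show ?thesis using fb(3)[of v j] w False by (simp add: b_def)
      qed
      then show ?thesis using fb(1,2) by (simp add: b_def)
    qed
    let ?S = "\<lambda>x. \<Sum>z\<in>Zs. b z x"
    have S: "const_near_zeros ?S" "wedge_int ?S = (\<Sum>z\<in>Zs. wedge_int (b z))" using wedge_int_sum[of Zs b] B by auto
    have mS: "const_near_zeros (\<lambda>x. - ?S x)" by (rule const_near_zeros_minus[OF S(1)])
    have a1: "const_near_zeros (\<lambda>x. 1 + - ?S x)" by (rule const_near_zeros_add[OF const_near_zeros_const mS])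
    have "zero_near_zeros (\<lambda>x. 1 + - ?S x)"
      unfolding zero_near_zeros_def
    proof (intro conjI allI impI)
      show "C1X (\<lambda>x. 1 + - ?S x)" using a1 unfolding const_near_zeros_def by blast
      fix i w assume w: "w \<in> cdom K i \<and> s i w = 0"
      then have z: "cpar K i w \<in> Zs" by (auto simp: Zs_def)
      obtain T where T: "openin (base K) T" "cpar K i w \<in> T" "\<forall>x\<in>T. 1 + - ?S x = 1 + - ?S (cpar K i w)"
        using a1 w unfolding const_near_zeros_def by blast
      have "?S (cpar K i w) = (\<Sum>z\<in>Zs. if cpar K i w = z then 1 else 0)"
        by (rule sum.cong) (use B z in auto)
      also have "\<dots> = 1" using z finite_Zs by simp
      finally show "\<exists>T. openin (base K) T \<and> cpar K i w \<in> T \<and> (\<forall>x\<in>T. 1 + - ?S x = 0)"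
        using T by auto
    qed
    then have "wedge_int (\<lambda>x. 1 + - ?S x) = 0" by (rule wedge_int_zero_near_zeros)
    moreover have "wedge_int (\<lambda>x. (1 + - ?S x) + ?S x) = wedge_int (\<lambda>x. 1 + - ?S x) + wedge_int ?S"
      by (rule wedge_int_add[OF a1 S(1)])
    ultimately have "wedge_int ?S = 0" using wedge_int_const[of 1] by simp
    then have "(\<Sum>z\<in>Zs. of_int (m * N z) * flux \<epsilon>) = 0" using S(2) B by simp
    then have "of_int m * (of_int (\<Sum>z\<in>Zs. N z)) * flux \<epsilon> = 0"
      by (simp add: sum_distrib_left sum_distrib_right mult.assoc)
    then have "(of_int (\<Sum>z\<in>Zs. N z) :: real) = 0" using flux_neg[OF e0] m0 by simp
    then show ?thesis using of_int_eq_0_iff by blast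
  qed simp
qed

end

section \<open>Eigenspaces of the Laplacian\<close>

lemma frechet_derivative_cong:
  assumes S: "open S" "x \<in> S" and eq: "\<And>y. y \<in> S \<Longrightarrow> f y = g y"
  shows "frechet_derivative f (at x) = frechet_derivative g (at x)"
proof -
  have "(f has_derivative D) (at x) \<longleftrightarrow> (g has_derivative D) (at x)" for D
    using has_derivative_transform_within_open[of f D x UNIV S g] has_derivative_transform_within_open[of g D x UNIV S f]
      S eq by auto
  then show ?thesis unfolding frechet_derivative_def by simp
qed

lemma Ck_on_cong:
  assumes S: "open S" and eq: "\<And>y. y \<in> S \<Longrightarrow> f y = g y" and f: "Ck_on k f S"
  shows "Ck_on k g S"
  using eq f
proof (induction k arbitrary: f g)
  case 0
  then show ?case by (simp cong: continuous_on_cong)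
next
  case (Suc k)
  have "g differentiable_on S"
    using Suc.prems S unfolding Ck_on.simps differentiable_on_eq_differentiable_at[OF S]
    by (meson differentiable_def has_derivative_transform_within_open)
  moreover have "Ck_on k (\<lambda>x. frechet_derivative g (at x) v) S" for v
  proof (rule Suc.IH)
    show "Ck_on k (\<lambda>x. frechet_derivative f (at x) v) S" using Suc.prems by simp
    show "frechet_derivative f (at y) v = frechet_derivative g (at y) v" if "y \<in> S" for y
      using frechet_derivative_cong[OF S that Suc.prems(1)] by simp
  qed
  ultimately show ?case by simp
qed

lemma frechet_derivative_linear_compose:
  assumes "bounded_linear T" "f differentiable (at x)"
  shows "frechet_derivative (\<lambda>x. T (f x)) (at x) v = T (frechet_derivative f (at x) v)"
  using frechet_derivative_at[OF bounded_linear.has_derivative[OF assms(1) iffD1[OF frechet_derivative_works assms(2)]]]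
  by metis

lemma Ck_on_linear:
  assumes S: "open S" and T: "bounded_linear T" and f: "Ck_on k f S"
  shows "Ck_on k (\<lambda>x. T (f x)) S"
  using f
proof (induction k arbitrary: f)
  case 0
  then show ?case using bounded_linear.continuous_on[OF T] by simp
next
  case (Suc k)
  then have d: "f differentiable (at x)" if "x \<in> S" for x
    using that by (simp add: differentiable_on_eq_differentiable_at[OF S])
  have "(\<lambda>x. T (f x)) differentiable_on S"
    unfolding differentiable_on_eq_differentiable_at[OF S]
    using d bounded_linear.has_derivative[OF T] unfolding differentiable_def by blast
  moreover have "Ck_on k (\<lambda>x. frechet_derivative (\<lambda>x. T (f x)) (at x) v) S" for v
    by (rule Ck_on_cong[OF S _ Suc.IH[of "\<lambda>x. frechet_derivative f (at x) v"]])
       (use Suc.prems frechet_derivative_linear_compose[OF T d] in auto)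
  ultimately show ?case by simp
qed

lemma frechet_derivative_add:
  assumes "f differentiable (at x)" "g differentiable (at x)"
  shows "frechet_derivative (\<lambda>x. f x + g x) (at x) v = frechet_derivative f (at x) v + frechet_derivative g (at x) v"
  using frechet_derivative_at[OF has_derivative_add[OF iffD1[OF frechet_derivative_works assms(1)] iffD1[OF frechet_derivative_works assms(2)]]]
  by metis

lemma Ck_on_add:
  assumes S: "open S" and f: "Ck_on k f S" "Ck_on k g S"
  shows "Ck_on k (\<lambda>x. f x + g x) S"
  using f
proof (induction k arbitrary: f g)
  case 0
  then show ?case by (simp add: continuous_on_add)
next
  case (Suc k)
  then have d: "f differentiable (at x)" "g differentiable (at x)" if "x \<in> S" for x
    using that by (simp_all add: differentiable_on_eq_differentiable_at[OF S])
  have "(\<lambda>x. f x + g x) differentiable_on S"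
    unfolding differentiable_on_eq_differentiable_at[OF S] using d by (intro ballI differentiable_add)
  moreover have "Ck_on k (\<lambda>x. frechet_derivative (\<lambda>x. f x + g x) (at x) v) S" for v
    by (rule Ck_on_cong[OF S _ Suc.IH[of "\<lambda>x. frechet_derivative f (at x) v" "\<lambda>x. frechet_derivative g (at x) v"]])
       (use Suc.prems frechet_derivative_add[OF d] in auto)
  ultimately show ?case by simp
qed

lemma smooth_on_differentiable:
  assumes "smooth_on f S" "open S" "x \<in> S"
  shows "f differentiable (at x)" "(\<lambda>y. frechet_derivative f (at y) v) differentiable (at x)"
proof -
  have "Ck_on (Suc (Suc 0)) f S" using assms(1) unfolding smooth_on_def by blast
  then show "f differentiable (at x)" "(\<lambda>y. frechet_derivative f (at y) v) differentiable (at x)"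
    using assms(2,3) by (auto simp: differentiable_on_eq_differentiable_at)
qed

text \<open>The determinant of the symmetric Gram matrix in three dimensions, expanded along the
  first row.\<close>

definition D3 :: "('e \<Rightarrow> 'e \<Rightarrow> real) \<Rightarrow> 'e \<Rightarrow> 'e \<Rightarrow> 'e \<Rightarrow> real" where
  "D3 B a b c = B a a * (B b b * B c c - (B b c)\<^sup>2) + B a b * (B a c * B b c - B a b * B c c) + B a c * (B a b * B b c - B a c * B b b)"

text \<open>The row of the adjugate matrix belonging to \<open>x\<close>, divided by the determinant
  and read as a vector: Cramer's rule for the vector that represents \<open>w \<bullet> x\<close>
  with respect to \<open>B\<close>.\<close>

definition inv3 :: "('e::real_vector \<Rightarrow> 'e \<Rightarrow> real) \<Rightarrow> 'e \<Rightarrow> 'e \<Rightarrow> 'e \<Rightarrow> 'e \<Rightarrow> 'e" where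
  "inv3 B a b c x = (
   if x = a then ((B b b * B c c - (B b c)\<^sup>2) / D3 B a b c) *\<^sub>R a + ((B a c * B b c - B a b * B c c) / D3 B a b c) *\<^sub>R b + ((B a b * B b c - B a c * B b b) / D3 B a b c) *\<^sub>R c
   else if x = b then ((B a c * B b c - B a b * B c c) / D3 B a b c) *\<^sub>R a + ((B a a * B c c - (B a c)\<^sup>2) / D3 B a b c) *\<^sub>R b + ((B a b * B a c - B a a * B b c) / D3 B a b c) *\<^sub>R c
   else ((B a b * B b c - B a c * B b b) / D3 B a b c) *\<^sub>R a + ((B a b * B a c - B a a * B b c) / D3 B a b c) *\<^sub>R b + ((B a a * B b b - (B a b)\<^sup>2) / D3 B a b c) *\<^sub>R c)"

locale pos_form3 =
  fixes B :: "'e::euclidean_space \<Rightarrow> 'e \<Rightarrow> real" and a b c :: 'e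
  assumes bil: "bilinear B" and sym: "B v w = B w v" and pos: "v \<noteq> 0 \<Longrightarrow> B v v > 0"
    and Basis: "Basis = {a, b, c}" and dist: "a \<noteq> b" "a \<noteq> c" "b \<noteq> c"
begin

lemma metric_det_eq: "metric_det B = (D3 B a b c)"
proof -
  have f: "finite {b, c}" "a \<notin> {b, c}" "finite {c}" "b \<notin> {c}" "finite ({} :: 'e set)" "c \<notin> {}"
    using dist by auto
  show ?thesis
    unfolding metric_det_def Basis
    unfolding sum_over_permutations_insert[OF f(1,2)] sum_over_permutations_insert[OF f(3,4)] sum_over_permutations_insert[OF f(5,6)]
    using dist sym[of b a] sym[of c a] sym[of c b]
    by (simp add: D3_def permutes_empty sign_swap_id permutation_swap_id permutation_compose sign_compose sign_id
        swap_id_eq Transposition.transpose_def power2_eq_square algebra_simps)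
qed

text \<open>Gram-Schmidt without normalisation: the vectors \<open>?u\<close> and \<open>?v\<close>
  are nonzero, and evaluating \<open>B\<close> on them yields products of consecutive leading
  minors, which must therefore all be positive.\<close>

lemma D3_pos: "(D3 B a b c) > 0"
proof -
  note bs = bilinear_ladd[OF bil] bilinear_radd[OF bil] bilinear_lmul[OF bil] bilinear_rmul[OF bil]
  have ne: "a \<in> Basis" "b \<in> Basis" "c \<in> Basis" using Basis by auto
  have ip: "a \<bullet> a = 1" "b \<bullet> b = 1" "c \<bullet> c = 1" "a \<bullet> b = 0" "a \<bullet> c = 0" "b \<bullet> c = 0"
    using ne dist by (simp_all add: inner_Basis)
  have a0: "B a a > 0" by (rule pos) (use ne nonzero_Basis in blast)
  define C33 where "C33 = B a a * B b b - (B a b)\<^sup>2"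
  let ?u = "- B a b *\<^sub>R a + B a a *\<^sub>R b"
  have "?u \<bullet> b = B a a" by (simp only: inner_add_left inner_scaleR_left ip mult_zero_right mult_1_right add_0)
  then have "?u \<noteq> 0" using a0 by auto
  then have "B ?u ?u > 0" by (rule pos)
  moreover have "B ?u ?u = B a a * C33"
    by (simp only: bs sym[of b a] C33_def) (simp add: power2_eq_square algebra_simps)
  ultimately have C0: "C33 > 0" using a0 by (simp add: zero_less_mult_iff)
  let ?v = "(B a b * B b c - B a c * B b b) *\<^sub>R a + (B a b * B a c - B a a * B b c) *\<^sub>R b + C33 *\<^sub>R c"
  have "?v \<bullet> c = C33" by (simp only: inner_add_left inner_scaleR_left ip mult_zero_right mult_1_right add_0)
  then have "?v \<noteq> 0" using C0 by auto
  then have "B ?v ?v > 0" by (rule pos)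
  moreover have "B ?v ?v = (D3 B a b c) * C33"
    by (simp only: bs sym[of b a] sym[of c a] sym[of c b] C33_def D3_def) (simp add: power2_eq_square algebra_simps)
  ultimately show ?thesis using C0 by (simp add: zero_less_mult_iff)
qed

lemma inv3_works:
  assumes x: "x \<in> Basis" shows "B (inv3 B a b c x) w = w \<bullet> x"
proof -
  note bs = bilinear_ladd[OF bil] bilinear_lmul[OF bil]
  have D: "(D3 B a b c) \<noteq> 0" using D3_pos by simp
  have ne: "a \<in> Basis" "b \<in> Basis" "c \<in> Basis" using Basis by auto
  have ip: "y \<bullet> x = (if y = x then 1 else 0)" if "y \<in> Basis" for y using that x by (simp add: inner_Basis)
  have D': "(D3 B a b c) = B a a * (B b b * B c c - (B b c)\<^sup>2) + B a b * (B a c * B b c - B a b * B c c) + B a c * (B a b * B b c - B a c * B b b)"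
    by (rule D3_def)
  have on_basis: "B (inv3 B a b c x) y = y \<bullet> x" if y: "y \<in> Basis" for y
  proof -
    have "(D3 B a b c) * B (inv3 B a b c x) y = (D3 B a b c) * (y \<bullet> x)"
      unfolding ip[OF y] using x y dist D unfolding Basis
      by (elim insertE emptyE)
         (simp_all add: inv3_def bs sym[of b a] sym[of c a] sym[of c b] distrib_left,
          simp_all add: D' power2_eq_square algebra_simps)
    then show ?thesis using D by simp
  qed
  have "B (inv3 B a b c x) w = B (inv3 B a b c x) (\<Sum>y\<in>Basis. (w \<bullet> y) *\<^sub>R y)"
    by (simp add: euclidean_representation)
  also have "\<dots> = (\<Sum>y\<in>Basis. (w \<bullet> y) * B (inv3 B a b c x) y)"
    using bil unfolding bilinear_def by (simp add: linear_sum linear_scale)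
  also have "\<dots> = (\<Sum>y\<in>Basis. (w \<bullet> y) * (y \<bullet> x))" by (intro sum.cong refl) (simp add: on_basis)
  also have "\<dots> = w \<bullet> x" unfolding euclidean_inner[of w x] by (simp add: inner_commute[of x])
  finally show ?thesis .
qed

lemma inverse_metric_eq:
  assumes x: "x \<in> Basis" shows "inverse_metric B x y = inv3 B a b c x \<bullet> y"
proof -
  have "(THE v. \<forall>w. B v w = w \<bullet> x) = inv3 B a b c x"
  proof (rule the_equality)
    fix v assume v: "\<forall>w. B v w = w \<bullet> x"
    have "B (v - inv3 B a b c x) (v - inv3 B a b c x) = 0"
      using v inv3_works[OF x] bilinear_lsub[OF bil] by simp
    then show "v = inv3 B a b c x" using pos[of "v - inv3 B a b c x"] by fastforce
  qed (use inv3_works[OF x] in blast)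
  then show ?thesis by (simp add: inverse_metric_def)
qed

end

text \<open>In dimension three the coefficients of the Laplacian are explicit algebraic expressions
  in the entries of the metric with positive determinant. Their differentiability is what allows
  derivatives to be split in the linearity proofs for the Laplacian.\<close>

lemma metric_coefficient_differentiable:
  fixes G :: "'e::euclidean_space \<Rightarrow> 'e \<Rightarrow> 'e \<Rightarrow> real"
  assumes S: "open S" "x \<in> S" and form: "\<And>y. y \<in> S \<Longrightarrow> pos_form3 (G y) a b c"
    and d: "\<And>v w. (\<lambda>y. G y v w) differentiable (at x)" and b1: "b1 \<in> Basis"
  shows "(\<lambda>y. sqrt (metric_det (G y)) * inverse_metric (G y) b1 c1) differentiable (at x)"
proof -
  have D0: "D3 (G x) a b c > 0" by (rule pos_form3.D3_pos[OF form[OF S(2)]])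
  have D: "(\<lambda>y. D3 (G y) a b c) differentiable (at x)"
    unfolding D3_def by (intro derivative_intros d)
  have "sqrt differentiable (at (D3 (G x) a b c))"
    using DERIV_real_sqrt[OF D0] unfolding has_field_derivative_def differentiable_def by blast
  from differentiable_compose[OF this D] have sq: "(\<lambda>y. sqrt (D3 (G y) a b c)) differentiable (at x)" .
  have di: "(\<lambda>y. p y / D3 (G y) a b c) differentiable (at x)" if "p differentiable (at x)" for p
    by (intro differentiable_divide that D) (use D0 in simp)
  have iv: "(\<lambda>y. inv3 (G y) a b c b1 \<bullet> c1) differentiable (at x)"
  proof -
    have lin3: "(\<lambda>y. (p1 y / D3 (G y) a b c) * r1 + (p2 y / D3 (G y) a b c) * r2 + (p3 y / D3 (G y) a b c) * r3) differentiable (at x)"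
      if "p1 differentiable (at x)" "p2 differentiable (at x)" "p3 differentiable (at x)" for p1 p2 p3 and r1 r2 r3 :: real
      by (intro differentiable_add differentiable_mult differentiable_const di that)
    consider (1) "b1 = a" | (2) "b1 \<noteq> a" "b1 = b" | (3) "b1 \<noteq> a" "b1 \<noteq> b" by blast
    then show ?thesis
    proof cases
      case 1
      show ?thesis unfolding inv3_def if_P[OF 1] inner_add_left inner_scaleR_left
        by (rule lin3) (intro derivative_intros d)+
    next
      case 2
      show ?thesis unfolding inv3_def if_not_P[OF 2(1)] if_P[OF 2(2)] inner_add_left inner_scaleR_left
        by (rule lin3) (intro derivative_intros d)+
    next
      case 3
      show ?thesis unfolding inv3_def if_not_P[OF 3(1)] if_not_P[OF 3(2)] inner_add_left inner_scaleR_left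
        by (rule lin3) (intro derivative_intros d)+
    qed
  qed
  have ev: "sqrt (metric_det (G y)) * inverse_metric (G y) b1 c1 = sqrt (D3 (G y) a b c) * (inv3 (G y) a b c b1 \<bullet> c1)"
    if "y \<in> S" for y
    using pos_form3.metric_det_eq[OF form[OF that]] pos_form3.inverse_metric_eq[OF form[OF that] b1] by simp
  obtain L where "((\<lambda>y. sqrt (D3 (G y) a b c) * (inv3 (G y) a b c b1 \<bullet> c1)) has_derivative L) (at x)"
    using differentiable_mult[OF sq iv] unfolding differentiable_def by blast
  then have "((\<lambda>y. sqrt (metric_det (G y)) * inverse_metric (G y) b1 c1) has_derivative L) (at x)"
    by (rule has_derivative_transform_within_open[OF _ S]) (simp add: ev)
  then show ?thesis unfolding differentiable_def by blast
qed


text \<open>The coefficients are real, so any real linear \<open>T\<close> passes through.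
  Multiplication by a complex constant and complex conjugation are the two instances of
  interest.\<close>

lemma laplacian_coord_linear:
  assumes S: "open S" "x \<in> S" and u: "smooth_on u S" and T: "bounded_linear T"
    and q: "\<And>b c. b \<in> Basis \<Longrightarrow> c \<in> Basis \<Longrightarrow> (\<lambda>y. sqrt (metric_det (g y)) * inverse_metric (g y) b c) differentiable (at x)"
  shows "laplacian_coord g (\<lambda>x. T (u x)) x = T (laplacian_coord g u x)"
proof -
  interpret T: bounded_linear T by (rule T)
  have eq: "frechet_derivative (\<lambda>y. (sqrt (metric_det (g y)) * inverse_metric (g y) b c) *\<^sub>R frechet_derivative (\<lambda>x. T (u x)) (at y) c) (at x) b
     = T (frechet_derivative (\<lambda>y. (sqrt (metric_det (g y)) * inverse_metric (g y) b c) *\<^sub>R frechet_derivative u (at y) c) (at x) b)"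
    if bc: "b \<in> Basis" "c \<in> Basis" for b c
  proof -
    let ?q = "\<lambda>y. sqrt (metric_det (g y)) * inverse_metric (g y) b c"
    have "frechet_derivative (\<lambda>y. ?q y *\<^sub>R frechet_derivative (\<lambda>x. T (u x)) (at y) c) (at x) b
       = frechet_derivative (\<lambda>y. T (?q y *\<^sub>R frechet_derivative u (at y) c)) (at x) b"
      by (rule fun_cong[OF frechet_derivative_cong[OF S]])
         (simp add: frechet_derivative_linear_compose[OF T smooth_on_differentiable(1)[OF u S(1)]] T.scaleR)
    also have "\<dots> = T (frechet_derivative (\<lambda>y. ?q y *\<^sub>R frechet_derivative u (at y) c) (at x) b)"
      by (rule frechet_derivative_linear_compose[OF T differentiable_scaleR[OF q[OF bc] smooth_on_differentiable(2)[OF u S]]])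
    finally show ?thesis .
  qed
  show ?thesis
    unfolding laplacian_coord_def T.scaleR T.sum
    by (intro arg_cong[where f="\<lambda>z. z /\<^sub>R _"] sum.cong refl eq)
qed

lemma laplacian_coord_add:
  assumes S: "open S" "x \<in> S" and u: "smooth_on u S" and v: "smooth_on v S"
    and q: "\<And>b c. b \<in> Basis \<Longrightarrow> c \<in> Basis \<Longrightarrow> (\<lambda>y. sqrt (metric_det (g y)) * inverse_metric (g y) b c) differentiable (at x)"
  shows "laplacian_coord g (\<lambda>x. u x + v x) x = laplacian_coord g u x + laplacian_coord g v x"
proof -
  have eq: "frechet_derivative (\<lambda>y. (sqrt (metric_det (g y)) * inverse_metric (g y) b c) *\<^sub>R frechet_derivative (\<lambda>x. u x + v x) (at y) c) (at x) b
     = frechet_derivative (\<lambda>y. (sqrt (metric_det (g y)) * inverse_metric (g y) b c) *\<^sub>R frechet_derivative u (at y) c) (at x) b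
     + frechet_derivative (\<lambda>y. (sqrt (metric_det (g y)) * inverse_metric (g y) b c) *\<^sub>R frechet_derivative v (at y) c) (at x) b"
    if bc: "b \<in> Basis" "c \<in> Basis" for b c
  proof -
    let ?q = "\<lambda>y. sqrt (metric_det (g y)) * inverse_metric (g y) b c"
    have "frechet_derivative (\<lambda>y. ?q y *\<^sub>R frechet_derivative (\<lambda>x. u x + v x) (at y) c) (at x) b
       = frechet_derivative (\<lambda>y. ?q y *\<^sub>R frechet_derivative u (at y) c + ?q y *\<^sub>R frechet_derivative v (at y) c) (at x) b"
      by (rule fun_cong[OF frechet_derivative_cong[OF S]])
         (simp add: frechet_derivative_add[OF smooth_on_differentiable(1)[OF u S(1)] smooth_on_differentiable(1)[OF v S(1)]] scaleR_add_right)
    also have "\<dots> = frechet_derivative (\<lambda>y. ?q y *\<^sub>R frechet_derivative u (at y) c) (at x) b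
       + frechet_derivative (\<lambda>y. ?q y *\<^sub>R frechet_derivative v (at y) c) (at x) b"
      by (rule frechet_derivative_add[OF differentiable_scaleR[OF q[OF bc] smooth_on_differentiable(2)[OF u S]]
            differentiable_scaleR[OF q[OF bc] smooth_on_differentiable(2)[OF v S]]])
    finally show ?thesis .
  qed
  have "laplacian_coord g (\<lambda>x. u x + v x) x = (\<Sum>b\<in>Basis. \<Sum>c\<in>Basis.
      frechet_derivative (\<lambda>y. (sqrt (metric_det (g y)) * inverse_metric (g y) b c) *\<^sub>R frechet_derivative u (at y) c) (at x) b
     + frechet_derivative (\<lambda>y. (sqrt (metric_det (g y)) * inverse_metric (g y) b c) *\<^sub>R frechet_derivative v (at y) c) (at x) b)
     /\<^sub>R sqrt (metric_det (g x))"
    unfolding laplacian_coord_def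
    by (intro arg_cong[where f="\<lambda>z. z /\<^sub>R _"] sum.cong refl eq)
  then show ?thesis
    by (simp add: laplacian_coord_def sum.distrib scaleR_add_right)
qed

section \<open>Laplace eigenspaces on the circle bundle\<close>

locale kk_laplace = kk_bundle K for K :: "('x, 'i, 'l::ab_group_add) bundle_data" +
  fixes G :: "'i \<times> real \<Rightarrow> complex \<times> real \<Rightarrow> complex \<times> real \<Rightarrow> complex \<times> real \<Rightarrow> real"
  assumes kkm: "kaluza_klein_metric K G"
begin

lemma riem_P: "riemannian_metric (Pdom K) (Ppar K) G"
  using kkm unfolding kaluza_klein_metric_def by blast

lemma coefficient_differentiable:
  assumes x: "x \<in> Pdom K k" and b: "b \<in> Basis"
  shows "(\<lambda>y. sqrt (metric_det (G k y)) * inverse_metric (G k y) b c) differentiable (at x)"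
proof (rule metric_coefficient_differentiable[OF open_Pdom x _ _ b])
  fix y assume y: "y \<in> Pdom K k"
  show "pos_form3 (G k y) (1, 0) (\<i>, 0) (0, 1)"
  proof
    show "bilinear (G k y)" "\<And>v w. G k y v w = G k y w v" "\<And>v. v \<noteq> 0 \<Longrightarrow> G k y v v > 0"
      using riem_P y unfolding riemannian_metric_def by blast+
    show "(Basis :: (complex \<times> real) set) = {(1, 0), (\<i>, 0), (0, 1)}"
      by (auto simp: Basis_prod_def Basis_complex_def)
  qed (auto simp: complex_eq_iff)
next
  fix v w
  have "smooth_on (\<lambda>x. G k x v w) (Pdom K k)"
    using riem_P unfolding riemannian_metric_def by blast
  then show "(\<lambda>y. G k y v w) differentiable (at x)"
    using smooth_on_differentiable(1) open_Pdom x by blast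
qed

text \<open>Every point lies in a chart whose angle interval is centred at its own angle; hence the
  choice operator in \<open>laplace_beltrami\<close> returns genuine coordinates of the
  point.\<close>

lemma chart_P:
  assumes "p \<in> circle_bundle K"
  obtains k x where "(SOME (i, x). x \<in> Pdom K i \<and> Ppar K i x = p) = (k, x)" "x \<in> Pdom K k" "Ppar K k x = p"
proof -
  obtain i w \<zeta> where w: "w \<in> cdom K i" "cmod \<zeta> = 1" "p = circle_pt i w \<zeta>" using assms by (rule pointE)
  have z: "cis (Arg \<zeta>) = \<zeta>" using cis_Arg[of \<zeta>] w(2) by (cases "\<zeta> = 0") (auto simp: sgn_eq)
  let ?P = "\<lambda>y. case y of (i, x) \<Rightarrow> x \<in> Pdom K i \<and> Ppar K i x = p"
  have "?P ((i, Arg \<zeta> - pi), (w, Arg \<zeta>))"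
    using w z by (simp add: Pdom_def Ppar_eq)
  then have "?P (SOME y. ?P y)" by (rule someI)
  moreover obtain k x where kx: "(SOME y. ?P y) = (k, x)" by (rule prod.exhaust)
  ultimately have "?P (k, x)" by (simp only:)
  then show thesis using that[OF kx] by simp
qed

lemma laplace_beltrami_linear:
  assumes u: "smooth_fun (Pdom K) (Ppar K) u" and T: "bounded_linear T" and p: "p \<in> circle_bundle K"
  shows "laplace_beltrami (Pdom K) (Ppar K) G (\<lambda>p. T (u p)) p = T (laplace_beltrami (Pdom K) (Ppar K) G u p)"
proof -
  obtain k x where kx: "(SOME (i, x). x \<in> Pdom K i \<and> Ppar K i x = p) = (k, x)" "x \<in> Pdom K k" "Ppar K k x = p" by (rule chart_P[OF p])
  have "smooth_on (u \<circ> Ppar K k) (Pdom K k)" using u unfolding smooth_fun_def by blast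
  from laplacian_coord_linear[OF open_Pdom kx(2) this T coefficient_differentiable[OF kx(2)]]
  show ?thesis unfolding laplace_beltrami_def kx(1) Let_def prod.case by (simp add: comp_def)
qed

lemma laplace_beltrami_add:
  assumes u: "smooth_fun (Pdom K) (Ppar K) u" and v: "smooth_fun (Pdom K) (Ppar K) v" and p: "p \<in> circle_bundle K"
  shows "laplace_beltrami (Pdom K) (Ppar K) G (\<lambda>p. u p + v p) p =
     laplace_beltrami (Pdom K) (Ppar K) G u p + laplace_beltrami (Pdom K) (Ppar K) G v p"
proof -
  obtain k x where kx: "(SOME (i, x). x \<in> Pdom K i \<and> Ppar K i x = p) = (k, x)" "x \<in> Pdom K k" "Ppar K k x = p" by (rule chart_P[OF p])
  have "smooth_on (u \<circ> Ppar K k) (Pdom K k)" "smooth_on (v \<circ> Ppar K k) (Pdom K k)" using u v unfolding smooth_fun_def by blast+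
  from laplacian_coord_add[OF open_Pdom kx(2) this coefficient_differentiable[OF kx(2)]]
  show ?thesis unfolding laplace_beltrami_def kx(1) Let_def prod.case by (simp add: comp_def)
qed

lemma smooth_fun_linear:
  "smooth_fun (Pdom K) (Ppar K) u \<Longrightarrow> bounded_linear T \<Longrightarrow> smooth_fun (Pdom K) (Ppar K) (\<lambda>p. T (u p))"
  using Ck_on_linear[OF open_Pdom] unfolding smooth_fun_def smooth_on_def by (fastforce simp: comp_def)

lemma smooth_fun_add:
  "smooth_fun (Pdom K) (Ppar K) u \<Longrightarrow> smooth_fun (Pdom K) (Ppar K) v \<Longrightarrow> smooth_fun (Pdom K) (Ppar K) (\<lambda>p. u p + v p)"
  using Ck_on_add[OF open_Pdom] unfolding smooth_fun_def smooth_on_def by (fastforce simp: comp_def)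

lemma eigenspace_scale: "u \<in> laplace_eigenspace K G e \<Longrightarrow> (\<lambda>p. c * u p) \<in> laplace_eigenspace K G e"
  using smooth_fun_linear[OF _ bounded_linear_mult_right[of c]] laplace_beltrami_linear[OF _ bounded_linear_mult_right[of c]]
  unfolding laplace_eigenspace_def by auto

lemma eigenspace_cnj: "u \<in> laplace_eigenspace K G e \<Longrightarrow> (\<lambda>p. cnj (u p)) \<in> laplace_eigenspace K G e"
  using smooth_fun_linear[OF _ bounded_linear_cnj] laplace_beltrami_linear[OF _ bounded_linear_cnj]
  unfolding laplace_eigenspace_def by auto

lemma eigenspace_add:
  "u \<in> laplace_eigenspace K G e \<Longrightarrow> v \<in> laplace_eigenspace K G e \<Longrightarrow> (\<lambda>p. u p + v p) \<in> laplace_eigenspace K G e"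
  using smooth_fun_add laplace_beltrami_add unfolding laplace_eigenspace_def by (auto simp: algebra_simps)

lemma eigenvalue_unique:
  assumes "u \<in> laplace_eigenspace K G e" "u \<in> laplace_eigenspace K G e'" "u p \<noteq> 0"
  shows "e = e'"
proof -
  have p: "p \<in> circle_bundle K" using assms(1,3) unfolding laplace_eigenspace_def by blast
  then have "laplace_beltrami (Pdom K) (Ppar K) G u p = - of_real e * u p"
    "laplace_beltrami (Pdom K) (Ppar K) G u p = - of_real e' * u p"
    using assms(1,2) unfolding laplace_eigenspace_def by blast+
  then show ?thesis using assms(3) by simp
qed

lemma fun_vector_space: "vector_space (\<lambda>(c::complex) (u :: 'p \<Rightarrow> complex) p. c * u p)"
  by unfold_locales (auto simp: fun_eq_iff algebra_simps plus_fun_def)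

lemma subspace_eigenspace:
  assumes "laplace_eigenspace K G e \<noteq> {}"
  shows "module.subspace (\<lambda>(c::complex) u p. c * u p) (laplace_eigenspace K G e)"
proof -
  interpret VF: vector_space "\<lambda>(c::complex) (u :: ('x \<times> ('l \<Rightarrow> complex)) \<Rightarrow> complex) p. c * u p" by (rule fun_vector_space)
  obtain u where "u \<in> laplace_eigenspace K G e" using assms by blast
  from eigenspace_scale[OF this, of 0] have z: "0 \<in> laplace_eigenspace K G e" by (simp add: zero_fun_def)
  show ?thesis
    by (rule VF.subspaceI) (use z eigenspace_scale eigenspace_add in \<open>auto simp: plus_fun_def\<close>)
qed

end

lemma (in vector_space) span_eq_of_dim:
  assumes S: "subspace E" and B: "B \<subseteq> E" "independent B" "finite B" and d: "dim E = card B" and ne: "B \<noteq> {}"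
  shows "E = span B"
proof -
  obtain C where C: "C \<subseteq> E" "independent C" "E \<subseteq> span C" "card C = dim E"
    using basis_exists by blast
  \<comment> \<open>The cardinality of an infinite set is \<open>0\<close>, whereas \<open>C\<close>
    has the positive cardinality of \<open>B\<close>; so the basis \<open>C\<close> is
    finite.\<close>
  have fC: "finite C" using C(4) d B(3) ne by (metis card_eq_0_iff)
  have BC: "B \<subseteq> span C" using B(1) C(3) by blast
  have "E \<subseteq> span B"
  proof
    fix x assume x: "x \<in> E"
    show "x \<in> span B"
    proof (rule ccontr)
      assume n: "x \<notin> span B"
      then have nB: "x \<notin> B" using span_base by blast
      have "independent (insert x B)" using B(2) n nB by (simp add: independent_insert)
      moreover have "insert x B \<subseteq> span C" using x C(3) BC by blast
      ultimately have "card (insert x B) \<le> card C" using independent_span_bound[OF fC] by blast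
      then show False using nB B(3) C(4) d by simp
    qed
  qed
  moreover have "span B \<subseteq> E" by (rule span_minimal[OF B(1) S])
  ultimately show ?thesis by blast
qed

section \<open>Existence of zeros and the conclusion\<close>

context kk_bundle begin

lemma lift_equivariant:
  assumes "is_lift K m s u" "p \<in> circle_bundle K"
  shows "u (S1_act t p) = cis (of_int m * t) * u p"
proof -
  obtain i w \<zeta> where w: "w \<in> cdom K i" "cmod \<zeta> = 1" "p = circle_pt i w \<zeta>" using assms(2) by (rule pointE)
  have "u (circle_pt i w (cis t * \<zeta>)) = s i w * (cis t * \<zeta> * of_real (frame_norm i w)) powi m"
    by (rule lift_circle_pt[OF assms(1) w(1)]) (use w in \<open>simp add: norm_mult\<close>)
  then show ?thesis
    using lift_circle_pt[OF assms(1) w(1,2)] w(3)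
    by (simp add: S1_act_circle_pt power_int_mult_distrib cis_powi mult_ac)
qed

lemma section_regular_index:
  assumes s: "smooth_section K m s" and r: "section_zero_regular K s" and w: "w \<in> cdom K i" "s i w = 0"
  shows "\<exists>n\<in>{1,-1}. has_index (s i) w n"
proof -
  have sm: "smooth_on (s i) (cdom K i)" using s unfolding smooth_section_def by blast
  obtain R where R: "R > 0" "ball w R \<subseteq> cdom K i" using w open_cdom openE by blast
  have "has_index (s i) w 1 \<or> has_index (s i) w (-1)"
  proof (rule has_index_regular_zero[OF R(1)])
    show "continuous_on (ball w R) (s i)"
      by (rule continuous_on_subset[OF smooth_on_continuous[OF sm] R(2)])
    show "(s i has_derivative frechet_derivative (s i) (at w)) (at w)"
      by (rule smooth_on_has_derivative[OF sm open_cdom w(1)])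
  qed (use r w in \<open>auto simp: section_zero_regular_def\<close>)
  then show ?thesis by blast
qed

end

lemma (in kk_measure) section_has_zero:
  assumes nontriv: "\<not> trivial_circle_bundle K" and lift: "is_lift K 1 s u"
    and s: "smooth_section K 1 s" and reg: "section_zero_regular K s"
    and t: "smooth_section K m t" and m: "m \<noteq> 0"
  shows "\<exists>i w. w \<in> cdom K i \<and> t i w = 0"
proof (rule ccontr)
  assume no: "\<nexists>i w. w \<in> cdom K i \<and> t i w = 0"
  have s_tr: "s j (tr i j w) = fc i j w * s i w" if "w \<in> ov i j" for i j w
    using s that unfolding smooth_section_def by simp
  define Z where "Z = {cpar K i w |i w. w \<in> cdom K i \<and> s i w = 0}"
  have Z: "cpar K i w \<in> Z \<longleftrightarrow> s i w = 0" if w: "w \<in> cdom K i" for i w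
  proof
    assume "cpar K i w \<in> Z"
    then obtain j v where v: "v \<in> cdom K j" "s j v = 0" "cpar K j v = cpar K i w" by (auto simp: Z_def)
    then show "s i w = 0" using s_tr[of v j i] tr_eqI[OF v(1) w v(3)] by simp
  qed (use w in \<open>auto simp: Z_def\<close>)
  define N where "N z = (if z \<in> Z then SOME n. \<exists>i w. w \<in> cdom K i \<and> cpar K i w = z \<and> has_index (s i) w n else 0)" for z
  have cont: "continuous_on (cdom K i) (s i)" for i
    using s unfolding smooth_section_def by (blast intro: smooth_on_continuous)
  have index: "has_index (s i) w (N (cpar K i w))" if w: "w \<in> cdom K i" for i w
  proof (cases "s i w = 0")
    case False
    then show ?thesis
      using has_index_0_open[OF open_cdom w cont False] Z[OF w] by (simp add: N_def)
  next
    case True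
    let ?P = "\<lambda>n. \<exists>j v. v \<in> cdom K j \<and> cpar K j v = cpar K i w \<and> has_index (s j) v n"
    have "\<exists>n. ?P n" using section_regular_index[OF s reg w True] w by blast
    then have "?P (SOME n. ?P n)" by (rule someI_ex)
    then have "?P (N (cpar K i w))" using True Z[OF w] by (simp add: N_def)
    then obtain j v where v: "v \<in> cdom K j" "cpar K j v = cpar K i w" "has_index (s j) v (N (cpar K i w))"
      by blast
    have o: "w \<in> ov i j" "tr i j w = v" using tr_eqI[OF w v(1)] v(2) by auto
    have "has_index (s j) (tr i j w) (N (cpar K i w))" using v(3) o(2) by simp
    from has_index_compose[OF this holomorphic_tr open_ov o(1) deriv_tr_nonzero[OF o(1)]]
    have c: "has_index (s j \<circ> tr i j) w (N (cpar K i w))" .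
    \<comment> \<open>The coefficient \<open>s i\<close> is the pulled back \<open>s j\<close>
      divided by the frame change, and the latter is holomorphic without zeros, hence of index
      \<open>0\<close>.\<close>
    have "has_index (fc i j) w 0"
      by (rule has_index_0_open[OF open_ov o(1) holomorphic_on_imp_continuous_on[OF holomorphic_fc] fc_nonzero[OF o(1)]])
    from has_index_mult[OF has_index_inverse[OF this] c]
    have "has_index (\<lambda>x. inverse (fc i j x) * (s j \<circ> tr i j) x) w (N (cpar K i w))" by simp
    then show ?thesis
      by (rule has_index_cong_open[OF _ open_ov o(1)]) (use s_tr fc_nonzero in simp)
  qed
  interpret St: kk_stokes K \<mu> s t m N
    by unfold_locales (use s t m no index in auto)
  have "trivial_circle_bundle K"
  proof (rule total_index_0_trivial[of u N St.Zs])
    show "finite St.Zs" by (rule St.finite_Zs)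
    show "St.Zs \<subseteq> X" by (auto simp: St.Zs_def)
    show "(\<Sum>z\<in>St.Zs. N z) = 0" by (rule St.sum_index_zero)
    have "St.Zs = Z" unfolding St.Zs_def Z_def ..
    then show "N z = 0" if "z \<notin> St.Zs" for z using that by (simp add: N_def)
    show "eq_index u N"
      unfolding eq_index_def equivariant_def
    proof (intro conjI ballI allI)
      fix p \<theta> assume "p \<in> circle_bundle K"
      from lift_equivariant[OF lift this, of \<theta>] show "u (S1_act \<theta> p) = cis \<theta> * u p" by simp
    next
      fix i w assume w: "w \<in> cdom K i"
      have "continuous_on (cdom K i) (\<lambda>v. complex_of_real (frame_norm i v))"
        by (intro continuous_intros continuous_on_frame_norm)
      then have "has_index (\<lambda>v. complex_of_real (frame_norm i v)) w 0"
        by (rule has_index_0_open[OF open_cdom w]) (use frame_norm_pos[OF w] in simp)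
      from has_index_mult[OF index[OF w] this]
      have "has_index (\<lambda>v. s i v * of_real (frame_norm i v)) w (N (cpar K i w))" by simp
      then show "has_index (\<lambda>v. u (circle_pt i v 1)) w (N (cpar K i w))"
        by (rule has_index_cong_open[OF _ open_cdom w]) (simp add: lift_circle_pt[OF lift])
    qed
  qed
  then show False using nontriv by blast
qed

theorem theorem1p5:
  fixes K :: "('x, 'i, 'l::ab_group_add) bundle_data"
    and G :: "'i \<times> real \<Rightarrow> complex \<times> real \<Rightarrow> complex \<times> real \<Rightarrow> complex \<times> real \<Rightarrow> real"
    and \<mu> :: "'x measure"
    and \<nu> :: "('x \<times> ('l \<Rightarrow> complex)) measure"
    and ev :: "int \<Rightarrow> nat \<Rightarrow> real"
    and \<phi> :: "int \<Rightarrow> nat \<Rightarrow> 'x \<times> ('l \<Rightarrow> complex) \<Rightarrow> complex"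
    and f :: "int \<Rightarrow> nat \<Rightarrow> 'i \<Rightarrow> complex \<Rightarrow> complex"
  assumes data: "kaluza_klein_data K"
    and nontrivial: "\<not> trivial_circle_bundle K"
    and metric: "kaluza_klein_metric K G"
    and vol_X: "riemannian_measure (base K) (cdom K) (cpar K) (gmet K) \<mu>"
    and vol_P: "riemannian_measure (Ptop K) (Pdom K) (Ppar K) G \<nu>"
    and basis: "joint_eigenbasis K G \<mu> \<nu> ev \<phi> f"
    and a_bochner: "\<And>m b. bochner_eigenspace K \<mu> m b \<noteq> {0} \<Longrightarrow>
                      vector_space.dim section_scale (bochner_eigenspace K \<mu> m b) = 1"
    and a_laplace: "\<And>m j. vector_space.dim fun_scale (laplace_eigenspace K G (ev m j)) =
                      (if m = 0 then 1 else 2)"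
    and b: "\<And>c u. u \<in> laplace_eigenspace K G c \<Longrightarrow>
              \<exists>d::complex. \<forall>p\<in>circle_bundle K. d_theta (d_theta u) p = d * u p"
    and c: "\<And>m j. m \<noteq> 0 \<Longrightarrow> isolated_section_zeros K (f m j) \<and> section_zero_regular K (f m j)"
    and d: "\<And>m j. m \<noteq> 0 \<Longrightarrow>
              zero_regular_value (Pdom K) (Ppar K) (\<lambda>p. Re (\<phi> m j p)) \<and>
              zero_regular_value (Pdom K) (Ppar K) (\<lambda>p. Im (\<phi> m j p))"
  shows "(\<forall>m j.
           ev m j = ev (- m) j \<and>
           laplace_eigenspace K G (ev m j) = module.span fun_scale {\<phi> m j, \<phi> (- m) j} \<and>
           \<phi> (- m) j = (\<lambda>p. cnj (\<phi> m j p)) \<and>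
           (\<forall>u\<in>laplace_eigenspace K G (ev m j). (\<forall>p. u p \<in> \<real>) \<longrightarrow>
              (\<exists>(a::real) \<theta>. \<forall>p\<in>circle_bundle K. u p = of_real (a * Re (\<phi> m j (S1_act \<theta> p)))))) \<and>
         (\<forall>m j. m \<noteq> 0 \<longrightarrow> connectedin (Ptop K) (nodal_set K (\<lambda>p. Re (\<phi> m j p)))) \<and>
         (\<forall>m j. m \<noteq> 0 \<longrightarrow> card (nodal_domains K (\<lambda>p. Re (\<phi> m j p))) = 2)"
proof -
  interpret kk_bundle K by unfold_locales (rule data)
  interpret kk_measure K \<mu> by unfold_locales (rule vol_X)
  interpret kk_laplace K G by unfold_locales (rule metric)
  interpret VF: vector_space "\<lambda>(c::complex) (u :: ('x \<times> ('l \<Rightarrow> complex)) \<Rightarrow> complex) p. c * u p"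
    by (rule fun_vector_space)
  let ?E = "\<lambda>m j. laplace_eigenspace K G (ev m j)"
  have ONB: "orthonormal_basis_L2 \<nu> (\<lambda>(m, j). \<phi> m j)" and phiE: "\<And>m j. \<phi> m j \<in> ?E m j"
    and conj: "\<And>m j. \<phi> (- m) j = (\<lambda>p. cnj (\<phi> m j p))" and lift: "\<And>m j. is_lift K m (f m j) (\<phi> m j)"
    and sect: "\<And>m j. \<exists>b. f m j \<in> bochner_eigenspace K \<mu> m b"
    using basis unfolding joint_eigenbasis_def by blast+
  have sm: "smooth_section K m (f m j)" for m j
    using sect[of m j] unfolding bochner_eigenspace_def by blast
  have orth: "(\<integral>p. \<phi> m j p * cnj (\<phi> m' j' p) \<partial>\<nu>) = (if m = m' \<and> j = j' then 1 else 0)" for m j m' j'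
  proof -
    have "\<forall>k l. (\<integral>p. (case k of (m, j) \<Rightarrow> \<phi> m j) p * cnj ((case l of (m, j) \<Rightarrow> \<phi> m j) p) \<partial>\<nu>) = (if k = l then 1 else 0)"
      using ONB unfolding orthonormal_basis_L2_def by blast
    from spec[OF spec[OF this, of "(m, j)"], of "(m', j')"] show ?thesis by simp
  qed
  have nonzero: "\<exists>p. \<phi> m j p \<noteq> 0" for m j
  proof (rule ccontr)
    assume "\<nexists>p. \<phi> m j p \<noteq> 0"
    then have z: "\<phi> m j = (\<lambda>_. 0)" by blast
    show False using orth[of m j m j] unfolding z by simp
  qed
  \<comment> \<open>The Laplacian and the eigenvalue are real, so the conjugate of \<phi> is an
    eigenfunction for the same eigenvalue, and a nonzero function has only one.\<close>
  have ev_eq: "ev m j = ev (- m) j" for m j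
  proof -
    obtain p where "\<phi> (- m) j p \<noteq> 0" using nonzero by blast
    moreover have "\<phi> (- m) j \<in> ?E m j" unfolding conj by (rule eigenspace_cnj[OF phiE])
    ultimately show ?thesis using eigenvalue_unique phiE by blast
  qed
  have span: "?E m j = VF.span {\<phi> m j, \<phi> (- m) j}" for m j
  proof (rule VF.span_eq_of_dim)
    show "VF.subspace (?E m j)" using subspace_eigenspace phiE by blast
    show "{\<phi> m j, \<phi> (- m) j} \<subseteq> ?E m j" using phiE[of m j] phiE[of "- m" j] ev_eq[of m j] by simp
    have n0: "\<phi> m j \<noteq> 0" for m using nonzero[of m j] by (auto simp: zero_fun_def)
    \<comment> \<open>Functions of opposite nonzero weights are orthogonal basis members;
      proportionality would make the norm \<open>1\<close> of \<phi> equal to a multiple of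
      \<open>0\<close>.\<close>
    have ns: "\<phi> m j \<notin> VF.span {\<phi> (- m) j}" if "m \<noteq> 0"
    proof
      assume "\<phi> m j \<in> VF.span {\<phi> (- m) j}"
      then obtain c where c: "\<phi> m j = (\<lambda>p. c * \<phi> (- m) j p)" by (auto simp: VF.span_singleton)
      have "1 = (\<integral>p. \<phi> m j p * cnj (\<phi> m j p) \<partial>\<nu>)" using orth[of m j m j] by simp
      also have "\<dots> = (\<integral>p. c * (\<phi> (- m) j p * cnj (\<phi> m j p)) \<partial>\<nu>)"
        by (rule Bochner_Integration.integral_cong[OF refl]) (simp add: fun_cong[OF c] mult.assoc)
      also have "\<dots> = 0" using orth[of "- m" j m j] that by simp
      finally show False by simp
    qed
    show "VF.independent {\<phi> m j, \<phi> (- m) j}"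
    proof (cases "m = 0")
      case True
      then show ?thesis using n0 by (simp add: VF.independent_insert)
    next
      case False
      have "\<phi> m j \<noteq> \<phi> (- m) j" using ns[OF False] VF.span_base by (metis singletonI)
      then show ?thesis using ns[OF False] n0 by (simp add: VF.independent_insert)
    qed
    have "\<phi> m j \<noteq> \<phi> (- m) j" if "m \<noteq> 0" using ns[OF that] VF.span_base by (metis singletonI)
    then show "VF.dim (?E m j) = card {\<phi> m j, \<phi> (- m) j}" unfolding a_laplace by simp
  qed auto
  have real: "\<exists>(a::real) \<theta>. \<forall>p\<in>circle_bundle K. u p = of_real (a * Re (\<phi> m j (S1_act \<theta> p)))"
    if u: "u \<in> ?E m j" and r: "\<forall>p. u p \<in> \<real>" for m j u
  proof -
    have "u \<in> VF.span {\<phi> m j, \<phi> (- m) j}" using u span by blast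
    then obtain a where "u - (\<lambda>p. a * \<phi> m j p) \<in> VF.span {\<phi> (- m) j}"
      using VF.span_breakdown_eq by metis
    then obtain a' where a': "u - (\<lambda>p. a * \<phi> m j p) = (\<lambda>p. a' * \<phi> (- m) j p)"
      by (auto simp: VF.span_singleton)
    \<comment> \<open>A real part does not change under conjugation, so the coefficient
      \<open>a'\<close> of the conjugate function can be moved as \<open>cnj a'\<close> to \<phi>
      itself.\<close>
    define C where "C = a + cnj a'"
    have up: "u p = of_real (Re (C * \<phi> m j p))" for p
    proof -
      have "u p = a * \<phi> m j p + a' * cnj (\<phi> m j p)"
        using fun_cong[OF a', of p] conj[of m j] by (simp add: fun_diff_def algebra_simps)
      then have "Re (u p) = Re (C * \<phi> m j p)" by (simp add: C_def algebra_simps)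
      moreover have "u p = of_real (Re (u p))" using r by (metis of_real_Re)
      ultimately show ?thesis by simp
    qed
    show ?thesis
    proof (cases "m = 0")
      case True
      \<comment> \<open>For weight \<open>0\<close> the relation between
        \<open>\<phi> (- m) j\<close> and \<open>\<phi> m j\<close> says that the function is real,
        and the identity rotation suffices.\<close>
      have "cnj (\<phi> m j p) = \<phi> m j p" for p using fun_cong[OF conj[of m j], of p] True by simp
      then have "Im (\<phi> m j p) = 0" for p by (metis complex_cnj_cancel_iff Reals_cnj_iff complex_is_Real_iff)
      moreover have "S1_act 0 p = p" for p :: "'x \<times> ('l \<Rightarrow> complex)" by (simp add: S1_act_def)
      ultimately show ?thesis
        using up by (intro exI[of _ "Re C"] exI[of _ 0]) simp
    next
      case False
      \<comment> \<open>The modulus of \<open>C\<close> is the amplitude, and its argument is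
        produced by a rotation through \<open>Arg C / m\<close>, since the lift has weight
        \<open>m\<close>.\<close>
      have C: "C = of_real (cmod C) * cis (Arg C)" using rcis_cmod_Arg[of C] by (simp add: rcis_def)
      have "u p = of_real (cmod C * Re (\<phi> m j (S1_act (Arg C / of_int m) p)))" if p: "p \<in> circle_bundle K" for p
      proof -
        have "\<phi> m j (S1_act (Arg C / of_int m) p) = cis (Arg C) * \<phi> m j p"
          using lift_equivariant[OF lift p, of m j "Arg C / of_int m"] False by simp
        moreover have "Re (C * \<phi> m j p) = cmod C * Re (cis (Arg C) * \<phi> m j p)"
          by (subst C) (simp only: scaleR_conv_of_real[symmetric] mult_scaleR_left scaleR_complex.sel)
        ultimately show ?thesis unfolding up by (simp only:)
      qed
      then show ?thesis by blast
    qed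
  qed
  have nodal: "connectedin (Ptop K) (nodal_set K (\<lambda>p. Re (\<phi> m j p))) \<and> card (nodal_domains K (\<lambda>p. Re (\<phi> m j p))) = 2"
    if m: "m \<noteq> 0" for m j
  proof -
    interpret L: kk_lift K "f m j" m "\<phi> m j"
    proof
      show "continuous_on (cdom K i) (f m j i)" for i
        using sm[of m j] unfolding smooth_section_def by (blast intro: smooth_on_continuous)
      show "\<exists>n\<in>{1, - 1}. has_index (f m j i) w n" if "w \<in> cdom K i" "f m j i w = 0" for w i
        using section_regular_index[OF sm _ that] c[OF m] by blast
    qed (use m lift in auto)
    \<comment> \<open>The comparison section lives in \<open>L\<close> itself: the weight
      \<open>1\<close> eigensection \<open>f 1 0\<close> has regular zeros, and its lift is
      equivariant in the sense needed for a trivialization.\<close>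
    have "section_zero_regular K (f 1 0)" using c[of 1 0] by simp
    from section_has_zero[OF nontrivial lift[of 1 0] sm this sm m, of j]
    have "L.Z \<noteq> {}" by (auto simp: L.Z_def)
    then show ?thesis using L.nodal_set_connected L.nodal_domains_card by blast
  qed
  show ?thesis
    using ev_eq span conj real nodal by blast
qed

end
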